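(* Let $M$ be a smooth manifold of dimension $m$, let $U\subset M$ be open, and let $\widehat Z\colon U\to\mathcal T_0$ be a section of $\mathcal T_0\to M$ over $U$ that obeys the Palatini gravity equations of motion (i.e. is an extremal of the Griffiths variational problem for Palatini gravity). Then the section $F_\omega\circ\widehat Z\colon U\to J^1\tau_\Sigma$ is holonomic (it equals $j^1\zeta$ for some section $\zeta\colon U\to\Sigma$ of $\tau_\Sigma$) and it obeys the Einstein--Hilbert gravity equations of motion.
   Context: Setting. $\tau\colon LM\to M$ is the bundle of linear frames $u=(X_1,\dots,X_m)$ of $M$, with right $GL(m)$-action $(u\cdot A)_j=A^i_jX_i$; $J^1\tau$ is its first jet bundle, with projections $\tau_{10}\colon J^1\tau\to LM$, $\tau_1\colon J^1\tau\to M$. Einstein summation is used. $\eta=\mathrm{diag}(-1,1,\dots,1)$ with entries $\eta_{ij}$ and inverse entries $\eta^{ij}$. $K=\{A\in GL(m):\eta_{ij}A^i_kA^j_l=\eta_{kl}\}$ has Lie algebra $\mathfrak k$, and $\mathfrak{gl}(m)=\mathfrak k\oplus\mathfrak p$ with projections $A_{\mathfrak k}=\frac12(A-\eta A^T\eta)$, $A_{\mathfrak p}=\frac12(A+\eta A^T\eta)$. $p_K^{LM}\colon LM\to\Sigma:=LM/K$ is the quotient and $\tau_\Sigma\colon\Sigma\to M$ the induced bundle; via $[X_1,\dots,X_m]_K\mapsto\eta^{ij}X_i\otimes X_j$, $\Sigma$ is the bundle of (contravariant) metrics on $M$ of signature $\eta$. Canonical forms on $J^1\tau$. $\theta=\theta^ie_i$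 is the pullback by $\tau_{10}$ of the tautological $\mathbb R^m$-valued form of $LM$ (so at $j^1_xs$ with $s(x)=(X_1,\dots,X_m)$ one has $T\tau_1(v)=\theta^i(v)X_i$). The Cartan form $T_{j^1_xs}\tau_{10}-T_xs\circ T_{j^1_xs}\tau_1$ takes values in the vertical bundle $V\tau\simeq LM\times\mathfrak{gl}(m)$ and so defines a $\mathfrak{gl}(m)$-valued 1-form $\omega=(\omega^i_j)$ on $J^1\tau$, which is a principal connection form on $J^1\tau\to J^1\tau/GL(m)$; $\omega_{\mathfrak p}$ is its $\mathfrak p$-component; $\Omega^i_j=d\omega^i_j+\omega^i_k\wedge\omega^k_j$ is its curvature. Put $\theta_0=\theta^1\wedge\cdots\wedge\theta^m$, $\theta_{ik}|_{j^1_xs}=X_i\lrcorner(X_k\lrcorner\theta_0)$ and $\mathcal L_{PG}=\eta^{ip}\theta_{ik}\wedge\Omega^k_p$, an $m$-form on $J^1\tau$. $\mathcal T_0\subset J^1\tau$ is the submanifold where the torsion $d\theta^j+\omega^j_k\wedge\theta^k$ vanishes; in coordinates $(x^\mu,e^\mu_k,e^\mu_{k\sigma})$ induced by coordinates $x^\mu$ of $M$ (with $X_k=e_k^\mu\partial/\partial x^\mu$ and $(e^k_\mu)$ the inverse matrix of $(e^\mu_k)$) it is given by $e^k_\mu e^\sigma_{k\nu}=e^k_\nu e^\sigma_{k\mu}$. Forms on $J^1\tau$ are pulled back to $\mathcal T_0$ with the same names. Palatini problem. The Griffiths variational problem for Palatini gravity: sections $\sigma\colon U\to\mathcal T_0$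 of $\mathcal T_0\to M$ with $\sigma^*\omega_{\mathfrak p}=0$; such a $\sigma$ is an extremal if for every compact $C\subset U$ and every smooth one-parameter family $\sigma_t$ of sections with $\sigma_t^*\omega_{\mathfrak p}=0$, $\sigma_0=\sigma$ and $\sigma_t=\sigma$ outside $C$, one has $\frac{d}{dt}\big|_{t=0}\int_C\sigma_t^*\mathcal L_{PG}=0$. Map. $F_\omega\colon\mathcal T_0\to J^1\tau_\Sigma$, $F_\omega(j^1_xs)=j^1_x(p_K^{LM}\circ s)$. First order Einstein--Hilbert problem. $\mathcal L_{EH}^{(1)}$ is the unique 2-horizontal $m$-form on $J^1\tau_\Sigma$ (2-horizontal: contraction with any two vectors vertical over $M$ is zero) such that $F_\omega^*\mathcal L_{EH}^{(1)}$ equals the pullback of $\mathcal L_{PG}$ to $\mathcal T_0$. A holonomic section $j^1\zeta$, $\zeta\colon U\to\Sigma$, obeys the Einstein--Hilbert equations of motion if for every compact $C\subset U$ and every smooth family of sections $\zeta_t$ with $\zeta_0=\zeta$ and $\zeta_t=\zeta$ outside $C$, $\frac{d}{dt}\big|_{t=0}\int_C(j^1\zeta_t)^*\mathcal L_{EH}^{(1)}=0$.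
   Formalization: As K has elements of determinant −1, which flip the sign of L_PG but fix F_ω, the Einstein–Hilbert form is defined over oriented open sets by F_ω^*L_EH = ±L_PG, the sign being the frame's orientation; integrals in both problems are over compact sets in oriented open subsets of U. *)

theory Defs
  imports "HOL-Analysis.Analysis" "HOL-Library.Uprod"
begin

section \<open>Smooth manifolds given by an atlas\<close>

fun Ck_on :: "nat \<Rightarrow> 'a::real_normed_vector set \<Rightarrow> ('a \<Rightarrow> 'b::real_normed_vector) \<Rightarrow> bool" where
  "Ck_on 0 S f \<longleftrightarrow> continuous_on S f"
| "Ck_on (Suc k) S f \<longleftrightarrow> f differentiable_on S \<and> (\<forall>v. Ck_on k S (\<lambda>x. frechet_derivative f (at x) v))"

text \<open>Only used for open \<open>S\<close>.\<close>
definition smooth_on :: "'a::real_normed_vector set \<Rightarrow> ('a \<Rightarrow> 'b::real_normed_vector) \<Rightarrow> bool" where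
  "smooth_on S f \<longleftrightarrow> (\<forall>k. Ck_on k S f)"

text \<open>A chart is a pair (domain, coordinate map); the values of the coordinate map outside the
  domain are irrelevant.  The underlying set of a manifold is the union of the chart domains.\<close>
type_synonym ('p, 'e) chart = "'p set \<times> ('p \<Rightarrow> 'e)"

abbreviation cinv :: "('p, 'e) chart \<Rightarrow> 'e \<Rightarrow> 'p" where
  "cinv c \<equiv> inv_into (fst c) (snd c)"

definition charts_at :: "('p, 'e) chart set \<Rightarrow> 'p \<Rightarrow> ('p, 'e) chart set" where
  "charts_at A p = {c \<in> A. p \<in> fst c}"

definition manifold_topology :: "('p, 'e::euclidean_space) chart set \<Rightarrow> 'p topology" where
  "manifold_topology A = topology_generated_by {fst c \<inter> snd c -` O' | c O'. c \<in> A \<and> open O'}"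

definition smooth_manifold :: "('p, 'e::euclidean_space) chart set \<Rightarrow> bool" where
  "smooth_manifold A \<longleftrightarrow>
     (\<forall>c\<in>A. inj_on (snd c) (fst c)) \<and>
     (\<forall>c\<in>A. \<forall>d\<in>A. open (snd c ` (fst c \<inter> fst d)) \<and>
        smooth_on (snd c ` (fst c \<inter> fst d)) (snd d \<circ> cinv c)) \<and>
     Hausdorff_space (manifold_topology A) \<and> second_countable (manifold_topology A)"

definition smooth_map_on ::
  "('p, 'e::euclidean_space) chart set \<Rightarrow> ('q, 'f::euclidean_space) chart set \<Rightarrow> 'p set \<Rightarrow> ('p \<Rightarrow> 'q) \<Rightarrow> bool" where
  "smooth_map_on A B W f \<longleftrightarrow>
     (\<forall>p\<in>W. \<exists>c\<in>charts_at A p. \<exists>d\<in>charts_at B (f p). \<exists>N.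
        openin (manifold_topology A) N \<and> p \<in> N \<and> N \<subseteq> W \<inter> fst c \<and> f ` N \<subseteq> fst d \<and>
        smooth_on (snd c ` N) (snd d \<circ> f \<circ> cinv c))"

definition line_atlas :: "(real, real) chart set" where
  "line_atlas = {(UNIV, id)}"

text \<open>The product manifold of the real line with \<open>A\<close>.\<close>
definition cylinder_atlas :: "('p, 'e) chart set \<Rightarrow> (real \<times> 'p, real \<times> 'e) chart set" where
  "cylinder_atlas A = (\<lambda>c. (UNIV \<times> fst c, map_prod id (snd c))) ` A"

section \<open>Tangent vectors\<close>

text \<open>A tangent vector at \<open>p\<close> is the family of its components in all charts at \<open>p\<close>, related by
  the Jacobians of the coordinate changes (and extended by 0 to charts not containing \<open>p\<close>).
  The base point is not part of the vector.\<close>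
type_synonym ('p, 'e) tvec = "('p, 'e) chart \<Rightarrow> 'e"

definition tangent_space :: "('p, 'e::euclidean_space) chart set \<Rightarrow> 'p \<Rightarrow> ('p, 'e) tvec set" where
  "tangent_space A p =
     {v. (\<forall>c\<in>charts_at A p. \<forall>d\<in>charts_at A p.
            v d = frechet_derivative (snd d \<circ> cinv c) (at (snd c p)) (v c)) \<and>
         (\<forall>c. c \<notin> charts_at A p \<longrightarrow> v c = 0)}"

text \<open>The tangent vector at \<open>p\<close> whose components in the chart \<open>c\<close> are \<open>w\<close>.\<close>
definition tvec_of :: "('p, 'e::euclidean_space) chart set \<Rightarrow> 'p \<Rightarrow> ('p, 'e) chart \<Rightarrow> 'e \<Rightarrow> ('p, 'e) tvec" where
  "tvec_of A p c w =
     (\<lambda>d. if d \<in> charts_at A p then frechet_derivative (snd d \<circ> cinv c) (at (snd c p)) w else 0)"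

definition tlincomb :: "('i::finite \<Rightarrow> ('p, 'e::euclidean_space) tvec) \<Rightarrow> real^'i \<Rightarrow> ('p, 'e) tvec" where
  "tlincomb X a = (\<lambda>c. \<Sum>i\<in>UNIV. a $ i *\<^sub>R X i c)"

text \<open>The tangent map of \<open>f\<close> at \<open>p\<close>, extended by 0 outside the tangent space, so that two tangent
  maps are equal as soon as they agree on the tangent space.\<close>
definition tmap ::
  "('p, 'e::euclidean_space) chart set \<Rightarrow> ('q, 'f::euclidean_space) chart set \<Rightarrow> ('p \<Rightarrow> 'q) \<Rightarrow> 'p
    \<Rightarrow> ('p, 'e) tvec \<Rightarrow> ('q, 'f) tvec" where
  "tmap A B f p v =
     (if v \<in> tangent_space A p then
        (let c = (SOME c. c \<in> charts_at A p) in
         (\<lambda>d. if d \<in> charts_at B (f p)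
              then frechet_derivative (snd d \<circ> f \<circ> cinv c) (at (snd c p)) (v c) else 0))
      else (\<lambda>_. 0))"

definition velocity :: "('p, 'e::euclidean_space) chart set \<Rightarrow> (real \<Rightarrow> 'p) \<Rightarrow> real \<Rightarrow> ('p, 'e) tvec" where
  "velocity A \<gamma> t = (\<lambda>c. if c \<in> charts_at A (\<gamma> t) then vector_derivative (snd c \<circ> \<gamma>) (at t) else 0)"

text \<open>The tangent space at \<open>p\<close> of an embedded submanifold \<open>S\<close>, inside that of the ambient manifold.\<close>
definition tangent_space_sub :: "('p, 'e::euclidean_space) chart set \<Rightarrow> 'p set \<Rightarrow> 'p \<Rightarrow> ('p, 'e) tvec set" where
  "tangent_space_sub A S p =
     {velocity A \<gamma> 0 | \<gamma> \<epsilon>. \<epsilon> > 0 \<and> smooth_map_on line_atlas A {-\<epsilon><..<\<epsilon>} \<gamma> \<and>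
        \<gamma> ` {-\<epsilon><..<\<epsilon>} \<subseteq> S \<and> \<gamma> 0 = p}"

section \<open>Differential forms\<close>

text \<open>A \<open>k\<close>-form assigns to a point a function of the list of its \<open>k\<close> arguments that vanishes on
  lists of any other length.  Hence the contraction of a form of degree 0 is 0 and no
  case distinction on degrees is needed.\<close>
type_synonym ('p, 'e) form = "'p \<Rightarrow> ('p, 'e) tvec list \<Rightarrow> real"

definition smooth_form :: "('p, 'e::euclidean_space) chart set \<Rightarrow> 'p set \<Rightarrow> nat \<Rightarrow> ('p, 'e) form \<Rightarrow> bool" where
  "smooth_form A W k \<alpha> \<longleftrightarrow>
     (\<forall>p\<in>W.
        (\<forall>vs. length vs \<noteq> k \<longrightarrow> \<alpha> p vs = 0) \<and>
        (\<forall>us ws v w a. set us \<union> set ws \<union> {v, w} \<subseteq> tangent_space A p \<longrightarrow>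
           \<alpha> p (us @ (\<lambda>c. a *\<^sub>R v c + w c) # ws) = a * \<alpha> p (us @ v # ws) + \<alpha> p (us @ w # ws)) \<and>
        (\<forall>vs. set vs \<subseteq> tangent_space A p \<and> \<not> distinct vs \<longrightarrow> \<alpha> p vs = 0)) \<and>
     (\<forall>c\<in>A. \<forall>ws. smooth_on (snd c ` (W \<inter> fst c))
        (\<lambda>y. \<alpha> (cinv c y) (map (tvec_of A (cinv c y) c) ws)))"

text \<open>Convention without factorials: \<open>(\<alpha> \<and> \<beta>)(v, w) = \<alpha>(v) \<beta>(w) - \<alpha>(w) \<beta>(v)\<close> for 1-forms.
  The sum is over all shuffles; the exponent counts inversions.\<close>
definition wedge :: "('v list \<Rightarrow> real) \<Rightarrow> ('v list \<Rightarrow> real) \<Rightarrow> 'v list \<Rightarrow> real" where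
  "wedge \<alpha> \<beta> vs =
     (\<Sum>S\<in>Pow {..<length vs}.
        (-1) ^ card {(i, j). i \<in> S \<and> j \<in> {..<length vs} - S \<and> j < i} *
        \<alpha> (nths vs S) * \<beta> (nths vs (- S)))"

definition one_form_unit :: "'v list \<Rightarrow> real" where
  "one_form_unit vs = (if vs = [] then 1 else 0)"

definition contract :: "'v \<Rightarrow> ('v list \<Rightarrow> real) \<Rightarrow> 'v list \<Rightarrow> real" where
  "contract v \<alpha> vs = \<alpha> (v # vs)"

text \<open>The exterior derivative, computed in a chart; for smooth forms the choice is irrelevant.\<close>
definition ext_deriv :: "('p, 'e::euclidean_space) chart set \<Rightarrow> ('p, 'e) form \<Rightarrow> ('p, 'e) form" where
  "ext_deriv A \<alpha> p vs =
     (let c = (SOME c. c \<in> charts_at A p) in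
      \<Sum>i<length vs. (-1) ^ i *
        frechet_derivative
          (\<lambda>y. \<alpha> (cinv c y)
             (map (\<lambda>v. tvec_of A (cinv c y) c (v c)) (take i vs @ drop (Suc i) vs)))
          (at (snd c p)) ((vs ! i) c))"

definition pullback ::
  "('p, 'e::euclidean_space) chart set \<Rightarrow> ('q, 'f::euclidean_space) chart set \<Rightarrow> ('p \<Rightarrow> 'q)
    \<Rightarrow> ('q, 'f) form \<Rightarrow> ('p, 'e) form" where
  "pullback A B f \<alpha> p vs = \<alpha> (f p) (map (tmap A B f p) vs)"

type_synonym 'm rvec = "(real, 'm) vec"
type_synonym 'm rmat = "((real, 'm) vec, 'm) vec"

section \<open>Sections and first jets\<close>

text \<open>Projections of fibred manifolds are written \<open>\<pi>\<close>; \<open>A\<close> is the atlas of the base and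
  \<open>B\<close> the atlas of the total space.\<close>
definition section_on ::
  "('a, 'b::euclidean_space) chart set \<Rightarrow> ('p, 'e::euclidean_space) chart set \<Rightarrow> ('p \<Rightarrow> 'a)
    \<Rightarrow> 'a set \<Rightarrow> ('a \<Rightarrow> 'p) \<Rightarrow> bool" where
  "section_on A B \<pi> W s \<longleftrightarrow> smooth_map_on A B W s \<and> (\<forall>x\<in>W. \<pi> (s x) = x)"

text \<open>The 1-jet of \<open>s\<close> at \<open>x\<close> is recorded as \<open>(x, s x, T\<^sub>x s)\<close>.\<close>
type_synonym ('a, 'b, 'p, 'e) jet = "'a \<times> 'p \<times> (('a, 'b) tvec \<Rightarrow> ('p, 'e) tvec)"

definition jet1 ::
  "('a, 'b::euclidean_space) chart set \<Rightarrow> ('p, 'e::euclidean_space) chart set \<Rightarrow> ('a \<Rightarrow> 'p) \<Rightarrow> 'a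
    \<Rightarrow> ('a, 'b, 'p, 'e) jet" where
  "jet1 A B s x = (x, s x, tmap A B s x)"

definition local_sections_at ::
  "('a, 'b::euclidean_space) chart set \<Rightarrow> ('p, 'e::euclidean_space) chart set \<Rightarrow> ('p \<Rightarrow> 'a) \<Rightarrow> 'a
    \<Rightarrow> ('a \<Rightarrow> 'p) set" where
  "local_sections_at A B \<pi> x =
     {s. \<exists>W. openin (manifold_topology A) W \<and> x \<in> W \<and> section_on A B \<pi> W s}"

definition jets ::
  "('a, 'b::euclidean_space) chart set \<Rightarrow> ('p, 'e::euclidean_space) chart set \<Rightarrow> ('p \<Rightarrow> 'a)
    \<Rightarrow> ('a, 'b, 'p, 'e) jet set" where
  "jets A B \<pi> = {jet1 A B s x | s x. s \<in> local_sections_at A B \<pi> x}"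

text \<open>A chart \<open>d\<close> of the total space is adapted to \<open>c\<close> if it has the form \<open>(x\<^sup>\<mu>, y\<^sup>a)\<close> with
  \<open>x\<^sup>\<mu>\<close> the coordinates of \<open>c\<close>.  The induced chart on jets is \<open>(x\<^sup>\<mu>, y\<^sup>a, y\<^sup>a\<^sub>\<sigma>)\<close>
  where \<open>y\<^sup>a\<^sub>\<sigma>(j\<^sup>1\<^sub>x s) = \<partial>(y\<^sup>a \<circ> s)/\<partial>x\<^sup>\<sigma>\<close>.\<close>
definition adapted ::
  "('p, 'b \<times> 'f) chart set \<Rightarrow> ('p \<Rightarrow> 'a) \<Rightarrow> ('a, 'b) chart \<Rightarrow> ('p, 'b \<times> 'f) chart \<Rightarrow> bool" where
  "adapted B \<pi> c d \<longleftrightarrow>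
     fst d = {e \<in> \<Union>(fst ` B). \<pi> e \<in> fst c} \<and> (\<forall>e\<in>fst d. fst (snd d e) = snd c (\<pi> e))"

definition jet_atlas ::
  "('a, ('m::finite) rvec) chart set \<Rightarrow> ('p, 'm rvec \<times> 'f::euclidean_space) chart set \<Rightarrow> ('p \<Rightarrow> 'a)
    \<Rightarrow> (('a, 'm rvec, 'p, 'm rvec \<times> 'f) jet, 'm rvec \<times> 'f \<times> ('f, 'm) vec) chart set" where
  "jet_atlas A B \<pi> =
     {({(x, e, L) \<in> jets A B \<pi>. x \<in> fst c \<and> e \<in> fst d},
       \<lambda>(x, e, L). (snd c x, snd (snd d e), \<chi> \<sigma>. snd (L (tvec_of A x c (axis \<sigma> 1)) d)))
      | c d. c \<in> A \<and> d \<in> B \<and> adapted B \<pi> c d}"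

section \<open>The frame bundle and the bundle of metrics\<close>

text \<open>The index set \<open>{1,\<dots>,m}\<close> is a finite linearly ordered type \<open>'m\<close>.
  A matrix \<open>A = (A\<^sup>i\<^sub>j)\<close> has upper index = row, i.e. \<open>A\<^sup>i\<^sub>j\<close> is \<open>A $ i $ j\<close>.\<close>

text \<open>The matrix \<open>\<eta>\<close> is its own inverse, so \<open>eta $ i $ j\<close> stands for both \<open>\<eta>\<^sub>i\<^sub>j\<close> and \<open>\<eta>\<^sup>i\<^sup>j\<close>.\<close>
definition eta :: "('m::{finite,linorder}) rmat" where
  "eta = (\<chi> i j. if i = j then (if i = Min UNIV then -1 else 1) else 0)"

definition K_group :: "(('m::{finite,linorder}) rmat) set" where
  "K_group = {A. invertible A \<and> transpose A ** eta ** A = eta}"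

definition p_part :: "('m::{finite,linorder}) rmat \<Rightarrow> 'm rmat" where
  "p_part A = (1/2) *\<^sub>R (A + eta ** transpose A ** eta)"

type_synonym ('a, 'm) frame = "'a \<times> ('m \<Rightarrow> ('a, 'm rvec) tvec)"

definition frame_bundle :: "('a, 'm rvec) chart set \<Rightarrow> ('a, 'm::finite) frame set" where
  "frame_bundle A =
     {(x, X). x \<in> \<Union>(fst ` A) \<and> (\<forall>k. X k \<in> tangent_space A x) \<and>
        (\<forall>v\<in>tangent_space A x. \<exists>!a. v = tlincomb X a)}"

definition frame_act :: "('a, 'm::finite) frame \<Rightarrow> 'm rmat \<Rightarrow> ('a, 'm) frame" where
  "frame_act u A = (fst u, \<lambda>j c. \<Sum>i\<in>UNIV. A $ i $ j *\<^sub>R snd u i c)"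

text \<open>Coordinates \<open>(x\<^sup>\<mu>, e\<^sup>\<mu>\<^sub>k)\<close>; \<open>e\<^sup>\<mu>\<^sub>k\<close> is \<open>e $ k $ \<mu>\<close>.\<close>
definition frame_atlas ::
  "('a, 'm rvec) chart set \<Rightarrow> (('a, 'm::finite) frame, 'm rvec \<times> 'm rmat) chart set" where
  "frame_atlas A =
     (\<lambda>c. ({(x, X) \<in> frame_bundle A. x \<in> fst c}, \<lambda>(x, X). (snd c x, \<chi> k. X k c))) ` A"

text \<open>Points of \<open>\<Sigma> = LM/K\<close> are the \<open>K\<close>-orbits.\<close>
definition proj_K :: "('a, 'm::{finite,linorder}) frame \<Rightarrow> ('a, 'm) frame set" where
  "proj_K u = frame_act u ` K_group"

definition tau_Sigma :: "('a, 'm::finite) frame set \<Rightarrow> 'a" where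
  "tau_Sigma S = (THE x. \<exists>u\<in>S. fst u = x)"

text \<open>The components \<open>g\<^sup>\<mu>\<^sup>\<nu>\<close>, in the chart \<open>c\<close>, of the metric \<open>\<eta>\<^sup>i\<^sup>j X\<^sub>i \<otimes> X\<^sub>j\<close> of an orbit.\<close>
definition metric_comp ::
  "('a, 'm rvec) chart \<Rightarrow> ('a, 'm::{finite,linorder}) frame set \<Rightarrow> 'm \<Rightarrow> 'm \<Rightarrow> real" where
  "metric_comp c S \<mu> \<nu> =
     (let X = snd (SOME u. u \<in> S) in \<Sum>i\<in>UNIV. \<Sum>j\<in>UNIV. eta $ i $ j * (X i c $ \<mu>) * (X j c $ \<nu>))"

instance uprod :: (finite) finite
  by standard simp

text \<open>Since \<open>g\<^sup>\<mu>\<^sup>\<nu>\<close> is symmetric, the fibre coordinates of \<open>\<Sigma>\<close> are indexed by unordered pairs.\<close>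
definition Sigma_atlas ::
  "('a, 'm rvec) chart set \<Rightarrow>
    (('a, 'm::{finite,linorder}) frame set, 'm rvec \<times> 'm uprod rvec) chart set" where
  "Sigma_atlas A =
     (\<lambda>c. ({S \<in> proj_K ` frame_bundle A. tau_Sigma S \<in> fst c},
           \<lambda>S. (snd c (tau_Sigma S),
                \<chi> P. metric_comp c S (Min (set_uprod P)) (Max (set_uprod P))))) ` A"

section \<open>Canonical forms on the jet bundle of the frame bundle\<close>

type_synonym ('a, 'm) fjet = "('a, 'm rvec, ('a, 'm) frame, 'm rvec \<times> 'm rmat) jet"
type_synonym 'm fjet_model = "'m rvec \<times> 'm rmat \<times> ('m rmat, 'm) vec"
type_synonym ('a, 'm) mjet =
  "('a, 'm rvec, ('a, 'm) frame set, 'm rvec \<times> 'm uprod rvec) jet"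
type_synonym 'm mjet_model = "'m rvec \<times> 'm uprod rvec \<times> ('m uprod rvec, 'm) vec"

definition J1_frame :: "('a, 'm rvec) chart set \<Rightarrow> (('a, 'm::finite) fjet, 'm fjet_model) chart set" where
  "J1_frame A = jet_atlas A (frame_atlas A) fst"

definition J1_Sigma ::
  "('a, 'm rvec) chart set \<Rightarrow> (('a, 'm::{finite,linorder}) mjet, 'm mjet_model) chart set" where
  "J1_Sigma A = jet_atlas A (Sigma_atlas A) tau_Sigma"

definition tau1 :: "('a, 'b, 'p, 'e) jet \<Rightarrow> 'a" where "tau1 = fst"
definition tau10 :: "('a, 'b, 'p, 'e) jet \<Rightarrow> 'p" where "tau10 = fst \<circ> snd"

definition taut_form ::
  "('a, 'm rvec) chart set \<Rightarrow> 'm \<Rightarrow> (('a, 'm::finite) frame, 'm rvec \<times> 'm rmat) form" where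
  "taut_form A i u vs =
     (case vs of [v] \<Rightarrow> (THE a. tmap (frame_atlas A) A fst u v = tlincomb (snd u) a) $ i | _ \<Rightarrow> 0)"

definition theta :: "('a, 'm rvec) chart set \<Rightarrow> 'm \<Rightarrow> (('a, 'm::finite) fjet, 'm fjet_model) form" where
  "theta A i = pullback (J1_frame A) (frame_atlas A) tau10 (taut_form A i)"

text \<open>The fundamental vector field on \<open>LM\<close>; the curve \<open>1 + tB\<close> in \<open>GL(m)\<close> has the same velocity at
  \<open>t = 0\<close> as \<open>exp (tB)\<close>.\<close>
definition fundamental ::
  "('a, 'm rvec) chart set \<Rightarrow> 'm rmat \<Rightarrow> ('a, 'm::finite) frame
    \<Rightarrow> (('a, 'm) frame, 'm rvec \<times> 'm rmat) tvec" where
  "fundamental A B u = velocity (frame_atlas A) (\<lambda>t. frame_act u (mat 1 + t *\<^sub>R B)) 0"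

text \<open>The \<open>V\<tau>\<close>-valued Cartan form, and the \<open>gl(m)\<close>-valued one obtained from \<open>V\<tau> \<simeq> LM \<times> gl(m)\<close>.\<close>
definition cartan ::
  "('a, 'm rvec) chart set \<Rightarrow> ('a, 'm::finite) fjet \<Rightarrow> (('a, 'm) fjet, 'm fjet_model) tvec
    \<Rightarrow> (('a, 'm) frame, 'm rvec \<times> 'm rmat) tvec" where
  "cartan A j v =
     (case j of (x, u, L) \<Rightarrow>
        (\<lambda>d. tmap (J1_frame A) (frame_atlas A) tau10 j v d - L (tmap (J1_frame A) A tau1 j v) d))"

definition omega_mat ::
  "('a, 'm rvec) chart set \<Rightarrow> ('a, 'm::finite) fjet \<Rightarrow> (('a, 'm) fjet, 'm fjet_model) tvec
    \<Rightarrow> 'm rmat" where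
  "omega_mat A j v = (THE B. fundamental A B (tau10 j) = cartan A j v)"

definition omega :: "('a, 'm rvec) chart set \<Rightarrow> 'm \<Rightarrow> 'm \<Rightarrow> (('a, 'm::finite) fjet, 'm fjet_model) form" where
  "omega A i k j vs = (case vs of [v] \<Rightarrow> omega_mat A j v $ i $ k | _ \<Rightarrow> 0)"

definition omega_p ::
  "('a, 'm rvec) chart set \<Rightarrow> 'm \<Rightarrow> 'm \<Rightarrow> (('a, 'm::{finite,linorder}) fjet, 'm fjet_model) form" where
  "omega_p A i k j vs = (case vs of [v] \<Rightarrow> p_part (omega_mat A j v) $ i $ k | _ \<Rightarrow> 0)"

definition curvature ::
  "('a, 'm rvec) chart set \<Rightarrow> 'm \<Rightarrow> 'm \<Rightarrow> (('a, 'm::finite) fjet, 'm fjet_model) form" where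
  "curvature A i k j vs =
     ext_deriv (J1_frame A) (omega A i k) j vs
     + (\<Sum>l\<in>UNIV. wedge (omega A i l j) (omega A l k j) vs)"

definition torsion :: "('a, 'm rvec) chart set \<Rightarrow> 'm \<Rightarrow> (('a, 'm::finite) fjet, 'm fjet_model) form" where
  "torsion A i j vs =
     ext_deriv (J1_frame A) (theta A i) j vs
     + (\<Sum>l\<in>UNIV. wedge (omega A i l j) (theta A l j) vs)"

definition T0 :: "('a, 'm rvec) chart set \<Rightarrow> ('a, 'm::finite) fjet set" where
  "T0 A =
     {j \<in> jets A (frame_atlas A) fst.
        \<forall>i vs. set vs \<subseteq> tangent_space (J1_frame A) j \<and> length vs = 2 \<longrightarrow> torsion A i j vs = 0}"

definition theta0 :: "('a, 'm rvec) chart set \<Rightarrow> (('a, 'm::{finite,linorder}) fjet, 'm fjet_model) form" where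
  "theta0 A j =
     foldr wedge (map (\<lambda>i. theta A i j) (sorted_list_of_set UNIV)) one_form_unit"

text \<open>The form \<open>\<theta>\<^sub>0\<close> is horizontal over \<open>M\<close>, so it can be contracted with tangent vectors of \<open>M\<close>
  by means of arbitrary lifts.\<close>
definition frame_lift ::
  "('a, 'm rvec) chart set \<Rightarrow> ('a, 'm::finite) fjet \<Rightarrow> 'm \<Rightarrow> (('a, 'm) fjet, 'm fjet_model) tvec" where
  "frame_lift A j i =
     (SOME w. w \<in> tangent_space (J1_frame A) j \<and> tmap (J1_frame A) A tau1 j w = snd (tau10 j) i)"

definition theta2 ::
  "('a, 'm rvec) chart set \<Rightarrow> 'm \<Rightarrow> 'm \<Rightarrow> (('a, 'm::{finite,linorder}) fjet, 'm fjet_model) form" where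
  "theta2 A i k j = contract (frame_lift A j i) (contract (frame_lift A j k) (theta0 A j))"

definition L_PG :: "('a, 'm rvec) chart set \<Rightarrow> (('a, 'm::{finite,linorder}) fjet, 'm fjet_model) form" where
  "L_PG A j vs =
     (\<Sum>i\<in>UNIV. \<Sum>p\<in>UNIV. \<Sum>k\<in>UNIV. eta $ i $ p * wedge (theta2 A i k j) (curvature A k p j) vs)"

definition F_omega :: "('a, 'm rvec) chart set \<Rightarrow> ('a, 'm::{finite,linorder}) fjet \<Rightarrow> ('a, 'm) mjet" where
  "F_omega A j =
     (THE j'. \<exists>s\<in>local_sections_at A (frame_atlas A) fst (tau1 j).
        j = jet1 A (frame_atlas A) s (tau1 j) \<and> j' = jet1 A (Sigma_atlas A) (proj_K \<circ> s) (tau1 j))"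

section \<open>Orientations and integration\<close>

text \<open>Integrals of \<open>m\<close>-forms need an orientation.  An orientation of the open set \<open>V\<close> is given as
  the function telling whether a frame is positive (1) or negative (-1).\<close>
definition coord_frame :: "('a, 'm rvec) chart set \<Rightarrow> ('a, 'm rvec) chart \<Rightarrow> 'a \<Rightarrow> ('a, 'm::finite) frame" where
  "coord_frame A c x = (x, \<lambda>k. tvec_of A x c (axis k 1))"

definition orientation_on :: "('a, 'm rvec) chart set \<Rightarrow> 'a set \<Rightarrow> (('a, 'm::finite) frame \<Rightarrow> real) \<Rightarrow> bool" where
  "orientation_on A V \<epsilon> \<longleftrightarrow>
     (\<forall>u\<in>frame_bundle A. fst u \<in> V \<longrightarrow>
        \<epsilon> u \<in> {1, -1} \<and> (\<forall>B. invertible B \<longrightarrow> \<epsilon> (frame_act u B) = sgn (det B) * \<epsilon> u)) \<and>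
     (\<forall>c\<in>A. continuous_map (subtopology (manifold_topology A) (V \<inter> fst c)) euclideanreal
        (\<lambda>x. \<epsilon> (coord_frame A c x)))"

text \<open>The compact set \<open>C\<close> is cut into finitely many disjoint Borel pieces, each inside the domain of
  a chart; the value does not depend on the decomposition.\<close>
definition chart_partition :: "('a, ('m::finite) rvec) chart set \<Rightarrow> 'a set \<Rightarrow> (('a, 'm rvec) chart \<times> 'a set) set \<Rightarrow> bool" where
  "chart_partition A C P \<longleftrightarrow>
     finite P \<and> (\<forall>(c, D)\<in>P. c \<in> A \<and> D \<subseteq> fst c \<and> snd c ` D \<in> sets borel) \<and>
     (\<forall>q\<in>P. \<forall>r\<in>P. q \<noteq> r \<longrightarrow> snd q \<inter> snd r = {}) \<and> \<Union>(snd ` P) = C"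

definition form_integral ::
  "('a, 'm rvec) chart set \<Rightarrow> (('a, 'm::{finite,linorder}) frame \<Rightarrow> real) \<Rightarrow> 'a set
    \<Rightarrow> ('a, 'm rvec) form \<Rightarrow> real" where
  "form_integral A \<epsilon> C \<alpha> =
     (let P = (SOME P. chart_partition A C P) in
      \<Sum>(c, D)\<in>P. LINT y:snd c ` D|lborel.
        (let u = coord_frame A c (cinv c y) in
         \<epsilon> u * \<alpha> (cinv c y) (map (snd u) (sorted_list_of_set UNIV))))"

section \<open>The variational problems\<close>

definition palatini_admissible ::
  "('a, 'm rvec) chart set \<Rightarrow> 'a set \<Rightarrow> ('a \<Rightarrow> ('a, 'm::{finite,linorder}) fjet) \<Rightarrow> bool" where
  "palatini_admissible A U \<sigma> \<longleftrightarrow>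
     section_on A (J1_frame A) tau1 U \<sigma> \<and> \<sigma> ` U \<subseteq> T0 A \<and>
     (\<forall>x\<in>U. \<forall>v\<in>tangent_space A x. \<forall>i k. pullback A (J1_frame A) \<sigma> (omega_p A i k) x [v] = 0)"

text \<open>The base manifold need not be orientable: the compact set \<open>C\<close> ranges over the compact subsets
  of oriented open sets \<open>V \<subseteq> U\<close>.  If \<open>U\<close> is oriented, restricting to \<open>V = U\<close> gives an
  equivalent condition.\<close>
definition palatini_extremal ::
  "('a, 'm rvec) chart set \<Rightarrow> 'a set \<Rightarrow> ('a \<Rightarrow> ('a, 'm::{finite,linorder}) fjet) \<Rightarrow> bool" where
  "palatini_extremal A U \<sigma> \<longleftrightarrow>
     palatini_admissible A U \<sigma> \<and>
     (\<forall>V \<epsilon> C r \<sigma>t.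
        openin (manifold_topology A) V \<and> V \<subseteq> U \<and> orientation_on A V \<epsilon> \<and>
        compactin (manifold_topology A) C \<and> C \<subseteq> V \<and> r > 0 \<and>
        smooth_map_on (cylinder_atlas A) (J1_frame A) ({-r<..<r} \<times> U) (\<lambda>(t, x). \<sigma>t t x) \<and>
        (\<forall>t\<in>{-r<..<r}. palatini_admissible A U (\<sigma>t t) \<and> (\<forall>x\<in>U - C. \<sigma>t t x = \<sigma> x)) \<and>
        (\<forall>x\<in>U. \<sigma>t 0 x = \<sigma> x) \<longrightarrow>
        ((\<lambda>t. form_integral A \<epsilon> C (pullback A (J1_frame A) (\<sigma>t t) (L_PG A)))
           has_real_derivative 0) (at 0))"

text \<open>The first order Einstein--Hilbert Lagrangian over the oriented open set \<open>V\<close>.  The group \<open>K\<close>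
  contains matrices of determinant \<open>-1\<close>, under which \<open>\<theta>\<^sub>0\<close>, hence \<open>L_PG\<close>, changes sign, while
  \<open>F_omega\<close> is invariant.  So the equation \<open>F\<^sub>\<omega>\<^sup>* L = L_PG\<close> can hold only at the positively
  oriented frames, and the sign at the negatively oriented ones is then forced.\<close>
definition EH_lagrangian ::
  "('a, 'm rvec) chart set \<Rightarrow> 'a set \<Rightarrow> (('a, 'm::{finite,linorder}) frame \<Rightarrow> real)
    \<Rightarrow> (('a, 'm) mjet, 'm mjet_model) form \<Rightarrow> bool" where
  "EH_lagrangian A V \<epsilon> L \<longleftrightarrow>
     (let W = {j \<in> jets A (Sigma_atlas A) tau_Sigma. tau1 j \<in> V} in
      smooth_form (J1_Sigma A) W CARD('m) L \<and>
      (\<forall>j\<in>W. \<forall>v\<in>tangent_space (J1_Sigma A) j. \<forall>w\<in>tangent_space (J1_Sigma A) j.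
         \<forall>vs. set vs \<subseteq> tangent_space (J1_Sigma A) j \<and>
           tmap (J1_Sigma A) A tau1 j v = (\<lambda>_. 0) \<and> tmap (J1_Sigma A) A tau1 j w = (\<lambda>_. 0) \<longrightarrow>
           contract w (contract v (L j)) vs = 0) \<and>
      (\<forall>j\<in>T0 A. tau1 j \<in> V \<longrightarrow>
         (\<forall>vs. set vs \<subseteq> tangent_space_sub (J1_frame A) (T0 A) j \<longrightarrow>
            pullback (J1_frame A) (J1_Sigma A) (F_omega A) L j vs = \<epsilon> (tau10 j) * L_PG A j vs)))"

definition EH_extremal ::
  "('a, 'm rvec) chart set \<Rightarrow> 'a set \<Rightarrow> ('a \<Rightarrow> ('a, 'm::{finite,linorder}) frame set) \<Rightarrow> bool" where
  "EH_extremal A U \<zeta> \<longleftrightarrow>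
     section_on A (Sigma_atlas A) tau_Sigma U \<zeta> \<and>
     (\<forall>V \<epsilon> L C r \<zeta>t.
        openin (manifold_topology A) V \<and> V \<subseteq> U \<and> orientation_on A V \<epsilon> \<and> EH_lagrangian A V \<epsilon> L \<and>
        compactin (manifold_topology A) C \<and> C \<subseteq> V \<and> r > 0 \<and>
        smooth_map_on (cylinder_atlas A) (Sigma_atlas A) ({-r<..<r} \<times> U) (\<lambda>(t, x). \<zeta>t t x) \<and>
        (\<forall>t\<in>{-r<..<r}. section_on A (Sigma_atlas A) tau_Sigma U (\<zeta>t t) \<and>
           (\<forall>x\<in>U - C. \<zeta>t t x = \<zeta> x)) \<and>
        (\<forall>x\<in>U. \<zeta>t 0 x = \<zeta> x) \<longrightarrow>
        ((\<lambda>t. form_integral A \<epsilon> C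
                (pullback A (J1_Sigma A) (jet1 A (Sigma_atlas A) (\<zeta>t t)) L))
           has_real_derivative 0) (at 0))"

end

theory Submission
  imports Defs
begin

text \<open>Let \<open>\<sigma>\<close> be a section of \<open>J\<^sup>1\<tau>\<close> and \<open>s = \<tau>\<^sub>1\<^sub>0 \<circ> \<sigma>\<close>.  The constraint \<open>\<sigma>\<^sup>*\<omega>\<^sub>\<pp> = 0\<close> holds at \<open>x\<close>
  if and only if \<open>F\<^sub>\<omega> (\<sigma> x) = j\<^sup>1\<^sub>x (p\<^sub>K \<circ> s)\<close>; this gives holonomy with \<open>\<zeta> = p\<^sub>K \<circ> s\<close>.  Let \<open>\<zeta>\<^sub>t\<close> be a
  variation of \<open>\<zeta>\<close> supported in a compact set.  The matrix of \<open>\<zeta>\<^sub>t\<close> relative to the frames \<open>s\<close> is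
  close to \<open>\<eta>\<close> for small \<open>t\<close>, so Gram--Schmidt gives frames \<open>s\<^sub>t = s \<cdot> B\<^sub>t\<close> with \<open>p\<^sub>K \<circ> s\<^sub>t = \<zeta>\<^sub>t\<close>, \<open>s\<^sub>0 = s\<close>
  and \<open>det B\<^sub>t > 0\<close> which depend smoothly on \<open>(t, x)\<close>.  By the fundamental lemma of Riemannian geometry
  there is exactly one \<open>\<sigma>\<^sub>t x \<in> \<T>\<^sub>0\<close> over \<open>s\<^sub>t x\<close> with \<open>F\<^sub>\<omega> (\<sigma>\<^sub>t x) = j\<^sup>1\<^sub>x \<zeta>\<^sub>t\<close>.  Hence \<open>\<sigma>\<^sub>t\<close> is an admissible
  variation of the given extremal, and since \<open>F\<^sub>\<omega>\<close> pulls the Einstein--Hilbert Lagrangian back to the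
  Palatini Lagrangian, the two action integrals coincide for all small \<open>t\<close>, once \<open>V\<close> carries the
  orientation for which the frames \<open>s\<close> are positive.\<close>

section \<open>Calculus of smooth maps\<close>

text \<open>No Euler-Lagrange equation is ever written down: each variation of the metrics is
  converted into a variation of the given section, and the two actions are compared integrand by
  integrand. Two obstacles shape the conversion. The converted family has to start at the given
  section and to rest outside the compact set. The start comes from uniqueness: the given section is
  itself the torsion-free lift of its own frames. Rest outside the compact set comes from
  normalising the orthonormalisation so that it sends \<eta> to the identity matrix; frames then do
  not move where the metric does not move. The second obstacle is that orthonormalisation in
  indefinite signature can run into null vectors, so it is only available near \<eta>, and
  compactness has to provide one time interval for all points. In coordinates, both the constraint
  \<open>\<omega>\<^sub>\<pp> = 0\<close> and the condition on \<open>F_omega\<close> become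
  equations for \<open>dmetric\<close>, the derivative of the metric of a frame; this is why they
  are equivalent.\<close>

lemma has_derivative_frechet:
  assumes "f differentiable_on S" "open S" "x \<in> S"
  shows "(f has_derivative frechet_derivative f (at x)) (at x)"
  using assms by (metis at_within_open differentiable_on_def frechet_derivative_works)

lemma Ck_on_imp_continuous_on: "Ck_on k S f \<Longrightarrow> continuous_on S f"
  by (cases k) (auto simp: differentiable_imp_continuous_on)

lemma Ck_on_SucD: "Ck_on (Suc k) S f \<Longrightarrow> Ck_on k S f"
  by (induction k arbitrary: f) (auto simp: differentiable_imp_continuous_on)

lemma Ck_on_subset: "Ck_on k S f \<Longrightarrow> T \<subseteq> S \<Longrightarrow> Ck_on k T f"
  by (induction k arbitrary: f) (auto intro: continuous_on_subset differentiable_on_subset)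

text \<open>Near \<open>x\<close> the two functions have the same candidates for a derivative, so
  the choice made by \<open>frechet_derivative\<close> is the same. No differentiability enters,
  which allows rewriting under \<open>frechet_derivative\<close> at once.\<close>

lemma frechet_derivative_cong_open:
  assumes "open S" "x \<in> S" "\<And>y. y \<in> S \<Longrightarrow> f y = g y"
  shows "frechet_derivative f (at x) = frechet_derivative g (at x)"
proof -
  have "(f has_derivative D) (at x) \<longleftrightarrow> (g has_derivative D) (at x)" for D
    using has_derivative_transform_within_open[OF _ assms(1,2)] assms(3) by metis
  then show ?thesis by (simp add: frechet_derivative_def)
qed

lemma Ck_on_cong:
  assumes "open S" "\<And>x. x \<in> S \<Longrightarrow> f x = g x"
  shows "Ck_on k S f \<longleftrightarrow> Ck_on k S g"
  using assms(2)
proof (induction k arbitrary: f g)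
  case 0
  then show ?case by (simp cong: continuous_on_cong)
next
  case (Suc k)
  have "f differentiable_on S \<longleftrightarrow> g differentiable_on S"
    unfolding differentiable_on_def differentiable_def using Suc.prems
    by (metis has_derivative_transform)
  moreover have "Ck_on k S (\<lambda>x. frechet_derivative f (at x) v) \<longleftrightarrow>
      Ck_on k S (\<lambda>x. frechet_derivative g (at x) v)" for v
    by (rule Suc.IH) (simp add: frechet_derivative_cong_open[OF assms(1) _ Suc.prems])
  ultimately show ?case by simp
qed

lemma Ck_on_local:
  assumes "\<And>x. x \<in> S \<Longrightarrow> \<exists>T. open T \<and> x \<in> T \<and> Ck_on k T f"
  shows "Ck_on k S f"
  using assms
proof (induction k arbitrary: f)
  case 0
  then have "isCont f x" if "x \<in> S" for x
    using that continuous_on_eq_continuous_at by (metis Ck_on.simps(1))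
  then show ?case by (simp add: continuous_at_imp_continuous_on)
next
  case (Suc k)
  have "f differentiable at x" if "x \<in> S" for x
    using Suc.prems[OF that] by (auto simp: differentiable_on_eq_differentiable_at)
  then have "f differentiable_on S" by (simp add: differentiable_at_imp_differentiable_on)
  moreover have "Ck_on k S (\<lambda>x. frechet_derivative f (at x) v)" for v
    by (rule Suc.IH) (use Suc.prems in fastforce)
  ultimately show ?case by simp
qed

lemma Ck_on_const: "Ck_on k S (\<lambda>x. c)"
proof (induction k arbitrary: c)
  case (Suc k)
  have "frechet_derivative (\<lambda>x. c) (at x) = (\<lambda>v. 0)" for x :: 'a
    by (simp add: frechet_derivative_at[symmetric])
  then show ?case using Suc by simp
qed simp

lemma Ck_on_bounded_linear:
  assumes "bounded_linear L"
  shows "Ck_on k S L"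
proof (cases k)
  case 0
  then show ?thesis using assms by (simp add: linear_continuous_on)
next
  case (Suc k')
  have "frechet_derivative L (at x) = L" for x
    using assms by (metis bounded_linear_imp_has_derivative frechet_derivative_at)
  then show ?thesis using assms
    by (simp add: Suc Ck_on_const bounded_linear_imp_differentiable_on)
qed

lemma Ck_on_add:
  assumes "open S"
  shows "Ck_on k S f \<Longrightarrow> Ck_on k S g \<Longrightarrow> Ck_on k S (\<lambda>x. f x + g x)"
proof (induction k arbitrary: f g)
  case (Suc k)
  have "frechet_derivative (\<lambda>x. f x + g x) (at x) =
      (\<lambda>v. frechet_derivative f (at x) v + frechet_derivative g (at x) v)" if "x \<in> S" for x
    using has_derivative_add[OF has_derivative_frechet has_derivative_frechet, of f S x g]
      Suc.prems that assms by (metis Ck_on.simps(2) frechet_derivative_at)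
  then show ?case using Suc
    by (auto simp: Ck_on_cong[OF assms(1), of "\<lambda>x. frechet_derivative (\<lambda>x. f x + g x) (at x) v"
      "\<lambda>x. frechet_derivative f (at x) v + frechet_derivative g (at x) v" for v])
qed (simp add: continuous_on_add)

text \<open>The product rule expresses the derivative by two terms of the same bilinear shape, each
  with one factor differentiated once; the induction hypothesis applies because the other factor
  drops one order by \<open>Ck_on_SucD\<close>.\<close>

lemma Ck_on_bilinear:
  assumes "open S" and B: "bounded_bilinear B"
  shows "Ck_on k S f \<Longrightarrow> Ck_on k S g \<Longrightarrow> Ck_on k S (\<lambda>x. B (f x) (g x))"
proof (induction k arbitrary: f g)
  case 0
  then show ?case using bounded_bilinear.continuous_on[OF B] by auto
next
  case (Suc k)
  have d: "((\<lambda>x. B (f x) (g x)) has_derivative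
      (\<lambda>v. B (f x) (frechet_derivative g (at x) v) + B (frechet_derivative f (at x) v) (g x))) (at x)"
    if "x \<in> S" for x
    using bounded_bilinear.FDERIV[OF B has_derivative_frechet has_derivative_frechet, of f S x g]
      Suc.prems that assms by auto
  then have eq: "frechet_derivative (\<lambda>x. B (f x) (g x)) (at x) v =
      B (f x) (frechet_derivative g (at x) v) + B (frechet_derivative f (at x) v) (g x)" if "x \<in> S" for x v
    by (simp add: frechet_derivative_at[OF d[OF that], symmetric])
  have "Ck_on k S (\<lambda>x. B (f x) (frechet_derivative g (at x) v) + B (frechet_derivative f (at x) v) (g x))" for v
    using Suc.prems Suc.prems[THEN Ck_on_SucD] by (intro Ck_on_add assms Suc.IH) auto
  then have "Ck_on k S (\<lambda>x. frechet_derivative (\<lambda>x. B (f x) (g x)) (at x) v)" for v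
    by (subst Ck_on_cong[OF assms(1) eq]) auto
  moreover have "(\<lambda>x. B (f x) (g x)) differentiable_on S"
    using d by (meson differentiable_at_imp_differentiable_on differentiable_def)
  ultimately show ?case by simp
qed

lemma Ck_on_linear_compose:
  assumes "open S" and L: "bounded_linear L"
  shows "Ck_on k S f \<Longrightarrow> Ck_on k S (\<lambda>x. L (f x))"
proof (induction k arbitrary: f)
  case 0
  then show ?case using bounded_linear.continuous_on[OF L] by auto
next
  case (Suc k)
  have d: "((\<lambda>x. L (f x)) has_derivative (\<lambda>v. L (frechet_derivative f (at x) v))) (at x)"
    if "x \<in> S" for x
    using bounded_linear.has_derivative[OF L has_derivative_frechet, of f S x] Suc.prems that assms by auto
  then have eq: "frechet_derivative (\<lambda>x. L (f x)) (at x) v = L (frechet_derivative f (at x) v)"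
    if "x \<in> S" for x v
    by (simp add: frechet_derivative_at[OF d[OF that], symmetric])
  have "Ck_on k S (\<lambda>x. frechet_derivative (\<lambda>x. L (f x)) (at x) v)" for v
    using Suc by (subst Ck_on_cong[OF assms(1) eq]) auto
  moreover have "(\<lambda>x. L (f x)) differentiable_on S"
    using d by (meson differentiable_at_imp_differentiable_on differentiable_def)
  ultimately show ?case by simp
qed

lemma Ck_on_sum:
  assumes "open S" "\<And>i. i \<in> I \<Longrightarrow> Ck_on k S (f i)"
  shows "Ck_on k S (\<lambda>x. \<Sum>i\<in>I. f i x)"
  using assms(2) by (induction I rule: infinite_finite_induct) (auto simp: Ck_on_const Ck_on_add assms(1))

text \<open>\<open>Ck_on\<close> differentiates in a fixed direction, whereas the chain rule
  produces the moving direction \<open>Df(x) v\<close>. Expansion in a basis turns a moving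
  direction into fixed directions with moving scalar coefficients.\<close>

lemma linear_frechet_basis:
  fixes g :: "'b::euclidean_space \<Rightarrow> 'c::real_normed_vector"
  assumes "g differentiable at y"
  shows "frechet_derivative g (at y) w = (\<Sum>b\<in>Basis. (w \<bullet> b) *\<^sub>R frechet_derivative g (at y) b)"
proof -
  interpret linear "frechet_derivative g (at y)" by (rule linear_frechet_derivative[OF assms])
  show ?thesis
    by (subst (1) euclidean_representation[of w, symmetric]) (simp only: sum scale)
qed

text \<open>Induction on the order with \<open>g\<close> arbitrary: by the chain rule and the basis
  expansion the derivative is a sum of products of a coefficient of \<open>Df(x) v\<close> and a
  partial derivative of \<open>g\<close> composed with \<open>f\<close>, and the latter falls under
  the induction hypothesis.\<close>

lemma Ck_on_compose:
  fixes g :: "'b::euclidean_space \<Rightarrow> 'c::real_normed_vector" and f :: "'a::real_normed_vector \<Rightarrow> 'b"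
  assumes "open S" "open T" "f ` S \<subseteq> T"
  shows "Ck_on k S f \<Longrightarrow> Ck_on k T g \<Longrightarrow> Ck_on k S (\<lambda>x. g (f x))"
proof (induction k arbitrary: g)
  case 0
  then show ?case using continuous_on_compose2 assms by auto
next
  case (Suc k)
  have d: "((\<lambda>x. g (f x)) has_derivative
      (\<lambda>v. frechet_derivative g (at (f x)) (frechet_derivative f (at x) v))) (at x)" if "x \<in> S" for x
    using diff_chain_at[OF has_derivative_frechet[of f S] has_derivative_frechet[of g T], of x] that assms Suc.prems
    by (auto simp: o_def)
  have eq: "frechet_derivative (\<lambda>x. g (f x)) (at x) v =
      (\<Sum>b\<in>Basis. (frechet_derivative f (at x) v \<bullet> b) *\<^sub>R frechet_derivative g (at (f x)) b)"
    if "x \<in> S" for x v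
  proof -
    have "g differentiable at (f x)"
      using Suc.prems assms that by (auto simp: differentiable_on_eq_differentiable_at)
    from linear_frechet_basis[OF this, of "frechet_derivative f (at x) v"] show ?thesis
      by (simp add: frechet_derivative_at[OF d[OF that], symmetric])
  qed
  have "Ck_on k S (\<lambda>x. (frechet_derivative f (at x) v \<bullet> b) *\<^sub>R frechet_derivative g (at (f x)) b)" for v b
  proof (rule Ck_on_bilinear[OF assms(1) bounded_bilinear_scaleR])
    show "Ck_on k S (\<lambda>x. frechet_derivative f (at x) v \<bullet> b)"
      using Suc.prems by (intro Ck_on_linear_compose[OF assms(1) bounded_linear_inner_left]) auto
    show "Ck_on k S (\<lambda>x. frechet_derivative g (at (f x)) b)"
      using Suc.prems Suc.prems[THEN Ck_on_SucD] by (intro Suc.IH) auto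
  qed
  then have "Ck_on k S (\<lambda>x. frechet_derivative (\<lambda>x. g (f x)) (at x) v)" for v
    by (subst Ck_on_cong[OF assms(1) eq]) (auto intro: Ck_on_sum assms)
  moreover have "(\<lambda>x. g (f x)) differentiable_on S"
    using d by (meson differentiable_at_imp_differentiable_on differentiable_def)
  ultimately show ?case by simp
qed

text \<open>The derivative of \<open>1/f\<close> is a product of \<open>1/f\<close> twice and the
  derivative of \<open>f\<close>, so the induction on the order closes with \<open>f\<close> fixed.
  The square root is treated in the same way.\<close>

lemma Ck_on_inverse:
  fixes f :: "'a::real_normed_vector \<Rightarrow> real"
  assumes "open S" "\<And>x. x \<in> S \<Longrightarrow> f x \<noteq> 0"
  shows "Ck_on k S f \<Longrightarrow> Ck_on k S (\<lambda>x. inverse (f x))"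
proof (induction k)
  case 0
  then show ?case using assms by (auto intro: continuous_on_inverse)
next
  case (Suc k)
  have d: "((\<lambda>x. inverse (f x)) has_derivative
      (\<lambda>v. - (inverse (f x) * frechet_derivative f (at x) v * inverse (f x)))) (at x)" if "x \<in> S" for x
    using Deriv.has_derivative_inverse[OF _ has_derivative_frechet[of f S x]] Suc.prems that assms by auto
  then have eq: "frechet_derivative (\<lambda>x. inverse (f x)) (at x) v =
      (- 1) * (inverse (f x) * frechet_derivative f (at x) v * inverse (f x))" if "x \<in> S" for x v
    by (simp add: frechet_derivative_at[OF d[OF that], symmetric])
  have "Ck_on k S (\<lambda>x. (- 1) * (inverse (f x) * frechet_derivative f (at x) v * inverse (f x)))" for v
    using Suc.prems Suc.prems[THEN Ck_on_SucD] Suc.IH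
    by (intro Ck_on_bilinear[OF assms(1) bounded_bilinear_mult]) (auto simp: Ck_on_const)
  then have "Ck_on k S (\<lambda>x. frechet_derivative (\<lambda>x. inverse (f x)) (at x) v)" for v
    by (subst Ck_on_cong[OF assms(1) eq]) auto
  moreover have "(\<lambda>x. inverse (f x)) differentiable_on S"
    using d by (meson differentiable_at_imp_differentiable_on differentiable_def)
  ultimately show ?case by simp
qed

lemma Ck_on_sqrt:
  fixes f :: "'a::real_normed_vector \<Rightarrow> real"
  assumes "open S" "\<And>x. x \<in> S \<Longrightarrow> f x > 0"
  shows "Ck_on k S f \<Longrightarrow> Ck_on k S (\<lambda>x. sqrt (f x))"
proof (induction k)
  case 0
  then show ?case by (auto intro: continuous_on_real_sqrt)
next
  case (Suc k)
  have d: "((\<lambda>x. sqrt (f x)) has_derivative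
      (\<lambda>v. frechet_derivative f (at x) v * (inverse (sqrt (f x)) * (1/2)))) (at x)" if "x \<in> S" for x
  proof -
    have "(sqrt has_derivative (*) (inverse (sqrt (f x)) / 2)) (at (f x))"
      using DERIV_real_sqrt[of "f x"] assms(2)[OF that] unfolding has_field_derivative_def by blast
    from diff_chain_at[OF has_derivative_frechet[of f S x] this]
    show ?thesis
      using Suc.prems(1) that assms(1) by (simp add: o_def mult.commute)
  qed
  have eq: "frechet_derivative (\<lambda>x. sqrt (f x)) (at x) v =
      frechet_derivative f (at x) v * (inverse (sqrt (f x)) * (1/2))" if "x \<in> S" for x v
    by (simp add: frechet_derivative_at[OF d[OF that], symmetric])
  have "Ck_on k S (\<lambda>x. inverse (sqrt (f x)))"
    using assms Suc.IH Suc.prems Suc.prems[THEN Ck_on_SucD] by (intro Ck_on_inverse[OF assms(1)]) force+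
  then have "Ck_on k S (\<lambda>x. frechet_derivative f (at x) v * (inverse (sqrt (f x)) * (1/2)))" for v
    using Suc.prems
    by (intro Ck_on_bilinear[OF assms(1) bounded_bilinear_mult]) (auto simp: Ck_on_const)
  then have "Ck_on k S (\<lambda>x. frechet_derivative (\<lambda>x. sqrt (f x)) (at x) v)" for v
    by (subst Ck_on_cong[OF assms(1) eq]) auto
  moreover have "(\<lambda>x. sqrt (f x)) differentiable_on S"
    using d by (meson differentiable_at_imp_differentiable_on differentiable_def)
  ultimately show ?case by simp
qed

section \<open>Closure properties of smooth functions\<close>

named_theorems smooth_intros

lemma smooth_on_subset: "smooth_on S f \<Longrightarrow> T \<subseteq> S \<Longrightarrow> smooth_on T f"
  by (auto simp: smooth_on_def intro: Ck_on_subset)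

lemma smooth_on_cong:
  assumes "smooth_on S f" "open S" "\<And>x. x \<in> S \<Longrightarrow> f x = g x"
  shows "smooth_on S g"
  using assms Ck_on_cong[of S f g] by (auto simp: smooth_on_def)

lemma smooth_on_local:
  assumes "\<And>x. x \<in> S \<Longrightarrow> \<exists>T. open T \<and> x \<in> T \<and> smooth_on T f"
  shows "smooth_on S f"
  using assms Ck_on_local[of S _ f] unfolding smooth_on_def by metis

lemma smooth_on_imp_continuous_on: "smooth_on S f \<Longrightarrow> continuous_on S f"
  using Ck_on_imp_continuous_on by (auto simp: smooth_on_def)

lemma smooth_on_imp_differentiable_on: "smooth_on S f \<Longrightarrow> f differentiable_on S"
  by (metis Ck_on.simps(2) smooth_on_def)

lemma smooth_on_has_derivative:
  assumes "smooth_on S f" "open S" "x \<in> S"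
  shows "(f has_derivative frechet_derivative f (at x)) (at x)"
  by (rule has_derivative_frechet[OF smooth_on_imp_differentiable_on[OF assms(1)] assms(2,3)])

lemma smooth_on_differentiable_at:
  assumes "smooth_on S f" "open S" "x \<in> S"
  shows "f differentiable at x"
  using smooth_on_has_derivative[OF assms] by (meson differentiable_def)

lemma smooth_on_const [smooth_intros]: "smooth_on S (\<lambda>x. c)"
  by (simp add: smooth_on_def Ck_on_const)

lemma smooth_on_bounded_linear: "bounded_linear L \<Longrightarrow> smooth_on S L"
  by (simp add: smooth_on_def Ck_on_bounded_linear)

lemma smooth_on_id [smooth_intros]: "smooth_on S (\<lambda>x. x)"
  by (simp add: smooth_on_bounded_linear)

lemma smooth_on_linear_compose:
  "bounded_linear L \<Longrightarrow> open S \<Longrightarrow> smooth_on S f \<Longrightarrow> smooth_on S (\<lambda>x. L (f x))"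
  by (simp add: smooth_on_def Ck_on_linear_compose)

lemma smooth_on_bilinear:
  "bounded_bilinear B \<Longrightarrow> open S \<Longrightarrow> smooth_on S f \<Longrightarrow> smooth_on S g \<Longrightarrow> smooth_on S (\<lambda>x. B (f x) (g x))"
  by (simp add: smooth_on_def Ck_on_bilinear)

lemma smooth_on_add [smooth_intros]:
  "open S \<Longrightarrow> smooth_on S f \<Longrightarrow> smooth_on S g \<Longrightarrow> smooth_on S (\<lambda>x. f x + g x)"
  by (simp add: smooth_on_def Ck_on_add)

lemma smooth_on_sum [smooth_intros]:
  "open S \<Longrightarrow> (\<And>i. i \<in> I \<Longrightarrow> smooth_on S (f i)) \<Longrightarrow> smooth_on S (\<lambda>x. \<Sum>i\<in>I. f i x)"
  by (simp add: smooth_on_def Ck_on_sum)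

lemmas smooth_on_scaleR [smooth_intros] = smooth_on_bilinear[OF bounded_bilinear_scaleR]
  and smooth_on_mult [smooth_intros] = smooth_on_bilinear[OF bounded_bilinear_mult]
  and smooth_on_fst [smooth_intros] = smooth_on_linear_compose[OF bounded_linear_fst]
  and smooth_on_snd [smooth_intros] = smooth_on_linear_compose[OF bounded_linear_snd]
  and smooth_on_vec_nth [smooth_intros] = smooth_on_linear_compose[OF bounded_linear_vec_nth]
  and smooth_on_minus [smooth_intros] = smooth_on_linear_compose[OF bounded_linear_minus[OF bounded_linear_ident]]

lemma smooth_on_diff [smooth_intros]:
  "open S \<Longrightarrow> smooth_on S f \<Longrightarrow> smooth_on S g \<Longrightarrow> smooth_on S (\<lambda>x. f x - g x)"
  using smooth_on_add[OF _ _ smooth_on_minus, of S f g] by simp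

lemma smooth_on_prod [smooth_intros]:
  fixes f :: "'i \<Rightarrow> 'a::real_normed_vector \<Rightarrow> real"
  assumes "open S"
  shows "(\<And>i. i \<in> I \<Longrightarrow> smooth_on S (f i)) \<Longrightarrow> smooth_on S (\<lambda>x. \<Prod>i\<in>I. f i x)"
  by (induction I rule: infinite_finite_induct) (auto simp: smooth_on_const smooth_on_mult assms)

lemma smooth_on_Pair [smooth_intros]:
  assumes "open S" "smooth_on S f" "smooth_on S g"
  shows "smooth_on S (\<lambda>x. (f x, g x))"
proof -
  have "bounded_linear (\<lambda>a. (a, 0))" "bounded_linear (\<lambda>b. (0, b))"
    by (simp_all add: bounded_linear_Pair)
  with assms have "smooth_on S (\<lambda>x. (f x, 0) + (0, g x))"
    by (intro smooth_on_add smooth_on_linear_compose[of "\<lambda>a. (a, 0)"]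
      smooth_on_linear_compose[of "\<lambda>b. (0, b)"]) auto
  then show ?thesis by simp
qed

lemma bounded_linear_axis: "bounded_linear (axis i :: 'b::euclidean_space \<Rightarrow> ('b, 'n::finite) vec)"
  unfolding linear_conv_bounded_linear[symmetric]
  by (rule linearI) (auto simp: vec_eq_iff axis_def)

lemma smooth_on_vec_lambda [smooth_intros]:
  fixes f :: "'n::finite \<Rightarrow> 'a::real_normed_vector \<Rightarrow> 'b::euclidean_space"
  assumes "open S" "\<And>i. smooth_on S (f i)"
  shows "smooth_on S (\<lambda>x. \<chi> i. f i x)"
proof -
  have "smooth_on S (\<lambda>x. \<Sum>i\<in>UNIV. axis i (f i x))"
    using assms by (intro smooth_on_sum smooth_on_linear_compose[OF bounded_linear_axis]) auto
  moreover have "(\<Sum>i\<in>UNIV. axis i (f i x)) = (\<chi> i. f i x)" for x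
    by (simp add: vec_eq_iff axis_def if_distrib cong: if_cong)
  ultimately show ?thesis by simp
qed

lemma smooth_on_compose:
  fixes g :: "'b::euclidean_space \<Rightarrow> 'c::real_normed_vector"
  assumes "smooth_on T g" "open T" "smooth_on S f" "open S" "f ` S \<subseteq> T"
  shows "smooth_on S (\<lambda>x. g (f x))"
  using assms by (simp add: smooth_on_def Ck_on_compose)

lemma smooth_on_inverse [smooth_intros]:
  fixes f :: "'a::real_normed_vector \<Rightarrow> real"
  shows "open S \<Longrightarrow> smooth_on S f \<Longrightarrow> (\<And>x. x \<in> S \<Longrightarrow> f x \<noteq> 0) \<Longrightarrow> smooth_on S (\<lambda>x. inverse (f x))"
  by (simp add: smooth_on_def Ck_on_inverse)

lemma smooth_on_sqrt [smooth_intros]: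
  fixes f :: "'a::real_normed_vector \<Rightarrow> real"
  shows "open S \<Longrightarrow> smooth_on S f \<Longrightarrow> (\<And>x. x \<in> S \<Longrightarrow> f x > 0) \<Longrightarrow> smooth_on S (\<lambda>x. sqrt (f x))"
  by (simp add: smooth_on_def Ck_on_sqrt)

lemma smooth_on_frechet_derivative [smooth_intros]:
  "smooth_on S f \<Longrightarrow> smooth_on S (\<lambda>x. frechet_derivative f (at x) v)"
  by (metis Ck_on.simps(2) smooth_on_def)

text \<open>Here both the base point and the direction move. This is the shape in which first
  derivatives of coordinate changes occur in the coordinate changes of jet bundles.\<close>

lemma smooth_on_frechet_derivative_compose:
  fixes g :: "'b::euclidean_space \<Rightarrow> 'c::real_normed_vector"
  assumes "smooth_on T g" "open T" "smooth_on S p" "smooth_on S w" "open S" "p ` S \<subseteq> T"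
  shows "smooth_on S (\<lambda>x. frechet_derivative g (at (p x)) (w x))"
proof -
  have "smooth_on S (\<lambda>x. (w x \<bullet> b) *\<^sub>R frechet_derivative g (at (p x)) b)" for b
  proof (rule smooth_on_scaleR[OF assms(5)])
    show "smooth_on S (\<lambda>x. w x \<bullet> b)"
      by (rule smooth_on_linear_compose[OF bounded_linear_inner_left assms(5,4)])
    show "smooth_on S (\<lambda>x. frechet_derivative g (at (p x)) b)"
      by (rule smooth_on_compose[OF smooth_on_frechet_derivative[OF assms(1)] assms(2,3,5,6)])
  qed
  then have sm: "smooth_on S (\<lambda>x. \<Sum>b\<in>Basis. (w x \<bullet> b) *\<^sub>R frechet_derivative g (at (p x)) b)"
    by (rule smooth_on_sum[OF assms(5)])
  have "g differentiable at (p x)" if "x \<in> S" for x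
    using assms(6) that by (intro smooth_on_differentiable_at[OF assms(1,2)]) auto
  then show ?thesis
    by (intro smooth_on_cong[OF sm assms(5)]) (simp add: linear_frechet_basis[symmetric])
qed

section \<open>Symmetry of second derivatives\<close>

lemma DERIV_along_line:
  assumes "f differentiable at (c + s *\<^sub>R a)"
  shows "((\<lambda>s. f (c + s *\<^sub>R a)) has_real_derivative frechet_derivative f (at (c + s *\<^sub>R a)) a) (at s)"
proof -
  let ?D = "frechet_derivative f (at (c + s *\<^sub>R a))"
  have "((\<lambda>s. c + s *\<^sub>R a) has_derivative (\<lambda>h. h *\<^sub>R a)) (at s)"
    by (auto intro!: derivative_eq_intros)
  from diff_chain_at[OF this, of f ?D]
  have "((\<lambda>s. f (c + s *\<^sub>R a)) has_derivative (\<lambda>h. ?D (h *\<^sub>R a))) (at s)"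
    using assms frechet_derivative_works by (auto simp: o_def)
  moreover have "?D (h *\<^sub>R a) = ?D a * h" for h
    using linear_frechet_derivative[OF assms] by (simp add: linear_scale)
  ultimately show ?thesis by (simp add: has_field_derivative_def)
qed

text \<open>Two applications of the mean value theorem: in direction \<open>a\<close> to the
  difference of \<open>f\<close> and its translate by \<open>h *\<^sub>R b\<close>, then in
  direction \<open>b\<close> to the resulting derivative along \<open>a\<close>.\<close>

lemma second_difference_mean_value:
  fixes f :: "'a::real_normed_vector \<Rightarrow> real"
  assumes f: "smooth_on S f" and S: "open S" and h: "h > 0"
    and sub: "\<And>s t. 0 \<le> s \<Longrightarrow> s \<le> h \<Longrightarrow> 0 \<le> t \<Longrightarrow> t \<le> h \<Longrightarrow> x + s *\<^sub>R a + t *\<^sub>R b \<in> S"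
  obtains s t where "0 < s" "s < h" "0 < t" "t < h"
    "f (x + h *\<^sub>R a + h *\<^sub>R b) - f (x + h *\<^sub>R b) - f (x + h *\<^sub>R a) + f x =
      h * h * frechet_derivative (\<lambda>y. frechet_derivative f (at y) a) (at (x + s *\<^sub>R a + t *\<^sub>R b)) b"
proof -
  let ?Da = "\<lambda>y. frechet_derivative f (at y) a"
  have df: "f differentiable at y" "?Da differentiable at y" if "y \<in> S" for y
    using smooth_on_differentiable_at[OF _ S that] f smooth_on_frechet_derivative[OF f] by auto
  have "DERIV (\<lambda>s. f ((x + h *\<^sub>R b) + s *\<^sub>R a) - f (x + s *\<^sub>R a)) s :>
      ?Da ((x + h *\<^sub>R b) + s *\<^sub>R a) - ?Da (x + s *\<^sub>R a)" if "0 \<le> s" "s \<le> h" for s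
    using sub[OF that, of h] sub[OF that, of 0] h
    by (intro DERIV_diff DERIV_along_line df) (auto simp: algebra_simps)
  from MVT2[OF h this] obtain s where s: "0 < s" "s < h"
    "f ((x + h *\<^sub>R b) + h *\<^sub>R a) - f (x + h *\<^sub>R a) - (f (x + h *\<^sub>R b) - f x) =
      h * (?Da ((x + h *\<^sub>R b) + s *\<^sub>R a) - ?Da (x + s *\<^sub>R a))"
    by auto
  have "DERIV (\<lambda>t. ?Da ((x + s *\<^sub>R a) + t *\<^sub>R b)) t :>
      frechet_derivative ?Da (at ((x + s *\<^sub>R a) + t *\<^sub>R b)) b" if "0 \<le> t" "t \<le> h" for t
    using sub[of s t] that s by (intro DERIV_along_line df) auto
  from MVT2[OF h this] obtain t where t: "0 < t" "t < h"
    "?Da ((x + s *\<^sub>R a) + h *\<^sub>R b) - ?Da (x + s *\<^sub>R a) =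
      h * frechet_derivative ?Da (at ((x + s *\<^sub>R a) + t *\<^sub>R b)) b"
    by auto
  show ?thesis
    by (rule that[OF s(1,2) t(1,2)]) (use s(3) t(3) in \<open>simp add: algebra_simps\<close>)
qed

text \<open>The second difference is symmetric in \<open>a\<close> and \<open>b\<close>. Its two
  mean value representations equate the mixed derivatives, taken in the two orders, at two points
  near \<open>x\<close>; continuity of the mixed derivatives transfers this to
  \<open>x\<close>.\<close>

lemma smooth_on_second_derivative_commute_real:
  fixes f :: "'a::real_normed_vector \<Rightarrow> real"
  assumes f: "smooth_on S f" and S: "open S" and x: "x \<in> S"
  shows "frechet_derivative (\<lambda>y. frechet_derivative f (at y) a) (at x) b =
    frechet_derivative (\<lambda>y. frechet_derivative f (at y) b) (at x) a"
proof -
  define P where "P a b y = frechet_derivative (\<lambda>y. frechet_derivative f (at y) a) (at y) b" for a b y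
  have near: "\<exists>d>0. \<forall>y. dist y x < d \<longrightarrow> y \<in> S \<and> \<bar>P a b y - P a b x\<bar> < e" if e: "e > 0" for a b e
  proof -
    have "continuous_on S (P a b)"
      unfolding P_def using f by (intro smooth_on_imp_continuous_on smooth_on_frechet_derivative)
    then obtain d1 where d1: "d1 > 0" "\<And>y. y \<in> S \<Longrightarrow> dist y x < d1 \<Longrightarrow> \<bar>P a b y - P a b x\<bar> < e"
      using x e unfolding continuous_on_iff dist_real_def by metis
    obtain d2 where "d2 > 0" "\<And>y. dist y x < d2 \<Longrightarrow> y \<in> S"
      using S x unfolding open_dist by metis
    with d1 show ?thesis by (intro exI[of _ "min d1 d2"]) auto
  qed
  have "\<bar>P a b x - P b a x\<bar> < e" if e: "e > 0" for e
  proof -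
    obtain d1 d2 where d: "d1 > 0" "\<And>y. dist y x < d1 \<Longrightarrow> y \<in> S \<and> \<bar>P a b y - P a b x\<bar> < e/2"
      "d2 > 0" "\<And>y. dist y x < d2 \<Longrightarrow> y \<in> S \<and> \<bar>P b a y - P b a x\<bar> < e/2"
      using near[of "e/2"] e by (metis half_gt_zero)
    \<comment> \<open>The summand 1 keeps \<open>n\<close> positive when \<open>a\<close> and
      \<open>b\<close> vanish. The side \<open>h\<close> is chosen so that every point of the
      parallelogram is within half of \<open>min d1 d2\<close> from \<open>x\<close>.\<close>
    define n where "n = norm a + norm b + 1"
    define h where "h = min d1 d2 / (2 * n)"
    have n: "n > 0" by (simp add: n_def add_nonneg_pos)
    have h: "h > 0" using d n by (simp add: h_def)
    have close: "dist (x + s *\<^sub>R a + t *\<^sub>R b) x < min d1 d2"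
      if "0 \<le> s" "s \<le> h" "0 \<le> t" "t \<le> h" for s t
    proof -
      have "norm (s *\<^sub>R a + t *\<^sub>R b) \<le> s * norm a + t * norm b"
        using that norm_triangle_ineq[of "s *\<^sub>R a" "t *\<^sub>R b"] by simp
      also have "\<dots> \<le> h * norm a + h * norm b" using that by (intro add_mono mult_right_mono) auto
      also have "\<dots> \<le> h * n" using h by (simp add: n_def algebra_simps)
      also have "h * n = min d1 d2 / 2" using n by (simp add: h_def)
      also have "\<dots> < min d1 d2" using d by linarith
      finally show ?thesis by (simp add: dist_norm add.assoc)
    qed
    have sub: "x + s *\<^sub>R a + t *\<^sub>R b \<in> S" if "0 \<le> s" "s \<le> h" "0 \<le> t" "t \<le> h" for s t
      using close[OF that] d by auto
    have sub': "x + s *\<^sub>R b + t *\<^sub>R a \<in> S" if "0 \<le> s" "s \<le> h" "0 \<le> t" "t \<le> h" for s t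
      using sub[OF that(3,4,1,2)] by (simp add: algebra_simps)
    obtain s t where 1: "0 < s" "s < h" "0 < t" "t < h"
      "f (x + h *\<^sub>R a + h *\<^sub>R b) - f (x + h *\<^sub>R b) - f (x + h *\<^sub>R a) + f x = h * h * P a b (x + s *\<^sub>R a + t *\<^sub>R b)"
      by (rule second_difference_mean_value[OF f S h, of x a b, folded P_def]) (use sub that in blast)+
    obtain s' t' where 2: "0 < s'" "s' < h" "0 < t'" "t' < h"
      "f (x + h *\<^sub>R b + h *\<^sub>R a) - f (x + h *\<^sub>R a) - f (x + h *\<^sub>R b) + f x = h * h * P b a (x + s' *\<^sub>R b + t' *\<^sub>R a)"
      by (rule second_difference_mean_value[OF f S h, of x b a, folded P_def]) (use sub' that in blast)+
    have "h * h * P a b (x + s *\<^sub>R a + t *\<^sub>R b) = h * h * P b a (x + s' *\<^sub>R b + t' *\<^sub>R a)"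
      using 1(5) 2(5) by (simp add: algebra_simps)
    then have "P a b (x + s *\<^sub>R a + t *\<^sub>R b) = P b a (x + s' *\<^sub>R b + t' *\<^sub>R a)"
      using h by simp
    moreover have "\<bar>P a b (x + s *\<^sub>R a + t *\<^sub>R b) - P a b x\<bar> < e/2"
      using d(2) close[of s t] 1 by auto
    moreover have "\<bar>P b a (x + s' *\<^sub>R b + t' *\<^sub>R a) - P b a x\<bar> < e/2"
      using d(4) close[of t' s'] 2 by (auto simp: algebra_simps)
    ultimately show ?thesis by linarith
  qed
  then have "P a b x = P b a x"
    using zero_less_abs_iff[of "P a b x - P b a x"] by (metis eq_iff_diff_eq_0 less_irrefl)
  then show ?thesis by (simp add: P_def)
qed

lemma frechet_derivative_linear_compose:
  assumes "bounded_linear L" "f differentiable at x"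
  shows "frechet_derivative (\<lambda>x. L (f x)) (at x) v = L (frechet_derivative f (at x) v)"
  using bounded_linear.has_derivative[OF assms(1), of f "frechet_derivative f (at x)"] assms(2)
    frechet_derivative_works frechet_derivative_at by metis

text \<open>Reduced to real functions by taking components. It is applied to coordinate changes of
  the base, whose symmetric Hessians make the torsion condition independent of the chart.\<close>

lemma smooth_on_second_derivative_commute:
  fixes f :: "'a::real_normed_vector \<Rightarrow> 'b::euclidean_space"
  assumes f: "smooth_on S f" and S: "open S" and x: "x \<in> S"
  shows "frechet_derivative (\<lambda>y. frechet_derivative f (at y) a) (at x) b =
    frechet_derivative (\<lambda>y. frechet_derivative f (at y) b) (at x) a"
proof (rule euclidean_eqI)
  fix i :: 'b
  let ?g = "\<lambda>y. f y \<bullet> i"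
  have g: "smooth_on S ?g"
    by (rule smooth_on_linear_compose[OF bounded_linear_inner_left S f])
  have 1: "frechet_derivative ?g (at y) c = frechet_derivative f (at y) c \<bullet> i" if "y \<in> S" for y c
    using frechet_derivative_linear_compose[OF bounded_linear_inner_left] smooth_on_differentiable_at[OF f S that] .
  have 2: "frechet_derivative (\<lambda>y. frechet_derivative ?g (at y) c) (at x) d =
      frechet_derivative (\<lambda>y. frechet_derivative f (at y) c) (at x) d \<bullet> i" for c d
    using frechet_derivative_cong_open[OF S x 1[of _ c]] frechet_derivative_linear_compose[OF bounded_linear_inner_left,
        OF smooth_on_differentiable_at[OF smooth_on_frechet_derivative[OF f] S x]] by simp
  show "frechet_derivative (\<lambda>y. frechet_derivative f (at y) a) (at x) b \<bullet> i =
      frechet_derivative (\<lambda>y. frechet_derivative f (at y) b) (at x) a \<bullet> i"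
    using smooth_on_second_derivative_commute_real[OF g S x, of a b] unfolding 2 .
qed

section \<open>Smoothness of matrix operations\<close>

lemma smooth_on_matrix_mult [smooth_intros]:
  fixes f :: "'a::real_normed_vector \<Rightarrow> real^'n::finite^'m::finite" and g :: "'a \<Rightarrow> real^'k::finite^'n"
  shows "open S \<Longrightarrow> smooth_on S f \<Longrightarrow> smooth_on S g \<Longrightarrow> smooth_on S (\<lambda>x. f x ** g x)"
  unfolding matrix_matrix_mult_def by (intro smooth_intros)

lemma smooth_on_transpose [smooth_intros]:
  fixes f :: "'a::real_normed_vector \<Rightarrow> real^'n::finite^'m::finite"
  shows "open S \<Longrightarrow> smooth_on S f \<Longrightarrow> smooth_on S (\<lambda>x. transpose (f x))"
  unfolding transpose_def by (intro smooth_intros)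

lemma smooth_on_det [smooth_intros]:
  fixes f :: "'a::real_normed_vector \<Rightarrow> real^'n::finite^'n"
  shows "open S \<Longrightarrow> smooth_on S f \<Longrightarrow> smooth_on S (\<lambda>x. det (f x))"
  unfolding det_def by (intro smooth_intros)

lemma matrix_inv_eq:
  fixes A :: "real^'n::finite^'n"
  assumes "invertible A"
  shows "A ** matrix_inv A = mat 1" "matrix_inv A ** A = mat 1"
  using someI_ex[OF assms[unfolded invertible_def]] by (simp_all add: matrix_inv_def)

text \<open>Cramer's rule gives the entries of the inverse as determinants divided by
  \<open>det A\<close>, from which smoothness of inversion can be read off.\<close>

lemma matrix_inv_cramer:
  fixes A :: "real^'n::finite^'n"
  assumes "det A \<noteq> 0"
  shows "matrix_inv A = (\<chi> k l. det (\<chi> i j. if j = k then axis l 1 $ i else A $ i $ j) * inverse (det A))"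
proof -
  have "matrix_inv A *v axis l 1 = (\<chi> k. det (\<chi> i j. if j = k then axis l 1 $ i else A $ i $ j) / det A)" for l
    using cramer[OF assms, of "matrix_inv A *v axis l 1" "axis l 1"] assms
    by (simp add: matrix_vector_mul_assoc matrix_inv_eq invertible_det_nz)
  then have "(matrix_inv A *v axis l 1) $ k = det (\<chi> i j. if j = k then axis l 1 $ i else A $ i $ j) / det A" for k l
    by simp
  then show ?thesis
    by (simp add: vec_eq_iff matrix_vector_mult_basis column_def divide_inverse)
qed

lemma smooth_on_matrix_inv [smooth_intros]:
  fixes f :: "'a::real_normed_vector \<Rightarrow> real^'n::finite^'n"
  assumes S: "open S" and f: "smooth_on S f" and "\<And>x. x \<in> S \<Longrightarrow> invertible (f x)"
  shows "smooth_on S (\<lambda>x. matrix_inv (f x))"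
proof -
  have nz: "det (f x) \<noteq> 0" if "x \<in> S" for x
    using assms that by (simp add: invertible_det_nz)
  have "smooth_on S (\<lambda>x. if j = k then axis l 1 $ i else f x $ i $ j)" for i j k l :: 'n
    using f S by (cases "j = k") (auto intro!: smooth_intros)
  then have "smooth_on S (\<lambda>x. (\<chi> k l. det (\<chi> i j. if j = k then axis l 1 $ i else f x $ i $ j) * inverse (det (f x))))"
    using nz by (intro smooth_intros S f)
  then show ?thesis
    by (rule smooth_on_cong[OF _ S]) (simp add: matrix_inv_cramer nz)
qed

lemma open_invertible: "open {A :: real^'n::finite^'n. invertible A}"
proof -
  have "continuous_on UNIV (\<lambda>A :: real^'n^'n. det A)"
    by (intro smooth_on_imp_continuous_on smooth_intros) auto
  from open_vimage[OF _ this, of "- {0}"] show ?thesis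
    by (simp add: vimage_def invertible_det_nz open_Compl Collect_neg_eq[symmetric])
qed

section \<open>Manifolds and tangent maps\<close>

text \<open>The local part of \<open>smooth_manifold\<close>. The atlases of frames, metrics, jets
  and the cylinder are shown to have this part; the Hausdorff property is called upon for the base
  only.\<close>

definition smooth_atlas :: "('p, 'e::euclidean_space) chart set \<Rightarrow> bool" where
  "smooth_atlas A \<longleftrightarrow>
     (\<forall>c\<in>A. inj_on (snd c) (fst c)) \<and>
     (\<forall>c\<in>A. \<forall>d\<in>A. open (snd c ` (fst c \<inter> fst d)) \<and>
        smooth_on (snd c ` (fst c \<inter> fst d)) (snd d \<circ> cinv c))"

lemma smooth_manifold_imp_smooth_atlas: "smooth_manifold A \<Longrightarrow> smooth_atlas A"
  by (simp add: smooth_manifold_def smooth_atlas_def)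

lemma charts_at_iff: "c \<in> charts_at A p \<longleftrightarrow> c \<in> A \<and> p \<in> fst c"
  by (simp add: charts_at_def)

lemma cinv_in: "y \<in> snd c ` fst c \<Longrightarrow> cinv c y \<in> fst c"
  by (rule inv_into_into)

lemma chart_cinv: "y \<in> snd c ` fst c \<Longrightarrow> snd c (cinv c y) = y"
  by (rule f_inv_into_f)

lemma cinv_chart: "smooth_atlas A \<Longrightarrow> c \<in> A \<Longrightarrow> x \<in> fst c \<Longrightarrow> cinv c (snd c x) = x"
  by (simp add: smooth_atlas_def)

lemma open_overlap: "smooth_atlas A \<Longrightarrow> c \<in> A \<Longrightarrow> d \<in> A \<Longrightarrow> open (snd c ` (fst c \<inter> fst d))"
  by (simp add: smooth_atlas_def)

lemma open_chart_image: "smooth_atlas A \<Longrightarrow> c \<in> A \<Longrightarrow> open (snd c ` fst c)"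
  using open_overlap[of A c c] by simp

lemma smooth_transition:
  "smooth_atlas A \<Longrightarrow> c \<in> A \<Longrightarrow> d \<in> A \<Longrightarrow> smooth_on (snd c ` (fst c \<inter> fst d)) (\<lambda>y. snd d (cinv c y))"
  by (simp add: smooth_atlas_def o_def)

lemma topspace_manifold: "topspace (manifold_topology A) = \<Union> (fst ` A)"
proof -
  have "\<Union> {fst c \<inter> snd c -` O' | c O'. c \<in> A \<and> open O'} = \<Union> (fst ` A)"
    by (auto, metis IntI UNIV_I open_UNIV vimage_UNIV)
  then show ?thesis by (simp add: manifold_topology_def)
qed

lemma openin_chart_vimage: "c \<in> A \<Longrightarrow> open V \<Longrightarrow> openin (manifold_topology A) (fst c \<inter> snd c -` V)"
  unfolding manifold_topology_def by (rule topology_generated_by_Basis) blast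

lemma openin_chart_domain: "c \<in> A \<Longrightarrow> openin (manifold_topology A) (fst c)"
  using openin_chart_vimage[of c A UNIV] by simp

lemma cinv_image:
  assumes "smooth_atlas A" "c \<in> A" "V \<subseteq> snd c ` fst c"
  shows "cinv c ` V = fst c \<inter> snd c -` V"
proof
  show "cinv c ` V \<subseteq> fst c \<inter> snd c -` V"
    using assms(3) cinv_in[of _ c] chart_cinv[of _ c] by fastforce
  show "fst c \<inter> snd c -` V \<subseteq> cinv c ` V"
    using cinv_chart[OF assms(1,2)] by force
qed

lemma openin_cinv_image:
  assumes "smooth_atlas A" "c \<in> A" "open V" "V \<subseteq> snd c ` fst c"
  shows "openin (manifold_topology A) (cinv c ` V)"
  using openin_chart_vimage[OF assms(2,3)] cinv_image[OF assms(1,2,4)] by simp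

text \<open>Induction over the generation of the topology. Intersections pass through the image
  because charts are injective, and generating sets because coordinate changes are continuous on
  open overlaps.\<close>

lemma open_image_chart:
  assumes A: "smooth_atlas A" and c: "c \<in> A" and N: "openin (manifold_topology A) N"
  shows "open (snd c ` (fst c \<inter> N))"
proof -
  have "generate_topology_on {fst c \<inter> snd c -` O' | c O'. c \<in> A \<and> open O'} N"
    using N unfolding manifold_topology_def by (rule openin_topology_generated_by)
  then show ?thesis
  proof induction
    case (Int a b)
    have "snd c ` (fst c \<inter> (a \<inter> b)) = snd c ` (fst c \<inter> a) \<inter> snd c ` (fst c \<inter> b)"
      using A c inj_on_image_Int[of "snd c" "fst c" "fst c \<inter> a" "fst c \<inter> b"]
      by (simp add: smooth_atlas_def inf_assoc inf_left_commute)
    with Int show ?case by (simp add: open_Int)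
  next
    case (UN K)
    have "snd c ` (fst c \<inter> \<Union>K) = (\<Union>k\<in>K. snd c ` (fst c \<inter> k))" by auto
    with UN show ?case by auto
  next
    case (Basis s)
    then obtain d O' where d: "s = fst d \<inter> snd d -` O'" "d \<in> A" "open O'" by auto
    have "open (snd c ` (fst c \<inter> fst d) \<inter> (\<lambda>y. snd d (cinv c y)) -` O')"
      by (rule continuous_open_preimage[OF smooth_on_imp_continuous_on[OF smooth_transition[OF A c d(2)]]
            open_overlap[OF A c d(2)] d(3)])
    moreover have "snd c ` (fst c \<inter> fst d) \<inter> (\<lambda>y. snd d (cinv c y)) -` O' = snd c ` (fst c \<inter> s)"
      using cinv_chart[OF A c] by (auto simp: d(1)) 
    ultimately show ?case by simp
  qed simp
qed

section \<open>Smooth maps read in charts\<close>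

lemma smooth_map_onI:
  assumes A: "smooth_atlas A"
    and "\<And>p. p \<in> W \<Longrightarrow> \<exists>c d V. c \<in> charts_at A p \<and> d \<in> charts_at B (f p) \<and> open V \<and> snd c p \<in> V \<and>
      V \<subseteq> snd c ` fst c \<and> cinv c ` V \<subseteq> W \<and> f ` cinv c ` V \<subseteq> fst d \<and> smooth_on V (\<lambda>y. snd d (f (cinv c y)))"
  shows "smooth_map_on A B W f"
  unfolding smooth_map_on_def
proof
  fix p assume "p \<in> W"
  from assms(2)[OF this] obtain c d V where
    h: "c \<in> charts_at A p" "d \<in> charts_at B (f p)" "open V" "snd c p \<in> V" "V \<subseteq> snd c ` fst c"
      "cinv c ` V \<subseteq> W" "f ` cinv c ` V \<subseteq> fst d" "smooth_on V (\<lambda>y. snd d (f (cinv c y)))"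
    by blast
  have c: "c \<in> A" "p \<in> fst c" using h(1) by (auto simp: charts_at_iff)
  have "snd c ` cinv c ` V = V"
    using h(5) chart_cinv[of _ c] by (force simp: image_iff)
  then show "\<exists>c\<in>charts_at A p. \<exists>d\<in>charts_at B (f p). \<exists>N. openin (manifold_topology A) N \<and> p \<in> N \<and>
      N \<subseteq> W \<inter> fst c \<and> f ` N \<subseteq> fst d \<and> smooth_on (snd c ` N) (snd d \<circ> f \<circ> cinv c)"
    using h c cinv_image[OF A c(1) h(5)] openin_cinv_image[OF A c(1) h(3,5)]
    by (intro bexI[OF _ h(1)] bexI[OF _ h(2)] exI[of _ "cinv c ` V"]) (auto simp: o_def)
qed

text \<open>The definition of smoothness provides some pair of charts. For an arbitrary pair the
  coordinate expression is the given one between two coordinate changes, on a neighbourhood small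
  enough for all of them to be defined.\<close>

lemma smooth_map_on_charts:
  assumes A: "smooth_atlas A" and B: "smooth_atlas B" and f: "smooth_map_on A B W f"
    and p: "p \<in> W" and c: "c \<in> charts_at A p" and d: "d \<in> charts_at B (f p)"
  obtains V where "open V" "snd c p \<in> V" "V \<subseteq> snd c ` fst c" "cinv c ` V \<subseteq> W" "f ` cinv c ` V \<subseteq> fst d"
    "smooth_on V (\<lambda>y. snd d (f (cinv c y)))"
proof -
  obtain c0 d0 N where h: "c0 \<in> charts_at A p" "d0 \<in> charts_at B (f p)" "openin (manifold_topology A) N" "p \<in> N"
      "N \<subseteq> W \<inter> fst c0" "f ` N \<subseteq> fst d0" "smooth_on (snd c0 ` N) (\<lambda>y. snd d0 (f (cinv c0 y)))"
    using f p unfolding smooth_map_on_def o_def by meson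
  have cA: "c \<in> A" "p \<in> fst c" and c0: "c0 \<in> A" "p \<in> fst c0" and dB: "d \<in> B" "f p \<in> fst d"
    and d0: "d0 \<in> B" "f p \<in> fst d0"
    using h c d by (auto simp: charts_at_iff)
  have oN: "open (snd c0 ` N)" using open_image_chart[OF A c0(1) h(3)] h(5) by (simp add: inf_absorb2)
  \<comment> \<open>The points, in the coordinates of \<open>c0\<close>, that \<open>f\<close> sends
    into the overlap of the two target charts.\<close>
  define Q where "Q = snd c0 ` N \<inter> (\<lambda>y. snd d0 (f (cinv c0 y))) -` (snd d0 ` (fst d0 \<inter> fst d))"
  have oQ: "open Q"
    unfolding Q_def
    by (rule continuous_open_preimage[OF smooth_on_imp_continuous_on[OF h(7)] oN open_overlap[OF B d0(1) dB(1)]])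
  define V where "V = snd c ` (fst c \<inter> fst c0) \<inter> (\<lambda>y. snd c0 (cinv c y)) -` Q"
  have oV: "open V" unfolding V_def
    by (rule continuous_open_preimage[OF smooth_on_imp_continuous_on[OF smooth_transition[OF A cA(1) c0(1)]]
          open_overlap[OF A cA(1) c0(1)] oQ])
  have V: "cinv c y \<in> fst c" "cinv c y \<in> N" "cinv c y \<in> fst c0" "f (cinv c y) \<in> fst d" "f (cinv c y) \<in> fst d0"
      "snd c (cinv c y) = y" "snd c0 (cinv c y) \<in> Q" if y: "y \<in> V" for y
  proof -
    from y obtain q where q: "q \<in> fst c" "q \<in> fst c0" "y = snd c q" and Q: "snd c0 (cinv c y) \<in> Q"
      by (auto simp: V_def)
    have e: "cinv c y = q" using q cinv_chart[OF A cA(1)] by simp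
    from Q e obtain n where n: "n \<in> N" "snd c0 q = snd c0 n" by (auto simp: Q_def)
    have "n = q" using n q h(5) cinv_chart[OF A c0(1)] by (metis IntD2 subsetD)
    moreover have "snd d0 (f q) \<in> snd d0 ` (fst d0 \<inter> fst d)"
      using Q e q cinv_chart[OF A c0(1) q(2)] by (simp add: Q_def)
    then have "f q \<in> fst d"
      using h(6) n \<open>n = q\<close> B d0(1) by (auto simp: smooth_atlas_def inj_on_def)
    ultimately show "cinv c y \<in> fst c" "cinv c y \<in> N" "cinv c y \<in> fst c0" "f (cinv c y) \<in> fst d"
      "f (cinv c y) \<in> fst d0" "snd c (cinv c y) = y" "snd c0 (cinv c y) \<in> Q"
      using e q n h(6) Q by auto
  qed
  have sm: "smooth_on V (\<lambda>y. snd d (cinv d0 (snd d0 (f (cinv c0 (snd c0 (cinv c y)))))))"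
  proof (rule smooth_on_compose[OF smooth_transition[OF B d0(1) dB(1)] open_overlap[OF B d0(1) dB(1)]])
    show "smooth_on V (\<lambda>y. snd d0 (f (cinv c0 (snd c0 (cinv c y)))))"
      by (rule smooth_on_compose[OF smooth_on_subset[OF h(7), of Q] oQ
        smooth_on_subset[OF smooth_transition[OF A cA(1) c0(1)]] oV])
         (auto simp: Q_def V_def)
    show "(\<lambda>y. snd d0 (f (cinv c0 (snd c0 (cinv c y))))) ` V \<subseteq> snd d0 ` (fst d0 \<inter> fst d)"
      using V(7) by (auto simp: Q_def)
  qed (rule oV)
  show ?thesis
  proof (rule that[OF oV])
    have "snd c0 p \<in> Q"
      using h(4) d0 dB cinv_chart[OF A c0] by (auto simp: Q_def)
    then show "snd c p \<in> V" using cinv_chart[OF A cA] cA c0 by (auto simp: V_def)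
    show "V \<subseteq> snd c ` fst c" by (auto simp: V_def)
    show "cinv c ` V \<subseteq> W" using V(2) h(5) by auto
    show "f ` cinv c ` V \<subseteq> fst d" using V(4) by auto
    show "smooth_on V (\<lambda>y. snd d (f (cinv c y)))"
      by (rule smooth_on_cong[OF sm oV]) (simp add: V cinv_chart[OF A c0(1)] cinv_chart[OF B d0(1)])
  qed
qed

lemma smooth_map_on_compose:
  assumes A: "smooth_atlas A" and B: "smooth_atlas B" and C: "smooth_atlas C"
    and f: "smooth_map_on A B W f" and g: "smooth_map_on B C W' g" and sub: "f ` W \<subseteq> W'"
  shows "smooth_map_on A C W (\<lambda>x. g (f x))"
proof (rule smooth_map_onI[OF A])
  fix p assume p: "p \<in> W"
  then have fp: "f p \<in> W'" using sub by auto
  obtain c d where c: "c \<in> charts_at A p" and d: "d \<in> charts_at B (f p)"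
    using f p unfolding smooth_map_on_def by meson
  obtain e where e: "e \<in> charts_at C (g (f p))"
    using g fp unfolding smooth_map_on_def by meson
  obtain V where V: "open V" "snd c p \<in> V" "V \<subseteq> snd c ` fst c" "cinv c ` V \<subseteq> W" "f ` cinv c ` V \<subseteq> fst d"
    "smooth_on V (\<lambda>y. snd d (f (cinv c y)))"
    by (rule smooth_map_on_charts[OF A B f p c d])
  obtain V' where V': "open V'" "snd d (f p) \<in> V'" "V' \<subseteq> snd d ` fst d" "cinv d ` V' \<subseteq> W'" "g ` cinv d ` V' \<subseteq> fst e"
    "smooth_on V' (\<lambda>y. snd e (g (cinv d y)))"
    by (rule smooth_map_on_charts[OF B C g fp d e])
  define X where "X = V \<inter> (\<lambda>y. snd d (f (cinv c y))) -` V'"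
  have oX: "open X" unfolding X_def
    by (rule continuous_open_preimage[OF smooth_on_imp_continuous_on[OF V(6)] V(1) V'(1)])
  have dB: "d \<in> B" and cA: "c \<in> A" "p \<in> fst c" using c d by (auto simp: charts_at_iff)
  have X: "cinv d (snd d (f (cinv c y))) = f (cinv c y)" if "y \<in> X" for y
    using V(5) that by (auto simp: X_def intro!: cinv_chart[OF B dB])
  have sm: "smooth_on X (\<lambda>y. snd e (g (cinv d (snd d (f (cinv c y))))))"
    by (rule smooth_on_compose[OF V'(6,1) smooth_on_subset[OF V(6)] oX]) (auto simp: X_def)
  have ge: "g (f (cinv c y)) \<in> fst e" if "y \<in> X" for y
  proof -
    have "snd d (f (cinv c y)) \<in> V'" using that by (auto simp: X_def)
    then have "g (cinv d (snd d (f (cinv c y)))) \<in> fst e" using V'(5) by blast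
    then show ?thesis using X[OF that] by simp
  qed
  show "\<exists>c d V. c \<in> charts_at A p \<and> d \<in> charts_at C (g (f p)) \<and> open V \<and> snd c p \<in> V \<and>
      V \<subseteq> snd c ` fst c \<and> cinv c ` V \<subseteq> W \<and> (\<lambda>x. g (f x)) ` cinv c ` V \<subseteq> fst d \<and>
      smooth_on V (\<lambda>y. snd d (g (f (cinv c y))))"
  proof (intro exI conjI)
    show "smooth_on X (\<lambda>y. snd e (g (f (cinv c y))))"
      by (rule smooth_on_cong[OF sm oX]) (simp add: X)
    show "snd c p \<in> X" using V(2) V'(2) cinv_chart[OF A cA] by (simp add: X_def)
    show "X \<subseteq> snd c ` fst c" "cinv c ` X \<subseteq> W" using V(3,4) by (auto simp: X_def)
    show "(\<lambda>x. g (f x)) ` cinv c ` X \<subseteq> fst e" using ge by auto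
  qed (fact c e oX)+
qed

lemma smooth_map_on_subset:
  assumes A: "smooth_atlas A" and B: "smooth_atlas B" and f: "smooth_map_on A B W f"
    and W': "openin (manifold_topology A) W'" "W' \<subseteq> W"
  shows "smooth_map_on A B W' f"
  unfolding smooth_map_on_def
proof
  fix p assume p: "p \<in> W'"
  then obtain c d N where h: "c \<in> charts_at A p" "d \<in> charts_at B (f p)" "openin (manifold_topology A) N" "p \<in> N"
      "N \<subseteq> W \<inter> fst c" "f ` N \<subseteq> fst d" "smooth_on (snd c ` N) (snd d \<circ> f \<circ> cinv c)"
    using f W' unfolding smooth_map_on_def by (meson subsetD)
  show "\<exists>c\<in>charts_at A p. \<exists>d\<in>charts_at B (f p). \<exists>N. openin (manifold_topology A) N \<and> p \<in> N \<and>
      N \<subseteq> W' \<inter> fst c \<and> f ` N \<subseteq> fst d \<and> smooth_on (snd c ` N) (snd d \<circ> f \<circ> cinv c)"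
    using h p W'(1)
    by (intro bexI[OF _ h(1)] bexI[OF _ h(2)] exI[of _ "N \<inter> W'"])
       (auto intro: smooth_on_subset)
qed

lemma openin_smooth_domain:
  assumes "smooth_map_on A B W f"
  shows "openin (manifold_topology A) W"
proof (subst openin_subopen, intro ballI)
  fix p assume "p \<in> W"
  with assms show "\<exists>T. openin (manifold_topology A) T \<and> p \<in> T \<and> T \<subseteq> W"
    unfolding smooth_map_on_def by (meson le_infE)
qed

lemma smooth_map_on_chart:
  assumes A: "smooth_atlas A" and c: "c \<in> A" "d \<in> B" and f: "f ` fst c \<subseteq> fst d"
    and "smooth_on (snd c ` fst c) (\<lambda>y. snd d (f (cinv c y)))"
  shows "smooth_map_on A B (fst c) f"
proof (rule smooth_map_onI[OF A])
  fix p assume "p \<in> fst c"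
  then show "\<exists>c' d V. c' \<in> charts_at A p \<and> d \<in> charts_at B (f p) \<and> open V \<and> snd c' p \<in> V \<and>
      V \<subseteq> snd c' ` fst c' \<and> cinv c' ` V \<subseteq> fst c \<and> f ` cinv c' ` V \<subseteq> fst d \<and> smooth_on V (\<lambda>y. snd d (f (cinv c' y)))"
    using assms open_chart_image[OF A c(1)] cinv_in[of _ c]
    by (intro exI[of _ c] exI[of _ d] exI[of _ "snd c ` fst c"]) (auto simp: charts_at_iff image_subset_iff)
qed

lemma smooth_map_on_Union:
  assumes "\<And>W. W \<in> F \<Longrightarrow> smooth_map_on A B W f"
  shows "smooth_map_on A B (\<Union>F) f"
  using assms unfolding smooth_map_on_def by (meson UnionE Union_upper le_infI1 le_inf_iff order_trans le_infE le_infI)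

section \<open>Tangent spaces and changes of chart\<close>

lemma transition_has_derivative:
  assumes A: "smooth_atlas A" and c: "c \<in> charts_at A p" and d: "d \<in> charts_at A p"
  shows "((\<lambda>y. snd d (cinv c y)) has_derivative frechet_derivative (snd d \<circ> cinv c) (at (snd c p))) (at (snd c p))"
  using smooth_on_has_derivative[OF smooth_transition[OF A] open_overlap[OF A]] c d
  by (auto simp: charts_at_iff o_def)

lemma transition_chain:
  assumes A: "smooth_atlas A" and c: "c \<in> charts_at A p" and d: "d \<in> charts_at A p" and e: "e \<in> charts_at A p"
  shows "frechet_derivative (snd e \<circ> cinv d) (at (snd d p)) (frechet_derivative (snd d \<circ> cinv c) (at (snd c p)) w) =
    frechet_derivative (snd e \<circ> cinv c) (at (snd c p)) w"
proof -
  have cA: "c \<in> A" "p \<in> fst c" and dA: "d \<in> A" "p \<in> fst d" using c d by (auto simp: charts_at_iff)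
  have "((\<lambda>y. snd e (cinv d y)) has_derivative frechet_derivative (snd e \<circ> cinv d) (at (snd d p))) (at (snd d (cinv c (snd c p))))"
    using transition_has_derivative[OF A d e] cinv_chart[OF A cA] by simp
  from diff_chain_at[OF transition_has_derivative[OF A c d] this]
  have h: "((\<lambda>y. snd e (cinv d (snd d (cinv c y)))) has_derivative
      (\<lambda>w. frechet_derivative (snd e \<circ> cinv d) (at (snd d p)) (frechet_derivative (snd d \<circ> cinv c) (at (snd c p)) w))) (at (snd c p))"
    by (simp add: o_def)
  have "frechet_derivative (\<lambda>y. snd e (cinv d (snd d (cinv c y)))) (at (snd c p)) =
      frechet_derivative (snd e \<circ> cinv c) (at (snd c p))"
    by (rule frechet_derivative_cong_open[OF open_overlap[OF A cA(1) dA(1)]])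
       (use cA dA cinv_chart[OF A cA(1)] cinv_chart[OF A dA(1)] in auto)
  from fun_cong[OF trans[OF frechet_derivative_at[OF h] this], of w] show ?thesis .
qed

lemma transition_self:
  assumes A: "smooth_atlas A" and c: "c \<in> charts_at A p"
  shows "frechet_derivative (snd c \<circ> cinv c) (at (snd c p)) w = w"
proof -
  have cA: "c \<in> A" "p \<in> fst c" using c by (auto simp: charts_at_iff)
  have "frechet_derivative (snd c \<circ> cinv c) (at (snd c p)) = frechet_derivative (\<lambda>y. y) (at (snd c p))"
    by (rule frechet_derivative_cong_open[OF open_chart_image[OF A cA(1)]]) (use cA chart_cinv[of _ c] in auto)
  also have "\<dots> = (\<lambda>y. y)" by (rule frechet_derivative_at[OF has_derivative_ident, symmetric])
  finally show ?thesis by simp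
qed

lemma tangent_space_transition:
  assumes "v \<in> tangent_space A p" "c \<in> charts_at A p" "d \<in> charts_at A p"
  shows "v d = frechet_derivative (snd d \<circ> cinv c) (at (snd c p)) (v c)"
  using assms unfolding tangent_space_def by blast

lemma tangent_space_outside: "v \<in> tangent_space A p \<Longrightarrow> c \<notin> charts_at A p \<Longrightarrow> v c = 0"
  unfolding tangent_space_def by blast

lemma tangent_space_eqI:
  assumes "v \<in> tangent_space A p" "w \<in> tangent_space A p" "c \<in> charts_at A p" "v c = w c"
  shows "v = w"
proof
  fix d
  show "v d = w d"
    using assms tangent_space_transition[OF assms(1,3)] tangent_space_transition[OF assms(2,3)]
      tangent_space_outside[of _ A p d] by metis
qed

text \<open>By the cocycle rule \<open>transition_chain\<close> for Jacobians, compatibility of all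
  components with those in one chart implies compatibility between any two charts.\<close>

lemma tangent_spaceI:
  assumes A: "smooth_atlas A" and c: "c \<in> charts_at A p"
    and v: "\<And>d. d \<in> charts_at A p \<Longrightarrow> v d = frechet_derivative (snd d \<circ> cinv c) (at (snd c p)) (v c)"
    and "\<And>d. d \<notin> charts_at A p \<Longrightarrow> v d = 0"
  shows "v \<in> tangent_space A p"
  unfolding tangent_space_def
proof (intro CollectI conjI ballI allI impI)
  fix d e assume d: "d \<in> charts_at A p" and e: "e \<in> charts_at A p"
  show "v e = frechet_derivative (snd e \<circ> cinv d) (at (snd d p)) (v d)"
    using v[OF e] unfolding v[OF d] transition_chain[OF A c d e] .
next
  fix d assume "d \<notin> charts_at A p"
  then show "v d = 0" by (rule assms(4))
qed

lemma tvec_of_tangent: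
  assumes A: "smooth_atlas A" and c: "c \<in> charts_at A p"
  shows "tvec_of A p c w \<in> tangent_space A p" "tvec_of A p c w c = w"
proof -
  show "tvec_of A p c w c = w" using transition_self[OF A c] c by (simp add: tvec_of_def)
  then show "tvec_of A p c w \<in> tangent_space A p"
    by (intro tangent_spaceI[OF A c]) (simp_all add: tvec_of_def)
qed

lemma linear_transition:
  assumes "smooth_atlas A" "c \<in> charts_at A p" "d \<in> charts_at A p"
  shows "linear (frechet_derivative (snd d \<circ> cinv c) (at (snd c p)))"
  using transition_has_derivative[OF assms] has_derivative_linear by blast

lemma tangent_space_lincomb:
  assumes A: "smooth_atlas A" and v: "\<And>i. i \<in> I \<Longrightarrow> X i \<in> tangent_space A p" and p: "p \<in> \<Union> (fst ` A)"
  shows "(\<lambda>c. \<Sum>i\<in>I. a i *\<^sub>R X i c) \<in> tangent_space A p"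
proof -
  from p obtain c where c: "c \<in> charts_at A p" by (auto simp: charts_at_iff)
  show ?thesis
  proof (rule tangent_spaceI[OF A c])
    fix d assume d: "d \<in> charts_at A p"
    then show "(\<Sum>i\<in>I. a i *\<^sub>R X i d) = frechet_derivative (snd d \<circ> cinv c) (at (snd c p)) (\<Sum>i\<in>I. a i *\<^sub>R X i c)"
      using tangent_space_transition[OF v c d]
      by (simp add: linear_sum[OF linear_transition[OF A c d]] linear_scale[OF linear_transition[OF A c d]])
  next
    fix d assume "d \<notin> charts_at A p"
    then show "(\<Sum>i\<in>I. a i *\<^sub>R X i d) = 0" using v tangent_space_outside by (metis (no_types, lifting) scaleR_zero_right sum.neutral)
  qed
qed

lemma tangent_space_diff:
  assumes A: "smooth_atlas A" and v: "v \<in> tangent_space A p" and w: "w \<in> tangent_space A p"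
  shows "(\<lambda>c. v c - w c) \<in> tangent_space A p"
proof (cases "charts_at A p = {}")
  case False
  then obtain c where c: "c \<in> charts_at A p" by auto
  show ?thesis
  proof (rule tangent_spaceI[OF A c])
    fix d assume d: "d \<in> charts_at A p"
    show "v d - w d = frechet_derivative (snd d \<circ> cinv c) (at (snd c p)) (v c - w c)"
      using tangent_space_transition[OF v c d] tangent_space_transition[OF w c d]
        linear_diff[OF linear_transition[OF A c d]] by metis
  qed (use assms tangent_space_outside in \<open>metis diff_self\<close>)
qed (use assms tangent_space_outside in \<open>auto simp: tangent_space_def\<close>)

lemma tlincomb_tangent:
  assumes "smooth_atlas A" "\<And>i. X i \<in> tangent_space A p" "p \<in> \<Union> (fst ` A)"
  shows "tlincomb X a \<in> tangent_space A p"
  unfolding tlincomb_def by (rule tangent_space_lincomb) (use assms in auto)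

lemma zero_tangent: "smooth_atlas A \<Longrightarrow> (\<lambda>_. 0) \<in> tangent_space A p"
  by (simp add: tangent_space_def linear_0[OF linear_transition])

section \<open>Tangent maps and the chain rule\<close>

lemma smooth_map_has_derivative:
  assumes A: "smooth_atlas A" and B: "smooth_atlas B" and f: "smooth_map_on A B W f"
    and p: "p \<in> W" and c: "c \<in> charts_at A p" and d: "d \<in> charts_at B (f p)"
  shows "((\<lambda>y. snd d (f (cinv c y))) has_derivative frechet_derivative (snd d \<circ> f \<circ> cinv c) (at (snd c p))) (at (snd c p))"
proof -
  obtain V where V: "open V" "snd c p \<in> V" "V \<subseteq> snd c ` fst c" "cinv c ` V \<subseteq> W" "f ` cinv c ` V \<subseteq> fst d"
    "smooth_on V (\<lambda>y. snd d (f (cinv c y)))"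
    by (rule smooth_map_on_charts[OF A B f p c d])
  show ?thesis using smooth_on_has_derivative[OF V(6,1,2)] by (simp add: o_def)
qed

lemma smooth_map_derivative_compose:
  assumes A: "smooth_atlas A" and B: "smooth_atlas B" and C: "smooth_atlas C"
    and f: "smooth_map_on A B W f" and g: "smooth_map_on B C W' g" and p: "p \<in> W" "f p \<in> W'"
    and c: "c \<in> charts_at A p" and d: "d \<in> charts_at B (f p)" and e: "e \<in> charts_at C (g (f p))"
  shows "frechet_derivative (snd e \<circ> (\<lambda>x. g (f x)) \<circ> cinv c) (at (snd c p)) w =
    frechet_derivative (snd e \<circ> g \<circ> cinv d) (at (snd d (f p))) (frechet_derivative (snd d \<circ> f \<circ> cinv c) (at (snd c p)) w)"
proof -
  have cA: "c \<in> A" "p \<in> fst c" and dB: "d \<in> B" "f p \<in> fst d" using c d by (auto simp: charts_at_iff)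
  obtain V where V: "open V" "snd c p \<in> V" "V \<subseteq> snd c ` fst c" "cinv c ` V \<subseteq> W" "f ` cinv c ` V \<subseteq> fst d"
    "smooth_on V (\<lambda>y. snd d (f (cinv c y)))"
    by (rule smooth_map_on_charts[OF A B f p(1) c d])
  have "((\<lambda>y. snd e (g (cinv d y))) has_derivative frechet_derivative (snd e \<circ> g \<circ> cinv d) (at (snd d (f p))))
      (at (snd d (f (cinv c (snd c p)))))"
    using smooth_map_has_derivative[OF B C g p(2) d e] cinv_chart[OF A cA] by simp
  from diff_chain_at[OF smooth_map_has_derivative[OF A B f p(1) c d] this]
  have h: "((\<lambda>y. snd e (g (cinv d (snd d (f (cinv c y)))))) has_derivative
      (\<lambda>w. frechet_derivative (snd e \<circ> g \<circ> cinv d) (at (snd d (f p))) (frechet_derivative (snd d \<circ> f \<circ> cinv c) (at (snd c p)) w))) (at (snd c p))"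
    by (simp add: o_def)
  have "frechet_derivative (\<lambda>y. snd e (g (cinv d (snd d (f (cinv c y)))))) (at (snd c p)) =
      frechet_derivative (snd e \<circ> (\<lambda>x. g (f x)) \<circ> cinv c) (at (snd c p))"
    by (rule frechet_derivative_cong_open[OF V(1,2)]) (use V(5) cinv_chart[OF B dB(1)] in \<open>auto simp: image_subset_iff\<close>)
  from fun_cong[OF trans[OF frechet_derivative_at[OF h] this], of w] show ?thesis by (rule sym)
qed

lemma smooth_map_on_id:
  assumes A: "smooth_atlas A" shows "smooth_map_on A A (\<Union> (fst ` A)) (\<lambda>x. x)"
proof (rule smooth_map_on_Union)
  fix W assume "W \<in> fst ` A"
  then obtain c where c: "c \<in> A" "W = fst c" by auto
  have "smooth_on (snd c ` fst c) (\<lambda>y. snd c (cinv c y))"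
    using smooth_transition[OF A c(1,1)] by simp
  then show "smooth_map_on A A W (\<lambda>x. x)" unfolding c(2) by (intro smooth_map_on_chart[OF A c(1,1)]) auto
qed

text \<open>\<open>tmap\<close> reads its argument in a chart picked by choice. Inserting the
  identity between \<open>c\<close> and the chosen chart and applying the chain rule shows that
  every chart gives the same value.\<close>

lemma tmap_chart:
  assumes A: "smooth_atlas A" and B: "smooth_atlas B" and f: "smooth_map_on A B W f" and p: "p \<in> W"
    and v: "v \<in> tangent_space A p" and c: "c \<in> charts_at A p" and d: "d \<in> charts_at B (f p)"
  shows "tmap A B f p v d = frechet_derivative (snd d \<circ> f \<circ> cinv c) (at (snd c p)) (v c)"
proof -
  define c0 where "c0 = (SOME c. c \<in> charts_at A p)"
  have c0: "c0 \<in> charts_at A p" unfolding c0_def using c by (rule someI)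
  have pA: "p \<in> \<Union> (fst ` A)" using c by (auto simp: charts_at_iff)
  have "tmap A B f p v d = frechet_derivative (snd d \<circ> f \<circ> cinv c0) (at (snd c0 p)) (v c0)"
    using v d by (simp add: tmap_def c0_def Let_def)
  also have "v c0 = frechet_derivative (snd c0 \<circ> (\<lambda>x. x) \<circ> cinv c) (at (snd c p)) (v c)"
    using tangent_space_transition[OF v c c0] by (simp add: o_def)
  also have "frechet_derivative (snd d \<circ> f \<circ> cinv c0) (at (snd c0 p)) \<dots> =
      frechet_derivative (snd d \<circ> (\<lambda>x. f x) \<circ> cinv c) (at (snd c p)) (v c)"
    by (rule smooth_map_derivative_compose[OF A A B smooth_map_on_id[OF A] f pA p c c0 d, symmetric])
  finally show ?thesis by simp
qed

lemma tmap_outside: "v \<notin> tangent_space A p \<Longrightarrow> tmap A B f p v = (\<lambda>_. 0)"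
  by (simp add: tmap_def)

lemma tmap_not_chart: "d \<notin> charts_at B (f p) \<Longrightarrow> tmap A B f p v d = 0"
  by (simp add: tmap_def Let_def)

lemma tmap_tangent:
  assumes A: "smooth_atlas A" and B: "smooth_atlas B" and f: "smooth_map_on A B W f" and p: "p \<in> W"
  shows "tmap A B f p v \<in> tangent_space B (f p)"
proof (cases "v \<in> tangent_space A p")
  case v: True
  obtain c d where c: "c \<in> charts_at A p" and d: "d \<in> charts_at B (f p)"
    using f p unfolding smooth_map_on_def by meson
  show ?thesis
  proof (rule tangent_spaceI[OF B d])
    fix e assume e: "e \<in> charts_at B (f p)"
    have fp: "f p \<in> \<Union> (fst ` B)" using d by (auto simp: charts_at_iff)
    show "tmap A B f p v e = frechet_derivative (snd e \<circ> cinv d) (at (snd d (f p))) (tmap A B f p v d)"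
      using smooth_map_derivative_compose[OF A B B f smooth_map_on_id[OF B] p fp c d e, of "v c"]
      unfolding tmap_chart[OF A B f p v c d] tmap_chart[OF A B f p v c e] by (simp add: o_def)
  qed (simp add: tmap_not_chart)
qed (simp add: tmap_outside zero_tangent B)

lemma tmap_comp:
  assumes A: "smooth_atlas A" and B: "smooth_atlas B" and C: "smooth_atlas C"
    and f: "smooth_map_on A B W f" and g: "smooth_map_on B C W' g" and sub: "f ` W \<subseteq> W'" and p: "p \<in> W"
    and v: "v \<in> tangent_space A p"
  shows "tmap A C (\<lambda>x. g (f x)) p v = tmap B C g (f p) (tmap A B f p v)"
proof
  fix e
  note gf = smooth_map_on_compose[OF A B C f g sub]
  have fp: "f p \<in> W'" using p sub by blast
  obtain c d where c: "c \<in> charts_at A p" and d: "d \<in> charts_at B (f p)"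
    using f p unfolding smooth_map_on_def by meson
  show "tmap A C (\<lambda>x. g (f x)) p v e = tmap B C g (f p) (tmap A B f p v) e"
  proof (cases "e \<in> charts_at C (g (f p))")
    case True
    show ?thesis
      unfolding tmap_chart[OF A C gf p v c True] tmap_chart[OF B C g fp tmap_tangent[OF A B f p] d True]
        tmap_chart[OF A B f p v c d]
      by (rule smooth_map_derivative_compose[OF A B C f g p fp c d True])
  qed (simp add: tmap_not_chart)
qed

text \<open>An equality of functions on all families of components: tangent maps are extended by
  zero, and locally equal maps have the same \<open>frechet_derivative\<close>. Jets record the
  tangent map as such a function, so this is what makes jets local.\<close>

lemma tmap_cong:
  fixes B :: "('q, 'f::euclidean_space) chart set"
  assumes A: "smooth_atlas A" and W: "openin (manifold_topology A) W" "p \<in> W" and eq: "\<And>x. x \<in> W \<Longrightarrow> f x = g x"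
  shows "tmap A B f p = tmap A B g p"
proof
  fix v
  define c0 where "c0 = (SOME c. c \<in> charts_at A p)"
  have "\<exists>c. c \<in> charts_at A p"
    using openin_subset[OF W(1)] W(2) unfolding topspace_manifold charts_at_iff by blast
  then have "c0 \<in> charts_at A p" unfolding c0_def by (rule someI_ex)
  then have c0: "c0 \<in> A" "p \<in> fst c0" by (auto simp: charts_at_iff)
  have "frechet_derivative (snd d \<circ> f \<circ> cinv c0) (at (snd c0 p)) = frechet_derivative (snd d \<circ> g \<circ> cinv c0) (at (snd c0 p))"
    for d :: "('q, 'f) chart"
    by (rule frechet_derivative_cong_open[OF open_image_chart[OF A c0(1) W(1)]])
       (use c0 W eq cinv_chart[OF A c0(1)] in auto)
  then show "tmap A B f p v = tmap A B g p v"
    unfolding tmap_def c0_def[symmetric] Let_def eq[OF W(2)] by (simp only:)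
qed

section \<open>Velocities of curves\<close>

lemma velocity_tangent:
  assumes A: "smooth_atlas A" and c: "c \<in> charts_at A (\<gamma> t)" and I: "open I" "t \<in> I" "\<gamma> ` I \<subseteq> fst c"
    and D: "((\<lambda>s. snd c (\<gamma> s)) has_vector_derivative w) (at t)"
  shows "velocity A \<gamma> t \<in> tangent_space A (\<gamma> t)" "velocity A \<gamma> t c = w"
proof -
  have cA: "c \<in> A" "\<gamma> t \<in> fst c" using c by (auto simp: charts_at_iff)
  show w: "velocity A \<gamma> t c = w"
    using c vector_derivative_at[OF D] by (simp add: velocity_def o_def)
  show "velocity A \<gamma> t \<in> tangent_space A (\<gamma> t)"
  proof (rule tangent_spaceI[OF A c])
    fix d assume d: "d \<in> charts_at A (\<gamma> t)"
    let ?D = "frechet_derivative (snd d \<circ> cinv c) (at (snd c (\<gamma> t)))"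
    have "((\<lambda>s. snd d (cinv c (snd c (\<gamma> s)))) has_derivative (\<lambda>h. ?D (h *\<^sub>R w))) (at t)"
      using diff_chain_at[OF D[unfolded has_vector_derivative_def] transition_has_derivative[OF A c d]] by (simp add: o_def)
    then have "((\<lambda>s. snd d (cinv c (snd c (\<gamma> s)))) has_vector_derivative ?D w) (at t)"
      by (simp add: has_vector_derivative_def linear_scale[OF linear_transition[OF A c d]])
    then have "((\<lambda>s. snd d (\<gamma> s)) has_vector_derivative ?D w) (at t)"
      by (rule has_vector_derivative_transform_within_open[OF _ I(1,2)]) (use I(3) cinv_chart[OF A cA(1)] in auto)
    then show "velocity A \<gamma> t d = ?D (velocity A \<gamma> t c)"
      using d w vector_derivative_at by (fastforce simp: velocity_def o_def)
  qed (simp add: velocity_def)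
qed

lemma line_atlas: "smooth_atlas line_atlas"
proof -
  have "smooth_on UNIV (snd (UNIV, id) \<circ> cinv (UNIV :: real set, id))"
    by (rule smooth_on_cong[OF smooth_on_id]) (use inv_into_f_f[of "id" UNIV] in auto)
  then show ?thesis by (simp add: smooth_atlas_def line_atlas_def)
qed

text \<open>The required curve in \<open>S\<close> is the image under \<open>f\<close> of the
  straight coordinate line through \<open>p\<close> with direction \<open>v c\<close>. The
  Lagrangian identity in \<open>EH_lagrangian\<close> is stated for tangent vectors of the
  submanifold \<open>T0\<close> in this curve form, so tangent vectors of sections must be brought
  into it.\<close>

lemma tmap_tangent_space_sub:
  assumes A: "smooth_atlas A" and B: "smooth_atlas B" and f: "smooth_map_on A B W f" and p: "p \<in> W"
    and v: "v \<in> tangent_space A p" and S: "f ` W \<subseteq> S"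
  shows "tmap A B f p v \<in> tangent_space_sub B S (f p)"
proof -
  obtain c d where c: "c \<in> charts_at A p" and d: "d \<in> charts_at B (f p)"
    using f p unfolding smooth_map_on_def by meson
  have cA: "c \<in> A" "p \<in> fst c" using c by (auto simp: charts_at_iff)
  obtain V where V: "open V" "snd c p \<in> V" "V \<subseteq> snd c ` fst c" "cinv c ` V \<subseteq> W" "f ` cinv c ` V \<subseteq> fst d"
    "smooth_on V (\<lambda>y. snd d (f (cinv c y)))"
    by (rule smooth_map_on_charts[OF A B f p c d])
  define l where "l t = snd c p + t *\<^sub>R v c" for t
  define \<gamma> where "\<gamma> t = f (cinv c (l t))" for t
  have sl: "smooth_on UNIV l" unfolding l_def by (intro smooth_intros smooth_on_id) auto
  have "open (l -` V)"
    using continuous_open_preimage[OF smooth_on_imp_continuous_on[OF sl] open_UNIV V(1)] by simp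
  moreover have "0 \<in> l -` V" using V(2) by (simp add: l_def)
  ultimately obtain \<epsilon> where e: "\<epsilon> > 0" "ball 0 \<epsilon> \<subseteq> l -` V" by (meson openE)
  have I: "{-\<epsilon><..<\<epsilon>} \<subseteq> l -` V" using e(2) by (auto simp: subset_iff dist_real_def)
  have p0: "cinv c (l 0) = p" using cinv_chart[OF A cA] by (simp add: l_def)
  have "smooth_map_on line_atlas B {-\<epsilon><..<\<epsilon>} \<gamma>"
  proof (rule smooth_map_onI[OF line_atlas])
    fix t assume t: "t \<in> {-\<epsilon><..<\<epsilon>}"
    then have "l t \<in> V" using I by (auto simp: subset_iff)
    then have "cinv c (l t) \<in> W" using V(4) by blast
    then obtain d' where d': "d' \<in> charts_at B (f (cinv c (l t)))" 
      using f unfolding smooth_map_on_def by meson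
    have q: "snd c (cinv c (l t)) = l t" "cinv c (l t) \<in> fst c"
      using \<open>l t \<in> V\<close> V(3) chart_cinv[of "l t" c] cinv_in[of "l t" c] by auto
    then have c': "c \<in> charts_at A (cinv c (l t))" using cA by (simp add: charts_at_iff)
    obtain V' where V': "open V'" "snd c (cinv c (l t)) \<in> V'" "V' \<subseteq> snd c ` fst c" "f ` cinv c ` V' \<subseteq> fst d'"
      "smooth_on V' (\<lambda>y. snd d' (f (cinv c y)))"
      using smooth_map_on_charts[OF A B f \<open>cinv c (l t) \<in> W\<close> c' d'] by metis
    define X where "X = {-\<epsilon><..<\<epsilon>} \<inter> l -` V'"
    have oX: "open X"
      unfolding X_def using continuous_open_preimage[OF smooth_on_imp_continuous_on[OF smooth_on_subset[OF sl]] _ V'(1)] by auto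
    have sm: "smooth_on X (\<lambda>t. snd d' (f (cinv c (l t))))"
      by (rule smooth_on_compose[OF V'(5,1) smooth_on_subset[OF sl] oX]) (auto simp: X_def)
    have id: "cinv (UNIV, id) = (id :: real \<Rightarrow> real)" using inv_into_f_f[of "id" UNIV] by auto
    show "\<exists>c d V. c \<in> charts_at line_atlas t \<and> d \<in> charts_at B (\<gamma> t) \<and> open V \<and> snd c t \<in> V \<and>
        V \<subseteq> snd c ` fst c \<and> cinv c ` V \<subseteq> {- \<epsilon><..<\<epsilon>} \<and> \<gamma> ` cinv c ` V \<subseteq> fst d \<and> smooth_on V (\<lambda>y. snd d (\<gamma> (cinv c y)))"
      by (intro exI[of _ "(UNIV, id)"] exI[of _ d'] exI[of _ X])
         (use d' t q V'(2,4) oX sm id in \<open>auto simp: charts_at_iff line_atlas_def \<gamma>_def X_def\<close>)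
  qed
  moreover have "tmap A B f p v = velocity B \<gamma> 0"
  proof
    fix e
    show "tmap A B f p v e = velocity B \<gamma> 0 e"
    proof (cases "e \<in> charts_at B (f p)")
      case True
      have "(l has_derivative (\<lambda>h. h *\<^sub>R v c)) (at 0)"
        unfolding l_def by (auto intro!: derivative_eq_intros)
      moreover have "((\<lambda>y. snd e (f (cinv c y))) has_derivative frechet_derivative (snd e \<circ> f \<circ> cinv c) (at (snd c p))) (at (l 0))"
        using smooth_map_has_derivative[OF A B f p c True] by (simp add: l_def)
      ultimately have "((\<lambda>t. snd e (\<gamma> t)) has_derivative (\<lambda>h. frechet_derivative (snd e \<circ> f \<circ> cinv c) (at (snd c p)) (h *\<^sub>R v c))) (at 0)"
        using diff_chain_at by (fastforce simp: o_def \<gamma>_def)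
      then have "((\<lambda>t. snd e (\<gamma> t)) has_vector_derivative frechet_derivative (snd e \<circ> f \<circ> cinv c) (at (snd c p)) (v c)) (at 0)"
        using linear_scale[OF has_derivative_linear[OF smooth_map_has_derivative[OF A B f p c True]]]
        by (simp add: has_vector_derivative_def)
      then show ?thesis
        using True p0 vector_derivative_at tmap_chart[OF A B f p v c True]
        by (fastforce simp: velocity_def \<gamma>_def o_def)
    qed (use p0 in \<open>simp add: tmap_not_chart velocity_def \<gamma>_def\<close>)
  qed
  moreover have "\<gamma> ` {-\<epsilon><..<\<epsilon>} \<subseteq> S" using I V(4) S unfolding \<gamma>_def by blast
  moreover have "\<gamma> 0 = f p" using p0 by (simp add: \<gamma>_def)
  ultimately show ?thesis
    unfolding tangent_space_sub_def using e(1) by blast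
qed

section \<open>First jet bundles\<close>

definition jet_chart ::
  "('a, ('m::finite) rvec) chart set \<Rightarrow> ('p, 'm rvec \<times> 'f::euclidean_space) chart set \<Rightarrow> ('p \<Rightarrow> 'a)
    \<Rightarrow> ('a, 'm rvec) chart \<Rightarrow> ('p, 'm rvec \<times> 'f) chart
    \<Rightarrow> (('a, 'm rvec, 'p, 'm rvec \<times> 'f) jet, 'm rvec \<times> 'f \<times> ('f, 'm) vec) chart" where
  "jet_chart A B \<pi> c d =
     ({(x, e, L) \<in> jets A B \<pi>. x \<in> fst c \<and> e \<in> fst d},
      \<lambda>(x, e, L). (snd c x, snd (snd d e), \<chi> \<sigma>. snd (L (tvec_of A x c (axis \<sigma> 1)) d)))"

lemma jet_atlas_eq: "jet_atlas A B \<pi> = {jet_chart A B \<pi> c d | c d. c \<in> A \<and> d \<in> B \<and> adapted B \<pi> c d}"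
  by (simp add: jet_atlas_def jet_chart_def)

lemma linear_axis_sum:
  fixes v :: "real^'m::finite"
  assumes "linear L"
  shows "L v = (\<Sum>\<sigma>\<in>UNIV. v $ \<sigma> *\<^sub>R L (axis \<sigma> 1))"
proof -
  have "v = (\<Sum>\<sigma>\<in>UNIV. v $ \<sigma> *\<^sub>R axis \<sigma> 1)"
    by (simp add: vec_eq_iff axis_def if_distrib cong: if_cong)
  then have "L v = L (\<Sum>\<sigma>\<in>UNIV. v $ \<sigma> *\<^sub>R axis \<sigma> 1)" by simp
  then show ?thesis by (simp add: linear_sum[OF assms] linear_scale[OF assms])
qed

text \<open>The common setting of the frame bundle and the bundle of metrics. Adapted charts over
  every base chart suffice to build the charts of the jet bundle.\<close>

locale fibred_manifold =
  fixes A :: "('a, ('m::finite) rvec) chart set" and B :: "('p, 'm rvec \<times> 'f::euclidean_space) chart set"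
    and \<pi> :: "'p \<Rightarrow> 'a"
  assumes A: "smooth_atlas A" and B: "smooth_atlas B"
    and proj: "\<pi> ` \<Union> (fst ` B) \<subseteq> \<Union> (fst ` A)"
    and adapted_ex: "\<And>c. c \<in> A \<Longrightarrow> \<exists>d\<in>B. adapted B \<pi> c d"
begin

abbreviation "jchart \<equiv> jet_chart A B \<pi>"

text \<open>The linear part of the jet at \<open>u\<close> with coordinates \<open>F\<close>.\<close>
definition jlin where
  "jlin c d x u F = (\<lambda>v. if v \<in> tangent_space A x
     then tvec_of B u d (v c, \<Sum>\<sigma>\<in>UNIV. v c $ \<sigma> *\<^sub>R F $ \<sigma>) else (\<lambda>_. 0))"

lemma adapted_iff: "adapted B \<pi> c d \<Longrightarrow> u \<in> fst d \<longleftrightarrow> u \<in> \<Union> (fst ` B) \<and> \<pi> u \<in> fst c"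
  by (auto simp: adapted_def)

lemma adapted_fst: "adapted B \<pi> c d \<Longrightarrow> u \<in> fst d \<Longrightarrow> fst (snd d u) = snd c (\<pi> u)"
  by (auto simp: adapted_def)

lemma smooth_map_proj: "smooth_map_on B A (\<Union> (fst ` B)) \<pi>"
proof -
  have sm: "smooth_map_on B A (fst d) \<pi>" if c: "c \<in> A" and d: "d \<in> B" "adapted B \<pi> c d" for c d
  proof (rule smooth_map_on_chart[OF B d(1) c])
    show "\<pi> ` fst d \<subseteq> fst c" using adapted_iff[OF d(2)] by auto
    show "smooth_on (snd d ` fst d) (\<lambda>y. snd c (\<pi> (cinv d y)))"
      by (rule smooth_on_cong[of _ fst])
         (use open_chart_image[OF B d(1)] cinv_chart[OF B d(1)] adapted_fst[OF d(2)] in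
           \<open>auto intro: smooth_on_bounded_linear bounded_linear_fst\<close>)
  qed
  have "\<Union> (fst ` B) = \<Union> {fst d | c d. c \<in> A \<and> d \<in> B \<and> adapted B \<pi> c d}"
  proof (intro equalityI subsetI)
    fix u assume u: "u \<in> \<Union> (fst ` B)"
    then have "\<pi> u \<in> \<Union> (fst ` A)" using proj by blast
    then obtain c where c: "c \<in> A" "\<pi> u \<in> fst c" by blast
    then obtain d where "d \<in> B" "adapted B \<pi> c d" using adapted_ex by blast
    then show "u \<in> \<Union> {fst d | c d. c \<in> A \<and> d \<in> B \<and> adapted B \<pi> c d}"
      using c u adapted_iff by blast
  qed blast
  then show ?thesis using sm by (auto intro!: smooth_map_on_Union)
qed

text \<open>In adapted coordinates a section has the form \<open>y \<mapsto> (y, f y)\<close>. Hence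
  the first component of its derivative is the identity, and the tangent map is determined by the
  partial derivatives of the fibre coordinates.\<close>

lemma section_coordinates:
  assumes W: "openin (manifold_topology A) W" "x \<in> W" and s: "section_on A B \<pi> W s"
    and c: "c \<in> A" "x \<in> fst c" and d: "d \<in> B" "adapted B \<pi> c d"
  shows "s x \<in> fst d" "\<pi> (s x) = x"
    and "v \<in> tangent_space A x \<Longrightarrow> tmap A B s x v d =
      (v c, \<Sum>\<sigma>\<in>UNIV. v c $ \<sigma> *\<^sub>R snd (frechet_derivative (snd d \<circ> s \<circ> cinv c) (at (snd c x)) (axis \<sigma> 1)))"
proof -
  let ?D = "frechet_derivative (snd d \<circ> s \<circ> cinv c) (at (snd c x))"
  have sm: "smooth_map_on A B W s" and ps: "\<And>x. x \<in> W \<Longrightarrow> \<pi> (s x) = x"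
    using s by (auto simp: section_on_def)
  show px: "\<pi> (s x) = x" using ps W by simp
  have "s x \<in> \<Union> (fst ` B)"
    using sm W(2) unfolding smooth_map_on_def charts_at_def by blast
  then show sd: "s x \<in> fst d" using adapted_iff[OF d(2)] c px by simp
  have c': "c \<in> charts_at A x" and d': "d \<in> charts_at B (s x)" using c d sd by (auto simp: charts_at_iff)
  obtain V where V: "open V" "snd c x \<in> V" "V \<subseteq> snd c ` fst c" "cinv c ` V \<subseteq> W" "s ` cinv c ` V \<subseteq> fst d"
    "smooth_on V (\<lambda>y. snd d (s (cinv c y)))"
    by (rule smooth_map_on_charts[OF A B sm W(2) c' d'])
  have hd: "((\<lambda>y. snd d (s (cinv c y))) has_derivative ?D) (at (snd c x))"
    by (rule smooth_map_has_derivative[OF A B sm W(2) c' d'])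
  then have lin: "linear ?D" by (rule has_derivative_linear)
  have eq: "fst (snd d (s (cinv c y))) = y" if "y \<in> V" for y
    using that V(3-5) adapted_fst[OF d(2), of "s (cinv c y)"] ps[of "cinv c y"] chart_cinv[of y c]
    by (auto simp: image_subset_iff subset_iff)
  have "((\<lambda>y. fst (snd d (s (cinv c y)))) has_derivative (\<lambda>w. fst (?D w))) (at (snd c x))"
    using hd by (rule has_derivative_fst)
  then have "((\<lambda>y. y) has_derivative (\<lambda>w. fst (?D w))) (at (snd c x))"
    by (rule has_derivative_transform_within_open[OF _ V(1,2)]) (rule eq)
  then have "(\<lambda>w. fst (?D w)) = (\<lambda>w. w)"
    using has_derivative_unique has_derivative_ident by blast
  then have f: "fst (?D w) = w" for w by metis
  show "tmap A B s x v d = (v c, \<Sum>\<sigma>\<in>UNIV. v c $ \<sigma> *\<^sub>R snd (?D (axis \<sigma> 1)))" if v: "v \<in> tangent_space A x"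
  proof -
    have "snd (?D (v c)) = (\<Sum>\<sigma>\<in>UNIV. v c $ \<sigma> *\<^sub>R snd (?D (axis \<sigma> 1)))"
      using linear_axis_sum[OF linear_compose[OF lin linear_snd], of "v c"] by simp
    then show ?thesis
      unfolding tmap_chart[OF A B sm W(2) v c' d'] using f[of "v c"] by (simp add: prod_eq_iff)
  qed
qed

lemma jet_chart_jet1:
  assumes W: "openin (manifold_topology A) W" "x \<in> W" and s: "section_on A B \<pi> W s"
    and c: "c \<in> A" "x \<in> fst c" and d: "d \<in> B" "adapted B \<pi> c d"
  shows "jet1 A B s x \<in> fst (jchart c d)"
    and "snd (jchart c d) (jet1 A B s x) = (snd c x, snd (snd d (s x)),
      \<chi> \<sigma>. snd (frechet_derivative (snd d \<circ> s \<circ> cinv c) (at (snd c x)) (axis \<sigma> 1)))"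
proof -
  note S = section_coordinates[OF W s c d]
  have c': "c \<in> charts_at A x" using c by (auto simp: charts_at_iff)
  show "jet1 A B s x \<in> fst (jchart c d)"
    using S(1) W s c unfolding jet_chart_def jets_def local_sections_at_def jet1_def by auto
  have "snd (tmap A B s x (tvec_of A x c (axis \<sigma> 1)) d) =
      snd (frechet_derivative (snd d \<circ> s \<circ> cinv c) (at (snd c x)) (axis \<sigma> 1))" for \<sigma>
    unfolding S(3)[OF tvec_of_tangent(1)[OF A c']] tvec_of_tangent(2)[OF A c']
    by (simp add: axis_def if_distrib[where f="\<lambda>a. a *\<^sub>R _"] cong: if_cong)
  then show "snd (jchart c d) (jet1 A B s x) = (snd c x, snd (snd d (s x)),
      \<chi> \<sigma>. snd (frechet_derivative (snd d \<circ> s \<circ> cinv c) (at (snd c x)) (axis \<sigma> 1)))"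
    by (simp add: jet_chart_def jet1_def)
qed

lemma jets_cases:
  assumes "j \<in> jets A B \<pi>"
  obtains s x W where "j = jet1 A B s x" "openin (manifold_topology A) W" "x \<in> W" "section_on A B \<pi> W s"
  using assms unfolding jets_def local_sections_at_def by blast

text \<open>The function \<open>L\<close> stored in a jet can be rebuilt from the coordinates of the
  jet. Injectivity of jet charts rests on this.\<close>

lemma jet_coordinates:
  assumes j: "(x, u, L) \<in> jets A B \<pi>" and c: "c \<in> A" "x \<in> fst c" and d: "d \<in> B" "adapted B \<pi> c d"
  shows "u \<in> fst d" "\<pi> u = x" "L = jlin c d x u (snd (snd (snd (jchart c d) (x, u, L))))"
proof -
  obtain s y W where s: "(x, u, L) = jet1 A B s y" "openin (manifold_topology A) W" "y \<in> W" "section_on A B \<pi> W s"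
    using j by (rule jets_cases)
  have y: "y = x" "u = s x" "L = tmap A B s x" using s(1) by (auto simp: jet1_def)
  have W: "openin (manifold_topology A) W" "x \<in> W" using s y by auto
  note S = section_coordinates[OF W s(4) c d]
  show u: "u \<in> fst d" "\<pi> u = x" using S y by auto
  have d': "d \<in> charts_at B u" using d u by (simp add: charts_at_iff)
  have sm: "smooth_map_on A B W s" using s(4) by (simp add: section_on_def)
  show "L = jlin c d x u (snd (snd (snd (jchart c d) (x, u, L))))"
  proof
    fix v
    show "L v = jlin c d x u (snd (snd (snd (jchart c d) (x, u, L)))) v"
    proof (cases "v \<in> tangent_space A x")
      case True
      have "L v = tvec_of B u d (L v d)"
        using tangent_space_eqI[OF _ tvec_of_tangent(1)[OF B d'] d'] tmap_tangent[OF A B sm W(2)]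
          tvec_of_tangent(2)[OF B d'] y by metis
      then show ?thesis
        using True S(3)[OF True] jet_chart_jet1(2)[OF W s(4) c d]
        by (simp add: jlin_def y jet1_def)
    qed (simp add: jlin_def y tmap_outside)
  qed
qed

text \<open>Arbitrary slopes \<open>F\<close> are realised by the section that is affine in the
  coordinates, \<open>y \<mapsto> (y, f0 + F (y - y0))\<close>, restricted to a neighbourhood
  \<open>V\<close> on which its values stay in the range of the chart \<open>d\<close>.\<close>

lemma jlin_jet:
  assumes c: "c \<in> A" and d: "d \<in> B" "adapted B \<pi> c d" and u: "u \<in> fst d"
  shows "(\<pi> u, u, jlin c d (\<pi> u) u F) \<in> fst (jchart c d)"
    "snd (jchart c d) (\<pi> u, u, jlin c d (\<pi> u) u F) = (snd c (\<pi> u), snd (snd d u), F)"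
proof -
  define x where "x = \<pi> u"
  define y0 where "y0 = snd c x"
  define f0 where "f0 = snd (snd d u)"
  have x: "x \<in> fst c" using adapted_iff[OF d(2)] u by (simp add: x_def)
  have du: "snd d u = (y0, f0)" using adapted_fst[OF d(2) u] by (simp add: prod_eq_iff y0_def f0_def x_def)
  define G where "G y = (y, f0 + (\<Sum>\<sigma>\<in>UNIV. (y - y0) $ \<sigma> *\<^sub>R F $ \<sigma>))" for y
  have smG: "smooth_on S G" if "open S" for S
    unfolding G_def by (intro smooth_intros smooth_on_id that)
  define V where "V = snd c ` fst c \<inter> G -` (snd d ` fst d)"
  have V: "open V" unfolding V_def
    by (rule continuous_open_preimage[OF smooth_on_imp_continuous_on[OF smG] open_chart_image[OF A c] open_chart_image[OF B d(1)]])
       (rule open_chart_image[OF A c])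
  have Vc: "V \<subseteq> snd c ` fst c" by (auto simp: V_def)
  define s where "s p = cinv d (G (snd c p))" for p
  have Gy0: "G y0 = (y0, f0)" by (simp add: G_def)
  have y0: "y0 \<in> V" using x u du[symmetric] Gy0 by (auto simp: V_def y0_def)
  have sc: "cinv c y \<in> fst c" "snd c (cinv c y) = y" "s (cinv c y) \<in> fst d" "snd d (s (cinv c y)) = G y"
    "\<pi> (s (cinv c y)) = cinv c y" if y: "y \<in> V" for y
  proof -
    show 1: "cinv c y \<in> fst c" "snd c (cinv c y) = y" using y Vc cinv_in[of y c] chart_cinv[of y c] by auto
    show 2: "s (cinv c y) \<in> fst d" "snd d (s (cinv c y)) = G y"
      using y 1 cinv_in[of "G y" d] chart_cinv[of "G y" d] by (auto simp: s_def V_def)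
    have "snd c (\<pi> (s (cinv c y))) = snd c (cinv c y)"
      using adapted_fst[OF d(2) 2(1)] 2(2) 1 by (simp add: G_def)
    then show "\<pi> (s (cinv c y)) = cinv c y"
      using adapted_iff[OF d(2)] 2(1) 1(1) A c by (auto simp: smooth_atlas_def inj_on_def)
  qed
  define W where "W = cinv c ` V"
  have W: "openin (manifold_topology A) W" unfolding W_def by (rule openin_cinv_image[OF A c V Vc])
  have xW: "x \<in> W" using y0 x cinv_chart[OF A c] by (force simp: W_def y0_def)
  have "smooth_map_on A B W s"
  proof (rule smooth_map_onI[OF A])
    fix p assume "p \<in> W"
    then obtain y where y: "y \<in> V" "p = cinv c y" by (auto simp: W_def)
    have "smooth_on V (\<lambda>y. snd d (s (cinv c y)))"
      by (rule smooth_on_cong[OF smG[OF V] V]) (simp add: sc)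
    then show "\<exists>c d V. c \<in> charts_at A p \<and> d \<in> charts_at B (s p) \<and> open V \<and> snd c p \<in> V \<and>
      V \<subseteq> snd c ` fst c \<and> cinv c ` V \<subseteq> W \<and> s ` cinv c ` V \<subseteq> fst d \<and> smooth_on V (\<lambda>y. snd d (s (cinv c y)))"
      using sc y V Vc c d(1) by (intro exI[of _ c] exI[of _ d] exI[of _ V]) (auto simp: charts_at_iff W_def)
  qed
  moreover have "\<pi> (s p) = p" if "p \<in> W" for p using that sc(5) by (auto simp: W_def)
  ultimately have s: "section_on A B \<pi> W s" by (simp add: section_on_def)
  have sx: "s x = u" using Gy0 du cinv_chart[OF B d(1) u] by (simp add: s_def y0_def[symmetric])
  have "(G has_derivative (\<lambda>w. (w, \<Sum>\<sigma>\<in>UNIV. w $ \<sigma> *\<^sub>R F $ \<sigma>))) (at y0)"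
    unfolding G_def by (auto intro!: derivative_eq_intros bounded_linear.has_derivative[OF bounded_linear_vec_nth])
  then have "frechet_derivative G (at y0) = (\<lambda>w. (w, \<Sum>\<sigma>\<in>UNIV. w $ \<sigma> *\<^sub>R F $ \<sigma>))"
    by (rule frechet_derivative_at[symmetric])
  moreover have "frechet_derivative (snd d \<circ> s \<circ> cinv c) (at y0) = frechet_derivative G (at y0)"
    by (rule frechet_derivative_cong_open[OF V y0]) (simp add: sc)
  ultimately have "snd (frechet_derivative (snd d \<circ> s \<circ> cinv c) (at (snd c x)) (axis \<sigma> 1)) = F $ \<sigma>" for \<sigma>
    by (simp add: y0_def axis_def if_distrib[where f="\<lambda>a. a *\<^sub>R _"] cong: if_cong)
  then have jc: "snd (jchart c d) (jet1 A B s x) = (snd c x, snd (snd d u), F)"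
    using jet_chart_jet1(2)[OF W xW s c x d] sx by (simp add: vec_eq_iff)
  have "jet1 A B s x \<in> fst (jchart c d)" using jet_chart_jet1(1)[OF W xW s c x d] .
  moreover from this have "jet1 A B s x = (x, u, jlin c d x u F)"
    using jet_coordinates(3)[OF _ c x d, of "s x" "tmap A B s x"] jc sx
    by (simp add: jet_chart_def jet1_def)
  ultimately show "(\<pi> u, u, jlin c d (\<pi> u) u F) \<in> fst (jchart c d)"
    "snd (jchart c d) (\<pi> u, u, jlin c d (\<pi> u) u F) = (snd c (\<pi> u), snd (snd d u), F)"
    using jc by (simp_all add: x_def)
qed

lemma jet_in_chart:
  assumes c: "c \<in> A" and d: "d \<in> B" "adapted B \<pi> c d" and j: "j \<in> fst (jchart c d)"
  obtains u F where "u \<in> fst d" "j = (\<pi> u, u, jlin c d (\<pi> u) u F)" "j \<in> jets A B \<pi>"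
proof -
  obtain x u L where jx: "j = (x, u, L)" "(x, u, L) \<in> jets A B \<pi>" "x \<in> fst c" "u \<in> fst d"
    using j by (auto simp: jet_chart_def)
  show ?thesis using jet_coordinates[OF jx(2) c jx(3) d] that jx by blast
qed

lemma jet_chart_inj:
  assumes c: "c \<in> A" and d: "d \<in> B" "adapted B \<pi> c d"
  shows "inj_on (snd (jchart c d)) (fst (jchart c d))"
proof (rule inj_onI)
  fix j j' assume j: "j \<in> fst (jchart c d)" "j' \<in> fst (jchart c d)"
    and eq: "snd (jchart c d) j = snd (jchart c d) j'"
  obtain u F where u: "u \<in> fst d" "j = (\<pi> u, u, jlin c d (\<pi> u) u F)" by (rule jet_in_chart[OF c d j(1)])
  obtain u' F' where u': "u' \<in> fst d" "j' = (\<pi> u', u', jlin c d (\<pi> u') u' F')" by (rule jet_in_chart[OF c d j(2)])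
  have e: "snd c (\<pi> u) = snd c (\<pi> u')" "snd (snd d u) = snd (snd d u')" "F = F'"
    using eq unfolding u u' jlin_jet(2)[OF c d u(1)] jlin_jet(2)[OF c d u'(1)] by auto
  have "snd d u = snd d u'" using e adapted_fst[OF d(2)] u(1) u'(1) by (simp add: prod_eq_iff)
  then have "u = u'" using u(1) u'(1) B d(1) by (auto simp: smooth_atlas_def inj_on_def)
  with e u u' show "j = j'" by simp
qed

text \<open>The slopes are free, so the overlap in jet coordinates is the preimage of the overlap of
  the charts below it. Its openness is then immediate.\<close>

lemma jet_chart_overlap:
  assumes c: "c \<in> A" and d: "d \<in> B" "adapted B \<pi> c d" and c': "c' \<in> A" and d': "d' \<in> B" "adapted B \<pi> c' d'"
  shows "snd (jchart c d) ` (fst (jchart c d) \<inter> fst (jchart c' d')) =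
    (\<lambda>(y, f, F). (y, f)) -` (snd d ` (fst d \<inter> fst d'))"
proof (intro equalityI subsetI)
  fix z assume "z \<in> snd (jchart c d) ` (fst (jchart c d) \<inter> fst (jchart c' d'))"
  then obtain j where j: "j \<in> fst (jchart c d)" "j \<in> fst (jchart c' d')"
      and z: "z = snd (jchart c d) j" by auto
  obtain u F where u: "u \<in> fst d" "j = (\<pi> u, u, jlin c d (\<pi> u) u F)" by (rule jet_in_chart[OF c d j(1)])
  have "u \<in> fst d'" using j(2) u(2) by (simp add: jet_chart_def)
  moreover have "snd d u = (snd c (\<pi> u), snd (snd d u))" using adapted_fst[OF d(2) u(1)] by (simp add: prod_eq_iff)
  ultimately show "z \<in> (\<lambda>(y, f, F). (y, f)) -` (snd d ` (fst d \<inter> fst d'))"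
    using z u jlin_jet(2)[OF c d u(1), of F] by (auto simp: image_iff intro!: bexI[of _ u])
next
  fix z :: "'m rvec \<times> 'f \<times> ('f, 'm) vec"
  assume "z \<in> (\<lambda>(y, f, F). (y, f)) -` (snd d ` (fst d \<inter> fst d'))"
  then obtain y f F u where z: "z = (y, f, F)" "u \<in> fst d" "u \<in> fst d'" "(y, f) = snd d u"
    by (cases z) auto
  let ?j = "(\<pi> u, u, jlin c d (\<pi> u) u F)"
  have "?j \<in> fst (jchart c' d')"
    using jlin_jet(1)[OF c d z(2), of F] adapted_iff[OF d'(2)] z(3) by (simp add: jet_chart_def)
  moreover have "snd (jchart c d) ?j = z"
    using jlin_jet(2)[OF c d z(2), of F] adapted_fst[OF d(2) z(2)] z(1,4)[symmetric] by simp
  ultimately show "z \<in> snd (jchart c d) ` (fst (jchart c d) \<inter> fst (jchart c' d'))"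
    using jlin_jet(1)[OF c d z(2), of F] by force
qed

lemma jet_chart_transition:
  assumes c: "c \<in> A" and d: "d \<in> B" "adapted B \<pi> c d" and c': "c' \<in> A" and d': "d' \<in> B" "adapted B \<pi> c' d'"
    and u: "u \<in> fst d" "u \<in> fst d'"
  shows "snd (jchart c' d') (\<pi> u, u, jlin c d (\<pi> u) u F) =
    (snd c' (\<pi> u), snd (snd d' u),
     \<chi> \<sigma>. let w = frechet_derivative (snd c \<circ> cinv c') (at (snd c' (\<pi> u))) (axis \<sigma> 1) in
       snd (frechet_derivative (snd d' \<circ> cinv d) (at (snd d u)) (w, \<Sum>\<rho>\<in>UNIV. w $ \<rho> *\<^sub>R F $ \<rho>)))"
proof -
  have cx: "c \<in> charts_at A (\<pi> u)" "c' \<in> charts_at A (\<pi> u)" "d' \<in> charts_at B u" "d \<in> charts_at B u"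
    using adapted_iff[OF d(2)] adapted_iff[OF d'(2)] u c c' d d' by (auto simp: charts_at_iff)
  have "tvec_of A (\<pi> u) c' (axis \<sigma> 1) c = frechet_derivative (snd c \<circ> cinv c') (at (snd c' (\<pi> u))) (axis \<sigma> 1)" for \<sigma>
    using cx by (simp add: tvec_of_def)
  then show ?thesis
    using tvec_of_tangent(1)[OF A cx(2)] cx(3) by (simp add: jet_chart_def jlin_def tvec_of_def[of B] Let_def)
qed

text \<open>The change of slopes contains first derivatives of both the base and the total
  coordinate changes, at moving points and in moving directions. The proof writes the transition as
  an explicit map \<open>T\<close> assembled from such derivatives.\<close>

theorem smooth_jet_atlas: "smooth_atlas (jet_atlas A B \<pi>)"
  unfolding smooth_atlas_def
proof (intro conjI ballI)
  fix k assume "k \<in> jet_atlas A B \<pi>"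
  then show "inj_on (snd k) (fst k)" unfolding jet_atlas_eq using jet_chart_inj by blast
next
  fix k k' assume "k \<in> jet_atlas A B \<pi>" "k' \<in> jet_atlas A B \<pi>"
  then obtain c d c' d' where c: "c \<in> A" and d: "d \<in> B" "adapted B \<pi> c d" and k: "k = jchart c d"
    and c': "c' \<in> A" and d': "d' \<in> B" "adapted B \<pi> c' d'" and k': "k' = jchart c' d'"
    unfolding jet_atlas_eq by blast
  let ?S = "(\<lambda>(y, f, F). (y, f)) -` (snd d ` (fst d \<inter> fst d')) :: ('m rvec \<times> 'f \<times> ('f, 'm) vec) set"
  have S: "?S = (\<lambda>z. (fst z, fst (snd z))) -` (snd d ` (fst d \<inter> fst d'))" by auto
  have oS: "open ?S" unfolding S
    by (rule open_vimage[OF open_overlap[OF B d(1) d'(1)]]) (intro continuous_intros)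
  have y: "fst z \<in> snd c ` (fst c \<inter> fst c') \<and> snd c' (cinv c (fst z)) \<in> snd c' ` (fst c' \<inter> fst c)
      \<and> (fst z, fst (snd z)) \<in> snd d ` (fst d \<inter> fst d')" if "z \<in> ?S" for z
  proof -
    from that obtain u where u: "u \<in> fst d" "u \<in> fst d'" "(fst z, fst (snd z)) = snd d u" by (auto simp: S)
    have "fst z = snd c (\<pi> u)" using adapted_fst[OF d(2) u(1)] u(3) by (metis fst_conv)
    moreover have "\<pi> u \<in> fst c" "\<pi> u \<in> fst c'" using u adapted_iff[OF d(2)] adapted_iff[OF d'(2)] by auto
    ultimately show ?thesis using that cinv_chart[OF A c] by (auto simp: S)
  qed
  \<comment> \<open>The coordinate vector field of \<open>c'\<close> with index
    \<open>\<sigma>\<close>, expressed in the coordinates of \<open>c\<close>.\<close>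
  define w where "w \<sigma> z = frechet_derivative (\<lambda>y. snd c (cinv c' y)) (at (snd c' (cinv c (fst z)))) (axis \<sigma> 1)"
    for \<sigma> and z :: "'m rvec \<times> 'f \<times> ('f, 'm) vec"
  define T where "T z = (snd c' (cinv c (fst z)), snd (snd d' (cinv d (fst z, fst (snd z)))),
     \<chi> \<sigma>. snd (frechet_derivative (\<lambda>y. snd d' (cinv d y)) (at (fst z, fst (snd z)))
       (w \<sigma> z, \<Sum>\<rho>\<in>UNIV. w \<sigma> z $ \<rho> *\<^sub>R snd (snd z) $ \<rho>)))" for z
  have fz: "smooth_on ?S (\<lambda>z. fst z)" "smooth_on ?S (\<lambda>z. (fst z, fst (snd z)))" "smooth_on ?S (\<lambda>z. snd (snd z))"
    by (intro smooth_intros smooth_on_id oS)+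
  have sc: "smooth_on ?S (\<lambda>z. snd c' (cinv c (fst z)))"
    by (rule smooth_on_compose[OF smooth_transition[OF A c c'] open_overlap[OF A c c'] fz(1) oS]) (use y in blast)
  have sw: "smooth_on ?S (w \<sigma>)" for \<sigma>
    unfolding w_def
    by (rule smooth_on_frechet_derivative_compose[OF smooth_transition[OF A c' c] open_overlap[OF A c' c] sc smooth_on_const oS])
       (use y in blast)
  have sF: "smooth_on ?S (\<lambda>z. frechet_derivative (\<lambda>y. snd d' (cinv d y)) (at (fst z, fst (snd z)))
       (w \<sigma> z, \<Sum>\<rho>\<in>UNIV. w \<sigma> z $ \<rho> *\<^sub>R snd (snd z) $ \<rho>))" for \<sigma>
  proof (rule smooth_on_frechet_derivative_compose[OF smooth_transition[OF B d(1) d'(1)] open_overlap[OF B d(1) d'(1)] fz(2) _ oS])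
    show "smooth_on ?S (\<lambda>z. (w \<sigma> z, \<Sum>\<rho>\<in>UNIV. w \<sigma> z $ \<rho> *\<^sub>R snd (snd z) $ \<rho>))"
      by (intro smooth_intros oS sw fz(3))
  qed (use y in blast)
  have sd: "smooth_on ?S (\<lambda>z. snd d' (cinv d (fst z, fst (snd z))))"
    by (rule smooth_on_compose[OF smooth_transition[OF B d(1) d'(1)] open_overlap[OF B d(1) d'(1)] fz(2) oS]) (use y in blast)
  have sT: "smooth_on ?S T"
    unfolding T_def by (intro smooth_intros oS sc sd sF)
  have eq: "T z = (snd k' \<circ> cinv k) z" if "z \<in> ?S" for z
  proof -
    from that obtain y f F u where z: "z = (y, f, F)" "u \<in> fst d" "u \<in> fst d'" "(y, f) = snd d u"
      by (cases z) auto
    have zy: "y = snd c (\<pi> u)" "f = snd (snd d u)" using z(4)[symmetric] adapted_fst[OF d(2) z(2)] by simp_all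
    let ?j = "(\<pi> u, u, jlin c d (\<pi> u) u F)"
    have "\<pi> u \<in> fst c" using z adapted_iff[OF d(2)] by auto
    then have cy: "cinv c y = \<pi> u" using zy cinv_chart[OF A c] by simp
    have "cinv k z = ?j"
      using inv_into_f_f[OF jet_chart_inj[OF c d] jlin_jet(1)[OF c d z(2), of F]] jlin_jet(2)[OF c d z(2), of F]
      unfolding k z(1) zy by simp
    then show ?thesis
      using jet_chart_transition[OF c d c' d' z(2,3), of F] cy z(4) cinv_chart[OF B d(1) z(2)]
      by (simp add: T_def w_def k' z(1) Let_def o_def)
  qed
  show "open (snd k ` (fst k \<inter> fst k'))"
    using oS unfolding k k' jet_chart_overlap[OF c d c' d'] .
  show "smooth_on (snd k ` (fst k \<inter> fst k')) (snd k' \<circ> cinv k)"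
    using smooth_on_cong[OF sT oS eq] jet_chart_overlap[OF c d c' d'] by (simp add: k k' o_def)
qed

lemma jet_chart_in: "c \<in> A \<Longrightarrow> d \<in> B \<Longrightarrow> adapted B \<pi> c d \<Longrightarrow> jchart c d \<in> jet_atlas A B \<pi>"
  unfolding jet_atlas_eq by blast

lemma jet_carrier: "\<Union> (fst ` jet_atlas A B \<pi>) = jets A B \<pi>"
proof (intro equalityI subsetI)
  fix j assume "j \<in> jets A B \<pi>"
  then obtain s x W where s: "j = jet1 A B s x" "openin (manifold_topology A) W" "x \<in> W" "section_on A B \<pi> W s"
    by (rule jets_cases)
  have "x \<in> \<Union> (fst ` A)" using openin_subset[OF s(2)] s(3) unfolding topspace_manifold by blast
  then obtain c where c: "c \<in> A" "x \<in> fst c" by blast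
  obtain d where d: "d \<in> B" "adapted B \<pi> c d" using adapted_ex[OF c(1)] by blast
  show "j \<in> \<Union> (fst ` jet_atlas A B \<pi>)"
    using jet_chart_jet1(1)[OF s(2-4) c d] jet_chart_in[OF c(1) d] s(1) by blast
qed (auto simp: jet_atlas_eq jet_chart_def)

lemma jet_chart_at:
  assumes c: "c \<in> A" and d: "d \<in> B" "adapted B \<pi> c d" and j: "j \<in> jets A B \<pi>" "tau1 j \<in> fst c"
  shows "jchart c d \<in> charts_at (jet_atlas A B \<pi>) j"
    "d \<in> charts_at B (tau10 j)" "c \<in> charts_at A (tau1 j)" "\<pi> (tau10 j) = tau1 j"
proof -
  obtain x u L where jx: "j = (x, u, L)" by (cases j)
  have x: "x \<in> fst c" using j(2) jx by (simp add: tau1_def)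
  have u: "u \<in> fst d" "\<pi> u = x" using jet_coordinates[OF _ c x d] j(1) jx by auto
  show "jchart c d \<in> charts_at (jet_atlas A B \<pi>) j"
    using jet_chart_in[OF c d] x u j(1) by (simp add: charts_at_iff jet_chart_def jx)
  show "d \<in> charts_at B (tau10 j)" "c \<in> charts_at A (tau1 j)" "\<pi> (tau10 j) = tau1 j"
    using c d x u by (simp_all add: charts_at_iff jx tau1_def tau10_def)
qed

lemma tau10_chart:
  assumes c: "c \<in> A" and d: "d \<in> B" "adapted B \<pi> c d"
  defines "J \<equiv> jchart c d"
  shows "tau10 ` fst J \<subseteq> fst d" "z \<in> snd J ` fst J \<Longrightarrow> snd d (tau10 (cinv J z)) = (fst z, fst (snd z))"
    "tau1 ` fst J \<subseteq> fst c" "z \<in> snd J ` fst J \<Longrightarrow> snd c (tau1 (cinv J z)) = fst z"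
proof -
  show "tau10 ` fst J \<subseteq> fst d" "tau1 ` fst J \<subseteq> fst c" by (auto simp: J_def jet_chart_def tau10_def tau1_def)
  assume z: "z \<in> snd J ` fst J"
  have j: "cinv J z \<in> fst J" "snd J (cinv J z) = z" using z cinv_in[of z J] chart_cinv[of z J] by auto
  obtain u F where u: "u \<in> fst d" "cinv J z = (\<pi> u, u, jlin c d (\<pi> u) u F)"
    using jet_in_chart[OF c d j(1)[unfolded J_def]] unfolding J_def by blast
  have "z = (snd c (\<pi> u), snd (snd d u), F)" using jlin_jet(2)[OF c d u(1), of F] j(2) u(2) by (simp add: J_def)
  then show "snd d (tau10 (cinv J z)) = (fst z, fst (snd z))" "snd c (tau1 (cinv J z)) = fst z"
    using u adapted_fst[OF d(2) u(1)] by (simp_all add: tau10_def tau1_def prod_eq_iff)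
qed

lemma smooth_tau10: "smooth_map_on (jet_atlas A B \<pi>) B (jets A B \<pi>) tau10"
  and smooth_tau1: "smooth_map_on (jet_atlas A B \<pi>) A (jets A B \<pi>) tau1"
proof -
  have "smooth_map_on (jet_atlas A B \<pi>) B (\<Union> (fst ` jet_atlas A B \<pi>)) tau10"
    and "smooth_map_on (jet_atlas A B \<pi>) A (\<Union> (fst ` jet_atlas A B \<pi>)) tau1"
  proof (safe intro!: smooth_map_on_Union)
    fix W k b assume k: "(W, b) \<in> jet_atlas A B \<pi>"
    then obtain c d where c: "c \<in> A" and d: "d \<in> B" "adapted B \<pi> c d" and J: "(W, b) = jchart c d"
      unfolding jet_atlas_eq by blast
    have W: "W = fst (jchart c d)" using J by (metis fst_conv)
    have o: "open (snd (jchart c d) ` fst (jchart c d))"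
      by (rule open_chart_image[OF smooth_jet_atlas jet_chart_in[OF c d]])
    have s: "smooth_on S (\<lambda>z. (fst z, fst (snd z)))" "smooth_on S (\<lambda>z. fst z)" if "open S"
      for S :: "('m rvec \<times> 'f \<times> ('f, 'm) vec) set"
      by (intro smooth_intros smooth_on_id that)+
    show "smooth_map_on (jet_atlas A B \<pi>) B (fst (W, b)) tau10" unfolding W fst_conv
      by (rule smooth_map_on_chart[OF smooth_jet_atlas jet_chart_in[OF c d] d(1) tau10_chart(1)[OF c d]],
          rule smooth_on_cong[OF s(1)[OF o] o]) (simp add: tau10_chart(2)[OF c d])
    show "smooth_map_on (jet_atlas A B \<pi>) A (fst (W, b)) tau1" unfolding W fst_conv
      by (rule smooth_map_on_chart[OF smooth_jet_atlas jet_chart_in[OF c d] c tau10_chart(3)[OF c d]],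
          rule smooth_on_cong[OF s(2)[OF o] o]) (simp add: tau10_chart(4)[OF c d])
  qed
  then show "smooth_map_on (jet_atlas A B \<pi>) B (jets A B \<pi>) tau10"
    "smooth_map_on (jet_atlas A B \<pi>) A (jets A B \<pi>) tau1"
    by (simp_all add: jet_carrier)
qed

lemma tmap_tau:
  assumes c: "c \<in> A" and d: "d \<in> B" "adapted B \<pi> c d" and j: "j \<in> jets A B \<pi>" "tau1 j \<in> fst c"
    and v: "v \<in> tangent_space (jet_atlas A B \<pi>) j"
  defines "J \<equiv> jchart c d"
  shows "tmap (jet_atlas A B \<pi>) B tau10 j v d = (fst (v J), fst (snd (v J)))"
    "tmap (jet_atlas A B \<pi>) A tau1 j v c = fst (v J)"
proof -
  note ch = jet_chart_at[OF c d j]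
  have jJ: "j \<in> fst J" "J \<in> jet_atlas A B \<pi>" using ch(1) by (auto simp: J_def charts_at_iff)
  have o: "open (snd J ` fst J)" by (rule open_chart_image[OF smooth_jet_atlas jJ(2)])
  have z: "snd J j \<in> snd J ` fst J" using jJ by auto
  have "frechet_derivative (snd d \<circ> tau10 \<circ> cinv J) (at (snd J j)) = frechet_derivative (\<lambda>z. (fst z, fst (snd z))) (at (snd J j))"
    by (rule frechet_derivative_cong_open[OF o z]) (simp add: tau10_chart(2)[OF c d] J_def)
  also have "\<dots> = (\<lambda>z. (fst z, fst (snd z)))"
    by (rule frechet_derivative_at[symmetric]) (auto intro!: derivative_eq_intros)
  finally show "tmap (jet_atlas A B \<pi>) B tau10 j v d = (fst (v J), fst (snd (v J)))"
    using tmap_chart[OF smooth_jet_atlas B smooth_tau10 j(1) v ch(1,2)] by (simp add: J_def)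
  have "frechet_derivative (snd c \<circ> tau1 \<circ> cinv J) (at (snd J j)) = frechet_derivative (\<lambda>z. fst z) (at (snd J j))"
    by (rule frechet_derivative_cong_open[OF o z]) (simp add: tau10_chart(4)[OF c d] J_def)
  also have "\<dots> = (\<lambda>z. fst z)"
    by (rule frechet_derivative_at[symmetric]) (auto intro!: derivative_eq_intros)
  finally show "tmap (jet_atlas A B \<pi>) A tau1 j v c = fst (v J)"
    using tmap_chart[OF smooth_jet_atlas A smooth_tau1 j(1) v ch(1,3)] by (simp add: J_def)
qed

end

section \<open>Gram--Schmidt orthonormalization near \<open>\<eta>\<close>\<close>

lemma smooth_on_matrix_vector_mult [smooth_intros]:
  fixes f :: "'a::real_normed_vector \<Rightarrow> real^'n::finite^'m::finite"
  shows "open S \<Longrightarrow> smooth_on S f \<Longrightarrow> smooth_on S g \<Longrightarrow> smooth_on S (\<lambda>x. f x *v g x)"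
  unfolding matrix_vector_mult_def by (intro smooth_intros)

lemmas smooth_on_inner [smooth_intros] = smooth_on_bilinear[OF bounded_bilinear_inner]

lemma eta_off_diagonal: "i \<noteq> j \<Longrightarrow> eta $ i $ j = 0"
  by (simp add: eta_def)

lemma eta_diagonal_square: "eta $ i $ i * eta $ i $ i = 1"
  by (simp add: eta_def)

lemma transpose_eta: "transpose eta = eta"
  by (simp add: vec_eq_iff transpose_def eta_def)

lemma eta_eta: "eta ** eta = mat 1"
  by (simp add: vec_eq_iff matrix_matrix_mult_def eta_def mat_def if_distrib[where f="\<lambda>x. _ * x"]
      if_distrib[where f="\<lambda>x. x * _"] cong: if_cong)

lemma inner_matrix_axis: "axis i 1 \<bullet> (g *v axis j 1) = (g $ i $ j :: real)"
  by (simp add: matrix_vector_mult_basis column_def inner_axis')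

lemma inner_matrix_symmetric:
  fixes g :: "real^'n::finite^'n"
  assumes "transpose g = g"
  shows "v \<bullet> (g *v w) = w \<bullet> (g *v v)"
  by (metis assms dot_lmul_matrix inner_commute transpose_matrix_vector)

text \<open>The vectors \<open>X i g\<close> depend on the symmetric matrix \<open>g\<close> and are
  to be orthonormal for the form of \<open>g\<close> with the signs of \<eta>. The new vector is the
  standard one minus its components along the earlier ones, then normalised. Its square could vanish
  for an indefinite form, so the domain is shrunk around \<eta>, for which the standard basis is
  already orthonormal.\<close>

lemma gram_schmidt_step:
  fixes X :: "'m::{finite,linorder} \<Rightarrow> 'm rmat \<Rightarrow> 'm rvec"
  assumes k: "k \<notin> S" and Q: "open Q" "eta \<in> Q" and X: "\<And>i. smooth_on Q (X i)" "\<And>i. X i eta = axis i 1"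
    and orth: "\<And>g i j. g \<in> Q \<Longrightarrow> transpose g = g \<Longrightarrow> i \<in> S \<Longrightarrow> j \<in> S \<Longrightarrow> X i g \<bullet> (g *v X j g) = eta $ i $ j"
  obtains Q' X' where "open Q'" "eta \<in> Q'" "\<And>i. smooth_on Q' (X' i)" "\<And>i. X' i eta = axis i 1"
    "\<And>g i j. g \<in> Q' \<Longrightarrow> transpose g = g \<Longrightarrow> i \<in> insert k S \<Longrightarrow> j \<in> insert k S \<Longrightarrow>
       X' i g \<bullet> (g *v X' j g) = eta $ i $ j"
proof -
  define Y where "Y g = axis k 1 - (\<Sum>i\<in>S. (eta $ i $ i * (axis k 1 \<bullet> (g *v X i g))) *\<^sub>R X i g)" for g
  \<comment> \<open>The sign \<open>eta $ k $ k\<close> makes this square equal to 1 at \<eta>,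
    hence positive nearby. Dividing \<open>Y\<close> by its root leaves a vector whose square is
    that sign.\<close>
  define n where "n g = eta $ k $ k * (Y g \<bullet> (g *v Y g))" for g
  have smY: "smooth_on Q Y" unfolding Y_def by (intro smooth_intros smooth_on_id Q X)
  have smn: "smooth_on Q n" unfolding n_def by (intro smooth_intros smooth_on_id Q smY)
  have Ye: "Y eta = axis k 1"
  proof -
    have "axis k 1 \<bullet> (eta *v X i eta) = 0" if "i \<in> S" for i
      using k that unfolding X(2) inner_matrix_axis by (intro eta_off_diagonal) auto
    then show ?thesis by (simp add: Y_def)
  qed
  have ne: "n eta = 1"
    unfolding n_def Ye inner_matrix_axis by (rule eta_diagonal_square)
  define Q' where "Q' = Q \<inter> n -` {0<..}"
  have Q': "open Q'"
    unfolding Q'_def by (rule continuous_open_preimage[OF smooth_on_imp_continuous_on[OF smn] Q(1)]) simp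
  have sub: "Q' \<subseteq> Q" and pos: "\<And>g. g \<in> Q' \<Longrightarrow> n g > 0" by (auto simp: Q'_def)
  define X' where "X' i = (if i = k then (\<lambda>g. inverse (sqrt (n g)) *\<^sub>R Y g) else X i)" for i
  have orthY: "Y g \<bullet> (g *v X j g) = 0" if g: "g \<in> Q" "transpose g = g" and j: "j \<in> S" for g j
  proof -
    have "Y g \<bullet> (g *v X j g) = axis k 1 \<bullet> (g *v X j g)
        - (\<Sum>i\<in>S. eta $ i $ i * (axis k 1 \<bullet> (g *v X i g)) * (X i g \<bullet> (g *v X j g)))"
      by (simp add: Y_def inner_diff_left inner_sum_left)
    also have "(\<Sum>i\<in>S. eta $ i $ i * (axis k 1 \<bullet> (g *v X i g)) * (X i g \<bullet> (g *v X j g))) =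
        (\<Sum>i\<in>S. if i = j then axis k 1 \<bullet> (g *v X j g) else 0)"
      using orth[OF g _ j] eta_off_diagonal eta_diagonal_square
      by (intro sum.cong refl) (auto simp: mult.commute mult.left_commute)
    also have "\<dots> = axis k 1 \<bullet> (g *v X j g)" using j by (simp add: sum.delta)
    finally show ?thesis by simp
  qed
  show ?thesis
  proof (rule that[of Q' X'])
    show "open Q'" by (rule Q')
    show "eta \<in> Q'" using Q ne by (simp add: Q'_def)
    fix i
    show "smooth_on Q' (X' i)"
    proof (cases "i = k")
      case True
      have "smooth_on Q' (\<lambda>g. inverse (sqrt (n g)) *\<^sub>R Y g)"
        using pos by (intro smooth_intros Q' smooth_on_subset[OF smn sub] smooth_on_subset[OF smY sub]) force+
      then show ?thesis using True by (simp add: X'_def)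
    qed (use smooth_on_subset[OF X(1) sub] in \<open>simp add: X'_def\<close>)
    show "X' i eta = axis i 1" using Ye ne X(2) by (simp add: X'_def)
  next
    fix g i j assume g: "g \<in> Q'" "transpose g = g" and i: "i \<in> insert k S" and j: "j \<in> insert k S"
    have gQ: "g \<in> Q" using g sub by auto
    have kk: "X' k g \<bullet> (g *v X' k g) = eta $ k $ k"
    proof -
      have "X' k g \<bullet> (g *v X' k g) = (inverse (sqrt (n g)) * inverse (sqrt (n g))) * (Y g \<bullet> (g *v Y g))"
        by (simp add: X'_def matrix_vector_mult_scaleR)
      also have "inverse (sqrt (n g)) * inverse (sqrt (n g)) = inverse (n g)"
        using pos[OF g(1)] by (simp flip: inverse_mult_distrib)
      also have "Y g \<bullet> (g *v Y g) = eta $ k $ k * n g"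
        by (simp add: n_def eta_diagonal_square flip: mult.assoc)
      finally show ?thesis using pos[OF g(1)] by simp
    qed
    have kj: "X' k g \<bullet> (g *v X' j g) = eta $ k $ j" if "j \<in> S" for j
      using that k orthY[OF gQ g(2) that] by (auto simp: X'_def eta_off_diagonal)
    show "X' i g \<bullet> (g *v X' j g) = eta $ i $ j"
    proof (cases "i = k")
      case True
      then show ?thesis using kk kj j by auto
    next
      case False
      then have iS: "i \<in> S" using i by simp
      show ?thesis
      proof (cases "j = k")
        case True
        then show ?thesis
          using kj[OF iS] inner_matrix_symmetric[OF g(2), of "X' i g" "X' j g"] False
          by (metis eta_off_diagonal)
      next
        case F2: False
        then show ?thesis using orth[OF gQ g(2) iS, of j] j False by (simp add: X'_def)
      qed
    qed
  qed
qed

text \<open>The value \<open>axis i 1\<close> at \<eta> is carried through the induction because it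
  makes the signed square of the next vector equal to 1 there.\<close>

lemma gram_schmidt_frames:
  fixes S :: "'m::{finite,linorder} set"
  shows "\<exists>Q (X :: 'm \<Rightarrow> 'm rmat \<Rightarrow> 'm rvec). open Q \<and> eta \<in> Q \<and> (\<forall>i. smooth_on Q (X i)) \<and> (\<forall>i. X i eta = axis i 1) \<and>
    (\<forall>g\<in>Q. transpose g = g \<longrightarrow> (\<forall>i\<in>S. \<forall>j\<in>S. X i g \<bullet> (g *v X j g) = eta $ i $ j))"
  using finite[of S]
proof (induction S rule: finite_induct)
  case empty
  show ?case by (intro exI[of _ UNIV] exI[of _ "\<lambda>i g. axis i 1"]) (simp add: smooth_on_const)
next
  case (insert k S)
  then obtain Q and X :: "'m \<Rightarrow> 'm rmat \<Rightarrow> 'm rvec" where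
    Q: "open Q" "eta \<in> Q" "\<And>i. smooth_on Q (X i)" "\<And>i. X i eta = axis i 1"
    "\<And>g i j. g \<in> Q \<Longrightarrow> transpose g = g \<Longrightarrow> i \<in> S \<Longrightarrow> j \<in> S \<Longrightarrow> X i g \<bullet> (g *v X j g) = eta $ i $ j"
    by blast
  obtain Q' and X' :: "'m \<Rightarrow> 'm rmat \<Rightarrow> 'm rvec" where
    "open Q'" "eta \<in> Q'" "\<And>i. smooth_on Q' (X' i)" "\<And>i. X' i eta = axis i 1"
    "\<And>g i j. g \<in> Q' \<Longrightarrow> transpose g = g \<Longrightarrow> i \<in> insert k S \<Longrightarrow> j \<in> insert k S \<Longrightarrow>
       X' i g \<bullet> (g *v X' j g) = eta $ i $ j"
    using gram_schmidt_step[OF insert(2) Q] by blast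
  then show ?case by blast
qed

lemma invertible_mat_1: "invertible (mat 1 :: real^'n::finite^'n)"
  by (simp add: invertible_det_nz)

lemma det_inverse_pos:
  fixes B :: "real^'n::finite^'n"
  assumes "det B > 0"
  shows "det (matrix_inv B) > 0"
proof -
  have "invertible B" using assms by (simp add: invertible_det_nz)
  then have "det (matrix_inv B) * det B = 1"
    using matrix_inv_eq(2)[of B] det_mul[of "matrix_inv B" B] by simp
  then show ?thesis using assms by (metis zero_less_mult_pos2 zero_less_one)
qed

text \<open>If the rows of \<open>B\<close> are orthonormal, then
  \<open>B ** g ** transpose B = eta\<close>, so the inverse of \<open>B\<close> factorises
  \<open>g\<close>. Since \<open>B\<close> is the identity at \<eta>, a smaller neighbourhood gives
  positive determinants; the value at \<eta> is recorded because it will keep frames fixed where the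
  metric is not varied.\<close>

theorem gram_schmidt:
  obtains Q and A :: "('m::{finite,linorder}) rmat \<Rightarrow> 'm rmat" where
    "open Q" "eta \<in> Q" "smooth_on Q A" "A eta = mat 1" "\<And>g. g \<in> Q \<Longrightarrow> det (A g) > 0"
    "\<And>g. g \<in> Q \<Longrightarrow> transpose g = g \<Longrightarrow> A g ** eta ** transpose (A g) = g"
proof -
  obtain Q and X :: "'m \<Rightarrow> 'm rmat \<Rightarrow> 'm rvec" where
    QX: "open Q \<and> eta \<in> Q \<and> (\<forall>i. smooth_on Q (X i)) \<and> (\<forall>i. X i eta = axis i 1) \<and>
    (\<forall>g\<in>Q. transpose g = g \<longrightarrow> (\<forall>i\<in>UNIV. \<forall>j\<in>UNIV. X i g \<bullet> (g *v X j g) = eta $ i $ j))"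
    using gram_schmidt_frames[of "UNIV :: 'm set"] by (elim exE)
  then have Q: "open Q" "eta \<in> Q" and X: "\<And>i. smooth_on Q (X i)" "\<And>i. X i eta = axis i 1"
    "\<And>g i j. g \<in> Q \<Longrightarrow> transpose g = g \<Longrightarrow> X i g \<bullet> (g *v X j g) = eta $ i $ j"
    by simp_all
  define B where "B g = (\<chi> i. X i g)" for g
  have smB: "smooth_on Q B" unfolding B_def by (intro smooth_intros Q X)
  have Be: "B eta = mat 1" by (simp add: B_def X vec_eq_iff axis_def mat_def)
  define Q' where "Q' = Q \<inter> (\<lambda>g. det (B g)) -` {0<..}"
  have Q': "open Q'" unfolding Q'_def
    by (rule continuous_open_preimage[OF smooth_on_imp_continuous_on Q(1)]) (intro smooth_intros Q smB, simp)
  have sub: "Q' \<subseteq> Q" and pos: "\<And>g. g \<in> Q' \<Longrightarrow> det (B g) > 0" by (auto simp: Q'_def)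
  have inv: "invertible (B g)" if "g \<in> Q'" for g
    using pos[OF that] by (simp add: invertible_det_nz)
  have BgB: "B g ** g ** transpose (B g) = eta" if "g \<in> Q'" "transpose g = g" for g
  proof -
    have "(B g ** g ** transpose (B g)) $ i $ j = X i g \<bullet> (g *v X j g)" for i j
      by (simp add: B_def matrix_matrix_mult_def matrix_vector_mult_def transpose_def inner_vec_def
        sum_distrib_left sum_distrib_right mult.assoc) (rule sum.swap)
    then show ?thesis using X(3)[of g] that sub by (auto simp: vec_eq_iff)
  qed
  show ?thesis
  proof (rule that[of Q' "\<lambda>g. matrix_inv (B g)"])
    show "open Q'" by (rule Q')
    show "eta \<in> Q'" using Q Be by (simp add: Q'_def)
    show "smooth_on Q' (\<lambda>g. matrix_inv (B g))"
      by (intro smooth_intros Q' smooth_on_subset[OF smB sub] inv)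
    show "matrix_inv (B eta) = mat 1"
      unfolding Be using matrix_inv_eq(1)[of "mat 1 :: 'm rmat"] invertible_mat_1 by simp
    fix g assume g: "g \<in> Q'"
    show "det (matrix_inv (B g)) > 0" by (rule det_inverse_pos[OF pos[OF g]])
    assume sym: "transpose g = g"
    let ?A = "matrix_inv (B g)"
    have "?A ** eta ** transpose ?A = ?A ** (B g ** g ** transpose (B g)) ** transpose ?A"
      by (simp add: BgB[OF g sym])
    also have "\<dots> = (?A ** B g) ** g ** transpose (?A ** B g)"
      by (simp add: matrix_mul_assoc matrix_transpose_mul)
    also have "\<dots> = g" by (simp add: matrix_inv_eq[OF inv[OF g]])
    finally show "?A ** eta ** transpose ?A = g" .
  qed
qed

section \<open>The frame bundle\<close>

text \<open>Row \<open>k\<close> holds the components of the \<open>k\<close>-th frame vector, in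
  keeping with the coordinates of \<open>frame_atlas\<close>. The right action by \<open>B\<close>
  therefore appears as left multiplication by \<open>transpose B\<close>.\<close>

definition frame_mat :: "('a, 'm rvec) chart \<Rightarrow> ('a, 'm::finite) frame \<Rightarrow> 'm rmat" where
  "frame_mat c u = (\<chi> k. snd u k c)"

definition frame_chart ::
  "('a, 'm rvec) chart set \<Rightarrow> ('a, 'm rvec) chart \<Rightarrow> (('a, 'm::finite) frame, 'm rvec \<times> 'm rmat) chart" where
  "frame_chart M c = ({u \<in> frame_bundle M. fst u \<in> fst c}, \<lambda>u. (snd c (fst u), frame_mat c u))"

definition frame_of ::
  "('a, 'm rvec) chart set \<Rightarrow> ('a, 'm rvec) chart \<Rightarrow> 'a \<Rightarrow> 'm rmat \<Rightarrow> ('a, 'm::finite) frame" where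
  "frame_of M c x e = (x, \<lambda>k. tvec_of M x c (e $ k))"

lemma frame_atlas_eq: "frame_atlas M = frame_chart M ` M"
proof -
  have "(\<lambda>c. ({(x, X) \<in> frame_bundle M. x \<in> fst c}, \<lambda>(x, X). (snd c x, \<chi> k. X k c))) = frame_chart M"
    by (auto simp: frame_chart_def frame_mat_def fun_eq_iff)
  then show ?thesis by (simp only: frame_atlas_def)
qed

lemma tlincomb_chart: "tlincomb (snd u) a c = transpose (frame_mat c u) *v a"
  by (simp add: tlincomb_def frame_mat_def vec_eq_iff matrix_vector_mult_def transpose_def mult.commute)

lemma invertible_ex1:
  fixes E :: "real^'n::finite^'n"
  shows "invertible E \<longleftrightarrow> (\<forall>w. \<exists>!a. w = E *v a)"
  unfolding invertible_eq_bij bij_iff by metis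

lemma frame_bundle_iff:
  assumes M: "smooth_atlas M" and c: "c \<in> charts_at M (fst u)" and u: "\<And>k. snd u k \<in> tangent_space M (fst u)"
  shows "u \<in> frame_bundle M \<longleftrightarrow> invertible (frame_mat c u)"
proof -
  have x: "fst u \<in> \<Union> (fst ` M)" using c unfolding charts_at_iff by blast
  have "v = tlincomb (snd u) a \<longleftrightarrow> v c = transpose (frame_mat c u) *v a" if "v \<in> tangent_space M (fst u)" for v a
    by (auto simp: tlincomb_chart intro: tangent_space_eqI[OF that tlincomb_tangent[OF M u x] c])
  moreover have all: "(\<forall>v\<in>tangent_space M (fst u). P (v c)) \<longleftrightarrow> (\<forall>w. P w)" for P
  proof (intro iffI allI ballI)
    fix w assume "\<forall>v\<in>tangent_space M (fst u). P (v c)"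
    from bspec[OF this tvec_of_tangent(1)[OF M c, of w]] show "P w" by (simp add: tvec_of_tangent(2)[OF M c])
  qed auto
  ultimately have "u \<in> frame_bundle M \<longleftrightarrow>
      (\<forall>v\<in>tangent_space M (fst u). \<exists>!a. v c = transpose (frame_mat c u) *v a)"
    using x u by (cases u) (simp add: frame_bundle_def)
  also have "\<dots> \<longleftrightarrow> (\<forall>w. \<exists>!a. w = transpose (frame_mat c u) *v a)"
    by (rule all)
  also have "\<dots> \<longleftrightarrow> invertible (frame_mat c u)"
    by (simp only: invertible_ex1[symmetric] invertible_det_nz det_transpose)
  finally show ?thesis .
qed

lemma frame_bundleD:
  assumes "u \<in> frame_bundle M"
  shows "fst u \<in> \<Union> (fst ` M)" "snd u k \<in> tangent_space M (fst u)"
proof -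
  note h = assms[unfolded frame_bundle_def case_prod_unfold mem_Collect_eq]
  show "fst u \<in> \<Union> (fst ` M)" by (rule conjunct1[OF h])
  show "snd u k \<in> tangent_space M (fst u)" by (rule spec[OF conjunct1[OF conjunct2[OF h]]])
qed

lemma frame_mat_invertible:
  "smooth_atlas M \<Longrightarrow> c \<in> charts_at M (fst u) \<Longrightarrow> u \<in> frame_bundle M \<Longrightarrow> invertible (frame_mat c u)"
  using frame_bundle_iff[of M c u] frame_bundleD(2)[of u M] by blast

lemma frame_of_frame:
  assumes M: "smooth_atlas M" and c: "c \<in> charts_at M x"
  shows "fst (frame_of M c x e) = x" "frame_mat c (frame_of M c x e) = e"
    "invertible e \<Longrightarrow> frame_of M c x e \<in> frame_bundle M"
proof -
  show 1: "fst (frame_of M c x e) = x" "frame_mat c (frame_of M c x e) = e"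
    using tvec_of_tangent[OF M c] by (simp_all add: frame_of_def frame_mat_def vec_eq_iff)
  show "invertible e \<Longrightarrow> frame_of M c x e \<in> frame_bundle M"
    using frame_bundle_iff[OF M, of c "frame_of M c x e"] 1 c tvec_of_tangent[OF M c]
    by (simp add: frame_of_def)
qed

lemma frame_eqI:
  assumes "u \<in> frame_bundle M" "u' \<in> frame_bundle M" "fst u = fst u'" "c \<in> charts_at M (fst u)"
    "frame_mat c u = frame_mat c u'"
  shows "u = u'"
proof -
  have "snd u k = snd u' k" for k
    using assms frame_bundleD(2)[of u M] frame_bundleD(2)[of u' M] tangent_space_eqI[of "snd u k" M "fst u" "snd u' k" c]
    by (simp add: frame_mat_def vec_eq_iff)
  then show ?thesis using assms(3) by (simp add: prod_eq_iff fun_eq_iff)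
qed

definition chart_jacobian ::
  "('a, ('m::finite) rvec) chart \<Rightarrow> ('a, 'm rvec) chart \<Rightarrow> 'm rvec \<Rightarrow> 'm rmat" where
  "chart_jacobian c d y = matrix (frechet_derivative (\<lambda>y. snd d (cinv c y)) (at y))"

lemma jacobian_mult:
  assumes "smooth_atlas M" "c \<in> charts_at M x" "d \<in> charts_at M x"
  shows "chart_jacobian c d (snd c x) *v w = frechet_derivative (snd d \<circ> cinv c) (at (snd c x)) w"
  using fun_cong[OF matrix_vector_mul(2)[OF linear_transition[OF assms]], of w]
  by (simp add: chart_jacobian_def o_def)

lemma smooth_jacobian:
  assumes "smooth_atlas M" "c \<in> M" "d \<in> M"
  shows "smooth_on (snd c ` (fst c \<inter> fst d)) (chart_jacobian c d)"
  unfolding chart_jacobian_def matrix_def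
  by (intro smooth_intros open_overlap[OF assms] smooth_transition[OF assms])

lemma frame_mat_transition:
  assumes M: "smooth_atlas M" and c: "c \<in> charts_at M (fst u)" and d: "d \<in> charts_at M (fst u)" and u: "u \<in> frame_bundle M"
  shows "frame_mat d u = frame_mat c u ** transpose (chart_jacobian c d (snd c (fst u)))"
proof -
  have "snd u k d = chart_jacobian c d (snd c (fst u)) *v snd u k c" for k
    using tangent_space_transition[OF frame_bundleD(2)[OF u] c d] jacobian_mult[OF M c d] by simp
  then show ?thesis
    by (simp add: frame_mat_def vec_eq_iff matrix_vector_mult_def matrix_matrix_mult_def transpose_def mult.commute)
qed

lemma frame_chart_inj:
  assumes M: "smooth_atlas M" and c: "c \<in> M"
  shows "inj_on (snd (frame_chart M c)) (fst (frame_chart M c))"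
proof (rule inj_onI)
  fix u u' assume u: "u \<in> fst (frame_chart M c)" "u' \<in> fst (frame_chart M c)"
    "snd (frame_chart M c) u = snd (frame_chart M c) u'"
  have "fst u = fst u'" using u M c by (auto simp: frame_chart_def smooth_atlas_def inj_on_def)
  then show "u = u'"
    using u c by (intro frame_eqI[of u M u' c]) (auto simp: frame_chart_def charts_at_iff)
qed

lemma frame_chart_overlap:
  assumes M: "smooth_atlas M" and c: "c \<in> M" and d: "d \<in> M"
  shows "snd (frame_chart M c) ` (fst (frame_chart M c) \<inter> fst (frame_chart M d)) =
    (snd c ` (fst c \<inter> fst d)) \<times> {e. invertible e}"
proof (intro equalityI subsetI)
  fix z assume "z \<in> snd (frame_chart M c) ` (fst (frame_chart M c) \<inter> fst (frame_chart M d))"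
  then obtain u where u: "u \<in> frame_bundle M" "fst u \<in> fst c" "fst u \<in> fst d" "z = (snd c (fst u), frame_mat c u)"
    unfolding frame_chart_def by auto
  then show "z \<in> (snd c ` (fst c \<inter> fst d)) \<times> {e. invertible e}"
    using frame_mat_invertible[OF M, of c u] c by (simp add: charts_at_iff)
next
  fix z :: "'b rvec \<times> 'b rmat"
  assume "z \<in> (snd c ` (fst c \<inter> fst d)) \<times> {e. invertible e}"
  then obtain x e where z: "z = (snd c x, e)" "x \<in> fst c" "x \<in> fst d" "invertible e" by auto
  have "c \<in> charts_at M x" using z c by (simp add: charts_at_iff)
  note f = frame_of_frame[OF M this, of e]
  show "z \<in> snd (frame_chart M c) ` (fst (frame_chart M c) \<inter> fst (frame_chart M d))"
    using f z by (intro image_eqI[of _ _ "frame_of M c x e"]) (auto simp: frame_chart_def)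
qed

lemma smooth_frame_atlas:
  assumes M: "smooth_atlas M"
  shows "smooth_atlas (frame_atlas M)"
  unfolding smooth_atlas_def
proof (intro conjI ballI)
  fix k assume "k \<in> frame_atlas M"
  then show "inj_on (snd k) (fst k)" unfolding frame_atlas_eq using frame_chart_inj[OF M] by blast
next
  fix k k' assume "k \<in> frame_atlas M" "k' \<in> frame_atlas M"
  then obtain c d where c: "c \<in> M" "k = frame_chart M c" and d: "d \<in> M" "k' = frame_chart M d"
    unfolding frame_atlas_eq by blast
  let ?S = "(snd c ` (fst c \<inter> fst d)) \<times> {e :: 'b rmat. invertible e}"
  have S: "snd k ` (fst k \<inter> fst k') = ?S" using frame_chart_overlap[OF M c(1) d(1)] c d by simp
  have oS: "open ?S" by (intro open_Times open_overlap[OF M] c d open_invertible)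
  define T where "T z = (snd d (cinv c (fst z)), snd z ** transpose (chart_jacobian c d (fst z)))" for z :: "'b rvec \<times> 'b rmat"
  have f: "smooth_on ?S (\<lambda>z. fst z)" "smooth_on ?S (\<lambda>z. snd z)" by (intro smooth_intros smooth_on_id oS)+
  have "smooth_on ?S (\<lambda>z. snd d (cinv c (fst z)))"
    by (rule smooth_on_compose[OF smooth_transition[OF M c(1) d(1)] open_overlap[OF M c(1) d(1)] f(1) oS]) auto
  moreover have "smooth_on ?S (\<lambda>z. chart_jacobian c d (fst z))"
    by (rule smooth_on_compose[OF smooth_jacobian[OF M c(1) d(1)] open_overlap[OF M c(1) d(1)] f(1) oS]) auto
  ultimately have sT: "smooth_on ?S T" unfolding T_def by (intro smooth_intros oS f)
  have eq: "T z = (snd k' \<circ> cinv k) z" if "z \<in> ?S" for z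
  proof -
    from that have "z \<in> snd k ` (fst k \<inter> fst k')" by (simp only: S)
    then obtain u where u: "u \<in> fst k" "u \<in> fst k'" "z = snd k u" by blast
    have "cinv k z = u" using frame_chart_inj[OF M c(1)] u c by simp
    then show ?thesis
      using u c d frame_mat_transition[OF M, of c u d] cinv_chart[OF M c(1)]
      by (simp add: T_def frame_chart_def charts_at_iff)
  qed
  show "open (snd k ` (fst k \<inter> fst k'))" using oS by (simp only: S)
  show "smooth_on (snd k ` (fst k \<inter> fst k')) (snd k' \<circ> cinv k)"
    unfolding S by (rule smooth_on_cong[OF sT oS eq])
qed

lemma frame_carrier: "\<Union> (fst ` frame_atlas M) = frame_bundle M"
  using frame_bundleD(1) by (fastforce simp: frame_atlas_eq frame_chart_def)

lemma frame_chart_adapted: "adapted (frame_atlas M) fst c (frame_chart M c)"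
  by (auto simp: adapted_def frame_carrier frame_chart_def)

text \<open>The coordinate change is the identity on the overlap, so its Jacobian is trivial. This
  handles adapted charts that come from another base chart.\<close>

lemma tangent_chart_agree:
  assumes M: "smooth_atlas M" and c: "c \<in> charts_at M x" "c0 \<in> charts_at M x"
    and agree: "\<And>p. p \<in> fst c \<Longrightarrow> p \<in> fst c0 \<Longrightarrow> snd c0 p = snd c p" and v: "v \<in> tangent_space M x"
  shows "v c0 = v c"
proof -
  have cM: "c \<in> M" "c0 \<in> M" "x \<in> fst c" "x \<in> fst c0" using c by (auto simp: charts_at_iff)
  have "frechet_derivative (snd c0 \<circ> cinv c) (at (snd c x)) = frechet_derivative (snd c \<circ> cinv c) (at (snd c x))"
    by (rule frechet_derivative_cong_open[OF open_overlap[OF M cM(1,2)]]) (use cM agree cinv_chart[OF M cM(1)] in auto)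
  then show ?thesis using tangent_space_transition[OF v c] transition_self[OF M c(1)] by simp
qed

lemma frame_fibred:
  assumes M: "smooth_atlas M"
  shows "fibred_manifold M (frame_atlas M) fst"
proof
  show "\<exists>d\<in>frame_atlas M. adapted (frame_atlas M) fst c d" if "c \<in> M" for c
    using that frame_chart_adapted[of M c] by (intro bexI[of _ "frame_chart M c"]) (simp_all add: frame_atlas_eq)
  show "fst ` \<Union> (fst ` frame_atlas M) \<subseteq> \<Union> (fst ` M)"
    unfolding frame_carrier by (rule image_subsetI) (rule frame_bundleD(1))
qed (use M smooth_frame_atlas in auto)

text \<open>A chart of \<open>LM\<close> adapted to \<open>c\<close> may stem from a chart other than \<open>c\<close>, which then agrees with \<open>c\<close>.\<close>
lemma frame_adapted_coordinates:
  assumes M: "smooth_atlas M" and c: "c \<in> M" and d: "d \<in> frame_atlas M" "adapted (frame_atlas M) fst c d" and u: "u \<in> fst d"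
  shows "snd d u = (snd c (fst u), frame_mat c u)"
proof -
  obtain c0 where c0: "c0 \<in> M" "d = frame_chart M c0" using d unfolding frame_atlas_eq by blast
  have uc: "u \<in> frame_bundle M" "fst u \<in> fst c" "fst u \<in> fst c0"
    using u d(2) c0(2) by (auto simp: adapted_def frame_carrier frame_chart_def)
  have agree: "snd c0 p = snd c p" if p: "p \<in> fst c" "p \<in> fst c0" for p
  proof -
    have cp: "c \<in> charts_at M p" using c p by (simp add: charts_at_iff)
    \<comment> \<open>Adaptedness speaks about points of the total space only. To compare the base
      coordinates at \<open>p\<close>, some frame over \<open>p\<close> is needed; the coordinate
      frame serves.\<close>
    have fd: "frame_of M c p (mat 1) \<in> fst d"
      using frame_of_frame[OF M cp, of "mat 1"] p c0(2) by (simp add: frame_chart_def invertible_mat_1)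
    show ?thesis
      using bspec[OF conjunct2[OF d(2)[unfolded adapted_def]] fd] frame_of_frame(1)[OF M cp, of "mat 1"]
      by (simp add: c0(2) frame_chart_def)
  qed
  have ca: "c \<in> charts_at M (fst u)" "c0 \<in> charts_at M (fst u)" using c c0 uc by (auto simp: charts_at_iff)
  have "frame_mat c0 u = frame_mat c u"
    using tangent_chart_agree[OF M ca agree frame_bundleD(2)[OF uc(1)]] by (simp add: frame_mat_def)
  then show ?thesis using agree uc c0(2) by (simp add: frame_chart_def)
qed

section \<open>The action of the general linear group on frames\<close>

lemma frame_act_mat: "frame_mat c (frame_act u B) = transpose B ** frame_mat c u"
  by (simp add: frame_mat_def frame_act_def vec_eq_iff matrix_matrix_mult_def transpose_def)

lemma fst_frame_act [simp]: "fst (frame_act u B) = fst u"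
  by (simp add: frame_act_def)

lemma frame_act_tangent:
  assumes "smooth_atlas M" "u \<in> frame_bundle M"
  shows "snd (frame_act u B) k \<in> tangent_space M (fst u)"
  unfolding frame_act_def snd_conv
  by (rule tangent_space_lincomb[OF assms(1) frame_bundleD(2)[OF assms(2)] frame_bundleD(1)[OF assms(2)]])

lemma frame_act_bundle_iff:
  assumes M: "smooth_atlas M" and u: "u \<in> frame_bundle M"
  shows "frame_act u B \<in> frame_bundle M \<longleftrightarrow> invertible B"
proof -
  obtain c where c: "c \<in> charts_at M (fst u)"
    using frame_bundleD(1)[OF u] unfolding charts_at_iff by blast
  have "frame_act u B \<in> frame_bundle M \<longleftrightarrow> invertible (transpose B ** frame_mat c u)"
    using frame_bundle_iff[OF M, of c "frame_act u B"] c frame_act_tangent[OF M u] by (simp add: frame_act_mat)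
  also have "\<dots> \<longleftrightarrow> invertible B"
    using frame_mat_invertible[OF M c u] by (simp add: invertible_det_nz det_mul det_transpose)
  finally show ?thesis .
qed

text \<open>The action multiplies the matrix of the frame on the left by \<open>transpose B\<close>,
  so the equation to be solved is \<open>transpose B ** e = e'\<close> with invertible
  \<open>e\<close>.\<close>

lemma frame_act_transitive:
  assumes M: "smooth_atlas M" and u: "u \<in> frame_bundle M" "u' \<in> frame_bundle M" "fst u = fst u'"
    and c: "c \<in> charts_at M (fst u)"
  shows "u' = frame_act u (transpose (frame_mat c u' ** matrix_inv (frame_mat c u)))"
proof (rule frame_eqI[OF u(2) _ _ _])
  let ?B = "transpose (frame_mat c u' ** matrix_inv (frame_mat c u))"
  have i: "invertible (frame_mat c u)" "invertible (frame_mat c u')"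
    using frame_mat_invertible[OF M] u c by auto
  have "invertible (matrix_inv (frame_mat c u))"
    using matrix_inv_eq[OF i(1)] unfolding invertible_def by blast
  with i have "invertible ?B" by (simp add: invertible_det_nz det_mul det_transpose)
  then show "frame_act u ?B \<in> frame_bundle M" using frame_act_bundle_iff[OF M u(1)] by simp
  show "frame_mat c u' = frame_mat c (frame_act u ?B)"
    by (simp add: frame_act_mat transpose_transpose matrix_inv_eq[OF i(1)] flip: matrix_mul_assoc)
  show "fst u' = fst (frame_act u ?B)" "c \<in> charts_at M (fst u')" using u c by auto
qed

lemma frame_act_act: "frame_act (frame_act u A) B = frame_act u (A ** B)"
  by (simp add: frame_act_def matrix_matrix_mult_def fun_eq_iff scaleR_sum_right scaleR_sum_left mult.commute)
     (intro allI sum.swap)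

lemma frame_act_1: "frame_act u (mat 1) = u"
  by (cases u) (simp add: frame_act_def mat_def fun_eq_iff if_distrib[where f="\<lambda>a. a *\<^sub>R _"] cong: if_cong)

section \<open>The bundle of metrics\<close>

lemma bounded_bilinear_matrix_mult:
  "bounded_bilinear ((**) :: real^'n::finite^'m::finite \<Rightarrow> real^'k::finite^'n \<Rightarrow> real^'k^'m)"
  unfolding bilinear_conv_bounded_bilinear[symmetric] bilinear_def
  by (auto intro!: linearI simp: vec_eq_iff matrix_matrix_mult_def algebra_simps sum.distrib sum_distrib_left)

lemma bounded_linear_transpose: "bounded_linear (transpose :: real^'n::finite^'m::finite \<Rightarrow> real^'m^'n)"
  unfolding linear_conv_bounded_linear[symmetric]
  by (auto intro!: linearI simp: vec_eq_iff transpose_def)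

text \<open>Both conditions say that \<open>eta ** transpose A ** eta\<close> is an inverse of
  \<open>A\<close>, once from the left and once from the right. The second form is the one that fits
  the contravariant metric of a frame.\<close>

lemma K_group_iff: "A \<in> K_group \<longleftrightarrow> A ** eta ** transpose A = (eta :: ('m::{finite,linorder}) rmat)"
proof -
  have 1: "(eta ** transpose A ** eta) ** A = mat 1 \<longleftrightarrow> transpose A ** eta ** A = eta"
  proof
    assume "(eta ** transpose A ** eta) ** A = mat 1"
    then have "eta ** ((eta ** transpose A ** eta) ** A) = eta" by simp
    then show "transpose A ** eta ** A = eta" by (simp add: matrix_mul_assoc eta_eta)
  next
    assume "transpose A ** eta ** A = eta"
    then have "eta ** (transpose A ** eta ** A) = eta ** eta" by simp
    then show "(eta ** transpose A ** eta) ** A = mat 1" by (simp add: matrix_mul_assoc eta_eta)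
  qed
  have 2: "A ** (eta ** transpose A ** eta) = mat 1 \<longleftrightarrow> A ** eta ** transpose A = eta"
  proof
    assume "A ** (eta ** transpose A ** eta) = mat 1"
    then have "A ** (eta ** transpose A ** eta) ** eta = eta" by simp
    moreover have "A ** (eta ** transpose A ** eta) ** eta = A ** eta ** transpose A ** (eta ** eta)"
      by (simp only: matrix_mul_assoc)
    ultimately show "A ** eta ** transpose A = eta" by (simp add: eta_eta)
  next
    assume "A ** eta ** transpose A = eta"
    then have "A ** eta ** transpose A ** eta = eta ** eta" by simp
    then show "A ** (eta ** transpose A ** eta) = mat 1" by (simp add: matrix_mul_assoc eta_eta)
  qed
  have "invertible A" if "A ** (eta ** transpose A ** eta) = mat 1"
    using that unfolding invertible_right_inverse by blast
  then show ?thesis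
    unfolding K_group_def using 1 2 matrix_left_right_inverse[of A "eta ** transpose A ** eta"] by auto
qed

lemma K_group_invertible: "A \<in> K_group \<Longrightarrow> invertible A"
  by (simp add: K_group_def)

lemma mat_1_K: "mat 1 \<in> K_group"
  by (simp add: K_group_iff)

lemma K_group_mult:
  assumes "A \<in> K_group" "B \<in> K_group"
  shows "A ** B \<in> K_group"
proof -
  have "(A ** B) ** eta ** transpose (A ** B) = A ** (B ** eta ** transpose B) ** transpose A"
    by (simp add: matrix_mul_assoc matrix_transpose_mul)
  then show ?thesis using assms by (simp add: K_group_iff)
qed

lemma K_group_inverse:
  assumes A: "A \<in> K_group"
  shows "matrix_inv A \<in> K_group"
proof -
  let ?B = "matrix_inv A"
  have i: "?B ** A = mat 1" using matrix_inv_eq(2)[OF K_group_invertible[OF A]] .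
  have "?B ** eta ** transpose ?B = ?B ** (A ** eta ** transpose A) ** transpose ?B"
    using A by (simp add: K_group_iff)
  also have "\<dots> = (?B ** A) ** eta ** transpose (?B ** A)"
    by (simp add: matrix_mul_assoc matrix_transpose_mul)
  finally show ?thesis by (simp add: i K_group_iff)
qed

lemma proj_K_act:
  fixes B :: "('m::{finite,linorder}) rmat"
  assumes "B \<in> K_group"
  shows "proj_K (frame_act u B) = proj_K u"
proof -
  have *: "B ** (matrix_inv B ** A) = A" for A :: "'m rmat"
    using matrix_inv_eq(1)[OF K_group_invertible[OF assms]] by (simp add: matrix_mul_assoc)
  have "(\<lambda>A. B ** A) ` K_group = K_group"
  proof (intro equalityI subsetI)
    fix A :: "'m rmat" assume "A \<in> K_group"
    then show "A \<in> (\<lambda>A. B ** A) ` K_group"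
      by (intro image_eqI[of _ _ "matrix_inv B ** A"]) (simp_all add: * K_group_mult K_group_inverse assms)
  qed (use K_group_mult[OF assms] in blast)
  moreover have "frame_act (frame_act u B) = (\<lambda>A. frame_act u (B ** A))" by (simp add: fun_eq_iff frame_act_act del: split_paired_All)
  ultimately show ?thesis unfolding proj_K_def by (metis image_image)
qed

text \<open>The contravariant metric
  \<open>\<eta>\<^sup>i\<^sup>j X\<^sub>i \<otimes> X\<^sub>j\<close> of a frame in coordinates;
  \<open>e\<close> has the frame vectors as rows.\<close>

definition metric_mat :: "('m::{finite,linorder}) rmat \<Rightarrow> 'm rmat" where
  "metric_mat e = transpose e ** eta ** e"

lemma transpose_metric_mat: "transpose (metric_mat e) = metric_mat e"
  by (simp add: metric_mat_def matrix_transpose_mul transpose_eta matrix_mul_assoc)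

lemma metric_mat_mult: "metric_mat (B ** e) = transpose e ** (transpose B ** eta ** B) ** e"
  by (simp add: metric_mat_def matrix_transpose_mul matrix_mul_assoc)

lemma metric_mat_act_K: "A \<in> K_group \<Longrightarrow> metric_mat (frame_mat c (frame_act u A)) = metric_mat (frame_mat c u)"
  unfolding frame_act_mat metric_mat_mult by (simp add: transpose_transpose K_group_iff metric_mat_def)

lemma tau_Sigma_proj: "tau_Sigma (proj_K u) = fst u"
  unfolding tau_Sigma_def proj_K_def using mat_1_K by (auto intro!: the_equality)

text \<open>\<open>metric_comp\<close> picks a frame of the orbit by choice. Any pick differs from
  \<open>u\<close> by an element of the group, which preserves the metric.\<close>

lemma metric_comp_proj: "metric_comp c (proj_K u) \<mu> \<nu> = metric_mat (frame_mat c u) $ \<mu> $ \<nu>"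
proof -
  define u' where "u' = (SOME u'. u' \<in> proj_K u)"
  have "u \<in> proj_K u" unfolding proj_K_def using frame_act_1[of u] mat_1_K by (rule image_eqI[OF sym])
  then have "u' \<in> proj_K u" unfolding u'_def by (rule someI)
  then obtain A where A: "A \<in> K_group" "u' = frame_act u A" unfolding proj_K_def by blast
  have "metric_mat e $ \<mu> $ \<nu> = (\<Sum>i\<in>UNIV. \<Sum>j\<in>UNIV. eta $ i $ j * e $ i $ \<mu> * e $ j $ \<nu>)" for e :: "'b rmat"
  proof -
    have "metric_mat e $ \<mu> $ \<nu> = (\<Sum>j\<in>UNIV. \<Sum>i\<in>UNIV. eta $ i $ j * e $ i $ \<mu> * e $ j $ \<nu>)"
      unfolding metric_mat_def matrix_matrix_mult_def transpose_def vec_lambda_beta sum_distrib_right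
      by (intro sum.cong refl) (simp only: mult.commute mult.left_commute)
    then show ?thesis by (subst sum.swap) simp
  qed
  then have "metric_comp c (proj_K u) \<mu> \<nu> = metric_mat (frame_mat c u') $ \<mu> $ \<nu>"
    unfolding metric_comp_def u'_def[symmetric] Let_def by (simp add: frame_mat_def)
  then show ?thesis by (simp add: A metric_mat_act_K)
qed

text \<open>This identifies orbits with metrics. If two frames have equal metrics, the matrix
  \<open>e' ** matrix_inv e\<close> relating them preserves \<eta>, so its transpose lies in the
  group.\<close>

lemma proj_K_eq_iff:
  assumes M: "smooth_atlas M" and u: "u \<in> frame_bundle M" "u' \<in> frame_bundle M" "fst u = fst u'"
    and c: "c \<in> charts_at M (fst u)"
  shows "proj_K u = proj_K u' \<longleftrightarrow> metric_mat (frame_mat c u) = metric_mat (frame_mat c u')"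
proof
  assume "proj_K u = proj_K u'"
  then have "metric_mat (frame_mat c u) $ i $ j = metric_mat (frame_mat c u') $ i $ j" for i j
    by (simp flip: metric_comp_proj)
  then show "metric_mat (frame_mat c u) = metric_mat (frame_mat c u')" by (simp add: vec_eq_iff)
next
  assume eq: "metric_mat (frame_mat c u) = metric_mat (frame_mat c u')"
  let ?e = "frame_mat c u" and ?e' = "frame_mat c u'"
  let ?B = "?e' ** matrix_inv ?e"
  have i: "invertible ?e" using frame_mat_invertible[OF M c u(1)] .
  have "?B ** ?e = ?e'" using matrix_inv_eq[OF i] by (simp flip: matrix_mul_assoc)
  then have "transpose ?e ** (transpose ?B ** eta ** ?B) ** ?e = transpose ?e ** eta ** ?e"
    using eq metric_mat_mult[of ?B ?e] by (simp add: metric_mat_def)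
  then have "transpose (matrix_inv ?e) ** (transpose ?e ** (transpose ?B ** eta ** ?B) ** ?e) ** matrix_inv ?e =
      transpose (matrix_inv ?e) ** (transpose ?e ** eta ** ?e) ** matrix_inv ?e" by simp
  moreover have "transpose (matrix_inv ?e) ** (transpose ?e ** C ** ?e) ** matrix_inv ?e = C" for C
  proof -
    have "transpose (matrix_inv ?e) ** (transpose ?e ** C ** ?e) ** matrix_inv ?e =
        transpose (?e ** matrix_inv ?e) ** C ** (?e ** matrix_inv ?e)"
      by (simp only: matrix_transpose_mul matrix_mul_assoc)
    then show ?thesis using matrix_inv_eq[OF i] by simp
  qed
  ultimately have "transpose ?B ** eta ** ?B = eta" by simp
  then have "transpose ?B \<in> K_group" by (simp add: K_group_iff transpose_transpose)
  then show "proj_K u = proj_K u'"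
    using frame_act_transitive[OF M u c] proj_K_act by metis
qed

text \<open>The fibre coordinates of the metric charts as a linear function of the matrix. On
  symmetric matrices \<open>sym_mat\<close> is the inverse, so calculations can be done with full
  matrices.\<close>

definition sym_vec :: "('m::{finite,linorder}) rmat \<Rightarrow> 'm uprod rvec" where
  "sym_vec g = (\<chi> P. g $ Min (set_uprod P) $ Max (set_uprod P))"

definition sym_mat :: "('m::{finite,linorder}) uprod rvec \<Rightarrow> 'm rmat" where
  "sym_mat w = (\<chi> i j. w $ Upair i j)"

lemma sym_mat_vec:
  assumes "transpose g = g"
  shows "sym_mat (sym_vec g) = g"
proof -
  have "g $ i $ j = g $ j $ i" for i j using assms by (metis transpose_def vec_lambda_beta)
  then show ?thesis by (auto simp: vec_eq_iff sym_mat_def sym_vec_def min_def max_def)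
qed

lemma sym_vec_mat: "sym_vec (sym_mat w) = w"
proof -
  have "w $ Upair (Min (set_uprod P)) (Max (set_uprod P)) = w $ P" for P
    by (cases P) (auto simp: min_def max_def intro!: arg_cong[where f="\<lambda>P. w $ P"])
  then show ?thesis by (simp add: vec_eq_iff sym_mat_def sym_vec_def)
qed

lemma transpose_sym_mat: "transpose (sym_mat w) = sym_mat w"
  by (auto simp: vec_eq_iff sym_mat_def transpose_def intro!: arg_cong[where f="\<lambda>P. w $ P"])

lemma smooth_on_sym_vec [smooth_intros]: "open S \<Longrightarrow> smooth_on S f \<Longrightarrow> smooth_on S (\<lambda>x. sym_vec (f x))"
  unfolding sym_vec_def by (intro smooth_intros)

lemma smooth_on_sym_mat [smooth_intros]: "open S \<Longrightarrow> smooth_on S h \<Longrightarrow> smooth_on S (\<lambda>x. sym_mat (h x))"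
  unfolding sym_mat_def by (rule smooth_on_vec_lambda smooth_on_vec_nth | assumption)+

lemma bounded_linear_sym_vec: "bounded_linear sym_vec"
  unfolding linear_conv_bounded_linear[symmetric] by (rule linearI) (simp_all add: vec_eq_iff sym_vec_def)

lemma smooth_on_metric_mat [smooth_intros]: "open S \<Longrightarrow> smooth_on S f \<Longrightarrow> smooth_on S (\<lambda>x. metric_mat (f x))"
  unfolding metric_mat_def by (intro smooth_intros)

definition sigma_chart ::
  "('a, 'm rvec) chart set \<Rightarrow> ('a, 'm rvec) chart \<Rightarrow> (('a, 'm::{finite,linorder}) frame set, 'm rvec \<times> 'm uprod rvec) chart" where
  "sigma_chart M c = ({S \<in> proj_K ` frame_bundle M. tau_Sigma S \<in> fst c},
           \<lambda>S. (snd c (tau_Sigma S), \<chi> P. metric_comp c S (Min (set_uprod P)) (Max (set_uprod P))))"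

lemma Sigma_atlas_eq: "Sigma_atlas M = sigma_chart M ` M"
  unfolding Sigma_atlas_def sigma_chart_def ..

lemma sigma_chart_dom: "fst (sigma_chart M c) = proj_K ` {u \<in> frame_bundle M. fst u \<in> fst c}"
  by (auto simp: sigma_chart_def tau_Sigma_proj)

lemma sigma_chart_domD: "proj_K u \<in> fst (sigma_chart M c) \<Longrightarrow> fst u \<in> fst c"
  unfolding sigma_chart_def fst_conv mem_Collect_eq tau_Sigma_proj by (rule conjunct2)

lemma sigma_chart_proj: "snd (sigma_chart M c) (proj_K u) = (snd c (fst u), sym_vec (metric_mat (frame_mat c u)))"
  by (simp add: sigma_chart_def tau_Sigma_proj metric_comp_proj sym_vec_def)

lemma sigma_chart_inj:
  assumes M: "smooth_atlas M" and c: "c \<in> M"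
  shows "inj_on (snd (sigma_chart M c)) (fst (sigma_chart M c))"
proof (rule inj_onI)
  fix S S' assume "S \<in> fst (sigma_chart M c)" "S' \<in> fst (sigma_chart M c)"
    and eq: "snd (sigma_chart M c) S = snd (sigma_chart M c) S'"
  then obtain u u' where u: "u \<in> frame_bundle M" "fst u \<in> fst c" "S = proj_K u"
    and u': "u' \<in> frame_bundle M" "fst u' \<in> fst c" "S' = proj_K u'" unfolding sigma_chart_dom by blast
  have e: "snd c (fst u) = snd c (fst u')" "sym_vec (metric_mat (frame_mat c u)) = sym_vec (metric_mat (frame_mat c u'))"
    using eq by (simp_all add: u u' sigma_chart_proj)
  have "fst u = fst u'" using e(1) u u' cinv_chart[OF M c] by metis
  moreover have "metric_mat (frame_mat c u) = metric_mat (frame_mat c u')"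
    using arg_cong[OF e(2), of sym_mat] by (simp add: sym_mat_vec transpose_metric_mat)
  ultimately show "S = S'"
    unfolding u(3) u'(3) using u u' c proj_K_eq_iff[OF M u(1) u'(1), of c] by (simp add: charts_at_iff)
qed

text \<open>Congruence with the inverse of a frame \<open>e0\<close> of the given metric moves that
  metric to \<eta>. Matrices near \<eta> are factorised by \<open>gram_schmidt\<close>, and the
  factor, applied to \<open>e0\<close>, gives a frame for every nearby symmetric matrix.\<close>

lemma open_metrics: "open {w :: ('m::{finite,linorder}) uprod rvec. \<exists>e. invertible e \<and> sym_mat w = metric_mat e}"
proof (subst open_subopen, intro ballI)
  fix w0 :: "'m uprod rvec"
  assume "w0 \<in> {w. \<exists>e. invertible e \<and> sym_mat w = metric_mat e}"
  then obtain e0 where e0: "invertible e0" "sym_mat w0 = metric_mat e0" by auto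
  obtain Q and A :: "'m rmat \<Rightarrow> 'm rmat" where Q: "open Q" "eta \<in> Q" "\<And>g. g \<in> Q \<Longrightarrow> det (A g) > 0"
    "\<And>g. g \<in> Q \<Longrightarrow> transpose g = g \<Longrightarrow> A g ** eta ** transpose (A g) = g"
    by (rule gram_schmidt) blast
  let ?i = "matrix_inv e0"
  define G where "G w = transpose ?i ** sym_mat w ** ?i" for w
  have "smooth_on UNIV G" unfolding G_def by (intro smooth_intros smooth_on_id) auto
  then have oG: "open (G -` Q)" using open_vimage[OF Q(1) smooth_on_imp_continuous_on] by blast
  have undo: "sym_mat w = transpose e0 ** G w ** e0" for w
  proof -
    have "transpose e0 ** G w ** e0 = transpose (?i ** e0) ** sym_mat w ** (?i ** e0)"
      by (simp only: G_def matrix_transpose_mul matrix_mul_assoc)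
    then show ?thesis using matrix_inv_eq[OF e0(1)] by simp
  qed
  have "G w0 = transpose (e0 ** ?i) ** eta ** (e0 ** ?i)"
    by (simp only: G_def e0 metric_mat_def matrix_transpose_mul matrix_mul_assoc)
  then have "G w0 = eta" using matrix_inv_eq[OF e0(1)] by simp
  then have "w0 \<in> G -` Q" using Q(2) by simp
  moreover have "G -` Q \<subseteq> {w. \<exists>e. invertible e \<and> sym_mat w = metric_mat e}"
  proof
    fix w assume w: "w \<in> G -` Q"
    have "transpose (G w) = G w"
      by (simp add: G_def matrix_transpose_mul transpose_transpose transpose_sym_mat matrix_mul_assoc)
    then have "A (G w) ** eta ** transpose (A (G w)) = G w" using Q(4) w by simp
    then have "metric_mat (transpose (A (G w)) ** e0) = sym_mat w"
      unfolding metric_mat_mult by (simp add: transpose_transpose undo)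
    moreover have "invertible (transpose (A (G w)) ** e0)"
      using Q(3)[of "G w"] w e0(1) by (simp add: invertible_det_nz det_mul det_transpose)
    ultimately show "w \<in> {w. \<exists>e. invertible e \<and> sym_mat w = metric_mat e}"
      by (intro CollectI exI[of _ "transpose (A (G w)) ** e0"] conjI) simp_all
  qed
  ultimately show "\<exists>T. open T \<and> w0 \<in> T \<and> T \<subseteq> {w. \<exists>e. invertible e \<and> sym_mat w = metric_mat e}"
    using oG by (intro exI[of _ "G -` Q"] conjI)
qed

lemma sigma_chart_overlap:
  assumes M: "smooth_atlas M" and c: "c \<in> M" and d: "d \<in> M"
  shows "snd (sigma_chart M c) ` (fst (sigma_chart M c) \<inter> fst (sigma_chart M d)) =
    (snd c ` (fst c \<inter> fst d)) \<times> {w :: ('m::{finite,linorder}) uprod rvec. \<exists>e. invertible e \<and> sym_mat w = metric_mat e}"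
proof (intro equalityI subsetI)
  fix z assume "z \<in> snd (sigma_chart M c) ` (fst (sigma_chart M c) \<inter> fst (sigma_chart M d))"
  then obtain S where S: "S \<in> fst (sigma_chart M c)" "S \<in> fst (sigma_chart M d)" "z = snd (sigma_chart M c) S" by blast
  then obtain u where u: "u \<in> frame_bundle M" "fst u \<in> fst c" "S = proj_K u" unfolding sigma_chart_dom by blast
  have "fst u \<in> fst d" using S(2) u(3) sigma_chart_domD by blast
  moreover have "invertible (frame_mat c u)" using frame_mat_invertible[OF M _ u(1)] c u by (simp add: charts_at_iff)
  ultimately show "z \<in> (snd c ` (fst c \<inter> fst d)) \<times> {w. \<exists>e. invertible e \<and> sym_mat w = metric_mat e}"
    unfolding S(3) u(3) sigma_chart_proj using u sym_mat_vec[OF transpose_metric_mat] by blast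
next
  fix z :: "'m rvec \<times> 'm uprod rvec"
  assume "z \<in> (snd c ` (fst c \<inter> fst d)) \<times> {w. \<exists>e. invertible e \<and> sym_mat w = metric_mat e}"
  then obtain x w e where z: "z = (snd c x, w)" "x \<in> fst c" "x \<in> fst d" "invertible e" "sym_mat w = metric_mat e" by auto
  have "c \<in> charts_at M x" using z c by (simp add: charts_at_iff)
  note f = frame_of_frame[OF M this, of e]
  have "w = sym_vec (metric_mat e)" using z(5) sym_vec_mat[of w] by simp
  then have "z = snd (sigma_chart M c) (proj_K (frame_of M c x e))" using z(1) f by (simp add: sigma_chart_proj)
  moreover have "proj_K (frame_of M c x e) \<in> fst (sigma_chart M c) \<inter> fst (sigma_chart M d)"
    unfolding sigma_chart_dom using f z by auto
  ultimately show "z \<in> snd (sigma_chart M c) ` (fst (sigma_chart M c) \<inter> fst (sigma_chart M d))" by blast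
qed

lemma smooth_Sigma_atlas:
  fixes M :: "('a, ('m::{finite,linorder}) rvec) chart set"
  assumes M: "smooth_atlas M"
  shows "smooth_atlas (Sigma_atlas M)"
  unfolding smooth_atlas_def
proof (intro conjI ballI)
  fix k assume "k \<in> Sigma_atlas M"
  then show "inj_on (snd k) (fst k)" unfolding Sigma_atlas_eq using sigma_chart_inj[OF M] by blast
next
  fix k k' assume "k \<in> Sigma_atlas M" "k' \<in> Sigma_atlas M"
  then obtain c d where c: "c \<in> M" "k = sigma_chart M c" and d: "d \<in> M" "k' = sigma_chart M d"
    unfolding Sigma_atlas_eq by blast
  let ?S = "(snd c ` (fst c \<inter> fst d)) \<times> {w :: 'm uprod rvec. \<exists>e. invertible e \<and> sym_mat w = metric_mat e}"
  have S: "snd k ` (fst k \<inter> fst k') = ?S" using sigma_chart_overlap[OF M c(1) d(1)] c d by simp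
  have oS: "open ?S" by (intro open_Times open_overlap[OF M] c d open_metrics)
  \<comment> \<open>The tensor law for contravariant metrics: congruence with the Jacobian of the
    base coordinate change.\<close>
  define T where "T z = (snd d (cinv c (fst z)),
    sym_vec (chart_jacobian c d (fst z) ** sym_mat (snd z) ** transpose (chart_jacobian c d (fst z))))" for z :: "'m rvec \<times> 'm uprod rvec"
  have f: "smooth_on ?S (\<lambda>z. fst z)" "smooth_on ?S (\<lambda>z. snd z)" by (intro smooth_intros smooth_on_id oS)+
  have "smooth_on ?S (\<lambda>z. snd d (cinv c (fst z)))"
    by (rule smooth_on_compose[OF smooth_transition[OF M c(1) d(1)] open_overlap[OF M c(1) d(1)] f(1) oS]) auto
  moreover have "smooth_on ?S (\<lambda>z. chart_jacobian c d (fst z))"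
    by (rule smooth_on_compose[OF smooth_jacobian[OF M c(1) d(1)] open_overlap[OF M c(1) d(1)] f(1) oS]) auto
  ultimately have sT: "smooth_on ?S T" unfolding T_def by (intro smooth_intros oS f)
  have eq: "T z = (snd k' \<circ> cinv k) z" if "z \<in> ?S" for z
  proof -
    from that have "z \<in> snd k ` (fst k \<inter> fst k')" by (simp only: S)
    then obtain P where P: "P \<in> fst k" "P \<in> fst k'" "z = snd k P" by blast
    then obtain u where u: "u \<in> frame_bundle M" "fst u \<in> fst c" "P = proj_K u" unfolding c(2) sigma_chart_dom by blast
    have ud: "fst u \<in> fst d" using P(2) u(3) d(2) sigma_chart_domD by blast
    have "cinv k z = P" using sigma_chart_inj[OF M c(1)] P c by simp
    then have "(snd k' \<circ> cinv k) z = (snd d (fst u), sym_vec (metric_mat (frame_mat d u)))"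
      by (simp add: u d sigma_chart_proj)
    also have "frame_mat d u = frame_mat c u ** transpose (chart_jacobian c d (snd c (fst u)))"
      using c(1) d(1) u ud by (intro frame_mat_transition[OF M]) (simp_all add: charts_at_iff)
    also have "metric_mat \<dots> = chart_jacobian c d (snd c (fst u)) ** metric_mat (frame_mat c u) ** transpose (chart_jacobian c d (snd c (fst u)))"
      by (simp only: metric_mat_def matrix_transpose_mul transpose_transpose matrix_mul_assoc)
    finally show ?thesis
      using P(3) u c cinv_chart[OF M c(1)] by (simp add: T_def sigma_chart_proj sym_mat_vec transpose_metric_mat)
  qed
  show "open (snd k ` (fst k \<inter> fst k'))" using oS by (simp only: S)
  show "smooth_on (snd k ` (fst k \<inter> fst k')) (snd k' \<circ> cinv k)"
    unfolding S by (rule smooth_on_cong[OF sT oS eq])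
qed

lemma Sigma_carrier: "\<Union> (fst ` Sigma_atlas M) = proj_K ` frame_bundle M"
proof (intro equalityI subsetI)
  fix S assume "S \<in> proj_K ` frame_bundle M"
  then obtain u where u: "u \<in> frame_bundle M" "S = proj_K u" by blast
  then obtain c where "c \<in> M" "fst u \<in> fst c" using frame_bundleD(1) by blast
  then have "S \<in> fst (sigma_chart M c)" "c \<in> M" using u by (auto simp: sigma_chart_dom)
  then show "S \<in> \<Union> (fst ` Sigma_atlas M)" unfolding Sigma_atlas_eq by blast
qed (auto simp: Sigma_atlas_eq sigma_chart_dom)

lemma sigma_chart_adapted: "adapted (Sigma_atlas M) tau_Sigma c (sigma_chart M c)"
  unfolding adapted_def Sigma_carrier by (simp add: sigma_chart_def)

lemma Sigma_fibred:
  assumes M: "smooth_atlas M"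
  shows "fibred_manifold M (Sigma_atlas M) tau_Sigma"
proof
  show "\<exists>d\<in>Sigma_atlas M. adapted (Sigma_atlas M) tau_Sigma c d" if "c \<in> M" for c
    using that sigma_chart_adapted[of M c] by (intro bexI[of _ "sigma_chart M c"]) (simp_all add: Sigma_atlas_eq)
  show "tau_Sigma ` \<Union> (fst ` Sigma_atlas M) \<subseteq> \<Union> (fst ` M)"
  proof (rule image_subsetI)
    fix S assume "S \<in> \<Union> (fst ` Sigma_atlas M)"
    then obtain u where "u \<in> frame_bundle M" "S = proj_K u" unfolding Sigma_carrier by blast
    then show "tau_Sigma S \<in> \<Union> (fst ` M)" using frame_bundleD(1) by (simp only: tau_Sigma_proj)
  qed
qed (use M smooth_Sigma_atlas in auto)

lemma sigma_adapted_coordinates: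
  assumes M: "smooth_atlas M" and c: "c \<in> M" and d: "d \<in> Sigma_atlas M" "adapted (Sigma_atlas M) tau_Sigma c d"
    and u: "u \<in> frame_bundle M" "fst u \<in> fst c"
  shows "proj_K u \<in> fst d" "snd d (proj_K u) = (snd c (fst u), sym_vec (metric_mat (frame_mat c u)))"
proof -
  obtain c0 where c0: "c0 \<in> M" "d = sigma_chart M c0" using d unfolding Sigma_atlas_eq by blast
  have dd: "v \<in> frame_bundle M \<Longrightarrow> fst v \<in> fst c \<Longrightarrow> proj_K v \<in> fst d" for v
    using d(2) unfolding adapted_def Sigma_carrier by (simp add: tau_Sigma_proj)
  show pd: "proj_K u \<in> fst d" using dd u by simp
  have dc0: "fst u \<in> fst c0" using pd sigma_chart_domD unfolding c0(2) by blast
  have agree: "snd c0 p = snd c p" if p: "p \<in> fst c" "p \<in> fst c0" for p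
  proof -
    have cp: "c \<in> charts_at M p" using c p by (simp add: charts_at_iff)
    note f = frame_of_frame[OF M cp, of "mat 1"]
    have "proj_K (frame_of M c p (mat 1)) \<in> fst d" using dd f p by (simp add: invertible_mat_1)
    from bspec[OF conjunct2[OF d(2)[unfolded adapted_def]] this] show ?thesis
      by (simp add: c0(2) sigma_chart_proj tau_Sigma_proj f(1))
  qed
  have ca: "c \<in> charts_at M (fst u)" "c0 \<in> charts_at M (fst u)" using c c0 u dc0 by (auto simp: charts_at_iff)
  have "frame_mat c0 u = frame_mat c u"
    using tangent_chart_agree[OF M ca agree frame_bundleD(2)[OF u(1)]] by (simp add: frame_mat_def)
  then show "snd d (proj_K u) = (snd c (fst u), sym_vec (metric_mat (frame_mat c u)))"
    using agree u dc0 by (simp add: c0(2) sigma_chart_proj)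
qed

text \<open>The differential of \<open>metric_mat\<close> at \<open>e\<close> in direction
  \<open>h\<close>. It is the bridge between the constraint and \<open>F_omega\<close>: it computes
  the derivative coordinates of \<open>F_omega\<close>, and its kernel consists of the directions
  without \<pp>-part.\<close>

definition dmetric :: "('m::{finite,linorder}) rmat \<Rightarrow> 'm rmat \<Rightarrow> 'm rmat" where
  "dmetric e h = transpose e ** eta ** h + transpose h ** eta ** e"

lemma transpose_add: "transpose (A + B) = transpose A + transpose B"
  by (simp add: vec_eq_iff transpose_def)

lemma transpose_dmetric: "transpose (dmetric e h) = dmetric e h"
  by (simp add: dmetric_def transpose_add matrix_transpose_mul transpose_eta transpose_transpose matrix_mul_assoc add.commute)

lemma metric_mat_has_derivative:
  assumes "(E has_derivative E') (at y)"
  shows "((\<lambda>y. metric_mat (E y)) has_derivative (\<lambda>v. dmetric (E y) (E' v))) (at y)"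
proof -
  have t: "((\<lambda>y. transpose (E y)) has_derivative (\<lambda>v. transpose (E' v))) (at y)"
    by (rule bounded_linear.has_derivative[OF bounded_linear_transpose assms])
  have "((\<lambda>y. transpose (E y) ** eta) has_derivative (\<lambda>v. transpose (E' v) ** eta)) (at y)"
    by (rule bounded_linear.has_derivative[OF bounded_bilinear.bounded_linear_left[OF bounded_bilinear_matrix_mult] t])
  from bounded_bilinear.FDERIV[OF bounded_bilinear_matrix_mult this assms] show ?thesis
    by (simp add: metric_mat_def dmetric_def)
qed

locale frame_geometry =
  fixes M :: "('a, ('m::{finite,linorder}) rvec) chart set"
  assumes M: "smooth_atlas M"
begin

sublocale frame: fibred_manifold M "frame_atlas M" fst by (rule frame_fibred[OF M])
sublocale sigma: fibred_manifold M "Sigma_atlas M" tau_Sigma by (rule Sigma_fibred[OF M])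

abbreviation "LM \<equiv> frame_atlas M"
abbreviation "SM \<equiv> Sigma_atlas M"
abbreviation "top_M \<equiv> manifold_topology M"
abbreviation "frame_section \<equiv> section_on M LM fst"
abbreviation "frame_jets \<equiv> jets M LM fst"

lemma smooth_J1_frame: "smooth_atlas (J1_frame M)"
  unfolding J1_frame_def by (rule frame.smooth_jet_atlas)

lemma smooth_J1_Sigma: "smooth_atlas (J1_Sigma M)"
  unfolding J1_Sigma_def by (rule sigma.smooth_jet_atlas)

section \<open>The projection to metrics and the map \<open>F_omega\<close> in coordinates\<close>

lemma smooth_proj_K: "smooth_map_on LM SM (frame_bundle M) proj_K"
proof -
  have "smooth_map_on LM SM (\<Union> (fst ` LM)) proj_K"
  proof (rule smooth_map_on_Union)
    fix W assume "W \<in> fst ` LM"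
    then obtain c where c: "c \<in> M" and W: "W = fst (frame_chart M c)" unfolding frame_atlas_eq by blast
    have cF: "frame_chart M c \<in> LM" "sigma_chart M c \<in> SM"
      using c by (simp_all add: frame_atlas_eq Sigma_atlas_eq)
    have o: "open (snd (frame_chart M c) ` fst (frame_chart M c))" by (rule open_chart_image[OF frame.B cF(1)])
    have sm: "smooth_on (snd (frame_chart M c) ` fst (frame_chart M c)) (\<lambda>z. (fst z, sym_vec (metric_mat (snd z))))"
      by (intro smooth_intros smooth_on_id o)
    show "smooth_map_on LM SM W proj_K" unfolding W
    proof (rule smooth_map_on_chart[OF frame.B cF])
      show "proj_K ` fst (frame_chart M c) \<subseteq> fst (sigma_chart M c)"
        unfolding sigma_chart_dom by (simp add: frame_chart_def)
      show "smooth_on (snd (frame_chart M c) ` fst (frame_chart M c)) (\<lambda>z. snd (sigma_chart M c) (proj_K (cinv (frame_chart M c) z)))"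
        by (rule smooth_on_cong[OF sm o])
           (auto simp: cinv_chart[OF frame.B cF(1)] sigma_chart_proj, auto simp: frame_chart_def)
    qed
  qed
  then show ?thesis by (simp only: frame_carrier)
qed

lemma section_frame: "frame_section W s \<Longrightarrow> x \<in> W \<Longrightarrow> s x \<in> frame_bundle M"
  unfolding section_on_def smooth_map_on_def charts_at_def frame_carrier[of M, symmetric] by blast

lemma section_proj_K:
  assumes s: "frame_section W s"
  shows "section_on M SM tau_Sigma W (proj_K \<circ> s)"
proof -
  have "smooth_map_on M SM W (\<lambda>x. proj_K (s x))"
    by (rule smooth_map_on_compose[OF M frame.B sigma.B _ smooth_proj_K])
       (use s section_frame[OF s] in \<open>auto simp: section_on_def\<close>)
  then show ?thesis using s by (simp add: section_on_def o_def tau_Sigma_proj)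
qed

lemma tmap_zero:
  assumes "smooth_atlas A" "smooth_atlas B" "smooth_map_on A B W f" "p \<in> W"
  shows "tmap A B f p (\<lambda>_. 0) = (\<lambda>_. 0)"
proof
  fix e
  show "tmap A B f p (\<lambda>_. 0) e = 0"
  proof (cases "e \<in> charts_at B (f p)")
    case True
    obtain c where c: "c \<in> charts_at A p" using assms(3,4) unfolding smooth_map_on_def by blast
    show ?thesis
      using tmap_chart[OF assms zero_tangent[OF assms(1)] c True]
        linear_0[OF has_derivative_linear[OF smooth_map_has_derivative[OF assms c True]]] by simp
  qed (simp add: tmap_not_chart)
qed

text \<open>The chain rule as an equality of functions, as stored in jets. Outside the tangent space
  the inner map gives the zero family, which the outer tangent map sends to zero.\<close>

lemma tmap_proj_K_section:
  assumes W: "x \<in> W" and s: "frame_section W s"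
  shows "tmap M SM (proj_K \<circ> s) x = (\<lambda>v. tmap LM SM proj_K (s x) (tmap M LM s x v))"
proof
  fix v
  have sm: "smooth_map_on M LM W s" using s by (simp add: section_on_def)
  show "tmap M SM (proj_K \<circ> s) x v = tmap LM SM proj_K (s x) (tmap M LM s x v)"
  proof (cases "v \<in> tangent_space M x")
    case True
    have sub: "s ` W \<subseteq> frame_bundle M" using section_frame[OF s] by blast
    show ?thesis
      using tmap_comp[OF M frame.B sigma.B sm smooth_proj_K sub W True] by (simp add: o_def)
  next
    case False
    then show ?thesis
      using tmap_zero[OF frame.B sigma.B smooth_proj_K section_frame[OF s W]] by (simp add: tmap_outside)
  qed
qed

text \<open>The definite description in \<open>F_omega\<close> denotes because the jet of
  \<open>proj_K \<circ> s\<close> depends on \<open>s\<close> only through its value and tangent map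
  at \<open>x\<close>.\<close>

lemma F_omega_jet1:
  assumes W: "openin top_M W" "x \<in> W" and s: "frame_section W s"
  shows "F_omega M (jet1 M LM s x) = jet1 M SM (proj_K \<circ> s) x"
proof -
  have t: "tau1 (jet1 M LM s x) = x" by (simp add: jet1_def tau1_def)
  have "s \<in> local_sections_at M LM fst x" using assms by (auto simp: local_sections_at_def)
  moreover have "jet1 M SM (proj_K \<circ> s') x = jet1 M SM (proj_K \<circ> s) x"
    if "s' \<in> local_sections_at M LM fst x" "jet1 M LM s x = jet1 M LM s' x" for s'
  proof -
    from that obtain W' where W': "x \<in> W'" "frame_section W' s'" by (auto simp: local_sections_at_def)
    show ?thesis using that(2) tmap_proj_K_section[OF W(2) s] tmap_proj_K_section[OF W'] by (simp add: jet1_def)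
  qed
  ultimately show ?thesis unfolding F_omega_def t by (intro the_equality) (blast, metis)
qed

lemma frame_jet_chart:
  assumes W: "openin top_M W" "x \<in> W" and s: "frame_section W s"
    and c: "c \<in> M" "x \<in> fst c" and d: "d \<in> LM" "adapted LM fst c d"
  shows "((\<lambda>y. frame_mat c (s (cinv c y))) has_derivative
      (\<lambda>w. \<Sum>\<sigma>\<in>UNIV. w $ \<sigma> *\<^sub>R snd (snd (snd (frame.jchart c d) (jet1 M LM s x))) $ \<sigma>)) (at (snd c x))"
    "snd (frame.jchart c d) (jet1 M LM s x) =
      (snd c x, frame_mat c (s x), snd (snd (snd (frame.jchart c d) (jet1 M LM s x))))"
proof -
  let ?J = "frame.jchart c d"
  let ?D = "frechet_derivative (snd d \<circ> s \<circ> cinv c) (at (snd c x))"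
  note S = frame.section_coordinates[OF W s c d]
  have sm: "smooth_map_on M LM W s" using s by (simp add: section_on_def)
  have cc: "c \<in> charts_at M x" "d \<in> charts_at LM (s x)" using c d S(1) by (auto simp: charts_at_iff)
  have co: "snd d (s p) = (snd c p, frame_mat c (s p))" if "p \<in> W" "p \<in> fst c" for p
    using frame_adapted_coordinates[OF M c(1) d frame.section_coordinates(1)[OF W(1) that(1) s c(1) that(2) d]]
      frame.section_coordinates(2)[OF W(1) that(1) s c(1) that(2) d] by simp
  have J: "snd ?J (jet1 M LM s x) = (snd c x, snd (snd d (s x)), \<chi> \<sigma>. snd (?D (axis \<sigma> 1)))"
    by (rule frame.jet_chart_jet1(2)[OF W s c d])
  then show "snd ?J (jet1 M LM s x) = (snd c x, frame_mat c (s x), snd (snd (snd ?J (jet1 M LM s x))))"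
    using co[OF W(2) c(2)] by simp
  have 1: "((\<lambda>y. snd (snd d (s (cinv c y)))) has_derivative (\<lambda>w. snd (?D w))) (at (snd c x))"
    by (rule has_derivative_snd[OF smooth_map_has_derivative[OF M frame.B sm W(2) cc]])
  have o: "open (snd c ` (fst c \<inter> W))" by (rule open_image_chart[OF M c(1) W(1)])
  have 2: "((\<lambda>y. frame_mat c (s (cinv c y))) has_derivative (\<lambda>w. snd (?D w))) (at (snd c x))"
    by (rule has_derivative_transform_within_open[OF 1 o]) (use W c co cinv_chart[OF M c(1)] in auto)
  have "(\<lambda>w. snd (?D w)) = (\<lambda>w. \<Sum>\<sigma>\<in>UNIV. w $ \<sigma> *\<^sub>R snd (snd (snd ?J (jet1 M LM s x))) $ \<sigma>)"
    by (rule ext, subst linear_axis_sum[OF has_derivative_linear[OF 1]]) (simp only: J snd_conv vec_lambda_beta)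
  with 2 show "((\<lambda>y. frame_mat c (s (cinv c y))) has_derivative
      (\<lambda>w. \<Sum>\<sigma>\<in>UNIV. w $ \<sigma> *\<^sub>R snd (snd (snd ?J (jet1 M LM s x))) $ \<sigma>)) (at (snd c x))" by simp
qed

lemma sigma_jet_chart:
  assumes W: "openin top_M W" "x \<in> W" and s: "frame_section W s"
    and c: "c \<in> M" "x \<in> fst c" and d: "d \<in> SM" "adapted SM tau_Sigma c d"
    and E: "((\<lambda>y. frame_mat c (s (cinv c y))) has_derivative E') (at (snd c x))"
  shows "snd (sigma.jchart c d) (jet1 M SM (proj_K \<circ> s) x) =
    (snd c x, sym_vec (metric_mat (frame_mat c (s x))), \<chi> \<sigma>. sym_vec (dmetric (frame_mat c (s x)) (E' (axis \<sigma> 1))))"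
proof -
  have co: "snd d (proj_K (s p)) = (snd c p, sym_vec (metric_mat (frame_mat c (s p))))" if "p \<in> W" "p \<in> fst c" for p
    using sigma_adapted_coordinates(2)[OF M c(1) d section_frame[OF s that(1)]] that s by (simp add: section_on_def)
  have "((\<lambda>y. sym_vec (metric_mat (frame_mat c (s (cinv c y))))) has_derivative
      (\<lambda>v. sym_vec (dmetric (frame_mat c (s (cinv c (snd c x)))) (E' v)))) (at (snd c x))"
    by (rule bounded_linear.has_derivative[OF bounded_linear_sym_vec metric_mat_has_derivative[OF E]])
  then have 1: "((\<lambda>y. (y, sym_vec (metric_mat (frame_mat c (s (cinv c y)))))) has_derivative
      (\<lambda>v. (v, sym_vec (dmetric (frame_mat c (s x)) (E' v))))) (at (snd c x))"
    using has_derivative_Pair[OF has_derivative_ident] cinv_chart[OF M c] by simp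
  have o: "open (snd c ` (fst c \<inter> W))" by (rule open_image_chart[OF M c(1) W(1)])
  have "((snd d \<circ> (proj_K \<circ> s) \<circ> cinv c) has_derivative
      (\<lambda>v. (v, sym_vec (dmetric (frame_mat c (s x)) (E' v))))) (at (snd c x))"
    by (rule has_derivative_transform_within_open[OF 1 o]) (use W c co cinv_chart[OF M c(1)] in auto)
  note D = frechet_derivative_at[OF this, symmetric]
  show ?thesis
    unfolding sigma.jet_chart_jet1(2)[OF W section_proj_K[OF s] c d] D by (simp add: co[OF W(2) c(2)])
qed

lemma F_omega_chart:
  assumes c: "c \<in> M" and d: "d \<in> LM" "adapted LM fst c d"
    and d': "d' \<in> SM" "adapted SM tau_Sigma c d'"
    and j: "j \<in> fst (frame.jchart c d)" and z: "z = snd (frame.jchart c d) j"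
  shows "F_omega M j \<in> fst (sigma.jchart c d')"
    "snd (sigma.jchart c d') (F_omega M j) =
      (fst z, sym_vec (metric_mat (fst (snd z))), \<chi> \<sigma>. sym_vec (dmetric (fst (snd z)) (snd (snd z) $ \<sigma>)))"
proof -
  have jj: "j \<in> frame_jets" "tau1 j \<in> fst c" using j by (auto simp: jet_chart_def tau1_def)
  obtain s x W where s: "j = jet1 M LM s x" "openin top_M W" "x \<in> W" "frame_section W s"
    using frame.jets_cases[OF jj(1)] by blast
  have x: "x \<in> fst c" using jj(2) s(1) by (simp add: tau1_def jet1_def)
  have F: "F_omega M j = jet1 M SM (proj_K \<circ> s) x" using F_omega_jet1[OF s(2-4)] s(1) by simp
  show "F_omega M j \<in> fst (sigma.jchart c d')"
    unfolding F by (rule sigma.jet_chart_jet1(1)[OF s(2,3) section_proj_K[OF s(4)] c x d'])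
  have z3: "z = (snd c x, frame_mat c (s x), snd (snd z))"
    using frame_jet_chart(2)[OF s(2-4) c x d] s(1) z by simp
  have e: "(\<Sum>\<rho>\<in>UNIV. axis \<sigma> 1 $ \<rho> *\<^sub>R snd (snd z) $ \<rho>) = snd (snd z) $ \<sigma>" for \<sigma>
    by (simp add: axis_def if_distrib[where f="\<lambda>a. a *\<^sub>R _"] cong: if_cong)
  have "snd (sigma.jchart c d') (F_omega M j) =
    (snd c x, sym_vec (metric_mat (frame_mat c (s x))), \<chi> \<sigma>. sym_vec (dmetric (frame_mat c (s x)) (snd (snd z) $ \<sigma>)))"
    using sigma_jet_chart[OF s(2-4) c x d' frame_jet_chart(1)[OF s(2-4) c x d]] F s(1) z e by simp
  then show "snd (sigma.jchart c d') (F_omega M j) =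
      (fst z, sym_vec (metric_mat (fst (snd z))), \<chi> \<sigma>. sym_vec (dmetric (fst (snd z)) (snd (snd z) $ \<sigma>)))"
    by (subst (1 2 3) z3) simp
qed

lemma smooth_F_omega: "smooth_map_on (J1_frame M) (J1_Sigma M) (frame_jets) (F_omega M)"
proof -
  have "smooth_map_on (J1_frame M) (J1_Sigma M) (\<Union> (fst ` J1_frame M)) (F_omega M)"
  proof (rule smooth_map_on_Union)
    fix W assume "W \<in> fst ` J1_frame M"
    then obtain c d where c: "c \<in> M" and d: "d \<in> LM" "adapted LM fst c d"
      and W: "W = fst (frame.jchart c d)" unfolding J1_frame_def jet_atlas_eq by blast
    obtain d' where d': "d' \<in> SM" "adapted SM tau_Sigma c d'" using sigma.adapted_ex[OF c] by blast
    let ?J = "frame.jchart c d" and ?J' = "sigma.jchart c d'"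
    have J: "?J \<in> J1_frame M" "?J' \<in> J1_Sigma M"
      unfolding J1_frame_def J1_Sigma_def by (rule frame.jet_chart_in[OF c d]) (rule sigma.jet_chart_in[OF c d'])
    have o: "open (snd ?J ` fst ?J)" by (rule open_chart_image[OF smooth_J1_frame J(1)])
    have sd: "smooth_on S (\<lambda>z. dmetric (f z) (g z))" if "open S" "smooth_on S f" "smooth_on S g" 
      for S :: "'m fjet_model set" and f g
      unfolding dmetric_def by (intro smooth_intros that)
    have sm: "smooth_on (snd ?J ` fst ?J) (\<lambda>z. (fst z, sym_vec (metric_mat (fst (snd z))),
        \<chi> \<sigma>. sym_vec (dmetric (fst (snd z)) (snd (snd z) $ \<sigma>))))"
      by (intro smooth_intros sd smooth_on_id o)
    show "smooth_map_on (J1_frame M) (J1_Sigma M) W (F_omega M)" unfolding W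
    proof (rule smooth_map_on_chart[OF smooth_J1_frame J])
      show "F_omega M ` fst ?J \<subseteq> fst ?J'" using F_omega_chart(1)[OF c d d'] by blast
      show "smooth_on (snd ?J ` fst ?J) (\<lambda>z. snd ?J' (F_omega M (cinv ?J z)))"
        by (rule smooth_on_cong[OF sm o])
           (rule F_omega_chart(2)[OF c d d', symmetric], simp_all only: cinv_in chart_cinv)
    qed
  qed
  then show ?thesis unfolding J1_frame_def frame.jet_carrier .
qed

end

section \<open>The canonical connection and torsion\<close>

declare transpose_matrix_vector [simp del]

lemmas matrix_add_rdistrib = bounded_bilinear.add_left[OF bounded_bilinear_matrix_mult]
  and matrix_scaleR_mult = bounded_bilinear.scaleR_left[OF bounded_bilinear_matrix_mult]
  and matrix_mult_scaleR = bounded_bilinear.scaleR_right[OF bounded_bilinear_matrix_mult]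

lemma transpose_diff: "transpose (A - B) = transpose A - transpose B"
  by (simp add: vec_eq_iff transpose_def)

lemma bounded_linear_matrix_vector_left: "bounded_linear (\<lambda>A :: real^'n::finite^'m::finite. A *v x)"
  unfolding linear_conv_bounded_linear[symmetric]
  by (auto intro!: linearI simp: matrix_vector_mult_add_rdistrib scaleR_matrix_vector_assoc)

lemma bounded_linear_dmetric: "bounded_linear (dmetric e)"
  unfolding linear_conv_bounded_linear[symmetric]
  by (rule linearI)
     (simp_all add: dmetric_def transpose_add matrix_add_ldistrib matrix_add_rdistrib transpose_scalar
       matrix_scaleR_mult matrix_mult_scaleR algebra_simps)

text \<open>For \<open>B = transpose (D ** matrix_inv e)\<close> and
  \<open>X = eta ** transpose B + B ** eta\<close> one has
  \<open>2 *\<^sub>R p_part B = X ** eta\<close> and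
  \<open>dmetric e D = transpose e ** X ** e\<close>. As \<eta> and \<open>e\<close> are invertible,
  both conditions mean \<open>X = 0\<close>.\<close>

lemma p_part_eq_0_iff:
  assumes e: "invertible e"
  shows "p_part (transpose (D ** matrix_inv e)) = 0 \<longleftrightarrow> dmetric e D = 0"
proof -
  define B where "B = transpose (D ** matrix_inv e)"
  have D: "D = transpose B ** e"
    using matrix_inv_eq[OF e] by (simp add: B_def transpose_transpose flip: matrix_mul_assoc)
  define X where "X = eta ** transpose B + B ** eta"
  have dX: "dmetric e D = transpose e ** X ** e"
    by (simp add: dmetric_def D X_def matrix_transpose_mul transpose_transpose matrix_add_ldistrib
      matrix_add_rdistrib matrix_mul_assoc)
  have X: "X = transpose (matrix_inv e) ** dmetric e D ** matrix_inv e"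
  proof -
    have "transpose (matrix_inv e) ** dmetric e D ** matrix_inv e = transpose (e ** matrix_inv e) ** X ** (e ** matrix_inv e)"
      by (simp only: dX matrix_transpose_mul matrix_mul_assoc)
    then show ?thesis using matrix_inv_eq[OF e] by simp
  qed
  have p: "2 *\<^sub>R p_part B = X ** eta"
    by (simp add: p_part_def X_def matrix_add_rdistrib eta_eta add.commute flip: matrix_mul_assoc)
  have Xe: "X = 2 *\<^sub>R p_part B ** eta"
    by (simp add: p eta_eta flip: matrix_mul_assoc)
  have "p_part B = 0 \<longleftrightarrow> X = 0" using p Xe by auto
  also have "X = 0 \<longleftrightarrow> dmetric e D = 0" using X dX by auto
  finally show ?thesis by (simp add: B_def)
qed

text \<open>Differentiation of the identity \<open>A ** matrix_inv A = mat 1\<close>, valid on the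
  open set of invertible matrices.\<close>

lemma matrix_inv_has_derivative:
  fixes A :: "real^'n::finite^'n"
  assumes "invertible A"
  shows "(matrix_inv has_derivative (\<lambda>H. - (matrix_inv A ** H ** matrix_inv A))) (at A)"
proof -
  let ?S = "{A :: real^'n^'n. invertible A}"
  have "smooth_on ?S (\<lambda>A. matrix_inv A)"
    by (intro smooth_intros open_invertible smooth_on_id) auto
  then have D: "(matrix_inv has_derivative frechet_derivative matrix_inv (at A)) (at A)"
    using smooth_on_has_derivative[OF _ open_invertible, of matrix_inv A] assms by simp
  have d1: "((\<lambda>A. A ** matrix_inv A) has_derivative
      (\<lambda>H. A ** frechet_derivative matrix_inv (at A) H + H ** matrix_inv A)) (at A)"
    by (rule bounded_bilinear.FDERIV[OF bounded_bilinear_matrix_mult has_derivative_ident D])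
  have d2: "((\<lambda>A. A ** matrix_inv A) has_derivative (\<lambda>H. 0)) (at A)"
    by (rule has_derivative_transform_within_open[OF has_derivative_const[of "mat 1"] open_invertible])
       (use assms in \<open>auto simp: matrix_inv_eq(1)\<close>)
  have eq: "A ** frechet_derivative matrix_inv (at A) H + H ** matrix_inv A = 0" for H
    by (rule fun_cong[OF has_derivative_unique[OF d1 d2]])
  have "frechet_derivative matrix_inv (at A) H = - (matrix_inv A ** H ** matrix_inv A)" for H
  proof -
    have "A ** frechet_derivative matrix_inv (at A) H = - (H ** matrix_inv A)" using eq[of H] by (simp add: eq_neg_iff_add_eq_0)
    then have "matrix_inv A ** (A ** frechet_derivative matrix_inv (at A) H) = matrix_inv A ** (- (H ** matrix_inv A))" by simp
    moreover have "matrix_inv A ** (- Y) = - (matrix_inv A ** Y)" for Y :: "real^'n^'n"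
      by (simp add: vec_eq_iff matrix_matrix_mult_def sum_negf)
    ultimately show ?thesis by (simp add: matrix_mul_assoc matrix_inv_eq[OF assms])
  qed
  then show ?thesis using D by presburger
qed

text \<open>Of the four subsets of \<open>{0, 1}\<close> the empty and the full one evaluate
  \<alpha> on a list of the wrong length. The singleton \<open>{1}\<close> has one inversion, which
  gives the minus sign.\<close>

lemma wedge_1_1:
  assumes "\<And>vs. length vs \<noteq> 1 \<Longrightarrow> \<alpha> vs = 0"
  shows "wedge \<alpha> \<beta> [v, w] = \<alpha> [v] * \<beta> [w] - \<alpha> [w] * \<beta> [v]"
proof -
  have P: "Pow {..<length [v, w]} = {{}, {0}, {1}, {0, 1}}"
    by (auto simp: lessThan_Suc Pow_insert)
  have e: "{(i, j). i \<in> {0} \<and> j \<in> {..<length [v, w]} - {0} \<and> j < i} = {}"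
    "{(i, j). i \<in> {1} \<and> j \<in> {..<length [v, w]} - {1} \<and> j < i} = {(1::nat, 0::nat)}"
    by auto
  have n: "nths [v, w] {0} = [v]" "nths [v, w] {1} = [w]" "nths [v, w] (- {0}) = [w]" "nths [v, w] (- {1}) = [v]"
    "nths [v, w] {0, 1} = [v, w]" "nths [v, w] {0, Suc 0} = [v, w]" "nths [v, w] {} = []"
    by (simp_all add: nths_Cons)
  have z: "\<alpha> [] = 0" "\<alpha> [v, w] = 0" using assms by simp_all
  have d: "{} \<notin> {{0}, {1}, {0, 1::nat}}" "{0} \<notin> {{1}, {0, 1::nat}}" "{1} \<notin> {{0, 1::nat}}" by auto
  show ?thesis
    unfolding wedge_def P
    by (subst sum.insert, simp, rule d, subst sum.insert, simp, rule d, subst sum.insert, simp, rule d)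
       (simp only: e n z, simp add: n z)
qed

section \<open>Torsion-free jets and the Levi-Civita formula\<close>

definition jet_lin :: "('f::real_vector, 'm::finite) vec \<Rightarrow> real^'m \<Rightarrow> 'f" where
  "jet_lin F \<xi> = (\<Sum>\<sigma>\<in>UNIV. \<xi> $ \<sigma> *\<^sub>R F $ \<sigma>)"

lemma jet_lin_axis: "jet_lin F (axis \<sigma> 1) = F $ \<sigma>"
  by (simp add: jet_lin_def axis_def if_distrib[where f="\<lambda>a. a *\<^sub>R _"] cong: if_cong)

text \<open>The condition \<open>e\<^sup>k\<^sub>\<mu> e\<^sup>\<sigma>\<^sub>k\<^sub>\<nu> = e\<^sup>k\<^sub>\<nu> e\<^sup>\<sigma>\<^sub>k\<^sub>\<mu>\<close>, contracted with \<open>\<xi>\<close> and \<open>\<zeta>\<close>.\<close>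
definition torsion_free :: "('m::finite) rmat \<Rightarrow> ('m rmat, 'm) vec \<Rightarrow> bool" where
  "torsion_free e F \<longleftrightarrow> (\<forall>\<xi> \<zeta>. transpose (jet_lin F \<xi>) *v (matrix_inv (transpose e) *v \<zeta>) =
     transpose (jet_lin F \<zeta>) *v (matrix_inv (transpose e) *v \<xi>))"

text \<open>Both sides of the defining equation are bilinear in \<xi> and \<zeta>, so basis vectors
  suffice. The matrices \<open>\<Gamma> \<sigma>\<close> are, up to sign, the coefficients of the
  connection given by the jet; their lower indices are to be symmetric.\<close>

lemma torsion_free_iff:
  "torsion_free e F \<longleftrightarrow> (\<forall>\<sigma> \<nu> \<mu>. (transpose (F $ \<sigma>) ** matrix_inv (transpose e)) $ \<mu> $ \<nu> =
     (transpose (F $ \<nu>) ** matrix_inv (transpose e)) $ \<mu> $ \<sigma>)"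
proof -
  let ?N = "matrix_inv (transpose e)"
  define \<Gamma> where "\<Gamma> \<sigma> = transpose (F $ \<sigma>) ** ?N" for \<sigma>
  have ax: "transpose (jet_lin F (axis \<sigma> 1)) *v (?N *v axis \<nu> 1) = \<Gamma> \<sigma> *v axis \<nu> 1" for \<sigma> \<nu>
    by (simp add: jet_lin_axis \<Gamma>_def matrix_vector_mul_assoc)
  have comp: "(\<Gamma> \<sigma> *v axis \<nu> 1) $ \<mu> = \<Gamma> \<sigma> $ \<mu> $ \<nu>" for \<sigma> \<nu> \<mu>
    by (simp add: matrix_vector_mult_basis column_def)
  have gen: "(transpose (jet_lin F \<xi>) *v (?N *v \<zeta>)) $ \<mu> = (\<Sum>\<sigma>\<in>UNIV. \<Sum>\<nu>\<in>UNIV. \<xi> $ \<sigma> * \<zeta> $ \<nu> * \<Gamma> \<sigma> $ \<mu> $ \<nu>)" for \<xi> \<zeta> \<mu>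
  proof -
    have "transpose (jet_lin F \<xi>) = (\<Sum>\<sigma>\<in>UNIV. \<xi> $ \<sigma> *\<^sub>R transpose (F $ \<sigma>))"
      unfolding jet_lin_def by (simp add: vec_eq_iff transpose_def)
    then have "transpose (jet_lin F \<xi>) *v (?N *v \<zeta>) = (\<Sum>\<sigma>\<in>UNIV. \<xi> $ \<sigma> *\<^sub>R (\<Gamma> \<sigma> *v \<zeta>))"
      by (simp add: linear_sum[OF bounded_linear.linear[OF bounded_linear_matrix_vector_left]]
        scaleR_matrix_vector_assoc[symmetric] \<Gamma>_def flip: matrix_vector_mul_assoc)
    then show ?thesis
      by (simp add: matrix_vector_mult_def sum_distrib_left mult_ac)
  qed
  show ?thesis
  proof
    assume t: "torsion_free e F"
    have "\<Gamma> \<sigma> *v axis \<nu> 1 = \<Gamma> \<nu> *v axis \<sigma> 1" for \<sigma> \<nu>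
      using t ax unfolding torsion_free_def by metis
    then show "\<forall>\<sigma> \<nu> \<mu>. (transpose (F $ \<sigma>) ** ?N) $ \<mu> $ \<nu> = (transpose (F $ \<nu>) ** ?N) $ \<mu> $ \<sigma>"
      using comp unfolding \<Gamma>_def by metis
  next
    assume "\<forall>\<sigma> \<nu> \<mu>. (transpose (F $ \<sigma>) ** ?N) $ \<mu> $ \<nu> = (transpose (F $ \<nu>) ** ?N) $ \<mu> $ \<sigma>"
    then have s: "\<Gamma> \<sigma> $ \<mu> $ \<nu> = \<Gamma> \<nu> $ \<mu> $ \<sigma>" for \<sigma> \<mu> \<nu> by (simp add: \<Gamma>_def)
    have "(transpose (jet_lin F \<xi>) *v (?N *v \<zeta>)) $ \<mu> = (transpose (jet_lin F \<zeta>) *v (?N *v \<xi>)) $ \<mu>" for \<xi> \<zeta> \<mu>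
      unfolding gen by (subst sum.swap, intro sum.cong refl, subst s) (simp only: mult.commute)
    then show "torsion_free e F" by (simp add: torsion_free_def vec_eq_iff)
  qed
qed

text \<open>The Levi-Civita connection of the metric of the frame \<open>e\<close> when \<open>G \<sigma>\<close> is the derivative of the
  contravariant metric in direction \<open>\<sigma>\<close>; the innermost matrix consists of the Christoffel symbols of
  the first kind.\<close>
definition levi_civita :: "('m::{finite,linorder}) rmat \<Rightarrow> ('m \<Rightarrow> 'm rmat) \<Rightarrow> ('m rmat, 'm) vec" where
  "levi_civita e G =
     (let h = matrix_inv (metric_mat e); P = (\<lambda>\<sigma>. h ** G \<sigma> ** h) in
      \<chi> \<sigma>. e ** transpose (metric_mat e **
        (\<chi> \<alpha> \<beta>. (P \<sigma> $ \<alpha> $ \<beta> + P \<beta> $ \<alpha> $ \<sigma> - P \<alpha> $ \<beta> $ \<sigma>) * (1/2))))"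

lemma matrix_inv_transpose:
  fixes A :: "real^'n::finite^'n"
  assumes "invertible A"
  shows "matrix_inv (transpose A) = transpose (matrix_inv A)"
proof -
  have i: "invertible (transpose A)" using assms by (simp add: invertible_det_nz det_transpose)
  have "transpose A ** transpose (matrix_inv A) = mat 1"
    using matrix_inv_eq(2)[OF assms] by (metis matrix_transpose_mul transpose_mat)
  then have "matrix_inv (transpose A) ** (transpose A ** transpose (matrix_inv A)) = matrix_inv (transpose A)" by simp
  then show ?thesis by (simp add: matrix_mul_assoc matrix_inv_eq[OF i])
qed

lemma metric_mat_invertible: "invertible e \<Longrightarrow> invertible (metric_mat e)"
proof -
  have "det (eta :: 'a rmat) * det (eta :: 'a rmat) = 1"
    using det_mul[of "eta :: 'a rmat" eta] by (simp add: eta_eta)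
  then have "det (eta :: 'a rmat) \<noteq> 0" by auto
  then show "invertible e \<Longrightarrow> invertible (metric_mat e)"
    by (simp add: metric_mat_def invertible_det_nz det_mul det_transpose)
qed

text \<open>The fundamental lemma by the Koszul argument. Let \<open>C \<sigma>\<close> be the
  connection coefficients, up to sign, with the upper index lowered by \<open>h\<close>. Prescribing
  the derivative of the metric means
  \<open>C \<sigma> + transpose (C \<sigma>) = P \<sigma>\<close>, and vanishing torsion means
  symmetry in \<sigma> and the last index. Together these equations have exactly one
  solution.\<close>

lemma levi_civita_iff:
  assumes e: "invertible e" and G: "\<And>\<sigma>. transpose (G \<sigma>) = G \<sigma>"
  shows "torsion_free e F \<and> (\<forall>\<sigma>. dmetric e (F $ \<sigma>) = G \<sigma>) \<longleftrightarrow> F = levi_civita e G"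
proof -
  let ?g = "metric_mat e"
  define h where "h = matrix_inv ?g"
  define N where "N = matrix_inv (transpose e)"
  define P where "P \<sigma> = h ** G \<sigma> ** h" for \<sigma>
  define C where "C \<sigma> = h ** (transpose (F $ \<sigma>) ** N)" for \<sigma>
  have gi: "invertible ?g" by (rule metric_mat_invertible[OF e])
  have ti: "invertible (transpose e)" using e by (simp add: invertible_det_nz det_transpose)
  have gh: "?g ** h = mat 1" "h ** ?g = mat 1" unfolding h_def by (rule matrix_inv_eq[OF gi])+
  have Ne: "transpose e ** N = mat 1" "N ** transpose e = mat 1" unfolding N_def by (rule matrix_inv_eq[OF ti])+
  have hs: "transpose h = h" using matrix_inv_transpose[OF gi] by (simp add: h_def transpose_metric_mat)
  have Ps: "P \<sigma> $ \<alpha> $ \<beta> = P \<sigma> $ \<beta> $ \<alpha>" for \<sigma> \<alpha> \<beta>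
  proof -
    have "transpose (P \<sigma>) = P \<sigma>" by (simp add: P_def matrix_transpose_mul hs G matrix_mul_assoc)
    then have "transpose (P \<sigma>) $ \<beta> $ \<alpha> = P \<sigma> $ \<beta> $ \<alpha>" by simp
    then show ?thesis by (simp add: transpose_def)
  qed
  have gC: "?g ** C \<sigma> = transpose (F $ \<sigma>) ** N" for \<sigma>
    by (simp add: C_def gh matrix_mul_assoc)
  have FC: "F $ \<sigma> = e ** transpose (?g ** C \<sigma>)" for \<sigma>
  proof -
    have "transpose (F $ \<sigma>) = ?g ** C \<sigma> ** transpose e" unfolding gC by (simp add: Ne flip: matrix_mul_assoc)
    then have "transpose (transpose (F $ \<sigma>)) = transpose (?g ** C \<sigma> ** transpose e)" by simp
    then show ?thesis by (simp add: transpose_transpose matrix_transpose_mul)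
  qed
  have dm: "dmetric e (F $ \<sigma>) = ?g ** (C \<sigma> + transpose (C \<sigma>)) ** ?g" for \<sigma>
  proof -
    have "dmetric e (F $ \<sigma>) = ?g ** transpose (?g ** C \<sigma>) + ?g ** C \<sigma> ** ?g"
      by (simp add: dmetric_def FC[of \<sigma>] metric_mat_def matrix_transpose_mul transpose_transpose matrix_mul_assoc)
    then show ?thesis
      by (simp add: matrix_transpose_mul transpose_metric_mat matrix_add_ldistrib matrix_add_rdistrib matrix_mul_assoc add.commute)
  qed
  have cond1: "dmetric e (F $ \<sigma>) = G \<sigma> \<longleftrightarrow> C \<sigma> + transpose (C \<sigma>) = P \<sigma>" for \<sigma>
  proof
    assume "dmetric e (F $ \<sigma>) = G \<sigma>"
    then have "P \<sigma> = h ** dmetric e (F $ \<sigma>) ** h" by (simp only: P_def)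
    then have "P \<sigma> = (h ** ?g) ** (C \<sigma> + transpose (C \<sigma>)) ** (?g ** h)" by (simp only: dm matrix_mul_assoc)
    then show "C \<sigma> + transpose (C \<sigma>) = P \<sigma>" by (simp add: gh)
  next
    assume "C \<sigma> + transpose (C \<sigma>) = P \<sigma>"
    then have "dmetric e (F $ \<sigma>) = (?g ** h) ** G \<sigma> ** (h ** ?g)" by (simp only: dm P_def matrix_mul_assoc)
    then show "dmetric e (F $ \<sigma>) = G \<sigma>" by (simp add: gh)
  qed
  have cond1': "C \<sigma> + transpose (C \<sigma>) = P \<sigma> \<longleftrightarrow> (\<forall>\<alpha> \<beta>. C \<sigma> $ \<alpha> $ \<beta> + C \<sigma> $ \<beta> $ \<alpha> = P \<sigma> $ \<alpha> $ \<beta>)" for \<sigma>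
    by (simp add: vec_eq_iff transpose_def)
  have cond2: "torsion_free e F \<longleftrightarrow> (\<forall>\<sigma> \<nu> \<alpha>. C \<sigma> $ \<alpha> $ \<nu> = C \<nu> $ \<alpha> $ \<sigma>)"
  proof -
    have "torsion_free e F \<longleftrightarrow> (\<forall>\<sigma> \<nu>. (?g ** C \<sigma>) *v axis \<nu> 1 = (?g ** C \<nu>) *v axis \<sigma> 1)"
      unfolding torsion_free_iff N_def[symmetric] gC[symmetric]
      by (simp add: vec_eq_iff matrix_vector_mult_basis column_def)
    also have "\<dots> \<longleftrightarrow> (\<forall>\<sigma> \<nu>. C \<sigma> *v axis \<nu> 1 = C \<nu> *v axis \<sigma> 1)"
    proof (intro all_cong1 iffI)
      fix \<sigma> \<nu>
      assume "(?g ** C \<sigma>) *v axis \<nu> 1 = (?g ** C \<nu>) *v axis \<sigma> 1"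
      then have "h *v ((?g ** C \<sigma>) *v axis \<nu> 1) = h *v ((?g ** C \<nu>) *v axis \<sigma> 1)" by simp
      then show "C \<sigma> *v axis \<nu> 1 = C \<nu> *v axis \<sigma> 1" by (simp only: matrix_vector_mul_assoc matrix_mul_assoc gh matrix_mul_lid)
    next
      fix \<sigma> \<nu>
      assume "C \<sigma> *v axis \<nu> 1 = C \<nu> *v axis \<sigma> 1"
      then show "(?g ** C \<sigma>) *v axis \<nu> 1 = (?g ** C \<nu>) *v axis \<sigma> 1" by (simp only: matrix_vector_mul_assoc[symmetric])
    qed
    finally show ?thesis by (simp add: vec_eq_iff matrix_vector_mult_basis column_def)
  qed
  \<comment> \<open>The cyclic combination of three instances of the metric equation in which, by
    the symmetry from the torsion condition, all terms cancel except twice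
    \<open>C \<sigma> $ \<alpha> $ \<beta>\<close>.\<close>
  define C0 where "C0 \<sigma> = (\<chi> \<alpha> \<beta>. (P \<sigma> $ \<alpha> $ \<beta> + P \<beta> $ \<alpha> $ \<sigma> - P \<alpha> $ \<beta> $ \<sigma>) * (1/2))" for \<sigma>
  have lc: "levi_civita e G = (\<chi> \<sigma>. e ** transpose (?g ** C0 \<sigma>))"
    unfolding levi_civita_def C0_def P_def h_def Let_def ..
  have "torsion_free e F \<and> (\<forall>\<sigma>. dmetric e (F $ \<sigma>) = G \<sigma>) \<longleftrightarrow> C = C0"
  proof
    assume H: "torsion_free e F \<and> (\<forall>\<sigma>. dmetric e (F $ \<sigma>) = G \<sigma>)"
    have a: "C \<sigma> $ \<alpha> $ \<nu> = C \<nu> $ \<alpha> $ \<sigma>" for \<sigma> \<nu> \<alpha>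
      using H[THEN conjunct1, unfolded cond2] by blast
    have b: "P \<sigma> $ \<alpha> $ \<nu> = C \<sigma> $ \<alpha> $ \<nu> + C \<sigma> $ \<nu> $ \<alpha>" for \<sigma> \<nu> \<alpha>
      using H[THEN conjunct2, unfolded cond1 cond1'] by simp
    have "C \<sigma> $ \<alpha> $ \<beta> = C0 \<sigma> $ \<alpha> $ \<beta>" for \<sigma> \<alpha> \<beta>
      unfolding C0_def vec_lambda_beta b using a[of \<beta> \<alpha> \<sigma>] a[of \<alpha> \<beta> \<sigma>] a[of \<alpha> \<sigma> \<beta>] by simp
    then show "C = C0" by (simp add: fun_eq_iff vec_eq_iff)
  next
    assume CC: "C = C0"
    have "C \<sigma> $ \<alpha> $ \<beta> + C \<sigma> $ \<beta> $ \<alpha> = P \<sigma> $ \<alpha> $ \<beta>" for \<sigma> \<alpha> \<beta>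
      unfolding CC C0_def vec_lambda_beta using Ps[of \<sigma> \<alpha> \<beta>] Ps[of \<beta> \<alpha> \<sigma>] Ps[of \<alpha> \<beta> \<sigma>] by argo
    moreover have "C \<sigma> $ \<alpha> $ \<nu> = C \<nu> $ \<alpha> $ \<sigma>" for \<sigma> \<nu> \<alpha>
      unfolding CC C0_def vec_lambda_beta using Ps[of \<alpha> \<sigma> \<nu>] by argo
    ultimately show "torsion_free e F \<and> (\<forall>\<sigma>. dmetric e (F $ \<sigma>) = G \<sigma>)"
      unfolding cond1 cond1' cond2 by blast
  qed
  also have "C = C0 \<longleftrightarrow> F = levi_civita e G"
  proof
    assume "C = C0"
    then show "F = levi_civita e G" using FC by (simp add: lc vec_eq_iff)
  next
    assume "F = levi_civita e G"
    then have F: "F $ \<sigma> = e ** transpose (?g ** C0 \<sigma>)" for \<sigma> by (simp add: lc)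
    have "C \<sigma> = C0 \<sigma>" for \<sigma>
    proof -
      have "C \<sigma> = (h ** ?g) ** C0 \<sigma> ** (transpose e ** N)"
        by (simp only: C_def F matrix_transpose_mul transpose_transpose matrix_mul_assoc)
      then show ?thesis by (simp add: gh Ne)
    qed
    then show "C = C0" by (rule ext)
  qed
  finally show ?thesis .
qed

lemma smooth_levi_civita:
  assumes S: "open S" and e: "smooth_on S e" "\<And>x. x \<in> S \<Longrightarrow> invertible (e x)" and G: "\<And>\<sigma>. smooth_on S (\<lambda>x. G x \<sigma>)"
  shows "smooth_on S (\<lambda>x. levi_civita (e x) (G x))"
  unfolding levi_civita_def Let_def
  by (intro smooth_intros S e G) (use metric_mat_invertible e in auto)

context frame_geometry
begin

lemma jet_atlas_J1: "jet_atlas M LM fst = J1_frame M" "jet_atlas M SM tau_Sigma = J1_Sigma M"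
  by (simp_all add: J1_frame_def J1_Sigma_def)

lemmas jet_chart_at = frame.jet_chart_at[unfolded jet_atlas_J1]
  and tmap_tau = frame.tmap_tau[unfolded jet_atlas_J1]
  and smooth_tau10 = frame.smooth_tau10[unfolded jet_atlas_J1]
  and smooth_tau1 = frame.smooth_tau1[unfolded jet_atlas_J1]
  and jet_carrier = frame.jet_carrier[unfolded jet_atlas_J1]

lemma tau10_frame: "j \<in> frame_jets \<Longrightarrow> tau10 j \<in> frame_bundle M"
  by (erule frame.jets_cases) (simp add: tau10_def jet1_def section_frame)

lemma jet_chart_tau:
  assumes c: "c \<in> M" and d: "d \<in> LM" "adapted LM fst c d"
    and j: "j \<in> frame_jets" "tau1 j \<in> fst c"
  shows "fst (snd (frame.jchart c d) j) = snd c (tau1 j)"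
    "fst (snd (snd (frame.jchart c d) j)) = frame_mat c (tau10 j)"
    "invertible (frame_mat c (tau10 j))" "fst (tau10 j) = tau1 j" "tau10 j \<in> fst d"
proof -
  note ch = jet_chart_at[OF c d j]
  show d': "tau10 j \<in> fst d" and f: "fst (tau10 j) = tau1 j" using ch by (auto simp: charts_at_iff)
  show "fst (snd (frame.jchart c d) j) = snd c (tau1 j)"
    by (simp add: jet_chart_def tau1_def case_prod_unfold)
  show "fst (snd (snd (frame.jchart c d) j)) = frame_mat c (tau10 j)"
    using frame_adapted_coordinates[OF M c d d'] by (simp add: jet_chart_def tau10_def case_prod_unfold)
  show "invertible (frame_mat c (tau10 j))"
    using frame_mat_invertible[OF M _ tau10_frame[OF j(1)]] ch(3) f by simp
qed

text \<open>Both terms of the Cartan form project to the same vector of the base, so the first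
  component cancels. The fibre component compares the motion of the frame with the motion prescribed
  by the slopes of the jet.\<close>

lemma cartan_chart:
  assumes c: "c \<in> M" and d: "d \<in> LM" "adapted LM fst c d"
    and j: "j \<in> frame_jets" "tau1 j \<in> fst c" and v: "v \<in> tangent_space (J1_frame M) j"
  defines "J \<equiv> frame.jchart c d"
  shows "cartan M j v \<in> tangent_space LM (tau10 j)"
    "cartan M j v d = (0, fst (snd (v J)) - jet_lin (snd (snd (snd J j))) (fst (v J)))"
proof -
  obtain x u L where jx: "j = (x, u, L)" by (cases j)
  have x: "x \<in> fst c" "u = tau10 j" "x = tau1 j" using j jx by (simp_all add: tau1_def tau10_def)
  note ch = jet_chart_at[OF c d j]
  note co = frame.jet_coordinates[OF j(1)[unfolded jx] c x(1) d]
  let ?w = "tmap (J1_frame M) M tau1 j v"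
  have w: "?w \<in> tangent_space M x"
    using tmap_tangent[OF smooth_J1_frame M smooth_tau1 j(1)] x by simp
  have L: "L ?w = tvec_of LM u d (?w c, \<Sum>\<sigma>\<in>UNIV. ?w c $ \<sigma> *\<^sub>R snd (snd (snd J j)) $ \<sigma>)"
    using w by (subst co(3)) (simp add: frame.jlin_def J_def jx)
  have du: "d \<in> charts_at LM u" using ch(2) x by simp
  have Lt: "L ?w \<in> tangent_space LM u" "L ?w d = (?w c, jet_lin (snd (snd (snd J j))) (?w c))"
    unfolding L using tvec_of_tangent[OF frame.B du] by (simp_all add: jet_lin_def)
  have cw: "cartan M j v = (\<lambda>d. tmap (J1_frame M) LM tau10 j v d - L ?w d)"
    by (simp add: cartan_def jx)
  show "cartan M j v \<in> tangent_space LM (tau10 j)"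
    unfolding cw using Lt(1) x(2) tmap_tangent[OF smooth_J1_frame frame.B smooth_tau10 j(1)]
    by (intro tangent_space_diff[OF frame.B]) auto
  show "cartan M j v d = (0, fst (snd (v J)) - jet_lin (snd (snd (snd J j))) (fst (v J)))"
    unfolding cw Lt(2) tmap_tau[OF c d j v] J_def[symmetric] by simp
qed

text \<open>In coordinates the curve is affine in \<open>t\<close>. Away from 0 the matrix
  \<open>1 + tB\<close> may be singular and the curve may leave the frame bundle; the open set
  \<open>I\<close> contains the times at which it does not.\<close>

lemma fundamental_chart:
  assumes c: "c \<in> M" and d: "d \<in> LM" "adapted LM fst c d" and u: "u \<in> fst d"
  shows "fundamental M B u \<in> tangent_space LM u" "fundamental M B u d = (0, transpose B ** frame_mat c u)"
proof -
  let ?\<gamma> = "\<lambda>t. frame_act u (mat 1 + t *\<^sub>R B)"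
  have ub: "u \<in> frame_bundle M" "fst u \<in> fst c"
    using u frame.adapted_iff[OF d(2)] frame_carrier by blast+
  have dC: "d \<in> charts_at LM u" using d u by (simp add: charts_at_iff)
  have g0: "?\<gamma> 0 = u" by (simp add: frame_act_1)
  define I where "I = {t :: real. invertible (mat 1 + t *\<^sub>R B)}"
  have "continuous_on UNIV (\<lambda>t. mat 1 + t *\<^sub>R B)"
    by (intro continuous_intros)
  from open_vimage[OF open_invertible this] have I: "open I" by (simp add: I_def vimage_def)
  have I0: "0 \<in> I" by (simp add: I_def invertible_mat_1)
  have gd: "?\<gamma> t \<in> fst d" if "t \<in> I" for t
    using that frame_act_bundle_iff[OF M ub(1)] ub(2) frame.adapted_iff[OF d(2)] frame_carrier[of M] unfolding I_def
    by simp
  have co: "snd d (?\<gamma> t) = (snd c (fst u), transpose (mat 1 + t *\<^sub>R B) ** frame_mat c u)" if "t \<in> I" for t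
    using frame_adapted_coordinates[OF M c d gd[OF that]] by (simp add: frame_act_mat)
  have e: "transpose (mat 1 + t *\<^sub>R B) ** frame_mat c u = frame_mat c u + t *\<^sub>R (transpose B ** frame_mat c u)" for t
    by (simp add: transpose_add transpose_scalar matrix_add_rdistrib matrix_scaleR_mult)
  have "((\<lambda>t. (snd c (fst u), frame_mat c u + t *\<^sub>R (transpose B ** frame_mat c u))) has_vector_derivative
      (0, transpose B ** frame_mat c u)) (at 0)"
    by (intro has_vector_derivative_Pair has_vector_derivative_const) (auto intro!: derivative_eq_intros)
  then have D: "((\<lambda>t. snd d (?\<gamma> t)) has_vector_derivative (0, transpose B ** frame_mat c u)) (at 0)"
    by (rule has_vector_derivative_transform_within_open[OF _ I I0]) (simp add: co e)
  show "fundamental M B u \<in> tangent_space LM u" "fundamental M B u d = (0, transpose B ** frame_mat c u)"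
    using velocity_tangent[OF frame.B _ I I0 _ D] g0 dC gd unfolding fundamental_def by auto
qed

lemma omega_mat_chart:
  assumes c: "c \<in> M" and d: "d \<in> LM" "adapted LM fst c d"
    and j: "j \<in> frame_jets" "tau1 j \<in> fst c" and v: "v \<in> tangent_space (J1_frame M) j"
  defines "J \<equiv> frame.jchart c d"
  shows "omega_mat M j v =
    transpose ((fst (snd (v J)) - jet_lin (snd (snd (snd J j))) (fst (v J))) ** matrix_inv (frame_mat c (tau10 j)))"
proof -
  let ?e = "frame_mat c (tau10 j)"
  let ?D = "fst (snd (v J)) - jet_lin (snd (snd (snd J j))) (fst (v J))"
  note T = jet_chart_tau[OF c d j]
  note ch = jet_chart_at[OF c d j]
  note ca = cartan_chart[OF c d j v, folded J_def]
  note fu = fundamental_chart[OF c d T(5)]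
  have "fundamental M B (tau10 j) = cartan M j v \<longleftrightarrow> B = transpose (?D ** matrix_inv ?e)" for B
  proof -
    have "fundamental M B (tau10 j) = cartan M j v \<longleftrightarrow> transpose B ** ?e = ?D"
      using tangent_space_eqI[OF fu(1) ca(1) ch(2)] fu(2) ca(2) by (metis Pair_inject)
    also have "\<dots> \<longleftrightarrow> B = transpose (?D ** matrix_inv ?e)"
    proof
      assume "transpose B ** ?e = ?D"
      then have "?D ** matrix_inv ?e = transpose B ** (?e ** matrix_inv ?e)" by (simp only: matrix_mul_assoc)
      then have "?D ** matrix_inv ?e = transpose B" by (simp add: matrix_inv_eq[OF T(3)])
      then show "B = transpose (?D ** matrix_inv ?e)" by (simp add: transpose_transpose)
    qed (simp add: transpose_transpose matrix_inv_eq[OF T(3)] flip: matrix_mul_assoc)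
    finally show ?thesis .
  qed
  then show ?thesis unfolding omega_mat_def by simp
qed

lemma section_jet:
  assumes s: "section_on M (J1_frame M) tau1 U \<sigma>" and x: "x \<in> U"
  shows "\<sigma> x \<in> frame_jets" "tau1 (\<sigma> x) = x"
  using assms unfolding section_on_def smooth_map_on_def charts_at_def jet_carrier[symmetric] by blast+

lemma section_tau10:
  assumes s: "section_on M (J1_frame M) tau1 U \<sigma>"
  shows "frame_section U (tau10 \<circ> \<sigma>)"
proof -
  have sub: "\<sigma> ` U \<subseteq> frame_jets" using section_jet[OF s] by blast
  have "smooth_map_on M LM U (\<lambda>x. tau10 (\<sigma> x))"
    by (rule smooth_map_on_compose[OF M smooth_J1_frame frame.B _ smooth_tau10 sub]) (use s in \<open>simp add: section_on_def\<close>)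
  moreover have "fst (tau10 (\<sigma> x)) = x" if x: "x \<in> U" for x
  proof -
    have "x \<in> \<Union> (fst ` M)" using s x unfolding section_on_def smooth_map_on_def charts_at_def by blast
    then obtain c where c: "c \<in> M" "x \<in> fst c" by blast
    obtain d where d: "d \<in> LM" "adapted LM fst c d" using frame.adapted_ex[OF c(1)] by blast
    show ?thesis using jet_chart_tau(4)[OF c(1) d section_jet(1)[OF s x]] section_jet(2)[OF s x] c(2) by simp
  qed
  ultimately show ?thesis by (simp add: section_on_def o_def)
qed

text \<open>Both jets are over the same metric because \<open>tau10 j = s x\<close>, so in a jet
  chart only the derivative coordinates remain to be compared. Symmetry of \<open>dmetric\<close>
  allows passing from \<open>sym_vec\<close> back to matrices.\<close>

lemma F_omega_eq_jet1_iff: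
  assumes W: "openin top_M W" "x \<in> W" and s: "frame_section W s"
    and c: "c \<in> M" "x \<in> fst c" and d: "d \<in> LM" "adapted LM fst c d"
    and j: "j \<in> frame_jets" "tau1 j = x" "tau10 j = s x"
    and E': "((\<lambda>y. frame_mat c (s (cinv c y))) has_derivative E') (at (snd c x))"
  shows "F_omega M j = jet1 M SM (proj_K \<circ> s) x \<longleftrightarrow>
    (\<forall>\<sigma>. dmetric (frame_mat c (s x)) (snd (snd (snd (frame.jchart c d) j)) $ \<sigma>) =
      dmetric (frame_mat c (s x)) (E' (axis \<sigma> 1)))"
proof -
  obtain d' where d': "d' \<in> SM" "adapted SM tau_Sigma c d'" using sigma.adapted_ex[OF c(1)] by blast
  let ?J = "frame.jchart c d" and ?J' = "sigma.jchart c d'"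
  let ?e = "frame_mat c (s x)" and ?F = "snd (snd (snd ?J j))"
  have jc: "tau1 j \<in> fst c" using j(2) c by simp
  note T = jet_chart_tau[OF c(1) d j(1) jc]
  have j1: "j \<in> fst ?J" using jet_chart_at[OF c(1) d j(1) jc] by (simp add: charts_at_iff)
  have "F_omega M j = jet1 M SM (proj_K \<circ> s) x \<longleftrightarrow>
      snd ?J' (F_omega M j) = snd ?J' (jet1 M SM (proj_K \<circ> s) x)"
    using inj_on_eq_iff[OF sigma.jet_chart_inj[OF c(1) d'] F_omega_chart(1)[OF c(1) d d' j1 refl]
      sigma.jet_chart_jet1(1)[OF W section_proj_K[OF s] c d']] by simp
  also have "\<dots> \<longleftrightarrow> (\<forall>\<sigma>. sym_vec (dmetric ?e (?F $ \<sigma>)) = sym_vec (dmetric ?e (E' (axis \<sigma> 1))))"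
    unfolding F_omega_chart(2)[OF c(1) d d' j1 refl] sigma_jet_chart[OF W s c d' E'] T(1,2) j(2,3)
    by (simp add: vec_eq_iff[where 'a="'m uprod rvec"])
  also have "\<dots> \<longleftrightarrow> (\<forall>\<sigma>. dmetric ?e (?F $ \<sigma>) = dmetric ?e (E' (axis \<sigma> 1)))"
    using sym_mat_vec[OF transpose_dmetric] by metis
  finally show ?thesis .
qed

text \<open>The constraint \<open>\<omega>\<^sub>\<pp> = 0\<close> says that the image under \<open>F\<^sub>\<omega>\<close> is holonomic.\<close>
lemma omega_p_pullback_iff:
  assumes s: "section_on M (J1_frame M) tau1 U \<sigma>" and x: "x \<in> U"
  shows "(\<forall>v\<in>tangent_space M x. \<forall>i k. pullback M (J1_frame M) \<sigma> (omega_p M i k) x [v] = 0) \<longleftrightarrow>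
    F_omega M (\<sigma> x) = jet1 M SM (proj_K \<circ> (tau10 \<circ> \<sigma>)) x"
proof -
  let ?s = "tau10 \<circ> \<sigma>"
  have sm: "smooth_map_on M (J1_frame M) U \<sigma>" using s by (simp add: section_on_def)
  have U: "openin top_M U" by (rule openin_smooth_domain[OF sm])
  note ss = section_tau10[OF s]
  have sms: "smooth_map_on M LM U ?s" using ss by (simp add: section_on_def)
  have "x \<in> \<Union> (fst ` M)" using openin_subset[OF U] x unfolding topspace_manifold by blast
  then obtain c where c: "c \<in> M" "x \<in> fst c" by blast
  obtain d where d: "d \<in> LM" "adapted LM fst c d" using frame.adapted_ex[OF c(1)] by blast
  let ?J = "frame.jchart c d"
  let ?j = "\<sigma> x"
  have j: "?j \<in> frame_jets" "tau1 ?j = x" using section_jet[OF s x] by auto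
  have jc: "tau1 ?j \<in> fst c" using j c by simp
  have cx: "c \<in> charts_at M x" using c by (simp add: charts_at_iff)
  note T = jet_chart_tau[OF c(1) d j(1) jc]
  let ?e = "frame_mat c (tau10 ?j)" and ?F = "snd (snd (snd ?J ?j))"
  define E' where "E' = (\<lambda>w. jet_lin (snd (snd (snd ?J (jet1 M LM ?s x)))) w)"
  have E': "((\<lambda>y. frame_mat c (?s (cinv c y))) has_derivative E') (at (snd c x))"
    using frame_jet_chart(1)[OF U x ss c d] by (simp add: E'_def jet_lin_def)
  \<comment> \<open>Since \<open>tau10 \<circ> \<sigma>\<close> is the section \<open>?s\<close>,
    the tangent vector of \<sigma> along \<open>v\<close> has frame component
    \<open>E' (v c)\<close>. Hence \<omega> measures the difference between the actual slope of
    \<open>?s\<close> and the slope recorded in the jet, and \<open>p_part_eq_0_iff\<close>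
    applies.\<close>
  have pull: "(\<forall>i k. pullback M (J1_frame M) \<sigma> (omega_p M i k) x [v] = 0) \<longleftrightarrow>
      dmetric ?e (E' (v c) - jet_lin ?F (v c)) = 0" if v: "v \<in> tangent_space M x" for v
  proof -
    let ?w = "tmap M (J1_frame M) \<sigma> x v"
    have w: "?w \<in> tangent_space (J1_frame M) ?j" by (rule tmap_tangent[OF M smooth_J1_frame sm x])
    have sub: "\<sigma> ` U \<subseteq> frame_jets" using section_jet[OF s] by blast
    have "tmap (J1_frame M) LM tau10 ?j ?w = tmap M LM ?s x v"
      using tmap_comp[OF M smooth_J1_frame frame.B sm smooth_tau10 sub x v] by (simp add: o_def)
    then have "(fst (?w ?J), fst (snd (?w ?J))) = tmap M LM ?s x v d"
      using tmap_tau(1)[OF c(1) d j(1) jc w] by simp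
    also have "\<dots> = (v c, E' (v c))"
      using frame.section_coordinates(3)[OF U x ss c d v] frame.jet_chart_jet1(2)[OF U x ss c d]
      by (simp add: E'_def jet_lin_def)
    finally have w': "fst (?w ?J) = v c" "fst (snd (?w ?J)) = E' (v c)" by auto
    have "(\<forall>i k. pullback M (J1_frame M) \<sigma> (omega_p M i k) x [v] = 0) \<longleftrightarrow> p_part (omega_mat M ?j ?w) = 0"
      by (simp add: pullback_def omega_p_def vec_eq_iff)
    also have "\<dots> \<longleftrightarrow> dmetric ?e (E' (v c) - jet_lin ?F (v c)) = 0"
      unfolding omega_mat_chart[OF c(1) d j(1) jc w] w' by (rule p_part_eq_0_iff[OF T(3)])
    finally show ?thesis .
  qed
  have "F_omega M ?j = jet1 M SM (proj_K \<circ> ?s) x \<longleftrightarrow>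
      (\<forall>\<sigma>. dmetric ?e (?F $ \<sigma>) = dmetric ?e (E' (axis \<sigma> 1)))"
    using F_omega_eq_jet1_iff[where s="?s", OF U x ss c d j _ E'] unfolding o_def by simp
  also have "\<dots> \<longleftrightarrow> (\<forall>w. dmetric ?e (E' w - jet_lin ?F w) = 0)"
  proof
    assume eq: "\<forall>\<sigma>. dmetric ?e (?F $ \<sigma>) = dmetric ?e (E' (axis \<sigma> 1))"
    interpret d: bounded_linear "dmetric ?e" by (rule bounded_linear_dmetric)
    show "\<forall>w. dmetric ?e (E' w - jet_lin ?F w) = 0"
    proof
      fix w
      have "dmetric ?e (E' w) = (\<Sum>\<sigma>\<in>UNIV. w $ \<sigma> *\<^sub>R dmetric ?e (E' (axis \<sigma> 1)))"
        by (subst linear_axis_sum[OF has_derivative_linear[OF E']]) (simp add: d.sum d.scaleR)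
      moreover have "dmetric ?e (jet_lin ?F w) = (\<Sum>\<sigma>\<in>UNIV. w $ \<sigma> *\<^sub>R dmetric ?e (?F $ \<sigma>))"
        by (simp add: jet_lin_def d.sum d.scaleR)
      ultimately show "dmetric ?e (E' w - jet_lin ?F w) = 0" using eq by (simp add: d.diff)
    qed
  next
    assume "\<forall>w. dmetric ?e (E' w - jet_lin ?F w) = 0"
    then have "dmetric ?e (E' (axis \<sigma> 1) - jet_lin ?F (axis \<sigma> 1)) = 0" for \<sigma> by blast
    then show "\<forall>\<sigma>. dmetric ?e (?F $ \<sigma>) = dmetric ?e (E' (axis \<sigma> 1))"
      by (simp add: jet_lin_axis linear_diff[OF bounded_linear.linear[OF bounded_linear_dmetric]])
  qed
  also have "\<dots> \<longleftrightarrow> (\<forall>v\<in>tangent_space M x. dmetric ?e (E' (v c) - jet_lin ?F (v c)) = 0)"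
  proof (intro iffI ballI allI)
    fix w assume a: "\<forall>v\<in>tangent_space M x. dmetric ?e (E' (v c) - jet_lin ?F (v c)) = 0"
    from bspec[OF a tvec_of_tangent(1)[OF M cx, of w]] show "dmetric ?e (E' w - jet_lin ?F w) = 0"
      by (simp only: tvec_of_tangent(2)[OF M cx])
  qed blast
  finally show ?thesis using pull by simp
qed

section \<open>The torsion form and the submanifold \<open>T0\<close> in coordinates\<close>

lemma theta_chart:
  assumes c: "c \<in> M" and d: "d \<in> LM" "adapted LM fst c d"
    and j: "j \<in> frame_jets" "tau1 j \<in> fst c" and v: "v \<in> tangent_space (J1_frame M) j"
  shows "theta M i j [v] = (matrix_inv (transpose (frame_mat c (tau10 j))) *v
    fst (v (frame.jchart c d))) $ i"
proof -
  let ?J = "frame.jchart c d" and ?e = "frame_mat c (tau10 j)" and ?u = "tau10 j"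
  note T = jet_chart_tau[OF c d j] and ch = jet_chart_at[OF c d j]
  have u: "?u \<in> frame_bundle M" by (rule tau10_frame[OF j(1)])
  have cu: "c \<in> charts_at M (fst ?u)" using ch(3) T(4) by simp
  have sub: "tau10 ` frame_jets \<subseteq> \<Union> (fst ` LM)" using tau10_frame frame_carrier by blast
  let ?w = "tmap LM M fst ?u (tmap (J1_frame M) LM tau10 j v)"
  have o: "openin (manifold_topology (J1_frame M)) (frame_jets)" by (rule openin_smooth_domain[OF smooth_tau1])
  have ft: "fst (tau10 j') = tau1 j'" if j': "j' \<in> frame_jets" for j'
    by (rule frame.jets_cases[OF j']) (simp add: tau10_def tau1_def jet1_def section_on_def)
  have "?w = tmap (J1_frame M) M (\<lambda>j. fst (tau10 j)) j v"
    by (rule tmap_comp[OF smooth_J1_frame frame.B M smooth_tau10 frame.smooth_map_proj sub j(1) v, symmetric])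
  also have "\<dots> = tmap (J1_frame M) M tau1 j v"
    by (rule fun_cong[OF tmap_cong[OF smooth_J1_frame o j(1)]]) (rule ft)
  finally have w: "?w = tmap (J1_frame M) M tau1 j v" .
  have wt: "?w \<in> tangent_space M (fst ?u)" "?w c = fst (v ?J)"
    unfolding w using tmap_tangent[OF smooth_J1_frame M smooth_tau1 j(1), of v] T(4) tmap_tau(2)[OF c d j v] by simp_all
  have ti: "invertible (transpose ?e)" using T(3) by (simp add: invertible_det_nz det_transpose)
  have tl: "tlincomb (snd ?u) a \<in> tangent_space M (fst ?u)" for a
    by (rule tlincomb_tangent[OF M _ frame_bundleD(1)[OF u]]) (rule frame_bundleD(2)[OF u])
  have "?w = tlincomb (snd ?u) a \<longleftrightarrow> a = matrix_inv (transpose ?e) *v fst (v ?J)" for a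
  proof -
    have "?w = tlincomb (snd ?u) a \<longleftrightarrow> fst (v ?J) = transpose ?e *v a"
      using tangent_space_eqI[OF wt(1) tl cu, of a] wt(2) tlincomb_chart[of ?u a c] by metis
    also have "\<dots> \<longleftrightarrow> a = matrix_inv (transpose ?e) *v fst (v ?J)"
    proof
      assume "fst (v ?J) = transpose ?e *v a"
      then show "a = matrix_inv (transpose ?e) *v fst (v ?J)"
        by (simp only: matrix_vector_mul_assoc matrix_inv_eq[OF ti] matrix_vector_mul_lid)
    next
      assume "a = matrix_inv (transpose ?e) *v fst (v ?J)"
      then show "fst (v ?J) = transpose ?e *v a"
        by (simp only: matrix_vector_mul_assoc matrix_inv_eq[OF ti] matrix_vector_mul_lid)
    qed
    finally show ?thesis .
  qed
  then show ?thesis unfolding theta_def pullback_def taut_form_def by simp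
qed

lemma omega_length: "length vs \<noteq> 1 \<Longrightarrow> omega M i k j vs = 0"
  unfolding omega_def by (cases vs rule: remdups_adj.cases) auto

text \<open>\<open>ext_deriv\<close> computes in a chart picked by choice, and the hypothesis on the
  jet chart says that it is this one. In it \<theta> is the inverse of \<open>transpose e\<close>
  applied to the base component, and only that inverse varies when vector fields with constant
  components are inserted.\<close>

lemma ext_deriv_theta:
  assumes c: "c \<in> M" and d: "d \<in> LM" "adapted LM fst c d"
    and j: "j \<in> frame_jets" "tau1 j \<in> fst c"
    and J: "frame.jchart c d = (SOME J. J \<in> charts_at (J1_frame M) j)"
  defines "N \<equiv> matrix_inv (transpose (frame_mat c (tau10 j)))"
    and "K \<equiv> frame.jchart c d"
  shows "ext_deriv (J1_frame M) (theta M i) j [v, w] =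
    (N *v (transpose (fst (snd (w K))) *v (N *v fst (v K))) - N *v (transpose (fst (snd (v K))) *v (N *v fst (w K)))) $ i"
proof -
  note T = jet_chart_tau[OF c d j] and ch = jet_chart_at[OF c d j]
  have K: "K \<in> J1_frame M" "j \<in> fst K" using ch(1) by (simp_all add: K_def charts_at_iff)
  have ti: "invertible (transpose (frame_mat c (tau10 j)))" using T(3) by (simp add: invertible_det_nz det_transpose)
  have oK: "open (snd K ` fst K)" by (rule open_chart_image[OF smooth_J1_frame K(1)])
  have D: "frechet_derivative (\<lambda>y. theta M i (cinv K y) [tvec_of (J1_frame M) (cinv K y) K a]) (at (snd K j)) b =
      - (N *v (transpose (fst (snd b)) *v (N *v fst a))) $ i" for a b
  proof -
    have th: "theta M i (cinv K y) [tvec_of (J1_frame M) (cinv K y) K a] = (matrix_inv (transpose (fst (snd y))) *v fst a) $ i"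
      if y: "y \<in> snd K ` fst K" for y
    proof -
      have k: "cinv K y \<in> fst K" "snd K (cinv K y) = y" by (rule cinv_in[OF y], rule chart_cinv[OF y])
      have kj: "cinv K y \<in> frame_jets" "tau1 (cinv K y) \<in> fst c"
        using k(1) by (auto simp: K_def jet_chart_def tau1_def)
      have kc: "K \<in> charts_at (J1_frame M) (cinv K y)" using K k by (simp add: charts_at_iff)
      note tt = tvec_of_tangent[OF smooth_J1_frame kc, of a]
      show ?thesis
        using theta_chart[OF c d kj tt(1), folded K_def, of i] jet_chart_tau(2)[OF c d kj, folded K_def] k(2) tt(2) by simp
    qed
    have e0: "fst (snd (snd K j)) = frame_mat c (tau10 j)" using T(2) by (simp add: K_def)
    have "((\<lambda>y. matrix_inv (transpose (fst (snd y)))) has_derivative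
        (\<lambda>b. - (N ** transpose (fst (snd b)) ** N))) (at (snd K j))"
    proof -
      have 1: "((\<lambda>y. transpose (fst (snd y))) has_derivative (\<lambda>b. transpose (fst (snd b)))) (at (snd K j))"
        by (rule bounded_linear.has_derivative[OF bounded_linear_transpose]) (auto intro!: derivative_eq_intros)
      have 2: "(matrix_inv has_derivative (\<lambda>H. - (N ** H ** N))) (at (transpose (fst (snd (snd K j)))))"
        unfolding e0 N_def by (rule matrix_inv_has_derivative[OF ti])
      from diff_chain_at[OF 1 2] show ?thesis by (simp add: o_def)
    qed
    then have "((\<lambda>y. (matrix_inv (transpose (fst (snd y))) *v fst a) $ i) has_derivative
        (\<lambda>b. (- (N ** transpose (fst (snd b)) ** N) *v fst a) $ i)) (at (snd K j))"
      by (intro bounded_linear.has_derivative[OF bounded_linear_vec_nth]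
          bounded_linear.has_derivative[OF bounded_linear_matrix_vector_left])
    then have "((\<lambda>y. theta M i (cinv K y) [tvec_of (J1_frame M) (cinv K y) K a]) has_derivative
        (\<lambda>b. (- (N ** transpose (fst (snd b)) ** N) *v fst a) $ i)) (at (snd K j))"
      by (rule has_derivative_transform_within_open[OF _ oK]) (use K th in auto)
    moreover have "(- A *v x) $ i = - ((A *v x) $ i)" for A :: "'m rmat" and x
      by (simp add: matrix_vector_mult_def sum_negf)
    ultimately show ?thesis
      by (simp only: frechet_derivative_at[symmetric] matrix_vector_mul_assoc matrix_mul_assoc)
  qed
  have S: "(SOME J. J \<in> charts_at (J1_frame M) j) = K" using J by (simp add: K_def)
  show ?thesis
    unfolding ext_deriv_def S Let_def by (simp add: lessThan_Suc numeral_2_eq_2 D)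
qed

text \<open>The terms in which the frame component of a tangent vector occurs appear with opposite
  signs in the exterior derivative of \<theta> and in the wedge product with \<omega>. What remains
  depends on the slopes and the base components only.\<close>

lemma torsion_chart:
  assumes c: "c \<in> M" and d: "d \<in> LM" "adapted LM fst c d"
    and j: "j \<in> frame_jets" "tau1 j \<in> fst c"
    and J: "frame.jchart c d = (SOME J. J \<in> charts_at (J1_frame M) j)"
    and v: "v \<in> tangent_space (J1_frame M) j" and w: "w \<in> tangent_space (J1_frame M) j"
  defines "N \<equiv> matrix_inv (transpose (frame_mat c (tau10 j)))"
    and "K \<equiv> frame.jchart c d"
  shows "torsion M i j [v, w] =
    (N *v (transpose (jet_lin (snd (snd (snd K j))) (fst (w K))) *v (N *v fst (v K)) -
           transpose (jet_lin (snd (snd (snd K j))) (fst (v K))) *v (N *v fst (w K)))) $ i"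
proof -
  let ?F = "snd (snd (snd K j))"
  note T = jet_chart_tau[OF c d j]
  have om: "omega_mat M j v = N ** (transpose (fst (snd (v K))) - transpose (jet_lin ?F (fst (v K))))"
    if v: "v \<in> tangent_space (J1_frame M) j" for v
    unfolding omega_mat_chart[OF c d j v] K_def[symmetric] N_def matrix_inv_transpose[OF T(3)]
    by (simp add: matrix_transpose_mul transpose_diff)
  have sum: "(\<Sum>l\<in>UNIV. omega M i l j [a] * theta M l j [b]) =
      (N *v (transpose (fst (snd (a K))) *v (N *v fst (b K)) - transpose (jet_lin ?F (fst (a K))) *v (N *v fst (b K)))) $ i"
    if a: "a \<in> tangent_space (J1_frame M) j" and b: "b \<in> tangent_space (J1_frame M) j" for a b
  proof -
    have "(\<Sum>l\<in>UNIV. omega M i l j [a] * theta M l j [b]) = (omega_mat M j a *v (N *v fst (b K))) $ i"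
      by (simp add: omega_def theta_chart[OF c d j b] N_def K_def matrix_vector_mult_def[of "omega_mat M j a"])
    then show ?thesis
      by (simp add: om[OF a] matrix_vector_mult_diff_rdistrib flip: matrix_vector_mul_assoc)
  qed
  have "torsion M i j [v, w] = ext_deriv (J1_frame M) (theta M i) j [v, w] +
      ((\<Sum>l\<in>UNIV. omega M i l j [v] * theta M l j [w]) - (\<Sum>l\<in>UNIV. omega M i l j [w] * theta M l j [v]))"
    unfolding torsion_def by (simp add: wedge_1_1[where \<alpha>="omega M i l j" for l, OF omega_length] sum_subtractf)
  also have "\<dots> = (N *v (transpose (jet_lin ?F (fst (w K))) *v (N *v fst (v K)) -
           transpose (jet_lin ?F (fst (v K))) *v (N *v fst (w K)))) $ i"
    unfolding sum[OF v w] sum[OF w v] ext_deriv_theta[OF c d j J, folded N_def K_def]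
    by (simp add: matrix_vector_mult_diff_distrib)
  finally show ?thesis .
qed

text \<open>\<open>J' \<xi> *v \<zeta>\<close> is the second derivative of the coordinate change in
  the directions \<zeta> and \<xi>.\<close>

lemma jacobian_derivative_symmetric:
  assumes c: "c \<in> charts_at M x" "c' \<in> charts_at M x"
  defines "J' \<equiv> frechet_derivative (chart_jacobian c c') (at (snd c x))"
  shows "(chart_jacobian c c' has_derivative J') (at (snd c x))" "J' \<xi> *v \<zeta> = J' \<zeta> *v \<xi>"
proof -
  have cc: "c \<in> M" "c' \<in> M" "x \<in> fst c" "x \<in> fst c'" using c by (auto simp: charts_at_iff)
  let ?S = "snd c ` (fst c \<inter> fst c')" and ?\<phi> = "\<lambda>y. snd c' (cinv c y)"
  have S: "open ?S" "snd c x \<in> ?S" using open_overlap[OF M cc(1,2)] cc by auto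
  note sp = smooth_transition[OF M cc(1,2)]
  show D: "(chart_jacobian c c' has_derivative J') (at (snd c x))"
    unfolding J'_def by (rule smooth_on_has_derivative[OF smooth_jacobian[OF M cc(1,2)] S])
  have lin: "J' \<xi> *v \<zeta> = frechet_derivative (\<lambda>y. frechet_derivative ?\<phi> (at y) \<zeta>) (at (snd c x)) \<xi>" for \<xi> \<zeta>
  proof -
    from bounded_linear.has_derivative[OF bounded_linear_matrix_vector_left D]
    have "((\<lambda>y. chart_jacobian c c' y *v \<zeta>) has_derivative (\<lambda>\<xi>. J' \<xi> *v \<zeta>)) (at (snd c x))" .
    then have "((\<lambda>y. frechet_derivative ?\<phi> (at y) \<zeta>) has_derivative (\<lambda>\<xi>. J' \<xi> *v \<zeta>)) (at (snd c x))"
    proof (rule has_derivative_transform_within_open[OF _ S])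
      fix y assume "y \<in> ?S"
      then obtain p where p: "y = snd c p" "c \<in> charts_at M p" "c' \<in> charts_at M p" using cc by (auto simp: charts_at_iff)
      show "chart_jacobian c c' y *v \<zeta> = frechet_derivative ?\<phi> (at y) \<zeta>"
        using jacobian_mult[OF M p(2,3)] by (simp add: p(1) o_def)
    qed
    from fun_cong[OF frechet_derivative_at[OF this], of \<xi>] show ?thesis .
  qed
  show "J' \<xi> *v \<zeta> = J' \<zeta> *v \<xi>"
    unfolding lin by (rule smooth_on_second_derivative_commute[OF sp S])
qed

text \<open>The slopes transform inhomogeneously, like connection coefficients: the extra term is
  the Hessian of the coordinate change. It is symmetric in its two arguments, so it drops out of the
  symmetry condition.\<close>

lemma torsion_free_transition:
  assumes c: "c \<in> M" and d: "d \<in> LM" "adapted LM fst c d"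
    and c': "c' \<in> M" and d': "d' \<in> LM" "adapted LM fst c' d'"
    and j: "j \<in> frame_jets" "tau1 j \<in> fst c" "tau1 j \<in> fst c'"
    and tf: "torsion_free (frame_mat c (tau10 j)) (snd (snd (snd (frame.jchart c d) j)))"
  shows "torsion_free (frame_mat c' (tau10 j)) (snd (snd (snd (frame.jchart c' d') j)))"
proof -
  obtain s x W where s: "j = jet1 M LM s x" "openin top_M W" "x \<in> W" "frame_section W s"
    using frame.jets_cases[OF j(1)] by blast
  have x: "tau1 j = x" "tau10 j = s x" "x \<in> fst c" "x \<in> fst c'" using j s(1) by (auto simp: tau1_def tau10_def jet1_def)
  have cc: "c \<in> charts_at M x" "c' \<in> charts_at M x" using c c' x by (auto simp: charts_at_iff)
  let ?F = "snd (snd (snd (frame.jchart c d) j))"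
  let ?F' = "snd (snd (snd (frame.jchart c' d') j))"
  let ?e = "frame_mat c (s x)" and ?e' = "frame_mat c' (s x)"
  let ?y = "snd c x" and ?y' = "snd c' x"
  let ?J = "chart_jacobian c c' ?y"
  define J' where "J' = frechet_derivative (chart_jacobian c c') (at ?y)"
  note JD = jacobian_derivative_symmetric[OF cc, folded J'_def]
  define \<psi> where "\<psi> = frechet_derivative (snd c \<circ> cinv c') (at ?y')"
  have \<psi>D: "((\<lambda>y. snd c (cinv c' y)) has_derivative \<psi>) (at ?y')"
    unfolding \<psi>_def by (rule transition_has_derivative[OF M cc(2,1)])
  have J\<psi>: "?J *v \<psi> w = w" for w
    using transition_chain[OF M cc(2,1,2), of w] transition_self[OF M cc(2), of w]
    by (simp add: jacobian_mult[OF M cc] \<psi>_def)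
  have FD: "((\<lambda>y. frame_mat c (s (cinv c y))) has_derivative jet_lin ?F) (at ?y)"
    using frame_jet_chart(1)[OF s(2-4) c x(3) d] s(1) by (simp add: jet_lin_def[abs_def])
  have FD': "((\<lambda>y. frame_mat c' (s (cinv c' y))) has_derivative jet_lin ?F') (at ?y')"
    using frame_jet_chart(1)[OF s(2-4) c' x(4) d'] s(1) by (simp add: jet_lin_def[abs_def])
  have e': "?e' = ?e ** transpose ?J"
    using frame_mat_transition[OF M, of c "s x" c'] cc section_frame[OF s(4,3)] s(3,4) by (simp add: section_on_def)
  have tD: "((\<lambda>y. transpose (chart_jacobian c c' y)) has_derivative (\<lambda>\<xi>. transpose (J' \<xi>))) (at ?y)"
    by (rule bounded_linear.has_derivative[OF bounded_linear_transpose JD(1)])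
  have "((\<lambda>y. frame_mat c (s (cinv c y)) ** transpose (chart_jacobian c c' y)) has_derivative
      (\<lambda>\<xi>. ?e ** transpose (J' \<xi>) + jet_lin ?F \<xi> ** transpose ?J)) (at ?y)"
    using bounded_bilinear.FDERIV[OF bounded_bilinear_matrix_mult FD tD] cinv_chart[OF M c x(3)] by simp
  then have "((\<lambda>y. frame_mat c (s (cinv c y)) ** transpose (chart_jacobian c c' y)) has_derivative
      (\<lambda>\<xi>. ?e ** transpose (J' \<xi>) + jet_lin ?F \<xi> ** transpose ?J)) (at (snd c (cinv c' ?y')))"
    using cinv_chart[OF M c' x(4)] by simp
  from diff_chain_at[OF \<psi>D this]
  have comp: "((\<lambda>y'. frame_mat c (s (cinv c (snd c (cinv c' y')))) ** transpose (chart_jacobian c c' (snd c (cinv c' y')))) has_derivative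
      (\<lambda>w. ?e ** transpose (J' (\<psi> w)) + jet_lin ?F (\<psi> w) ** transpose ?J)) (at ?y')"
    by (simp add: o_def)
  have oW: "open (snd c' ` (fst c' \<inter> (W \<inter> fst c)))"
    by (rule open_image_chart[OF M c' openin_Int[OF s(2) openin_chart_domain[OF c]]])
  have "((\<lambda>y. frame_mat c' (s (cinv c' y))) has_derivative
      (\<lambda>w. ?e ** transpose (J' (\<psi> w)) + jet_lin ?F (\<psi> w) ** transpose ?J)) (at ?y')"
  proof (rule has_derivative_transform_within_open[OF comp oW])
    show "?y' \<in> snd c' ` (fst c' \<inter> (W \<inter> fst c))" using x s(3) by auto
    fix y' assume "y' \<in> snd c' ` (fst c' \<inter> (W \<inter> fst c))"
    then obtain p where p: "p \<in> fst c'" "p \<in> W" "p \<in> fst c" "y' = snd c' p" by blast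
    have "frame_mat c' (s p) = frame_mat c (s p) ** transpose (chart_jacobian c c' (snd c p))"
      using frame_mat_transition[OF M, of c "s p" c'] c c' p section_frame[OF s(4) p(2)] s(4) by (simp add: section_on_def charts_at_iff)
    then show "frame_mat c (s (cinv c (snd c (cinv c' y')))) ** transpose (chart_jacobian c c' (snd c (cinv c' y'))) = frame_mat c' (s (cinv c' y'))"
      using p cinv_chart[OF M c] cinv_chart[OF M c'] by simp
  qed
  then have "(\<lambda>w. ?e ** transpose (J' (\<psi> w)) + jet_lin ?F (\<psi> w) ** transpose ?J) = jet_lin ?F'"
    by (rule has_derivative_unique[OF _ FD'])
  then have lin': "jet_lin ?F' w = ?e ** transpose (J' (\<psi> w)) + jet_lin ?F (\<psi> w) ** transpose ?J" for w
    by (rule fun_cong[OF sym])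
  have ei: "invertible (transpose ?e)" "invertible (transpose ?e')"
    using jet_chart_tau(3)[OF c d j(1,2)] jet_chart_tau(3)[OF c' d' j(1,3)] x(2) by (simp_all add: invertible_det_nz det_transpose)
  let ?N = "matrix_inv (transpose ?e)" and ?N' = "matrix_inv (transpose ?e')"
  have N': "?N' *v w = ?N *v \<psi> w" for w
  proof -
    have "transpose ?e' *v (?N *v \<psi> w) = ?J *v ((transpose ?e ** ?N) *v \<psi> w)"
      by (simp only: e' matrix_transpose_mul transpose_transpose matrix_vector_mul_assoc matrix_mul_assoc)
    then have "transpose ?e' *v (?N *v \<psi> w) = w" using J\<psi> by (simp only: matrix_inv_eq[OF ei(1)] matrix_vector_mul_lid)
    then have "?N' *v w = (?N' ** transpose ?e') *v (?N *v \<psi> w)" by (simp only: matrix_vector_mul_assoc[symmetric])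
    then show ?thesis by (simp only: matrix_inv_eq[OF ei(2)] matrix_vector_mul_lid)
  qed
  \<comment> \<open>The transformation law of the connection coefficients, with the Hessian as first
    summand and the tensorial part as second.\<close>
  have "transpose (jet_lin ?F' \<xi>) *v (?N' *v \<zeta>) = J' (\<psi> \<xi>) *v \<psi> \<zeta> + ?J *v (transpose (jet_lin ?F (\<psi> \<xi>)) *v (?N *v \<psi> \<zeta>))" for \<xi> \<zeta>
  proof -
    have "transpose (jet_lin ?F' \<xi>) *v (?N' *v \<zeta>) = (J' (\<psi> \<xi>) ** transpose ?e + ?J ** transpose (jet_lin ?F (\<psi> \<xi>))) *v (?N *v \<psi> \<zeta>)"
      by (simp only: lin' N' transpose_add matrix_transpose_mul transpose_transpose)
    also have "\<dots> = J' (\<psi> \<xi>) *v ((transpose ?e ** ?N) *v \<psi> \<zeta>) + ?J *v (transpose (jet_lin ?F (\<psi> \<xi>)) *v (?N *v \<psi> \<zeta>))"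
      by (simp only: matrix_vector_mult_add_rdistrib matrix_add_rdistrib matrix_vector_mul_assoc matrix_mul_assoc)
    finally show ?thesis by (simp only: matrix_inv_eq[OF ei(1)] matrix_vector_mul_lid)
  qed
  then show ?thesis
    using tf JD(2) unfolding torsion_free_def x(2) by metis
qed

text \<open>The torsion form can be evaluated directly only in the chart chosen by
  \<open>ext_deriv\<close>. The condition is established there and carried to an arbitrary jet chart
  by \<open>torsion_free_transition\<close>.\<close>

lemma T0_iff:
  assumes c: "c \<in> M" and d: "d \<in> LM" "adapted LM fst c d"
    and j: "j \<in> frame_jets" "tau1 j \<in> fst c"
  shows "j \<in> T0 M \<longleftrightarrow> torsion_free (frame_mat c (tau10 j)) (snd (snd (snd (frame.jchart c d) j)))"
proof -
  let ?K = "SOME J. J \<in> charts_at (J1_frame M) j"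
  have "?K \<in> charts_at (J1_frame M) j" using jet_chart_at(1)[OF c d j] by (rule someI)
  then obtain c0 d0 where c0: "c0 \<in> M" and d0: "d0 \<in> LM" "adapted LM fst c0 d0"
    and K: "frame.jchart c0 d0 = ?K" and jK: "j \<in> fst (frame.jchart c0 d0)"
    unfolding charts_at_iff J1_frame_def jet_atlas_eq by auto
  have j0: "tau1 j \<in> fst c0" using jK by (auto simp: jet_chart_def tau1_def)
  let ?F = "snd (snd (snd (frame.jchart c0 d0) j))"
  let ?K' = "frame.jchart c0 d0"
  let ?e = "frame_mat c0 (tau10 j)"
  let ?N = "matrix_inv (transpose ?e)"
  have ti: "invertible (transpose ?e)" using jet_chart_tau(3)[OF c0 d0 j(1) j0] by (simp add: invertible_det_nz det_transpose)
  note tor = torsion_chart[OF c0 d0 j(1) j0 K]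
  have Kc: "?K' \<in> charts_at (J1_frame M) j" by (rule jet_chart_at(1)[OF c0 d0 j(1) j0])
  have "j \<in> T0 M \<longleftrightarrow> torsion_free ?e ?F"
  proof
    assume T: "j \<in> T0 M"
    have "transpose (jet_lin ?F \<xi>) *v (?N *v \<zeta>) = transpose (jet_lin ?F \<zeta>) *v (?N *v \<xi>)" for \<xi> \<zeta>
    proof -
      \<comment> \<open>The torsion sees base components only, so tangent vectors with these
        components and zero elsewhere test all pairs \<zeta>, \<xi>.\<close>
      let ?v = "tvec_of (J1_frame M) j ?K' (\<zeta>, 0, 0)" and ?w = "tvec_of (J1_frame M) j ?K' (\<xi>, 0, 0)"
      note v = tvec_of_tangent[OF smooth_J1_frame Kc, of "(\<zeta>, 0, 0)"] and w = tvec_of_tangent[OF smooth_J1_frame Kc, of "(\<xi>, 0, 0)"]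
      have "torsion M i j [?v, ?w] = 0" for i
        using T v(1) w(1) unfolding T0_def by simp
      then have "?N *v (transpose (jet_lin ?F \<xi>) *v (?N *v \<zeta>) - transpose (jet_lin ?F \<zeta>) *v (?N *v \<xi>)) = 0"
        unfolding tor[OF v(1) w(1)] v(2) w(2) fst_conv by (simp add: vec_eq_iff)
      then have "transpose ?e *v (?N *v (transpose (jet_lin ?F \<xi>) *v (?N *v \<zeta>) - transpose (jet_lin ?F \<zeta>) *v (?N *v \<xi>))) = 0"
        by (simp only: matrix_vector_mult_0_right)
      then show ?thesis
        by (simp only: matrix_vector_mul_assoc[of "transpose ?e"] matrix_inv_eq[OF ti] matrix_vector_mul_lid right_minus_eq)
    qed
    then show "torsion_free ?e ?F" unfolding torsion_free_def by blast
  next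
    assume tf: "torsion_free ?e ?F"
    have "torsion M i j vs = 0" if vs: "set vs \<subseteq> tangent_space (J1_frame M) j" "length vs = 2" for i vs
    proof -
      obtain v w where "vs = [v, w]" using vs(2) by (auto simp: length_Suc_conv numeral_2_eq_2)
      moreover have "transpose (jet_lin ?F (fst (w ?K'))) *v (?N *v fst (v ?K')) - transpose (jet_lin ?F (fst (v ?K'))) *v (?N *v fst (w ?K')) = 0"
        using tf unfolding torsion_free_def right_minus_eq by blast
      ultimately show ?thesis using tor[of v w i] vs(1) by simp
    qed
    then show "j \<in> T0 M" unfolding T0_def using j(1) by blast
  qed
  also have "\<dots> \<longleftrightarrow> torsion_free (frame_mat c (tau10 j)) (snd (snd (snd (frame.jchart c d) j)))"
    using torsion_free_transition[OF c0 d0 c d j(1) j0 j(2)] torsion_free_transition[OF c d c0 d0 j(1,2) j0] by blast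
  finally show ?thesis .
qed

end

section \<open>Smooth families over a cylinder\<close>

definition cylinder_chart :: "('p, 'e) chart \<Rightarrow> (real \<times> 'p, real \<times> 'e) chart" where
  "cylinder_chart c = (UNIV \<times> fst c, map_prod id (snd c))"

lemma cylinder_atlas_eq: "cylinder_atlas A = cylinder_chart ` A"
  by (simp add: cylinder_atlas_def cylinder_chart_def[abs_def])

lemma map_prod_id_image: "map_prod id g ` (I \<times> S) = I \<times> g ` S"
proof (intro equalityI subsetI)
  fix z assume "z \<in> I \<times> g ` S"
  then obtain t x where "z = (t, g x)" "t \<in> I" "x \<in> S" by auto
  then show "z \<in> map_prod id g ` (I \<times> S)" by (intro image_eqI[of _ _ "(t, x)"]) auto
qed auto

lemma cylinder_chart_cinv:
  assumes "smooth_atlas A" "c \<in> A" "y \<in> snd c ` fst c"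
  shows "cinv (cylinder_chart c) (t, y) = (t, cinv c y)"
proof -
  have i: "inj_on (snd (cylinder_chart c)) (fst (cylinder_chart c))"
    using assms(1,2) by (auto simp: cylinder_chart_def smooth_atlas_def inj_on_def)
  have "(t, cinv c y) \<in> fst (cylinder_chart c)" "snd (cylinder_chart c) (t, cinv c y) = (t, y)"
    using cinv_in[OF assms(3)] chart_cinv[OF assms(3)] by (simp_all add: cylinder_chart_def)
  then show ?thesis using inv_into_f_f[OF i] by metis
qed

lemma smooth_cylinder_atlas:
  assumes A: "smooth_atlas A"
  shows "smooth_atlas (cylinder_atlas A)"
  unfolding smooth_atlas_def
proof (intro conjI ballI)
  fix k assume "k \<in> cylinder_atlas A"
  then show "inj_on (snd k) (fst k)"
    using A by (auto simp: cylinder_atlas_eq cylinder_chart_def smooth_atlas_def inj_on_def)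
next
  fix k k' assume "k \<in> cylinder_atlas A" "k' \<in> cylinder_atlas A"
  then obtain c d where c: "c \<in> A" "k = cylinder_chart c" and d: "d \<in> A" "k' = cylinder_chart d"
    unfolding cylinder_atlas_eq by blast
  let ?S = "UNIV \<times> snd c ` (fst c \<inter> fst d) :: (real \<times> 'b) set"
  have S: "snd k ` (fst k \<inter> fst k') = ?S"
    by (simp add: c d cylinder_chart_def Times_Int_Times map_prod_id_image)
  have o: "open ?S" by (intro open_Times open_UNIV open_overlap[OF A c(1) d(1)])
  have f: "smooth_on ?S (\<lambda>z. fst z)" "smooth_on ?S (\<lambda>z. snd z)" by (intro smooth_intros smooth_on_id o)+
  have "smooth_on ?S (\<lambda>z. snd d (cinv c (snd z)))"
    by (rule smooth_on_compose[OF smooth_transition[OF A c(1) d(1)] open_overlap[OF A c(1) d(1)] f(2) o]) auto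
  then have sm: "smooth_on ?S (\<lambda>z. (fst z, snd d (cinv c (snd z))))" by (intro smooth_intros o f)
  show "open (snd k ` (fst k \<inter> fst k'))" using o by (simp only: S)
  show "smooth_on (snd k ` (fst k \<inter> fst k')) (snd k' \<circ> cinv k)"
    unfolding S
  proof (rule smooth_on_cong[OF sm o])
    fix z assume "z \<in> ?S"
    then have "snd z \<in> snd c ` fst c" by auto
    from cylinder_chart_cinv[OF A c(1) this, of "fst z"]
    show "(fst z, snd d (cinv c (snd z))) = (snd k' \<circ> cinv k) z" by (simp add: c d cylinder_chart_def)
  qed
qed

lemma smooth_family_coordinates:
  assumes A: "smooth_atlas A" and B: "smooth_atlas B" and I: "open I" and U: "openin (manifold_topology A) U"
    and f: "smooth_map_on (cylinder_atlas A) B (I \<times> U) (\<lambda>(t, x). f t x)" and c: "c \<in> A" and d: "d \<in> B"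
    and fd: "\<And>t x. t \<in> I \<Longrightarrow> x \<in> U \<Longrightarrow> x \<in> fst c \<Longrightarrow> f t x \<in> fst d"
  shows "smooth_on (I \<times> snd c ` (fst c \<inter> U)) (\<lambda>z. snd d (f (fst z) (cinv c (snd z))))"
proof (rule smooth_on_local)
  fix z assume "z \<in> I \<times> snd c ` (fst c \<inter> U)"
  then obtain t x where z: "z = (t, snd c x)" "t \<in> I" "x \<in> fst c" "x \<in> U" by auto
  let ?k = "cylinder_chart c"
  have k: "?k \<in> charts_at (cylinder_atlas A) (t, x)"
    using c z by (simp add: charts_at_iff cylinder_atlas_eq) (simp add: cylinder_chart_def)
  have dd: "d \<in> charts_at B ((\<lambda>(t, x). f t x) (t, x))" using d fd z by (simp add: charts_at_iff)
  have tx: "(t, x) \<in> I \<times> U" using z by simp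
  obtain V where V: "open V" "snd ?k (t, x) \<in> V" "V \<subseteq> snd ?k ` fst ?k"
    "smooth_on V (\<lambda>y. snd d ((\<lambda>(t, x). f t x) (cinv ?k y)))"
    using smooth_map_on_charts[OF smooth_cylinder_atlas[OF A] B f tx k dd] by metis
  have "smooth_on V (\<lambda>z. snd d (f (fst z) (cinv c (snd z))))"
  proof (rule smooth_on_cong[OF V(4,1)])
    fix y assume "y \<in> V"
    then have "snd y \<in> snd c ` fst c" using V(3) by (auto simp: cylinder_chart_def map_prod_id_image)
    from cylinder_chart_cinv[OF A c this, of "fst y"]
    show "snd d ((\<lambda>(t, x). f t x) (cinv ?k y)) = snd d (f (fst y) (cinv c (snd y)))" by simp
  qed
  moreover have "z \<in> V" using V(2) z(1) by (simp add: cylinder_chart_def)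
  ultimately show "\<exists>T. open T \<and> z \<in> T \<and> smooth_on T (\<lambda>z. snd d (f (fst z) (cinv c (snd z))))" using V(1) by blast
qed

text \<open>Bundle charts contain all values of the family over a base chart, so one target chart
  serves for the whole strip \<open>I \<times> (U \<inter> fst c)\<close> and no shrinking is
  necessary.\<close>

lemma smooth_familyI:
  assumes A: "smooth_atlas A" and I: "open I" and U: "openin (manifold_topology A) U"
    and f: "\<And>c. c \<in> A \<Longrightarrow> \<exists>d\<in>B. (\<forall>t\<in>I. \<forall>x\<in>U \<inter> fst c. f t x \<in> fst d) \<and>
      smooth_on (I \<times> snd c ` (fst c \<inter> U)) (\<lambda>z. snd d (f (fst z) (cinv c (snd z))))"
  shows "smooth_map_on (cylinder_atlas A) B (I \<times> U) (\<lambda>(t, x). f t x)"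
proof (rule smooth_map_onI[OF smooth_cylinder_atlas[OF A]])
  fix p assume "p \<in> I \<times> U"
  then obtain t x where p: "p = (t, x)" "t \<in> I" "x \<in> U" by auto
  have "x \<in> \<Union> (fst ` A)" using p(3) openin_subset[OF U] unfolding topspace_manifold by blast
  then obtain c where c: "c \<in> A" "x \<in> fst c" by blast
  obtain d where d: "d \<in> B" "\<And>t x. t \<in> I \<Longrightarrow> x \<in> U \<Longrightarrow> x \<in> fst c \<Longrightarrow> f t x \<in> fst d"
    and sm: "smooth_on (I \<times> snd c ` (fst c \<inter> U)) (\<lambda>z. snd d (f (fst z) (cinv c (snd z))))"
    using f[OF c(1)] by blast
  let ?k = "cylinder_chart c"
  let ?V = "I \<times> snd c ` (fst c \<inter> U)"
  have o: "open ?V" by (intro open_Times I open_image_chart[OF A c(1) U])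
  have kz: "cinv ?k z = (fst z, cinv c (snd z))" if "z \<in> ?V" for z
    using that cylinder_chart_cinv[OF A c(1), of "snd z" "fst z"] by auto
  have kU: "cinv c (snd z) \<in> fst c \<inter> U" if "z \<in> ?V" for z
    using that cinv_chart[OF A c(1)] by auto
  show "\<exists>k d V. k \<in> charts_at (cylinder_atlas A) p \<and> d \<in> charts_at B ((\<lambda>(t, x). f t x) p) \<and> open V \<and> snd k p \<in> V \<and>
      V \<subseteq> snd k ` fst k \<and> cinv k ` V \<subseteq> I \<times> U \<and> (\<lambda>(t, x). f t x) ` cinv k ` V \<subseteq> fst d \<and>
      smooth_on V (\<lambda>y. snd d ((\<lambda>(t, x). f t x) (cinv k y)))"
  proof (intro exI conjI)
    show "?k \<in> charts_at (cylinder_atlas A) p"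
      using c p by (simp add: charts_at_iff cylinder_atlas_eq) (simp add: cylinder_chart_def)
    show "d \<in> charts_at B ((\<lambda>(t, x). f t x) p)" using d c p by (simp add: charts_at_iff)
    show "open ?V" by (rule o)
    show "snd ?k p \<in> ?V" using c p by (simp add: cylinder_chart_def)
    show "?V \<subseteq> snd ?k ` fst ?k" by (auto simp: cylinder_chart_def map_prod_id_image)
    show "cinv ?k ` ?V \<subseteq> I \<times> U" using kz kU by (auto simp: mem_Times_iff)
    show "(\<lambda>(t, x). f t x) ` cinv ?k ` ?V \<subseteq> fst d"
    proof
      fix q assume "q \<in> (\<lambda>(t, x). f t x) ` cinv ?k ` ?V"
      then obtain z where z: "z \<in> ?V" "q = (\<lambda>(t, x). f t x) (cinv ?k z)" by blast
      then show "q \<in> fst d"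
        using d(2)[of "fst z" "cinv c (snd z)"] kz[OF z(1)] kU[OF z(1)] by (simp add: mem_Times_iff)
    qed
    show "smooth_on ?V (\<lambda>y. snd d ((\<lambda>(t, x). f t x) (cinv ?k y)))"
      by (rule smooth_on_cong[OF sm o]) (simp add: kz)
  qed
qed

lemma smooth_family_slice:
  assumes A: "smooth_atlas A" and B: "smooth_atlas B" and U: "openin (manifold_topology A) U"
    and f: "smooth_map_on (cylinder_atlas A) B (I \<times> U) (\<lambda>(t, x). f t x)" and t: "t \<in> I"
  shows "smooth_map_on A B U (f t)"
proof -
  have "smooth_map_on A (cylinder_atlas A) (\<Union> (fst ` A)) (\<lambda>x. (t, x))"
  proof (rule smooth_map_on_Union)
    fix W assume "W \<in> fst ` A"
    then obtain c where c: "c \<in> A" "W = fst c" by blast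
    have o: "open (snd c ` fst c)" by (rule open_chart_image[OF A c(1)])
    have sm: "smooth_on (snd c ` fst c) (\<lambda>y. (t, y))" by (intro smooth_intros smooth_on_id o)
    show "smooth_map_on A (cylinder_atlas A) W (\<lambda>x. (t, x))"
      unfolding c(2)
    proof (rule smooth_map_on_chart[OF A c(1), of "cylinder_chart c"])
      show "smooth_on (snd c ` fst c) (\<lambda>y. snd (cylinder_chart c) (t, cinv c y))"
        by (rule smooth_on_cong[OF sm o]) (simp add: cylinder_chart_def chart_cinv)
    qed (use c in \<open>auto simp: cylinder_atlas_eq cylinder_chart_def\<close>)
  qed
  then have i: "smooth_map_on A (cylinder_atlas A) U (\<lambda>x. (t, x))"
    by (rule smooth_map_on_subset[OF A smooth_cylinder_atlas[OF A] _ U]) (use openin_subset[OF U] topspace_manifold in metis)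
  have "smooth_map_on A B U (\<lambda>x. (\<lambda>(t, x). f t x) (t, x))"
    by (rule smooth_map_on_compose[OF A smooth_cylinder_atlas[OF A] B i f]) (use t in auto)
  then show ?thesis by simp
qed

section \<open>Integration over compact sets\<close>

lemma compactin_finite_cover:
  assumes C: "compactin X C" and N: "\<forall>i\<in>I. openin X (N i)" "C \<subseteq> \<Union> (N ` I)"
  shows "\<exists>F. finite F \<and> F \<subseteq> I \<and> C \<subseteq> \<Union> (N ` F)"
proof -
  have "\<forall>W\<in>N ` I. openin X W" using N(1) by blast
  then obtain \<F> where \<F>: "finite \<F>" "\<F> \<subseteq> N ` I" "C \<subseteq> \<Union>\<F>"
    using mp[OF spec[OF conjunct2[OF C[unfolded compactin_def]], of "N ` I"]] N(2) by blast
  from finite_subset_image[OF \<F>(1,2)] obtain F where "F \<subseteq> I" "finite F" "\<F> = N ` F" by blast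
  with \<F>(3) show ?thesis by blast
qed

text \<open>Each further chart contributes the part of \<open>C\<close> in its domain that the
  earlier domains do not cover. In coordinates this part is a difference of two open sets and
  therefore Borel.\<close>

lemma chart_partition_Union:
  assumes A: "smooth_atlas A" and C: "closedin (manifold_topology A) C"
    and F: "finite F" "F \<subseteq> A"
  shows "\<exists>P. chart_partition A (C \<inter> \<Union> (fst ` F)) P"
  using F
proof (induction F rule: finite_induct)
  case empty
  show ?case by (rule exI[of _ "{}"]) (simp add: chart_partition_def)
next
  case (insert c F)
  then obtain P where P: "chart_partition A (C \<inter> \<Union> (fst ` F)) P" by auto
  have c: "c \<in> A" and F: "F \<subseteq> A" using insert by auto
  define D where "D = C \<inter> fst c - \<Union> (fst ` F)"
  \<comment> \<open>The open set to be removed from the domain of \<open>c\<close>: the complement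
    of the closed set \<open>C\<close> together with the earlier domains.\<close>
  define N where "N = (topspace (manifold_topology A) - C) \<union> \<Union> (fst ` F)"
  have N: "openin (manifold_topology A) N"
    unfolding N_def using C F openin_chart_domain by (intro openin_Un openin_Union) (auto simp: closedin_def)
  have ct: "fst c \<subseteq> topspace (manifold_topology A)" unfolding topspace_manifold using c by blast
  have "D = fst c - (fst c \<inter> N)" unfolding D_def N_def using ct by blast
  moreover have "inj_on (snd c) (fst c)" using A c by (simp add: smooth_atlas_def)
  ultimately have "snd c ` D = snd c ` fst c - snd c ` (fst c \<inter> N)"
    using inj_on_image_set_diff[of "snd c" "fst c" "fst c" "fst c \<inter> N"] by auto
  then have b: "snd c ` D \<in> sets borel"
    using open_chart_image[OF A c] open_image_chart[OF A c N] by auto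
  have disj: "D \<inter> snd q = {}" if "q \<in> P" for q
  proof -
    have "snd q \<subseteq> \<Union> (snd ` P)" using that by blast
    also have "\<dots> = C \<inter> \<Union> (fst ` F)" using P by (simp add: chart_partition_def)
    finally show ?thesis unfolding D_def by blast
  qed
  have "chart_partition A (C \<inter> \<Union> (fst ` insert c F)) (insert (c, D) P)"
    unfolding chart_partition_def
  proof (intro conjI)
    show "finite (insert (c, D) P)" using P by (simp add: chart_partition_def)
    show "\<forall>(c, D)\<in>insert (c, D) P. c \<in> A \<and> D \<subseteq> fst c \<and> snd c ` D \<in> sets borel"
      using P b c unfolding chart_partition_def D_def by auto
    show "\<forall>q\<in>insert (c, D) P. \<forall>r\<in>insert (c, D) P. q \<noteq> r \<longrightarrow> snd q \<inter> snd r = {}"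
    proof (intro ballI impI)
      fix q r assume "q \<in> insert (c, D) P" "r \<in> insert (c, D) P" "q \<noteq> r"
      moreover have "snd q \<inter> snd r = {}" if "q \<in> P" "r \<in> P" "q \<noteq> r"
        using P that unfolding chart_partition_def by blast
      ultimately show "snd q \<inter> snd r = {}" using disj by (metis Int_commute insert_iff snd_conv)
    qed
    have "\<Union> (snd ` P) = C \<inter> \<Union> (fst ` F)" using P by (simp add: chart_partition_def)
    then show "\<Union> (snd ` insert (c, D) P) = C \<inter> \<Union> (fst ` insert c F)" unfolding D_def by auto
  qed
  then show ?case by blast
qed

text \<open>\<open>form_integral\<close> picks a partition by choice, so its pieces have the
  expected properties once some partition exists. Compactness gives finitely many charts, and the
  Hausdorff property makes \<open>C\<close> closed.\<close>

lemma chart_partition_ex: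
  assumes A: "smooth_manifold A" and C: "compactin (manifold_topology A) C"
  shows "\<exists>P. chart_partition A C P"
proof -
  have sA: "smooth_atlas A" by (rule smooth_manifold_imp_smooth_atlas[OF A])
  have cl: "closedin (manifold_topology A) C"
    using A C compactin_imp_closedin by (auto simp: smooth_manifold_def)
  have "C \<subseteq> \<Union> (fst ` A)" using compactin_subset_topspace[OF C] by (simp only: topspace_manifold)
  moreover have "\<forall>c\<in>A. openin (manifold_topology A) (fst c)" by (intro ballI openin_chart_domain)
  ultimately obtain F where F: "finite F" "F \<subseteq> A" "C \<subseteq> \<Union> (fst ` F)"
    using compactin_finite_cover[OF C, of A fst] by blast
  have "C \<inter> \<Union> (fst ` F) = C" using F(3) by blast
  then show ?thesis using chart_partition_Union[OF sA cl F(1,2)] by simp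
qed

text \<open>The chosen partition depends on the atlas and on \<open>C\<close> alone, so both
  integrals use the same pieces and charts. Equality of the integrands at the points of
  \<open>C\<close> is then enough, with different orientations permitted on the two sides.\<close>

lemma form_integral_cong:
  assumes A: "smooth_manifold A" and C: "compactin (manifold_topology A) C"
    and eq: "\<And>c x. x \<in> C \<Longrightarrow> c \<in> charts_at A x \<Longrightarrow>
      \<epsilon> (coord_frame A c x) * \<alpha> x (map (snd (coord_frame A c x)) (sorted_list_of_set UNIV)) =
      \<epsilon>' (coord_frame A c x) * \<beta> x (map (snd (coord_frame A c x)) (sorted_list_of_set UNIV))"
  shows "form_integral A \<epsilon> C \<alpha> = form_integral A \<epsilon>' C \<beta>"
proof -
  define P where "P = (SOME P. chart_partition A C P)"
  have P: "chart_partition A C P" unfolding P_def by (rule someI_ex[OF chart_partition_ex[OF A C]])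
  have "(LINT y:snd c ` D|lborel. (let u = coord_frame A c (cinv c y) in
         \<epsilon> u * \<alpha> (cinv c y) (map (snd u) (sorted_list_of_set UNIV)))) =
      (LINT y:snd c ` D|lborel. (let u = coord_frame A c (cinv c y) in
         \<epsilon>' u * \<beta> (cinv c y) (map (snd u) (sorted_list_of_set UNIV))))" if cD: "(c, D) \<in> P" for c D
  proof -
    have c: "c \<in> A" "D \<subseteq> fst c" using P cD unfolding chart_partition_def by auto
    have DC: "D \<subseteq> C" using P cD unfolding chart_partition_def by force
    have "cinv c y \<in> C \<and> c \<in> charts_at A (cinv c y)" if "y \<in> snd c ` D" for y
      using that c DC cinv_chart[OF smooth_manifold_imp_smooth_atlas[OF A] c(1)]
      by (auto simp: charts_at_iff subset_iff)
    then show ?thesis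
      unfolding set_lebesgue_integral_def Let_def
      by (intro Bochner_Integration.integral_cong refl) (simp add: indicator_def eq)
  qed
  then show ?thesis unfolding form_integral_def P_def[symmetric] Let_def by (intro sum.cong refl) auto
qed

lemma continuous_map_in_chart:
  assumes A: "smooth_atlas A" and c: "c \<in> A" and V: "openin (manifold_topology A) V"
    and h: "continuous_on (snd c ` (fst c \<inter> V)) h" and f: "\<And>x. x \<in> V \<Longrightarrow> x \<in> fst c \<Longrightarrow> f x = (h (snd c x) :: real)"
  shows "continuous_map (subtopology (manifold_topology A) (V \<inter> fst c)) euclideanreal f"
  unfolding continuous_map_def
proof (intro conjI allI impI)
  let ?T = "subtopology (manifold_topology A) (V \<inter> fst c)"
  have "V \<inter> fst c \<subseteq> topspace (manifold_topology A)" using openin_subset[OF V] by blast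
  then have ts: "topspace ?T = V \<inter> fst c" by (simp add: inf_absorb2)
  fix O' :: "real set" assume "openin euclideanreal O'"
  then have O': "open O'" by simp
  let ?Y = "snd c ` (fst c \<inter> V)"
  have o: "open (?Y \<inter> h -` O')" by (rule continuous_open_preimage[OF h open_image_chart[OF A c V] O'])
  have eq: "{x \<in> topspace ?T. f x \<in> O'} = cinv c ` (?Y \<inter> h -` O')"
    unfolding ts
  proof (intro equalityI subsetI)
    fix x assume "x \<in> {x \<in> V \<inter> fst c. f x \<in> O'}"
    then show "x \<in> cinv c ` (?Y \<inter> h -` O')"
      using cinv_chart[OF A c] f by (intro image_eqI[of _ _ "snd c x"]) auto
  qed (use cinv_chart[OF A c] f in auto)
  have "openin (manifold_topology A) (cinv c ` (?Y \<inter> h -` O'))"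
    by (rule openin_cinv_image[OF A c o]) auto
  moreover have "{x \<in> topspace ?T. f x \<in> O'} \<subseteq> V \<inter> fst c" unfolding ts by blast
  ultimately show "openin ?T {x \<in> topspace ?T. f x \<in> O'}"
    unfolding openin_subtopology eq by (intro exI[of _ "cinv c ` (?Y \<inter> h -` O')"]) blast
qed simp

section \<open>Levi-Civita lifts\<close>

context frame_geometry
begin

text \<open>Characterised by its properties and thus independent of charts; \<open>lc_coord\<close>
  gives its slopes in a chart. The fundamental lemma ensures existence and uniqueness.\<close>

definition lc_lift :: "('a \<Rightarrow> ('a, 'm) frame) \<Rightarrow> 'a \<Rightarrow> ('a, 'm) fjet" where
  "lc_lift s x = (THE j. j \<in> T0 M \<and> tau10 j = s x \<and> F_omega M j = jet1 M SM (proj_K \<circ> s) x)"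

definition lc_coord where
  "lc_coord c s x = levi_civita (frame_mat c (s x))
     (\<lambda>\<sigma>. dmetric (frame_mat c (s x)) (frechet_derivative (\<lambda>y. frame_mat c (s (cinv c y))) (at (snd c x)) (axis \<sigma> 1)))"

lemma T0_jet: "j \<in> T0 M \<Longrightarrow> j \<in> frame_jets"
  by (simp add: T0_def)

text \<open>In coordinates membership in \<open>T0\<close> is \<open>torsion_free\<close>, and the
  condition on \<open>F_omega\<close> prescribes the derivative of the metric.
  \<open>levi_civita_iff\<close> solves the two together.\<close>

lemma lc_lift_iff:
  assumes W: "openin top_M W" "x \<in> W" and s: "frame_section W s"
    and c: "c \<in> M" "x \<in> fst c" and d: "d \<in> LM" "adapted LM fst c d"
    and j: "j \<in> frame_jets" "tau10 j = s x"
  shows "j \<in> T0 M \<and> F_omega M j = jet1 M SM (proj_K \<circ> s) x \<longleftrightarrow>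
    snd (snd (snd (frame.jchart c d) j)) = lc_coord c s x"
proof -
  let ?J = "frame.jchart c d"
  let ?e = "frame_mat c (s x)" and ?F = "snd (snd (snd ?J j))"
  let ?E' = "frechet_derivative (\<lambda>y. frame_mat c (s (cinv c y))) (at (snd c x))"
  have fs: "fst (s x) = x" using s W(2) by (simp add: section_on_def)
  have t1: "tau1 j = x" 
  proof -
    have "fst (tau10 j) = tau1 j"
      by (rule frame.jets_cases[OF j(1)]) (simp add: tau10_def tau1_def jet1_def section_on_def)
    then show ?thesis using j(2) fs by simp
  qed
  have jc: "tau1 j \<in> fst c" using t1 c by simp
  note T = jet_chart_tau[OF c(1) d j(1) jc]
  have E': "((\<lambda>y. frame_mat c (s (cinv c y))) has_derivative ?E') (at (snd c x))"
    unfolding frechet_derivative_at[OF frame_jet_chart(1)[OF W s c d], symmetric] by (rule frame_jet_chart(1)[OF W s c d])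
  note F = F_omega_eq_jet1_iff[OF W s c d j(1) t1 j(2) E']
  have e: "invertible ?e" using T(3) j(2) by simp
  show ?thesis
    unfolding F T0_iff[OF c(1) d j(1) jc] j(2) lc_coord_def
    by (rule levi_civita_iff[OF e transpose_dmetric])
qed

lemma lc_lift:
  assumes W: "openin top_M W" "x \<in> W" and s: "frame_section W s"
  shows "lc_lift s x \<in> T0 M" "tau10 (lc_lift s x) = s x" "tau1 (lc_lift s x) = x"
    "F_omega M (lc_lift s x) = jet1 M SM (proj_K \<circ> s) x"
    "\<And>j. j \<in> T0 M \<Longrightarrow> tau10 j = s x \<Longrightarrow> F_omega M j = jet1 M SM (proj_K \<circ> s) x \<Longrightarrow> j = lc_lift s x"
proof -
  let ?P = "\<lambda>j. j \<in> T0 M \<and> tau10 j = s x \<and> F_omega M j = jet1 M SM (proj_K \<circ> s) x"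
  have "x \<in> \<Union> (fst ` M)" using openin_subset[OF W(1)] W(2) unfolding topspace_manifold by blast
  then obtain c where c: "c \<in> M" "x \<in> fst c" by blast
  obtain d where d: "d \<in> LM" "adapted LM fst c d" using frame.adapted_ex[OF c(1)] by blast
  let ?J = "frame.jchart c d"
  have fs: "fst (s x) = x" using s W(2) by (simp add: section_on_def)
  have sd: "s x \<in> fst d" by (rule frame.section_coordinates(1)[OF W s c d])
  define j0 where "j0 = (x, s x, frame.jlin c d x (s x) (lc_coord c s x))"
  have j0: "j0 \<in> fst ?J" "snd (snd (snd ?J j0)) = lc_coord c s x"
    using frame.jlin_jet[OF c(1) d sd, of "lc_coord c s x"] by (simp_all add: fs j0_def)
  have jj: "j0 \<in> frame_jets" "tau10 j0 = s x" using j0(1) by (auto simp: j0_def jet_chart_def tau10_def)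
  have P0: "?P j0" using lc_lift_iff[OF W s c d jj] j0(2) jj(2) by blast
  have uni: "j = j0" if P: "?P j" for j
  proof -
    have j: "j \<in> frame_jets" "tau10 j = s x" using P T0_jet by auto
    have "fst (tau10 j) = tau1 j"
      by (rule frame.jets_cases[OF j(1)]) (simp add: tau10_def tau1_def jet1_def section_on_def)
    then have t1: "tau1 j = x" using j(2) fs by simp
    have jc: "tau1 j \<in> fst c" "tau1 j0 \<in> fst c" using t1 c by (simp_all add: j0_def tau1_def)
    have "snd (snd (snd ?J j)) = lc_coord c s x" using lc_lift_iff[OF W s c d j] P by blast
    then have "snd ?J j = snd ?J j0"
      using jet_chart_tau(1,2)[OF c(1) d j(1) jc(1)] jet_chart_tau(1,2)[OF c(1) d jj(1) jc(2)] j0(2) j(2) jj(2) t1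
      by (simp add: prod_eq_iff) (simp add: j0_def tau1_def)
    moreover have "j \<in> fst ?J" using jet_chart_at(1)[OF c(1) d j(1) jc(1)] by (simp add: charts_at_iff)
    ultimately show "j = j0" using inj_onD[OF frame.jet_chart_inj[OF c(1) d]] j0(1) by blast
  qed
  have l: "lc_lift s x = j0" unfolding lc_lift_def using P0 uni by (rule the_equality)
  show "lc_lift s x \<in> T0 M" "tau10 (lc_lift s x) = s x" "tau1 (lc_lift s x) = x"
    "F_omega M (lc_lift s x) = jet1 M SM (proj_K \<circ> s) x"
    using P0 unfolding l by (simp_all add: j0_def tau1_def)
  show "j = lc_lift s x" if "j \<in> T0 M" "tau10 j = s x" "F_omega M j = jet1 M SM (proj_K \<circ> s) x" for j
    unfolding l by (rule uni) (use that in blast)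
qed

lemma lc_lift_chart:
  assumes W: "openin top_M W" "x \<in> W" and s: "frame_section W s"
    and c: "c \<in> M" "x \<in> fst c" and d: "d \<in> LM" "adapted LM fst c d"
  shows "lc_lift s x \<in> fst (frame.jchart c d)"
    "snd (frame.jchart c d) (lc_lift s x) = (snd c x, frame_mat c (s x), lc_coord c s x)"
proof -
  note L = lc_lift[OF W s]
  have j: "lc_lift s x \<in> frame_jets" "tau1 (lc_lift s x) \<in> fst c"
    by (rule T0_jet[OF L(1)], simp add: L(3) c)
  show "lc_lift s x \<in> fst (frame.jchart c d)"
    using jet_chart_at(1)[OF c(1) d j] by (simp add: charts_at_iff)
  have "snd (snd (snd (frame.jchart c d) (lc_lift s x))) = lc_coord c s x"
    using lc_lift_iff[OF W s c d j(1) L(2)] L(1,4) by blast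
  then show "snd (frame.jchart c d) (lc_lift s x) = (snd c x, frame_mat c (s x), lc_coord c s x)"
    using jet_chart_tau(1,2)[OF c(1) d j] L(2,3) by (simp add: prod_eq_iff)
qed

lemma jet1_cong:
  assumes W: "openin top_M W" "x \<in> W" and eq: "\<And>y. y \<in> W \<Longrightarrow> \<zeta> y = \<zeta>' y"
  shows "jet1 M SM \<zeta> x = jet1 M SM \<zeta>' x"
  unfolding jet1_def using tmap_cong[OF M W, of \<zeta> \<zeta>' "SM"] eq W(2) by simp

lemma section_frame_mat_smooth:
  assumes U: "openin top_M U" and s: "frame_section U s" and c: "c \<in> M"
  shows "smooth_on (snd c ` (fst c \<inter> U)) (\<lambda>y. frame_mat c (s (cinv c y)))"
proof (rule smooth_on_local)
  fix y assume "y \<in> snd c ` (fst c \<inter> U)"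
  then obtain x where x: "y = snd c x" "x \<in> fst c" "x \<in> U" by blast
  have sm: "smooth_map_on M LM U s" and fs: "fst (s x) = x" using s x by (auto simp: section_on_def)
  have cc: "c \<in> charts_at M x" "frame_chart M c \<in> charts_at LM (s x)"
    using c x fs section_frame[OF s x(3)] by (simp_all add: charts_at_iff frame_atlas_eq frame_chart_def)
  obtain V where V: "open V" "snd c x \<in> V" "smooth_on V (\<lambda>y. snd (frame_chart M c) (s (cinv c y)))"
    using smooth_map_on_charts[OF M frame.B sm x(3) cc] by metis
  have "smooth_on V (\<lambda>y. snd (snd (frame_chart M c) (s (cinv c y))))" by (intro smooth_intros V)
  then have "smooth_on V (\<lambda>y. frame_mat c (s (cinv c y)))" by (simp add: frame_chart_def)
  then show "\<exists>T. open T \<and> y \<in> T \<and> smooth_on T (\<lambda>y. frame_mat c (s (cinv c y)))" using V x by blast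
qed

text \<open>The lift at time \<open>t\<close> differentiates the frame in the space variables only.
  These partial derivatives are values of the full derivative of the frame matrix on the cylinder,
  which makes the lift jointly smooth in time and space.\<close>

lemma smooth_lc_lift:
  assumes U: "openin top_M U" and I: "open I"
    and S: "smooth_map_on (cylinder_atlas M) LM (I \<times> U) (\<lambda>(t, x). S t x)"
    and sec: "\<And>t. t \<in> I \<Longrightarrow> frame_section U (S t)"
  shows "smooth_map_on (cylinder_atlas M) (J1_frame M) (I \<times> U) (\<lambda>(t, x). lc_lift (S t) x)"
proof (rule smooth_familyI[OF M I U])
  fix c assume c: "c \<in> M"
  obtain d where d: "d \<in> LM" "adapted LM fst c d" using frame.adapted_ex[OF c] by blast
  let ?J = "frame.jchart c d"
  let ?Y = "snd c ` (fst c \<inter> U)"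
  define E where "E z = frame_mat c (S (fst z) (cinv c (snd z)))" for z
  have oY: "open ?Y" by (rule open_image_chart[OF M c U])
  have o: "open (I \<times> ?Y)" by (intro open_Times I oY)
  have fc: "frame_chart M c \<in> LM" using c by (simp add: frame_atlas_eq)
  have SB: "S t x \<in> frame_bundle M" "fst (S t x) = x" if "t \<in> I" "x \<in> U" for t x
    using section_frame[OF sec[OF that(1)] that(2)] sec[OF that(1)] that(2) by (simp_all add: section_on_def)
  have "smooth_on (I \<times> ?Y) (\<lambda>z. snd (frame_chart M c) (S (fst z) (cinv c (snd z))))"
    by (rule smooth_family_coordinates[OF M frame.B I U S c fc]) (simp add: frame_chart_def SB)
  then have "smooth_on (I \<times> ?Y) (\<lambda>z. snd (snd (frame_chart M c) (S (fst z) (cinv c (snd z)))))"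
    by (intro smooth_intros o)
  then have smE: "smooth_on (I \<times> ?Y) E" by (simp add: frame_chart_def E_def[abs_def])
  have inv: "invertible (E z)" if z: "z \<in> I \<times> ?Y" for z
  proof -
    from z obtain t x where zx: "z = (t, snd c x)" "t \<in> I" "x \<in> fst c" "x \<in> U" by auto
    then show ?thesis
      using frame_mat_invertible[OF M, of c "S t x"] SB[of t x] c cinv_chart[OF M c zx(3)] by (simp add: E_def charts_at_iff)
  qed
  \<comment> \<open>The space derivative of a time slice is the full derivative in a direction with
    time component 0.\<close>
  have part: "frechet_derivative (\<lambda>y. frame_mat c (S (fst z) (cinv c y))) (at (snd z)) a = frechet_derivative E (at z) (0, a)"
    if z: "z \<in> I \<times> ?Y" for z a
  proof -
    have "((\<lambda>y. (fst z, y)) has_derivative (\<lambda>a. (0, a))) (at (snd z))" by (auto intro!: derivative_eq_intros)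
    moreover have "(E has_derivative frechet_derivative E (at z)) (at (fst z, snd z))"
      using smooth_on_has_derivative[OF smE o z] by simp
    ultimately have "((\<lambda>y. E (fst z, y)) has_derivative (\<lambda>a. frechet_derivative E (at z) (0, a))) (at (snd z))"
      using diff_chain_at[of "\<lambda>y. (fst z, y)" _ "snd z" E] by (simp add: o_def)
    from fun_cong[OF frechet_derivative_at[OF this], of a] show ?thesis by (simp add: E_def)
  qed
  define T where "T z = (snd z, E z, levi_civita (E z) (\<lambda>\<sigma>. dmetric (E z) (frechet_derivative E (at z) (0, axis \<sigma> 1))))" for z
  have sd: "smooth_on (I \<times> ?Y) (\<lambda>z. dmetric (E z) (frechet_derivative E (at z) (0, axis \<sigma> 1)))" for \<sigma>
    unfolding dmetric_def by (intro smooth_intros o smE)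
  have sL: "smooth_on (I \<times> ?Y) (\<lambda>z. levi_civita (E z) (\<lambda>\<sigma>. dmetric (E z) (frechet_derivative E (at z) (0, axis \<sigma> 1))))"
    by (rule smooth_levi_civita[OF o smE inv sd])
  have sT: "smooth_on (I \<times> ?Y) T"
    unfolding T_def by (intro smooth_intros smooth_on_id o smE sL)
  have J: "?J \<in> J1_frame M" unfolding J1_frame_def by (rule frame.jet_chart_in[OF c d])
  show "\<exists>d\<in>J1_frame M. (\<forall>t\<in>I. \<forall>x\<in>U \<inter> fst c. lc_lift (S t) x \<in> fst d) \<and>
      smooth_on (I \<times> ?Y) (\<lambda>z. snd d (lc_lift (S (fst z)) (cinv c (snd z))))"
  proof (intro bexI[OF _ J] conjI ballI)
    show "lc_lift (S t) x \<in> fst ?J" if "t \<in> I" "x \<in> U \<inter> fst c" for t x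
      using lc_lift_chart(1)[OF U _ sec[OF that(1)] c _ d, of x] that(2) by blast
    show "smooth_on (I \<times> ?Y) (\<lambda>z. snd ?J (lc_lift (S (fst z)) (cinv c (snd z))))"
    proof (rule smooth_on_cong[OF sT o])
      fix z assume z: "z \<in> I \<times> ?Y"
      then obtain t x where zx: "z = (t, snd c x)" "t \<in> I" "x \<in> fst c" "x \<in> U" by auto
      have cx: "cinv c (snd c x) = x" by (rule cinv_chart[OF M c zx(3)])
      show "T z = snd ?J (lc_lift (S (fst z)) (cinv c (snd z)))"
        using lc_lift_chart(2)[OF U zx(4) sec[OF zx(2)] c zx(3) d] part[OF z]
        by (simp add: T_def zx(1) cx lc_coord_def E_def)
    qed
  qed
qed

section \<open>Lifting variations of the metric to orthonormal frames\<close>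

text \<open>The matrix of the metric \<open>S\<close> with respect to the frame \<open>u\<close>.
  For \<open>S = proj_K (frame_act u B)\<close> it equals \<open>B ** eta ** transpose B\<close>, so
  its value is the same in every chart at the base point.\<close>

definition rel_metric :: "('a, 'm rvec) chart \<Rightarrow> ('a, 'm) frame \<Rightarrow> ('a, 'm) frame set \<Rightarrow> 'm rmat" where
  "rel_metric c u S = transpose (matrix_inv (frame_mat c u)) ** sym_mat (snd (snd (sigma_chart M c) S)) ** matrix_inv (frame_mat c u)"

lemma rel_metric_act:
  assumes u: "u \<in> frame_bundle M" and c: "c \<in> charts_at M (fst u)"
  shows "rel_metric c u (proj_K (frame_act u B)) = B ** eta ** transpose B"
proof -
  let ?e = "frame_mat c u"
  have i: "invertible ?e" by (rule frame_mat_invertible[OF M c u])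
  have "rel_metric c u (proj_K (frame_act u B)) = transpose (matrix_inv ?e) ** metric_mat (transpose B ** ?e) ** matrix_inv ?e"
    by (simp add: rel_metric_def sigma_chart_proj sym_mat_vec transpose_metric_mat frame_act_mat)
  also have "\<dots> = transpose (?e ** matrix_inv ?e) ** (B ** eta ** transpose B) ** (?e ** matrix_inv ?e)"
    by (simp only: metric_mat_def matrix_transpose_mul transpose_transpose matrix_mul_assoc)
  finally show ?thesis by (simp add: matrix_inv_eq[OF i])
qed

lemma metric_over_frame:
  assumes u: "u \<in> frame_bundle M" and S: "S \<in> proj_K ` frame_bundle M" "tau_Sigma S = fst u"
  obtains B where "invertible B" "S = proj_K (frame_act u B)"
proof -
  obtain u' where u': "u' \<in> frame_bundle M" "S = proj_K u'" using S(1) by blast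
  have f: "fst u = fst u'" using S(2) u'(2) by (simp add: tau_Sigma_proj)
  obtain c where c: "c \<in> charts_at M (fst u)" using frame_bundleD(1)[OF u] unfolding charts_at_iff by blast
  let ?B = "transpose (frame_mat c u' ** matrix_inv (frame_mat c u))"
  have "u' = frame_act u ?B" by (rule frame_act_transitive[OF M u u'(1) f c])
  then show ?thesis using that[of ?B] u' frame_act_bundle_iff[OF M u] by metis
qed

lemma proj_K_act_cong:
  assumes u: "u \<in> frame_bundle M" and B: "invertible A" "invertible B" "A ** eta ** transpose A = B ** eta ** transpose B"
  shows "proj_K (frame_act u A) = proj_K (frame_act u B)"
proof -
  obtain c where c: "c \<in> charts_at M (fst u)" using frame_bundleD(1)[OF u] unfolding charts_at_iff by blast
  have "metric_mat (frame_mat c (frame_act u A)) = metric_mat (frame_mat c (frame_act u B))"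
    using B(3) by (simp add: frame_act_mat metric_mat_mult transpose_transpose)
  then show ?thesis
    using proj_K_eq_iff[OF M, of "frame_act u A" "frame_act u B" c] frame_act_bundle_iff[OF M u] B(1,2) c by simp
qed

lemma section_Sigma:
  assumes "section_on M SM tau_Sigma U \<zeta>" "x \<in> U"
  shows "\<zeta> x \<in> proj_K ` frame_bundle M" "tau_Sigma (\<zeta> x) = x"
  using assms unfolding section_on_def smooth_map_on_def charts_at_def Sigma_carrier[of M, symmetric] by blast+

text \<open>A finite subcover of \<open>C\<close> and the smallest of the corresponding time
  bounds.\<close>

lemma compact_time_bound:
  assumes C: "compactin top_M C" and r: "r > (0::real)"
    and loc: "\<And>x. x \<in> C \<Longrightarrow> \<exists>\<delta>>0. \<exists>N. openin top_M N \<and> x \<in> N \<and> (\<forall>t y. \<bar>t\<bar> < \<delta> \<and> y \<in> N \<longrightarrow> P t y)"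
  shows "\<exists>r'>0. r' \<le> r \<and> (\<forall>t x. \<bar>t\<bar> < r' \<and> x \<in> C \<longrightarrow> P t x)"
proof -
  obtain \<delta> N where N: "\<And>x. x \<in> C \<Longrightarrow> \<delta> x > (0::real)" "\<And>x. x \<in> C \<Longrightarrow> openin top_M (N x)"
    "\<And>x. x \<in> C \<Longrightarrow> x \<in> N x" "\<And>x t y. x \<in> C \<Longrightarrow> \<bar>t\<bar> < \<delta> x \<Longrightarrow> y \<in> N x \<Longrightarrow> P t y"
    using loc by metis
  have "C \<subseteq> \<Union> (N ` C)" using N(3) by blast
  moreover have "\<forall>x\<in>C. openin top_M (N x)" using N(2) by blast
  ultimately obtain F where F: "finite F" "F \<subseteq> C" "C \<subseteq> \<Union> (N ` F)"
    using compactin_finite_cover[OF C, of C N] by blast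
  \<comment> \<open>Inserting \<open>r\<close> bounds \<open>r'\<close> from above and keeps the
    minimum over a nonempty set when \<open>C\<close> is empty.\<close>
  define r' where "r' = Min (insert r (\<delta> ` F))"
  have "r' > 0" unfolding r'_def using F N(1) r by (subst Min_gr_iff) auto
  moreover have "r' \<le> r" unfolding r'_def using F(1) by (intro Min_le) auto
  moreover have "P t x" if tx: "\<bar>t\<bar> < r'" "x \<in> C" for t x
  proof -
    obtain y where y: "y \<in> F" "x \<in> N y" using F(3) tx(2) by blast
    have "r' \<le> \<delta> y" unfolding r'_def using F(1) y(1) by (intro Min_le) auto
    then show ?thesis using N(4)[of y t x] y F(2) tx(1) by auto
  qed
  ultimately show ?thesis by blast
qed

text \<open>The matrix of \<open>\<zeta> t x\<close> relative to \<open>s x\<close> is \<eta> at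
  time 0 and outside \<open>C\<close> at all times. Membership in the domain \<open>Q\<close> of the
  orthonormalisation therefore has to be secured on \<open>C\<close> only, where compactness
  supplies the time bound; and since \<open>A\<close> sends \<eta> to the identity, the frames stay
  put wherever the metric does.\<close>

theorem orthonormal_lift:
  assumes U: "openin top_M U" and s: "frame_section U s"
    and C: "compactin top_M C" "C \<subseteq> U" and r: "r > 0"
    and \<zeta>: "smooth_map_on (cylinder_atlas M) SM ({-r<..<r} \<times> U) (\<lambda>(t, x). \<zeta> t x)"
    and sec: "\<And>t. t \<in> {-r<..<r} \<Longrightarrow> section_on M SM tau_Sigma U (\<zeta> t)"
    and off: "\<And>t x. t \<in> {-r<..<r} \<Longrightarrow> x \<in> U - C \<Longrightarrow> \<zeta> t x = proj_K (s x)"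
    and init: "\<And>x. x \<in> U \<Longrightarrow> \<zeta> 0 x = proj_K (s x)"
  obtains r' B where "r' > 0" "r' \<le> r"
    "smooth_map_on (cylinder_atlas M) LM ({-r'<..<r'} \<times> U) (\<lambda>(t, x). frame_act (s x) (B t x))"
    "\<And>t x. t \<in> {-r'<..<r'} \<Longrightarrow> x \<in> U \<Longrightarrow> det (B t x) > 0 \<and> proj_K (frame_act (s x) (B t x)) = \<zeta> t x"
    "\<And>t x. t \<in> {-r'<..<r'} \<Longrightarrow> x \<in> U - C \<Longrightarrow> B t x = mat 1" "\<And>x. x \<in> U \<Longrightarrow> B 0 x = mat 1"
proof -
  obtain Q and A :: "'m rmat \<Rightarrow> 'm rmat" where Q: "open Q" "eta \<in> Q" "smooth_on Q A" "A eta = mat 1"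
    "\<And>g. g \<in> Q \<Longrightarrow> det (A g) > 0" "\<And>g. g \<in> Q \<Longrightarrow> transpose g = g \<Longrightarrow> A g ** eta ** transpose (A g) = g"
    by (rule gram_schmidt) (rule that)
  \<comment> \<open>A chart is picked by choice to make \<open>G\<close> a global function;
    \<open>G_eq\<close> shows that any chart at \<open>x\<close> yields the same matrix, so
    smoothness can be checked chart by chart.\<close>
  define G where "G t x = rel_metric (SOME c. c \<in> charts_at M x) (s x) (\<zeta> t x)" for t x
  have sb: "s x \<in> frame_bundle M" "fst (s x) = x" if "x \<in> U" for x
    using section_frame[OF s that] s that by (simp_all add: section_on_def)
  have G_eq: "\<exists>B. invertible B \<and> \<zeta> t x = proj_K (frame_act (s x) B) \<and> G t x = B ** eta ** transpose B \<and>
      (\<forall>c\<in>charts_at M x. G t x = rel_metric c (s x) (\<zeta> t x))" if t: "t \<in> {-r<..<r}" and x: "x \<in> U" for t x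
  proof -
    obtain B where B: "invertible B" "\<zeta> t x = proj_K (frame_act (s x) B)"
      using metric_over_frame[OF sb(1)[OF x] section_Sigma(1)[OF sec[OF t] x]] section_Sigma(2)[OF sec[OF t] x] sb(2)[OF x] by metis
    have "x \<in> \<Union> (fst ` M)" using frame_bundleD(1)[OF sb(1)[OF x]] sb(2)[OF x] by simp
    then have "\<exists>c. c \<in> charts_at M x" unfolding charts_at_iff by blast
    then have "(SOME c. c \<in> charts_at M x) \<in> charts_at M x" by (rule someI_ex)
    then have "G t x = B ** eta ** transpose B"
      unfolding G_def B(2) using rel_metric_act[OF sb(1)[OF x]] sb(2)[OF x] by simp
    moreover have "rel_metric c (s x) (\<zeta> t x) = B ** eta ** transpose B" if "c \<in> charts_at M x" for c
      unfolding B(2) using rel_metric_act[OF sb(1)[OF x]] sb(2)[OF x] that by simp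
    ultimately show ?thesis using B by auto
  qed
  have G_id: "G t x = eta" if gx: "x \<in> U" "\<zeta> t x = proj_K (s x)" "t \<in> {-r<..<r}" for t x
  proof -
    obtain c where c: "c \<in> charts_at M x"
      using frame_bundleD(1)[OF sb(1)[OF gx(1)]] sb(2)[OF gx(1)] unfolding charts_at_iff by auto
    have "G t x = rel_metric c (s x) (proj_K (frame_act (s x) (mat 1)))"
      using G_eq[OF gx(3,1)] c gx(2) by (auto simp: frame_act_1)
    then show ?thesis using rel_metric_act[OF sb(1)[OF gx(1)], of c "mat 1"] sb(2)[OF gx(1)] c by simp
  qed
  have smG: "smooth_on ({-r<..<r} \<times> snd c ` (fst c \<inter> U)) (\<lambda>z. G (fst z) (cinv c (snd z)))" if c: "c \<in> M" for c
  proof -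
    let ?V = "{-r<..<r} \<times> snd c ` (fst c \<inter> U)"
    have oY: "open (snd c ` (fst c \<inter> U))" by (rule open_image_chart[OF M c U])
    have o: "open ?V" by (intro open_Times oY) auto
    have sd: "smooth_on ?V (\<lambda>z. snd z)" by (intro smooth_intros smooth_on_id o)
    have e: "smooth_on ?V (\<lambda>z. frame_mat c (s (cinv c (snd z))))"
      by (rule smooth_on_compose[OF section_frame_mat_smooth[OF U s c] oY sd o]) auto
    have cx: "cinv c (snd z) \<in> fst c \<inter> U" if "z \<in> ?V" for z using that cinv_chart[OF M c] by auto
    have inv: "invertible (frame_mat c (s (cinv c (snd z))))" if z: "z \<in> ?V" for z
      using frame_mat_invertible[OF M _ sb(1)] sb(2) cx[OF z] c by (simp add: charts_at_iff)
    have sc: "sigma_chart M c \<in> SM" using c by (simp add: Sigma_atlas_eq)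
    have "smooth_on ?V (\<lambda>z. snd (sigma_chart M c) (\<zeta> (fst z) (cinv c (snd z))))"
    proof (rule smooth_family_coordinates[OF M sigma.B _ U \<zeta> c sc])
      fix t x assume t: "t \<in> {-r<..<r}" and x: "x \<in> U" "x \<in> fst c"
      show "\<zeta> t x \<in> fst (sigma_chart M c)"
        using section_Sigma[OF sec[OF t] x(1)] x(2) by (simp add: sigma_chart_def)
    qed simp
    then have "smooth_on ?V (\<lambda>z. rel_metric c (s (cinv c (snd z))) (\<zeta> (fst z) (cinv c (snd z))))"
      unfolding rel_metric_def by (intro smooth_intros o e inv)
    then show ?thesis
    proof (rule smooth_on_cong[OF _ o])
      fix z assume z: "z \<in> ?V"
      have "c \<in> charts_at M (cinv c (snd z))" using cx[OF z] c by (simp add: charts_at_iff)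
      then show "rel_metric c (s (cinv c (snd z))) (\<zeta> (fst z) (cinv c (snd z))) = G (fst z) (cinv c (snd z))"
        using G_eq[of "fst z" "cinv c (snd z)"] cx[OF z] z by auto
    qed
  qed
  have "\<exists>r'>0. r' \<le> r \<and> (\<forall>t x. \<bar>t\<bar> < r' \<and> x \<in> C \<longrightarrow> G t x \<in> Q)"
  proof (rule compact_time_bound[OF C(1) r])
    fix x assume "x \<in> C"
    then have x: "x \<in> U" using C(2) by blast
    have "x \<in> \<Union> (fst ` M)" using frame_bundleD(1)[OF sb(1)[OF x]] sb(2)[OF x] by simp
    then obtain c where c: "c \<in> M" "x \<in> fst c" by blast
    let ?Y = "snd c ` (fst c \<inter> U)"
    have oY: "open ?Y" by (rule open_image_chart[OF M c(1) U])
    have o: "open ({-r<..<r} \<times> ?Y)" by (intro open_Times oY) auto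
    \<comment> \<open>The points of the cylinder, in coordinates, at which \<open>G\<close> lies in
      \<open>Q\<close>. A box around \<open>(0, snd c x)\<close> inside this open set yields the
      time bound and the neighbourhood.\<close>
    let ?X = "({-r<..<r} \<times> ?Y) \<inter> (\<lambda>z. G (fst z) (cinv c (snd z))) -` Q"
    have "open ?X"
      by (rule continuous_open_preimage[OF smooth_on_imp_continuous_on[OF smG[OF c(1)]] o Q(1)])
    moreover have "(0, snd c x) \<in> ?X"
      using r c x cinv_chart[OF M c] G_id[OF x init[OF x]] Q(2) by auto
    ultimately obtain T Y' where TY: "open T" "open Y'" "(0, snd c x) \<in> T \<times> Y'" "T \<times> Y' \<subseteq> ?X"
      by (rule open_prod_elim)
    obtain \<delta> where \<delta>: "\<delta> > 0" "ball 0 \<delta> \<subseteq> T" using TY(1,3) openE by blast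
    have Y': "Y' \<subseteq> snd c ` fst c" using TY(3,4) by auto
    show "\<exists>\<delta>>0. \<exists>N. openin top_M N \<and> x \<in> N \<and> (\<forall>t y. \<bar>t\<bar> < \<delta> \<and> y \<in> N \<longrightarrow> G t y \<in> Q)"
    proof (intro exI conjI allI impI)
      show "\<delta> > 0" by (rule \<delta>(1))
      show "openin top_M (cinv c ` Y')" by (rule openin_cinv_image[OF M c(1) TY(2) Y'])
      show "x \<in> cinv c ` Y'" using TY(3) cinv_chart[OF M c] by force
      fix t y assume ty: "\<bar>t\<bar> < \<delta> \<and> y \<in> cinv c ` Y'"
      then obtain z where z: "z \<in> Y'" "y = cinv c z" by blast
      have "t \<in> T" using \<delta>(2) ty by (auto simp: subset_iff)
      then have "(t, z) \<in> ?X" using TY(4) z(1) by blast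
      then show "G t y \<in> Q" using z(2) by simp
    qed
  qed
  then obtain r' where r': "r' > 0" "r' \<le> r" "\<And>t x. \<bar>t\<bar> < r' \<Longrightarrow> x \<in> C \<Longrightarrow> G t x \<in> Q" by blast
  have tr: "t \<in> {-r<..<r}" if "t \<in> {-r'<..<r'}" for t using that r'(2) by auto
  have GQ: "G t x \<in> Q" if "t \<in> {-r'<..<r'}" "x \<in> U" for t x
  proof (cases "x \<in> C")
    case True
    then show ?thesis using r'(3) that(1) by auto
  next
    case False
    then show ?thesis using G_id[OF that(2) off[OF tr[OF that(1)]] tr[OF that(1)]] that(2) Q(2) by simp
  qed
  show ?thesis
  proof (rule that[of r' "\<lambda>t x. A (G t x)"])
    show "r' > 0" "r' \<le> r" by (rule r')+
    show "A (G 0 x) = mat 1" if "x \<in> U" for x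
      using G_id[OF that init[OF that]] r Q(4) by simp
    show "A (G t x) = mat 1" if "t \<in> {-r'<..<r'}" "x \<in> U - C" for t x
      using G_id[OF _ off[OF tr[OF that(1)] that(2)] tr[OF that(1)]] that(2) Q(4) by simp
    show "det (A (G t x)) > 0 \<and> proj_K (frame_act (s x) (A (G t x))) = \<zeta> t x" if t: "t \<in> {-r'<..<r'}" and x: "x \<in> U" for t x
    proof
      show d: "det (A (G t x)) > 0" by (rule Q(5)[OF GQ[OF t x]])
      obtain B where B: "invertible B" "\<zeta> t x = proj_K (frame_act (s x) B)" "G t x = B ** eta ** transpose B"
        using G_eq[OF tr[OF t] x] by blast
      have "transpose (G t x) = G t x"
        by (simp add: B(3) matrix_transpose_mul transpose_transpose transpose_eta matrix_mul_assoc)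
      then have "A (G t x) ** eta ** transpose (A (G t x)) = B ** eta ** transpose B"
        using Q(6)[OF GQ[OF t x]] B(3) by simp
      then show "proj_K (frame_act (s x) (A (G t x))) = \<zeta> t x"
        unfolding B(2) using d B(1) by (intro proj_K_act_cong[OF sb(1)[OF x]]) (simp_all add: invertible_det_nz)
    qed
    show "smooth_map_on (cylinder_atlas M) LM ({-r'<..<r'} \<times> U) (\<lambda>(t, x). frame_act (s x) (A (G t x)))"
    proof (rule smooth_familyI[OF M _ U])
      fix c assume c: "c \<in> M"
      let ?V = "{-r'<..<r'} \<times> snd c ` (fst c \<inter> U)"
      have oY: "open (snd c ` (fst c \<inter> U))" by (rule open_image_chart[OF M c U])
      have o: "open ?V" by (intro open_Times oY) auto
      have cx: "cinv c (snd z) \<in> fst c \<inter> U" "snd c (cinv c (snd z)) = snd z" if "z \<in> ?V" for z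
        using that cinv_chart[OF M c] by auto
      have sd: "smooth_on ?V (\<lambda>z. snd z)" by (intro smooth_intros smooth_on_id o)
      have e: "smooth_on ?V (\<lambda>z. frame_mat c (s (cinv c (snd z))))"
        by (rule smooth_on_compose[OF section_frame_mat_smooth[OF U s c] oY sd o]) auto
      have g: "smooth_on ?V (\<lambda>z. G (fst z) (cinv c (snd z)))"
        by (rule smooth_on_subset[OF smG[OF c]]) (use r'(2) in auto)
      have a: "smooth_on ?V (\<lambda>z. A (G (fst z) (cinv c (snd z))))"
        by (rule smooth_on_compose[OF Q(3,1) g o]) (use GQ cx in auto)
      have sm: "smooth_on ?V (\<lambda>z. (snd z, transpose (A (G (fst z) (cinv c (snd z)))) ** frame_mat c (s (cinv c (snd z)))))"
        by (intro smooth_intros o sd a e)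
      have fc: "frame_chart M c \<in> LM" using c by (simp add: frame_atlas_eq)
      show "\<exists>d\<in>LM. (\<forall>t\<in>{-r'<..<r'}. \<forall>x\<in>U \<inter> fst c. frame_act (s x) (A (G t x)) \<in> fst d) \<and>
        smooth_on ?V (\<lambda>z. snd d (frame_act (s (cinv c (snd z))) (A (G (fst z) (cinv c (snd z))))))"
      proof (intro bexI[OF _ fc] conjI ballI)
        fix t x assume t: "t \<in> {-r'<..<r'}" and x: "x \<in> U \<inter> fst c"
        have "invertible (A (G t x))" using Q(5)[OF GQ[OF t]] x by (simp add: invertible_det_nz less_imp_neq[symmetric])
        then show "frame_act (s x) (A (G t x)) \<in> fst (frame_chart M c)"
          using frame_act_bundle_iff[OF M sb(1)] sb(2) x by (simp add: frame_chart_def)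
      next
        show "smooth_on ?V (\<lambda>z. snd (frame_chart M c) (frame_act (s (cinv c (snd z))) (A (G (fst z) (cinv c (snd z))))))"
          by (rule smooth_on_cong[OF sm o]) (use cx sb(2) in \<open>simp add: frame_chart_def frame_act_mat\<close>)
      qed
    qed simp
  qed
qed

section \<open>Extremals\<close>

lemma coord_frame:
  assumes c: "c \<in> charts_at M x"
  shows "coord_frame M c x \<in> frame_bundle M" "fst (coord_frame M c x) = x" "frame_mat c (coord_frame M c x) = mat 1"
    "snd (coord_frame M c x) k \<in> tangent_space M x"
proof -
  have "(mat 1 :: 'm rmat) $ k = axis k 1" for k by (simp add: vec_eq_iff mat_def axis_def)
  then have "coord_frame M c x = frame_of M c x (mat 1)" by (simp add: coord_frame_def frame_of_def)
  then show "coord_frame M c x \<in> frame_bundle M" and f: "fst (coord_frame M c x) = x" and "frame_mat c (coord_frame M c x) = mat 1"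
    using frame_of_frame[OF M c, of "mat 1"] by (simp_all add: invertible_mat_1)
  then show "snd (coord_frame M c x) k \<in> tangent_space M x" using frame_bundleD(2)[of "coord_frame M c x" M k] by simp
qed

text \<open>The orientation of \<open>V\<close> for which the frames \<open>s\<close> are positive.\<close>
lemma orientation_of_frame:
  assumes V: "openin top_M V" and s: "frame_section U s" "V \<subseteq> U"
    and U: "openin top_M U"
    and \<epsilon>: "orientation_on M V \<epsilon>"
  shows "orientation_on M V (\<lambda>u. \<epsilon> u * \<epsilon> (s (fst u)))"
proof -
  have sb: "s x \<in> frame_bundle M" "fst (s x) = x" if "x \<in> V" for x
    using section_frame[OF s(1)] s that by (auto simp: section_on_def)
  have e1: "\<epsilon> u \<in> {1, -1}" and e2: "invertible B \<Longrightarrow> \<epsilon> (frame_act u B) = sgn (det B) * \<epsilon> u"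
    if "u \<in> frame_bundle M" "fst u \<in> V" for u B
    using \<epsilon> that unfolding orientation_on_def by blast+
  have e3: "\<epsilon> (s (fst u)) \<in> {1, -1}" if "u \<in> frame_bundle M" "fst u \<in> V" for u
    using e1 sb that by metis
  show ?thesis
    unfolding orientation_on_def
  proof (intro conjI ballI impI allI)
    fix u assume u: "u \<in> frame_bundle M" "fst u \<in> V"
    show "\<epsilon> u * \<epsilon> (s (fst u)) \<in> {1, - 1}" using e1[OF u] e3[OF u] by auto
    fix B :: "'m rmat" assume "invertible B"
    then show "\<epsilon> (frame_act u B) * \<epsilon> (s (fst (frame_act u B))) = sgn (det B) * (\<epsilon> u * \<epsilon> (s (fst u)))"
      using e2[OF u] by simp
  next
    fix c assume c: "c \<in> M"
    \<comment> \<open>The transformation rule gives \<open>\<epsilon> (s x)\<close> as this sign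
      times the value of \<epsilon> at the coordinate frame. As that value squares to 1, the new
      orientation of the coordinate frame is the sign of a nonvanishing continuous
      determinant.\<close>
    let ?h = "\<lambda>y. sgn (det (frame_mat c (s (cinv c y))))"
    let ?Y = "snd c ` (fst c \<inter> V)"
    have sm: "smooth_on ?Y (\<lambda>y. frame_mat c (s (cinv c y)))"
      by (rule smooth_on_subset[OF section_frame_mat_smooth[OF U s(1) c]]) (use s(2) in auto)
    have oY: "open ?Y" by (rule open_image_chart[OF M c V])
    have cd: "continuous_on ?Y (\<lambda>y. det (frame_mat c (s (cinv c y))))"
      by (intro smooth_on_imp_continuous_on smooth_intros oY sm)
    have nz: "det (frame_mat c (s x)) \<noteq> 0" if "x \<in> V" "x \<in> fst c" for x
      using frame_mat_invertible[OF M _ sb(1)[OF that(1)], of c] sb(2)[OF that(1)] c that by (simp add: charts_at_iff invertible_det_nz)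
    have ch: "continuous_on ?Y ?h"
      by (rule continuous_on_sgn[OF cd]) (use nz cinv_chart[OF M c] in auto)
    show "continuous_map (subtopology top_M (V \<inter> fst c)) euclideanreal
        (\<lambda>x. \<epsilon> (coord_frame M c x) * \<epsilon> (s (fst (coord_frame M c x))))"
    proof (rule continuous_map_in_chart[OF M c V ch])
      fix x assume x: "x \<in> V" "x \<in> fst c"
      have cx: "c \<in> charts_at M x" using c x by (simp add: charts_at_iff)
      note cf = coord_frame[OF cx]
      let ?B = "transpose (frame_mat c (s x) ** matrix_inv (mat 1))"
      have "matrix_inv (mat 1 :: 'm rmat) = mat 1" using matrix_inv_eq(1)[of "mat 1 :: 'm rmat"] by (simp add: invertible_mat_1)
      then have B: "det ?B = det (frame_mat c (s x))" by (simp add: det_transpose)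
      have "s x = frame_act (coord_frame M c x) ?B"
        using frame_act_transitive[OF M cf(1) sb(1)[OF x(1)], of c] cf sb(2)[OF x(1)] cx by simp
      then have "\<epsilon> (s x) = sgn (det (frame_mat c (s x))) * \<epsilon> (coord_frame M c x)"
        using e2[OF cf(1), of ?B] cf(2) x(1) B nz[OF x] by (simp add: invertible_det_nz)
      moreover have "\<epsilon> (coord_frame M c x) * \<epsilon> (coord_frame M c x) = 1"
        using e1[OF cf(1)] cf(2) x(1) by auto
      ultimately show "\<epsilon> (coord_frame M c x) * \<epsilon> (s (fst (coord_frame M c x))) = ?h (snd c x)"
        using cf(2) cinv_chart[OF M c x(2)] by (simp add: mult.left_commute)
    qed
  qed
qed

text \<open>On the open set \<open>U\<close> the jet section is the composite of
  \<open>F_omega\<close> and \<sigma>, so the pullback can be done in two stages. Tangent vectors of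
  \<sigma> are tangent to \<open>T0\<close>, where the defining identity of the Lagrangian is
  available; it contributes the sign of the frame.\<close>

lemma pullback_EH_lagrangian:
  assumes U: "openin top_M U" and \<sigma>: "section_on M (J1_frame M) tau1 U \<sigma>" "\<sigma> ` U \<subseteq> T0 M"
    and L: "EH_lagrangian M V \<epsilon> L" and x: "x \<in> U" "x \<in> V"
    and hol: "\<And>x. x \<in> U \<Longrightarrow> F_omega M (\<sigma> x) = jet1 M SM \<zeta> x"
    and ws: "set ws \<subseteq> tangent_space M x"
  shows "pullback M (J1_Sigma M) (jet1 M SM \<zeta>) L x ws =
    \<epsilon> (tau10 (\<sigma> x)) * pullback M (J1_frame M) \<sigma> (L_PG M) x ws"
proof -
  have sm: "smooth_map_on M (J1_frame M) U \<sigma>" using \<sigma>(1) by (simp add: section_on_def)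
  have sub: "\<sigma> ` U \<subseteq> frame_jets" using section_jet(1)[OF \<sigma>(1)] by blast
  have "tmap M (J1_Sigma M) (jet1 M SM \<zeta>) x w =
      tmap (J1_frame M) (J1_Sigma M) (F_omega M) (\<sigma> x) (tmap M (J1_frame M) \<sigma> x w)" if w: "w \<in> tangent_space M x" for w
  proof -
    have "tmap M (J1_Sigma M) (jet1 M SM \<zeta>) x = tmap M (J1_Sigma M) (\<lambda>x. F_omega M (\<sigma> x)) x"
      by (rule tmap_cong[OF M U x(1)]) (simp add: hol)
    then show ?thesis using tmap_comp[OF M smooth_J1_frame smooth_J1_Sigma sm smooth_F_omega sub x(1) w] by simp
  qed
  then have mp: "map (tmap M (J1_Sigma M) (jet1 M SM \<zeta>) x) ws =
      map (tmap (J1_frame M) (J1_Sigma M) (F_omega M) (\<sigma> x)) (map (tmap M (J1_frame M) \<sigma> x) ws)"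
    using ws by auto
  have "pullback M (J1_Sigma M) (jet1 M SM \<zeta>) L x ws =
      pullback (J1_frame M) (J1_Sigma M) (F_omega M) L (\<sigma> x) (map (tmap M (J1_frame M) \<sigma> x) ws)"
    unfolding pullback_def mp hol[OF x(1)] ..
  also have "\<dots> = \<epsilon> (tau10 (\<sigma> x)) * L_PG M (\<sigma> x) (map (tmap M (J1_frame M) \<sigma> x) ws)"
  proof -
    have "set (map (tmap M (J1_frame M) \<sigma> x) ws) \<subseteq> tangent_space_sub (J1_frame M) (T0 M) (\<sigma> x)"
      using tmap_tangent_space_sub[OF M smooth_J1_frame sm x(1) _ \<sigma>(2)] ws by auto
    moreover have "\<sigma> x \<in> T0 M" "tau1 (\<sigma> x) \<in> V" using \<sigma>(2) x section_jet(2)[OF \<sigma>(1) x(1)] by auto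
    ultimately show ?thesis using L unfolding EH_lagrangian_def Let_def by blast
  qed
  finally show ?thesis by (simp add: pullback_def)
qed

text \<open>The lift lies over \<open>s\<close> and its image under \<open>F_omega\<close> is the
  jet of \<open>proj_K \<circ> s\<close>; by \<open>omega_p_pullback_iff\<close> this is the
  constraint.\<close>

lemma lc_lift_admissible:
  assumes U: "openin top_M U" and s: "frame_section U s"
    and sm: "smooth_map_on M (J1_frame M) U (lc_lift s)"
  shows "palatini_admissible M U (lc_lift s)"
proof -
  have sec: "section_on M (J1_frame M) tau1 U (lc_lift s)"
    using sm lc_lift(3)[OF U _ s] by (simp add: section_on_def)
  have "F_omega M (lc_lift s x) = jet1 M SM (proj_K \<circ> (tau10 \<circ> lc_lift s)) x" if x: "x \<in> U" for x
    unfolding lc_lift(4)[OF U x s] by (rule jet1_cong[OF U x]) (simp add: lc_lift(2)[OF U _ s])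
  then show ?thesis
    unfolding palatini_admissible_def
    using sec lc_lift(1)[OF U _ s] omega_p_pullback_iff[OF sec] by auto
qed

theorem palatini_extremal_imp_EH_extremal:
  assumes mf: "smooth_manifold M" and U: "openin top_M U" and Z: "palatini_extremal M U Z"
  shows "EH_extremal M U (proj_K \<circ> (tau10 \<circ> Z))"
  unfolding EH_extremal_def
proof (intro conjI allI impI)
  let ?s = "tau10 \<circ> Z"
  have Zad: "palatini_admissible M U Z" using Z by (simp add: palatini_extremal_def)
  have Zsec: "section_on M (J1_frame M) tau1 U Z" and ZT: "Z ` U \<subseteq> T0 M" using Zad by (auto simp: palatini_admissible_def)
  note s = section_tau10[OF Zsec]
  have hol: "F_omega M (Z x) = jet1 M SM (proj_K \<circ> ?s) x" if "x \<in> U" for x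
    using omega_p_pullback_iff[OF Zsec that] Zad that unfolding palatini_admissible_def by blast
  show "section_on M SM tau_Sigma U (proj_K \<circ> ?s)" by (rule section_proj_K[OF s])
  fix V \<epsilon> L C r \<zeta>t
  assume asm: "openin top_M V \<and> V \<subseteq> U \<and> orientation_on M V \<epsilon> \<and> EH_lagrangian M V \<epsilon> L \<and>
        compactin top_M C \<and> C \<subseteq> V \<and> r > 0 \<and>
        smooth_map_on (cylinder_atlas M) SM ({-r<..<r} \<times> U) (\<lambda>(t, x). \<zeta>t t x) \<and>
        (\<forall>t\<in>{-r<..<r}. section_on M SM tau_Sigma U (\<zeta>t t) \<and>
           (\<forall>x\<in>U - C. \<zeta>t t x = (proj_K \<circ> ?s) x)) \<and>
        (\<forall>x\<in>U. \<zeta>t 0 x = (proj_K \<circ> ?s) x)"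
  then have V: "openin top_M V" "V \<subseteq> U" and \<epsilon>: "orientation_on M V \<epsilon>" and L: "EH_lagrangian M V \<epsilon> L"
    and C: "compactin top_M C" "C \<subseteq> V" and r: "r > 0"
    and \<zeta>: "smooth_map_on (cylinder_atlas M) SM ({-r<..<r} \<times> U) (\<lambda>(t, x). \<zeta>t t x)"
    and \<zeta>sec: "\<And>t. t \<in> {-r<..<r} \<Longrightarrow> section_on M SM tau_Sigma U (\<zeta>t t)"
    and off: "\<And>t x. t \<in> {-r<..<r} \<Longrightarrow> x \<in> U - C \<Longrightarrow> \<zeta>t t x = proj_K (?s x)"
    and init: "\<And>x. x \<in> U \<Longrightarrow> \<zeta>t 0 x = proj_K (?s x)"
    by auto
  have CU: "C \<subseteq> U" using C(2) V(2) by blast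
  have H: "Hausdorff_space top_M" using mf by (simp add: smooth_manifold_def)
  obtain r' B where r': "r' > 0" "r' \<le> r"
    and smB: "smooth_map_on (cylinder_atlas M) LM ({-r'<..<r'} \<times> U) (\<lambda>(t, x). frame_act (?s x) (B t x))"
    and B: "\<And>t x. t \<in> {-r'<..<r'} \<Longrightarrow> x \<in> U \<Longrightarrow> det (B t x) > 0 \<and> proj_K (frame_act (?s x) (B t x)) = \<zeta>t t x"
    and Boff: "\<And>t x. t \<in> {-r'<..<r'} \<Longrightarrow> x \<in> U - C \<Longrightarrow> B t x = mat 1" and B0: "\<And>x. x \<in> U \<Longrightarrow> B 0 x = mat 1"
    by (rule orthonormal_lift[OF U s C(1) CU r \<zeta> \<zeta>sec off init]) (assumption | rule that)+
  define S where "S t x = frame_act (?s x) (B t x)" for t x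
  define \<sigma>t where "\<sigma>t t = lc_lift (S t)" for t
  let ?I = "{-r'<..<r'}"
  have smS: "smooth_map_on (cylinder_atlas M) LM (?I \<times> U) (\<lambda>(t, x). S t x)"
    using smB by (simp add: S_def)
  have S: "frame_section U (S t)" if t: "t \<in> ?I" for t
    unfolding section_on_def using smooth_family_slice[OF M frame.B U smS t] s
    by (simp add: section_on_def) (simp add: S_def)
  have sm\<sigma>: "smooth_map_on (cylinder_atlas M) (J1_frame M) (?I \<times> U) (\<lambda>(t, x). \<sigma>t t x)"
    unfolding \<sigma>t_def by (rule smooth_lc_lift[OF U _ smS S]) auto
  have adm: "palatini_admissible M U (\<sigma>t t)" if t: "t \<in> ?I" for t
    using lc_lift_admissible[OF U S[OF t]] smooth_family_slice[OF M smooth_J1_frame U sm\<sigma> t] by (simp add: \<sigma>t_def)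
  \<comment> \<open>Where the frames do not move on an open set, the jets of the metrics agree with
    those of the original metric. There \<open>Z x\<close> is an element of \<open>T0\<close> over
    the same frame with the same image, so uniqueness of the lift identifies it with
    \<open>\<sigma>t t x\<close>.\<close>
  have \<sigma>Z: "\<sigma>t t x = Z x" if t: "t \<in> ?I" and O: "openin top_M O'" "O' \<subseteq> U" "x \<in> O'" and eq: "\<And>y. y \<in> O' \<Longrightarrow> B t y = mat 1"
    for t x O'
  proof -
    have x: "x \<in> U" using O by blast
    have Seq: "S t y = ?s y" if "y \<in> O'" for y using eq[OF that] by (simp add: S_def frame_act_1)
    have "jet1 M SM (proj_K \<circ> S t) x = jet1 M SM (proj_K \<circ> ?s) x"
      by (rule jet1_cong[OF O(1,3)]) (simp add: Seq)
    then show ?thesis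
      unfolding \<sigma>t_def using lc_lift(5)[OF U x S[OF t], of "Z x"] ZT x hol[OF x] Seq[OF O(3)] by auto
  qed
  \<comment> \<open>Equality of jets needs equality of sections on a neighbourhood. The complement
    of \<open>C\<close> is open because a compact set in a Hausdorff space is closed.\<close>
  have cl: "openin top_M (U - C)"
    by (rule openin_diff[OF U compactin_imp_closedin[OF H C(1)]])
  have off': "\<sigma>t t x = Z x" if "t \<in> ?I" "x \<in> U - C" for t x
    by (rule \<sigma>Z[OF that(1) cl _ that(2)]) (use Boff[OF that(1)] in auto)
  have init': "\<sigma>t 0 x = Z x" if "x \<in> U" for x
    by (rule \<sigma>Z[OF _ U _ that]) (use r' B0 in auto)
  \<comment> \<open>Multiplication by the sign of the frame \<open>?s\<close> over the same point
    makes these frames positive.\<close>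
  define \<epsilon>' where "\<epsilon>' u = \<epsilon> u * \<epsilon> (?s (fst u))" for u
  have or': "orientation_on M V \<epsilon>'"
    using orientation_of_frame[OF V(1) s V(2) U \<epsilon>] by (simp only: \<epsilon>'_def[abs_def])
  have D: "((\<lambda>t. form_integral M \<epsilon>' C (pullback M (J1_frame M) (\<sigma>t t) (L_PG M))) has_real_derivative 0) (at 0)"
  proof (rule mp[OF spec[OF spec[OF spec[OF spec[OF spec[OF conjunct2[OF Z[unfolded palatini_extremal_def]],
          of V], of \<epsilon>'], of C], of r'], of \<sigma>t]])
  qed (intro conjI ballI V or' C r'(1) sm\<sigma> adm off' init'; assumption)
  have eq: "form_integral M \<epsilon>' C (pullback M (J1_frame M) (\<sigma>t t) (L_PG M)) =
      form_integral M \<epsilon> C (pullback M (J1_Sigma M) (jet1 M SM (\<zeta>t t)) L)" if t: "t \<in> ?I" for t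
  proof (rule form_integral_cong[OF mf C(1)])
    fix c x assume x: "x \<in> C" and c: "c \<in> charts_at M x"
    have xU: "x \<in> U" "x \<in> V" using x C(2) V(2) by auto
    let ?ws = "map (snd (coord_frame M c x)) (sorted_list_of_set UNIV)"
    have ws: "set ?ws \<subseteq> tangent_space M x" using coord_frame(4)[OF c] by auto
    have \<sigma>sec: "section_on M (J1_frame M) tau1 U (\<sigma>t t)" "\<sigma>t t ` U \<subseteq> T0 M"
      using adm[OF t] by (auto simp: palatini_admissible_def)
    have hol': "F_omega M (\<sigma>t t y) = jet1 M SM (\<zeta>t t) y" if y: "y \<in> U" for y
      unfolding \<sigma>t_def lc_lift(4)[OF U y S[OF t]]
      by (rule jet1_cong[OF U y]) (use B[OF t] in \<open>simp add: S_def\<close>)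
    \<comment> \<open>The identity for the Lagrangian at \<open>\<sigma>t t x\<close> carries the
      sign of the varied frame. Since \<open>det (B t x) > 0\<close>, this is the sign of
      \<open>?s x\<close>, which is exactly the factor contained in
      \<open>\<epsilon>'\<close>.\<close>
    have "\<epsilon> (tau10 (\<sigma>t t x)) = \<epsilon> (frame_act (?s x) (B t x))"
      by (simp add: \<sigma>t_def lc_lift(2)[OF U xU(1) S[OF t]] S_def)
    also have "\<dots> = sgn (det (B t x)) * \<epsilon> (?s x)"
    proof -
      have "?s x \<in> frame_bundle M" "fst (?s x) \<in> V" "invertible (B t x)"
        using section_frame[OF s xU(1)] s xU B[OF t xU(1)] by (auto simp: section_on_def invertible_det_nz)
      then show ?thesis using \<epsilon> unfolding orientation_on_def by blast
    qed
    finally have "\<epsilon> (tau10 (\<sigma>t t x)) = \<epsilon> (?s x)" using B[OF t xU(1)] by simp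
    then show "\<epsilon>' (coord_frame M c x) * pullback M (J1_frame M) (\<sigma>t t) (L_PG M) x ?ws =
        \<epsilon> (coord_frame M c x) * pullback M (J1_Sigma M) (jet1 M SM (\<zeta>t t)) L x ?ws"
      using pullback_EH_lagrangian[OF U \<sigma>sec L xU hol' ws] coord_frame(2)[OF c] by (simp add: \<epsilon>'_def)
  qed
  \<comment> \<open>The derivative at 0 sees only small \<open>t\<close>, so agreement of the two
    actions on the shorter interval suffices.\<close>
  show "((\<lambda>t. form_integral M \<epsilon> C (pullback M (J1_Sigma M) (jet1 M SM (\<zeta>t t)) L))
      has_real_derivative 0) (at 0)"
    by (rule has_field_derivative_transform_within_open[where S="?I", OF D _ _ eq]) (use r' in auto)
qed

end

theorem theorem11p4:
  fixes M :: "('a, (real, 'm::{finite,linorder}) vec) chart set"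
    and U :: "'a set"
    and Z :: "'a \<Rightarrow> ('a, 'm) fjet"
  assumes "smooth_manifold M"
    and "openin (manifold_topology M) U"
    and "palatini_extremal M U Z"
  shows "\<exists>\<zeta>. section_on M (Sigma_atlas M) tau_Sigma U \<zeta> \<and>
             (\<forall>x\<in>U. F_omega M (Z x) = jet1 M (Sigma_atlas M) \<zeta> x) \<and>
             EH_extremal M U \<zeta>"
proof -
  interpret frame_geometry M
    by standard (rule smooth_manifold_imp_smooth_atlas[OF assms(1)])
  have Z: "palatini_admissible M U Z" using assms(3) by (simp add: palatini_extremal_def)
  then have sec: "section_on M (J1_frame M) tau1 U Z" by (simp add: palatini_admissible_def)
  have "F_omega M (Z x) = jet1 M (Sigma_atlas M) (proj_K \<circ> (tau10 \<circ> Z)) x" if "x \<in> U" for x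
    using omega_p_pullback_iff[OF sec that] Z that unfolding palatini_admissible_def by blast
  then show ?thesis
    using section_proj_K[OF section_tau10[OF sec]] palatini_extremal_imp_EH_extremal[OF assms] by blast
qed

end
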